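(* Let $\Gamma$ be a compact connected metric graph, let $\kappa\in L_\infty(\Gamma)$ satisfy $\operatorname{ess\,inf}_\Gamma\kappa\ge\kappa_0>0$, let $a:\Gamma\to\mathbb R$ be Lipschitz and positive with $a_0=\min_\Gamma a>0$, and let $\alpha\in\mathbb R$. Suppose that either $\alpha\ge0$, or, with $S=|\alpha|/d_0$ and $d_0=\min_vd_v$, one has $\kappa_0^2>4S/\min_el_e$ and $2S\max_el_e\le a_0$. Let $u$ be the solution of $L_\alpha^\beta u=\mathcal W$ on $\Gamma$ with $\mathcal W$ Gaussian white noise, where $L_\alpha$ has generalized Kirchhoff vertex conditions, and let $u^Q_{h,k}=Q_{h,k,\beta}\mathcal W_h$ be its finite element/quadrature approximation with quadrature step size $k>0$ (defined in the context). If $\frac14<\beta<1$ and $\frac14<\sigma<\beta$, then there exists $C=C_\sigma>0$ such that $$\big(\mathbb E\|u-u^Q_{h,k}\|^2_{L_2(\Gamma)}\big)^{\frac12}\le C\big(\hat h^{2\sigma-\frac12}+\hat h^{2\sigma}N_h^{\frac12}+e^{-\frac{\pi^2}{2k}}N_h^{\frac12}\big),$$ where $N_h=\dim V_h$.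
   Context: A compact metric graph $\Gamma$ consists of a finite vertex set $\mathcal V$ and a finite edge set $\mathcal E$ (loops and multiple edges allowed); each edge $e$ is identified with $[0,l_e]$, $0<l_e<\infty$; $\Gamma$ carries the shortest-path metric; $\mathcal E_v$ is the set of edges incident to $v$ (a loop at $v$ counted twice) and $d_v=|\mathcal E_v|$. $\partial_eu(v)$ is the derivative of $u$ along $e$ at $v$ in the direction away from $v$. $L_2(\Gamma)=\bigoplus_eL_2(e)$ with inner product $(\cdot,\cdot)$; $\widetilde H^2(\Gamma)=\bigoplus_eH^2(e)$; $C(\Gamma)$ is the space of continuous functions on $\Gamma$; $H^1(\Gamma)$ is the space of continuous functions on $\Gamma$ in $H^1(e)$ on each edge. $L_\alpha$ acts on each edge by $(L_\alpha u)_e=-(a_eu_e')'+\kappa_e^2u_e$ with domain $\{u\in\widetilde H^2(\Gamma)\cap C(\Gamma): a(v)\sum_{e\in\mathcal E_v}\partial_eu(v)=\alpha u(v)\ \forall v\in\mathcal V\}$; under the hypotheses it is self-adjoint and positive definite with compact inverse; $\{e_j\}$ is an orthonormal eigenbasis of $L_2(\Gamma)$ with eigenvalues $\lambda_j$, and fractional powers are defined spectrally. Its bilinear form is $\mathfrak h_\alpha(f,g)=(\kappa^2f,g)+\sum_e\int_ea f_e'g_e'\,dx+\sum_v\alpha f(v)g(v)$ on $H^1(\Gamma)$. White noise: $\mathcal W=\sum_j\xi_je_j$ with $\xi_j$ independent standard normal variables; $u=L_\alpha^{-\beta}\mathcal W=\sum_j\lambda_j^{-\beta}\xi_je_j$.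 Finite elements: each edge $e$ is subdivided into $n_e\ge2$ intervals of equal length $h_e=l_e/n_e$; $V_h\subset H^1(\Gamma)$ consists of the continuous functions on $\Gamma$ affine on every subinterval; $\hat h=\max_eh_e$; $P_h:L_2(\Gamma)\to V_h$ is the $L_2(\Gamma)$-orthogonal projection; $L_h:V_h\to V_h$ is defined by $(L_hu,w)=\mathfrak h_\alpha(u,w)$ for $u,w\in V_h$. $\mathcal W_h=\sum_{j=1}^\infty\xi_jP_he_j$ (same $\xi_j$). Quadrature: for step size $k>0$, $$Q_{h,k,\beta}=\frac{2k\sin(\pi\beta)}{\pi}\sum_{l=-K^-}^{K^+}e^{2\beta lk}\big(\mathrm{Id}_{V_h}+e^{2lk}L_h\big)^{-1},\quad K^-=\Big\lceil\frac{\pi^2}{4\beta k^2}\Big\rceil,\ K^+=\Big\lceil\frac{\pi^2}{4(1-\beta)k^2}\Big\rceil.$$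
   Formalization: The constant C is uniform in the mesh and in step sizes 0 < k ≤ k0, for each arbitrary k0 > 0 (C may depend on k0); a C uniform over all k > 0 cannot exist, since on a fixed mesh the quadrature approximation grows linearly in k while the right-hand side stays bounded. *)

theory Defs
  imports
    "HOL-Probability.Probability"
    "HOL-Library.Function_Algebras"
    "Graph_Theory.Digraph_Component"
begin

section \<open>Compact metric graphs\<close>

text \<open>
  The combinatorial skeleton is a digraph (loops and multiple arcs allowed).  The direction of
  an arc \<open>e\<close> only records the identification of the edge with the interval \<open>[0, elen e]\<close>:
  the tail is the point \<open>0\<close> and the head is the point \<open>elen e\<close>.
\<close>

record ('v, 'e) metric_graph =
  skel :: "('v, 'e) pre_digraph"
  elen :: "'e \<Rightarrow> real"

abbreviation vertices :: "('v, 'e) metric_graph \<Rightarrow> 'v set" where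
  "vertices \<Gamma> \<equiv> verts (skel \<Gamma>)"

abbreviation edges :: "('v, 'e) metric_graph \<Rightarrow> 'e set" where
  "edges \<Gamma> \<equiv> arcs (skel \<Gamma>)"

definition compact_metric_graph :: "('v, 'e) metric_graph \<Rightarrow> bool" where
  "compact_metric_graph \<Gamma> \<longleftrightarrow>
     fin_digraph (skel \<Gamma>) \<and> edges \<Gamma> \<noteq> {} \<and> (\<forall>e\<in>edges \<Gamma>. 0 < elen \<Gamma> e)"

text \<open>Connectedness ignores the direction of the arcs.\<close>

definition connected_graph :: "('v, 'e) metric_graph \<Rightarrow> bool" where
  "connected_graph \<Gamma> \<longleftrightarrow> Digraph_Component.connected (skel \<Gamma>)"

text \<open>A loop contributes twice to the degree of its vertex.\<close>

definition degree :: "('v, 'e) metric_graph \<Rightarrow> 'v \<Rightarrow> nat" where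
  "degree \<Gamma> v = out_degree (skel \<Gamma>) v + in_degree (skel \<Gamma>) v"

datatype ('v, 'e) point = Vertex 'v | Inner 'e real

definition points :: "('v, 'e) metric_graph \<Rightarrow> ('v, 'e) point set" where
  "points \<Gamma> = Vertex ` vertices \<Gamma> \<union>
     {Inner e x | e x. e \<in> edges \<Gamma> \<and> 0 < x \<and> x < elen \<Gamma> e}"

text \<open>
  The parametrization of an edge, to be used for \<open>x \<in> {0..elen \<Gamma> e}\<close>.  The restriction of
  \<open>u\<close> to \<open>e\<close>, as a function on that interval, is \<open>\<lambda>x. u (edge_point \<Gamma> e x)\<close>.
\<close>

definition edge_point :: "('v, 'e) metric_graph \<Rightarrow> 'e \<Rightarrow> real \<Rightarrow> ('v, 'e) point" where
  "edge_point \<Gamma> e x =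
     (if x \<le> 0 then Vertex (tail (skel \<Gamma>) e)
      else if elen \<Gamma> e \<le> x then Vertex (head (skel \<Gamma>) e)
      else Inner e x)"

definition on_edge ::
  "('v, 'e) metric_graph \<Rightarrow> (('v, 'e) point \<Rightarrow> real) \<Rightarrow> 'e \<Rightarrow> real \<Rightarrow> real" where
  "on_edge \<Gamma> u e = (\<lambda>x. u (edge_point \<Gamma> e x))"

text \<open>\<open>graph_path \<Gamma> p q s\<close>: some path from \<open>p\<close> to \<open>q\<close> made of finitely many edge segments has total
  length \<open>s\<close>.\<close>

inductive graph_path ::
  "('v, 'e) metric_graph \<Rightarrow> ('v, 'e) point \<Rightarrow> ('v, 'e) point \<Rightarrow> real \<Rightarrow> bool" for \<Gamma> p where
  nil: "p \<in> points \<Gamma> \<Longrightarrow> graph_path \<Gamma> p p 0"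
| step: "graph_path \<Gamma> p (edge_point \<Gamma> e x) s \<Longrightarrow> e \<in> edges \<Gamma> \<Longrightarrow>
    x \<in> {0..elen \<Gamma> e} \<Longrightarrow> y \<in> {0..elen \<Gamma> e} \<Longrightarrow> graph_path \<Gamma> p (edge_point \<Gamma> e y) (s + \<bar>x - y\<bar>)"

definition graph_dist ::
  "('v, 'e) metric_graph \<Rightarrow> ('v, 'e) point \<Rightarrow> ('v, 'e) point \<Rightarrow> real" where
  "graph_dist \<Gamma> p q =
     (if p \<in> points \<Gamma> \<and> q \<in> points \<Gamma> then Inf {s. graph_path \<Gamma> p q s} else 0)"

definition graph_metric :: "('v, 'e) metric_graph \<Rightarrow> ('v, 'e) point metric" where
  "graph_metric \<Gamma> = metric (points \<Gamma>, graph_dist \<Gamma>)"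

lemma edge_point_in:
  assumes "compact_metric_graph \<Gamma>" "e \<in> edges \<Gamma>"
  shows "edge_point \<Gamma> e x \<in> points \<Gamma>"
proof -
  interpret fin_digraph "skel \<Gamma>" using assms by (simp add: compact_metric_graph_def)
  show ?thesis using assms by (auto simp: edge_point_def points_def)
qed

lemma path_in:
  assumes "compact_metric_graph \<Gamma>" "graph_path \<Gamma> p q s"
  shows "p \<in> points \<Gamma> \<and> q \<in> points \<Gamma>"
  using assms(2) by induction (auto simp: edge_point_in[OF assms(1)])

lemma path_nonneg: "graph_path \<Gamma> p q s \<Longrightarrow> 0 \<le> s"
  by (induction rule: graph_path.induct) auto

lemma path_trans:
  assumes "graph_path \<Gamma> q r t" "graph_path \<Gamma> p q s" shows "graph_path \<Gamma> p r (s + t)"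
  using assms(1)
proof induction
  case nil then show ?case using assms(2) by simp
next
  case (step e x t y)
  from graph_path.step[OF step.IH step.hyps(2-4)] show ?case by (simp add: add.assoc)
qed

lemma path_sym:
  assumes "compact_metric_graph \<Gamma>" "graph_path \<Gamma> p q s" shows "graph_path \<Gamma> q p s"
  using assms(2)
proof induction
  case nil then show ?case by (rule graph_path.nil)
next
  case (step e x s y)
  have "graph_path \<Gamma> (edge_point \<Gamma> e y) (edge_point \<Gamma> e x) (0 + \<bar>y - x\<bar>)"
    by (rule graph_path.step) (use step edge_point_in[OF assms(1)] in \<open>auto intro: graph_path.nil\<close>)
  from path_trans[OF step.IH this] show ?case by (simp add: abs_minus_commute add.commute)
qed

lemma path_Lipschitz:
  assumes "graph_path \<Gamma> p q s"
    and "\<And>e x y. \<lbrakk>e \<in> edges \<Gamma>; x \<in> {0..elen \<Gamma> e}; y \<in> {0..elen \<Gamma> e}\<rbrakk> \<Longrightarrow>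
      \<bar>f (edge_point \<Gamma> e x) - f (edge_point \<Gamma> e y)\<bar> \<le> \<bar>x - y\<bar>"
  shows "\<bar>f p - f q\<bar> \<le> (s::real)"
  using assms(1)
proof induction
  case (step e x s y)
  then show ?case using assms(2)[of e x y] by auto
qed simp

lemma separating_function:
  assumes G: "compact_metric_graph \<Gamma>" and p: "p \<in> points \<Gamma>" and "q \<in> points \<Gamma>" "p \<noteq> q"
  obtains f :: "_ \<Rightarrow> real" where "f p \<noteq> f q"
    "\<And>e x y. \<lbrakk>e \<in> edges \<Gamma>; x \<in> {0..elen \<Gamma> e}; y \<in> {0..elen \<Gamma> e}\<rbrakk> \<Longrightarrow>
      \<bar>f (edge_point \<Gamma> e x) - f (edge_point \<Gamma> e y)\<bar> \<le> \<bar>x - y\<bar>"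
proof (cases p)
  case (Inner e0 x0)
  define r where "r = min x0 (elen \<Gamma> e0 - x0)"
  have r: "0 < r" "r \<le> x0" "r \<le> elen \<Gamma> e0 - x0"
    using p Inner by (auto simp: points_def r_def)
  define f where "f z = (case z of Vertex v \<Rightarrow> r
     | Inner e x \<Rightarrow> if e = e0 then min \<bar>x - x0\<bar> r else r)" for z :: "('a, 'b) point"
  have on: "f (edge_point \<Gamma> e x) = (if e = e0 then min \<bar>x - x0\<bar> r else r)"
    if "e \<in> edges \<Gamma>" "x \<in> {0..elen \<Gamma> e}" for e x
    using that r by (auto simp: f_def edge_point_def)
  show thesis
  proof (rule that)
    have "f p = 0" using Inner r by (simp add: f_def)
    moreover have "f q \<noteq> 0" using Inner r \<open>p \<noteq> q\<close> by (auto simp: f_def min_def split: point.split)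
    ultimately show "f p \<noteq> f q" by simp
    show "\<bar>f (edge_point \<Gamma> e x) - f (edge_point \<Gamma> e y)\<bar> \<le> \<bar>x - y\<bar>"
      if "e \<in> edges \<Gamma>" "x \<in> {0..elen \<Gamma> e}" "y \<in> {0..elen \<Gamma> e}" for e x y
      using that by (auto simp: on min_def)
  qed
next
  case (Vertex v)
  have fin: "finite (edges \<Gamma>)" "edges \<Gamma> \<noteq> {}" "\<And>e. e \<in> edges \<Gamma> \<Longrightarrow> 0 < elen \<Gamma> e"
    using G by (auto simp: compact_metric_graph_def fin_digraph_def fin_digraph_axioms_def)
  define r where "r = Min (elen \<Gamma> ` edges \<Gamma>) / 2"
  have "0 < r" using fin by (simp add: r_def)
  have r: "2 * r \<le> elen \<Gamma> e" if "e \<in> edges \<Gamma>" for e using fin that by (simp add: r_def)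
  define d where "d b t = (if b then min t r else r)" for b and t :: real
  define f where "f z = (case z of Vertex w \<Rightarrow> if w = v then 0 else r
     | Inner e x \<Rightarrow> min (d (tail (skel \<Gamma>) e = v) x) (d (head (skel \<Gamma>) e = v) (elen \<Gamma> e - x)))"
    for z
  have on: "f (edge_point \<Gamma> e x) =
      min (d (tail (skel \<Gamma>) e = v) x) (d (head (skel \<Gamma>) e = v) (elen \<Gamma> e - x))"
    if "e \<in> edges \<Gamma>" "x \<in> {0..elen \<Gamma> e}" for e x
    using that r[OF that(1)] \<open>0 < r\<close> by (auto simp: f_def edge_point_def d_def)
  have dl: "\<bar>d b s - d b t\<bar> \<le> \<bar>s - t\<bar>" for b s t by (auto simp: d_def min_def)
  have ml: "\<bar>min a b - min a' b'\<bar> \<le> c" if "\<bar>a - a'\<bar> \<le> c" "\<bar>b - b'\<bar> \<le> c" for a b a' b' c :: real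
    using that by (auto simp: min_def)
  show thesis
  proof (rule that)
    have "f p = 0" using Vertex by (simp add: f_def)
    moreover have "f q \<noteq> 0"
      using Vertex \<open>0 < r\<close> \<open>p \<noteq> q\<close> \<open>q \<in> points \<Gamma>\<close>
      by (auto simp: f_def d_def min_def points_def split: if_splits)
    ultimately show "f p \<noteq> f q" by simp
    show "\<bar>f (edge_point \<Gamma> e x) - f (edge_point \<Gamma> e y)\<bar> \<le> \<bar>x - y\<bar>"
      if "e \<in> edges \<Gamma>" "x \<in> {0..elen \<Gamma> e}" "y \<in> {0..elen \<Gamma> e}" for e x y
      unfolding on[OF that(1,2)] on[OF that(1,3)]
      by (intro ml order.trans[OF dl]) (auto simp: abs_minus_commute)
  qed
qed

lemma path_exists_vertices:
  assumes G: "compact_metric_graph \<Gamma>" and "connected_graph \<Gamma>"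
    and "v \<in> vertices \<Gamma>" "w \<in> vertices \<Gamma>"
  shows "\<exists>s. graph_path \<Gamma> (Vertex v) (Vertex w) s"
proof -
  interpret fin_digraph "skel \<Gamma>" using G by (simp add: compact_metric_graph_def)
  have seg: "graph_path \<Gamma> (Vertex (tail (skel \<Gamma>) e)) (Vertex (head (skel \<Gamma>) e)) (0 + \<bar>0 - elen \<Gamma> e\<bar>)"
    if "e \<in> edges \<Gamma>" for e
  proof -
    have l: "0 < elen \<Gamma> e" using G that by (auto simp: compact_metric_graph_def)
    have "graph_path \<Gamma> (Vertex (tail (skel \<Gamma>) e)) (edge_point \<Gamma> e (elen \<Gamma> e)) (0 + \<bar>0 - elen \<Gamma> e\<bar>)"
      by (rule graph_path.step) (use l that in \<open>auto simp: edge_point_def points_def intro!: graph_path.nil\<close>)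
    then show ?thesis using l by (simp add: edge_point_def)
  qed
  have seg': "\<exists>s. graph_path \<Gamma> (Vertex x) (Vertex y) s" if "(x, y) \<in> (arcs_ends (skel \<Gamma>))\<^sup>s" for x y
    using that seg path_sym[OF G] by (fastforce simp: arcs_ends_conv symcl_def)
  have "(v, w) \<in> rtrancl_on (vertices \<Gamma>) ((arcs_ends (skel \<Gamma>))\<^sup>s)"
  proof -
    have "(arcs_ends (skel \<Gamma>))\<^sup>s = parcs (mk_symmetric (skel \<Gamma>))"
      by (auto simp: parcs_mk_symmetric symcl_def arcs_ends_conv)
    then show ?thesis
      using assms(2-4) by (auto simp: connected_graph_def Digraph_Component.connected_def
          strongly_connected_def reachable_def)
  qed
  then show ?thesis
  proof induction
    case base
    then have "Vertex w \<in> points \<Gamma>" by (simp add: points_def)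
    then show ?case using graph_path.nil by blast
  next
    case (step x y)
    then show ?case using seg'[of x y] path_trans by blast
  qed
qed

lemma path_exists:
  assumes G: "compact_metric_graph \<Gamma>" and c: "connected_graph \<Gamma>"
    and "p \<in> points \<Gamma>" "q \<in> points \<Gamma>"
  shows "\<exists>s. graph_path \<Gamma> p q s"
proof -
  interpret fin_digraph "skel \<Gamma>" using G by (simp add: compact_metric_graph_def)
  have to_vertex: "\<exists>v\<in>vertices \<Gamma>. \<exists>s. graph_path \<Gamma> p (Vertex v) s" if p: "p \<in> points \<Gamma>" for p
  proof (cases p)
    case (Vertex v)
    then have "v \<in> vertices \<Gamma>" using p by (auto simp: points_def)
    then show ?thesis using graph_path.nil[OF p] Vertex by blast
  next
    case (Inner e x)
    then have e: "e \<in> edges \<Gamma>" "0 < x" "x < elen \<Gamma> e" using p by (auto simp: points_def)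
    have "graph_path \<Gamma> p (edge_point \<Gamma> e 0) (0 + \<bar>x - 0\<bar>)"
      by (rule graph_path.step) (use e Inner p in \<open>auto simp: edge_point_def intro: graph_path.nil\<close>)
    then show ?thesis using e by (auto simp: edge_point_def)
  qed
  obtain v w s t where "v \<in> vertices \<Gamma>" "w \<in> vertices \<Gamma>" "graph_path \<Gamma> p (Vertex v) s"
    "graph_path \<Gamma> q (Vertex w) t" using assms to_vertex by meson
  then show ?thesis using path_exists_vertices[OF G c] path_sym[OF G] path_trans by meson
qed

lemma Metric_space_graph_dist:
  assumes G: "compact_metric_graph \<Gamma>" and c: "connected_graph \<Gamma>"
  shows "Metric_space (points \<Gamma>) (graph_dist \<Gamma>)"
proof
  have bdd: "bdd_below {s. graph_path \<Gamma> p q s}" for p q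
    by (rule bdd_belowI[of _ 0]) (auto dest: path_nonneg)
  have ne: "{s. graph_path \<Gamma> p q s} \<noteq> {}" if "p \<in> points \<Gamma>" "q \<in> points \<Gamma>" for p q
    using path_exists[OF G c that] by auto
  show nn: "0 \<le> graph_dist \<Gamma> p q" for p q
    using ne by (auto simp: graph_dist_def intro!: cInf_greatest dest: path_nonneg)
  have "{s. graph_path \<Gamma> p q s} = {s. graph_path \<Gamma> q p s}" for p q using path_sym[OF G] by blast
  then show "graph_dist \<Gamma> p q = graph_dist \<Gamma> q p" for p q by (simp add: graph_dist_def)
  show "graph_dist \<Gamma> p q = 0 \<longleftrightarrow> p = q" if pq: "p \<in> points \<Gamma>" "q \<in> points \<Gamma>" for p q
  proof
    assume "p = q"
    then have "graph_dist \<Gamma> p q \<le> 0"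
      using pq bdd by (auto simp: graph_dist_def intro!: cInf_lower graph_path.nil)
    with nn[of p q] show "graph_dist \<Gamma> p q = 0" by simp
  next
    assume d: "graph_dist \<Gamma> p q = 0"
    show "p = q"
    proof (rule ccontr)
      assume "p \<noteq> q"
      with separating_function[OF G pq] obtain f :: "_ \<Rightarrow> real" where f: "f p \<noteq> f q"
        "\<And>e x y. \<lbrakk>e \<in> edges \<Gamma>; x \<in> {0..elen \<Gamma> e}; y \<in> {0..elen \<Gamma> e}\<rbrakk> \<Longrightarrow>
          \<bar>f (edge_point \<Gamma> e x) - f (edge_point \<Gamma> e y)\<bar> \<le> \<bar>x - y\<bar>" by blast
      have "\<bar>f p - f q\<bar> \<le> Inf {s. graph_path \<Gamma> p q s}"
        by (rule cInf_greatest[OF ne[OF pq]]) (use path_Lipschitz[OF _ f(2)] in auto)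
      with d f(1) pq show False by (simp add: graph_dist_def)
    qed
  qed
  show "graph_dist \<Gamma> p r \<le> graph_dist \<Gamma> p q + graph_dist \<Gamma> q r"
    if pqr: "p \<in> points \<Gamma>" "q \<in> points \<Gamma>" "r \<in> points \<Gamma>" for p q r
  proof -
    have "Inf {s. graph_path \<Gamma> p r s} - t \<le> s" if "graph_path \<Gamma> p q s" "graph_path \<Gamma> q r t" for s t
      using cInf_lower[OF _ bdd, of "s + t" p r] path_trans[OF that(2,1)] by simp
    then have "Inf {s. graph_path \<Gamma> p r s} - t \<le> Inf {s. graph_path \<Gamma> p q s}" if "graph_path \<Gamma> q r t" for t
      using that by (intro cInf_greatest ne pqr) auto
    then have "Inf {s. graph_path \<Gamma> p r s} - Inf {s. graph_path \<Gamma> p q s} \<le> Inf {s. graph_path \<Gamma> q r s}"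
      by (intro cInf_greatest ne pqr) (force simp: algebra_simps)
    then show ?thesis using pqr by (simp add: graph_dist_def)
  qed
qed

lemma
  assumes "compact_metric_graph \<Gamma>" "connected_graph \<Gamma>"
  shows mspace_graph_metric: "mspace (graph_metric \<Gamma>) = points \<Gamma>"
    and mdist_graph_metric: "mdist (graph_metric \<Gamma>) = graph_dist \<Gamma>"
  using Metric_space_graph_dist[OF assms]
  by (simp_all add: graph_metric_def Metric_space.mspace_metric Metric_space.mdist_metric)

definition continuous_on_graph ::
  "('v, 'e) metric_graph \<Rightarrow> (('v, 'e) point \<Rightarrow> real) \<Rightarrow> bool" where
  "continuous_on_graph \<Gamma> u \<longleftrightarrow>
     continuous_map (mtopology_of (graph_metric \<Gamma>)) euclideanreal u"

definition Lipschitz_on_graph ::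
  "('v, 'e) metric_graph \<Rightarrow> (('v, 'e) point \<Rightarrow> real) \<Rightarrow> bool" where
  "Lipschitz_on_graph \<Gamma> u \<longleftrightarrow> Lipschitz_continuous_map (graph_metric \<Gamma>) euclidean_metric u"


section \<open>Function spaces\<close>

definition square_integrable :: "real \<Rightarrow> (real \<Rightarrow> real) \<Rightarrow> bool" where
  "square_integrable l f \<longleftrightarrow>
     f \<in> borel_measurable (lebesgue_on {0..l}) \<and> integrable (lebesgue_on {0..l}) (\<lambda>x. (f x)\<^sup>2)"

text \<open>Smooth functions with compact support in the open interval from \<open>0\<close> to \<open>l\<close>.\<close>

definition test_function :: "real \<Rightarrow> (real \<Rightarrow> real) \<Rightarrow> bool" where
  "test_function l \<phi> \<longleftrightarrow>
     (\<forall>n x. (deriv ^^ n) \<phi> field_differentiable (at x)) \<and>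
     (\<exists>c d. 0 < c \<and> d < l \<and> (\<forall>x. x \<notin> {c..d} \<longrightarrow> \<phi> x = 0))"

definition is_weak_deriv :: "real \<Rightarrow> (real \<Rightarrow> real) \<Rightarrow> (real \<Rightarrow> real) \<Rightarrow> bool" where
  "is_weak_deriv l f g \<longleftrightarrow>
     (\<forall>\<phi>. test_function l \<phi> \<longrightarrow>
        (LINT x|lebesgue_on {0..l}. f x * deriv \<phi> x) = - (LINT x|lebesgue_on {0..l}. g x * \<phi> x))"

definition H1_interval :: "real \<Rightarrow> (real \<Rightarrow> real) \<Rightarrow> bool" where
  "H1_interval l f \<longleftrightarrow>
     square_integrable l f \<and> (\<exists>g. square_integrable l g \<and> is_weak_deriv l f g)"

text \<open>A representative; it is determined up to null sets for \<open>f\<close> in \<open>H1_interval l\<close>.\<close>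

definition weak_deriv :: "real \<Rightarrow> (real \<Rightarrow> real) \<Rightarrow> real \<Rightarrow> real" where
  "weak_deriv l f = (SOME g. square_integrable l g \<and> is_weak_deriv l f g)"

definition H2_interval :: "real \<Rightarrow> (real \<Rightarrow> real) \<Rightarrow> bool" where
  "H2_interval l f \<longleftrightarrow> H1_interval l f \<and> H1_interval l (weak_deriv l f)"

definition L2_graph :: "('v, 'e) metric_graph \<Rightarrow> (('v, 'e) point \<Rightarrow> real) set" where
  "L2_graph \<Gamma> = {u. \<forall>e\<in>edges \<Gamma>. square_integrable (elen \<Gamma> e) (on_edge \<Gamma> u e)}"

definition L2_inner ::
  "('v, 'e) metric_graph \<Rightarrow> (('v, 'e) point \<Rightarrow> real) \<Rightarrow> (('v, 'e) point \<Rightarrow> real) \<Rightarrow> real" where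
  "L2_inner \<Gamma> u w =
     (\<Sum>e\<in>edges \<Gamma>. LINT x|lebesgue_on {0..elen \<Gamma> e}. on_edge \<Gamma> u e x * on_edge \<Gamma> w e x)"

definition L2_norm :: "('v, 'e) metric_graph \<Rightarrow> (('v, 'e) point \<Rightarrow> real) \<Rightarrow> real" where
  "L2_norm \<Gamma> u = sqrt (L2_inner \<Gamma> u u)"

definition Linfty_graph :: "('v, 'e) metric_graph \<Rightarrow> (('v, 'e) point \<Rightarrow> real) set" where
  "Linfty_graph \<Gamma> = {u. \<forall>e\<in>edges \<Gamma>.
     on_edge \<Gamma> u e \<in> borel_measurable (lebesgue_on {0..elen \<Gamma> e}) \<and>
     (\<exists>B. AE x in lebesgue_on {0..elen \<Gamma> e}. \<bar>on_edge \<Gamma> u e x\<bar> \<le> B)}"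

text \<open>The sum of a series with respect to the \<open>L\<^sub>2\<close> norm, taken as an element of the space \<open>X\<close>.\<close>

definition series_converges_to ::
  "('v, 'e) metric_graph \<Rightarrow> (nat \<Rightarrow> ('v, 'e) point \<Rightarrow> real) \<Rightarrow> (('v, 'e) point \<Rightarrow> real) \<Rightarrow> bool"
  where
  "series_converges_to \<Gamma> f u \<longleftrightarrow>
     (\<lambda>n. L2_norm \<Gamma> (\<lambda>p. u p - (\<Sum>j<n. f j p))) \<longlonglongrightarrow> 0"

definition series_sum ::
  "('v, 'e) metric_graph \<Rightarrow> (('v, 'e) point \<Rightarrow> real) set \<Rightarrow> (nat \<Rightarrow> ('v, 'e) point \<Rightarrow> real) \<Rightarrow>
     ('v, 'e) point \<Rightarrow> real" where
  "series_sum \<Gamma> X f =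
     (if \<exists>u\<in>X. series_converges_to \<Gamma> f u then SOME u. u \<in> X \<and> series_converges_to \<Gamma> f u
      else (\<lambda>p. 0))"


section \<open>The operator with generalized Kirchhoff conditions\<close>

definition outward_deriv_tail ::
  "('v, 'e) metric_graph \<Rightarrow> (('v, 'e) point \<Rightarrow> real) \<Rightarrow> 'e \<Rightarrow> real" where
  "outward_deriv_tail \<Gamma> u e = vector_derivative (on_edge \<Gamma> u e) (at 0 within {0..elen \<Gamma> e})"

definition outward_deriv_head ::
  "('v, 'e) metric_graph \<Rightarrow> (('v, 'e) point \<Rightarrow> real) \<Rightarrow> 'e \<Rightarrow> real" where
  "outward_deriv_head \<Gamma> u e =
     - vector_derivative (on_edge \<Gamma> u e) (at (elen \<Gamma> e) within {0..elen \<Gamma> e})"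

definition op_domain ::
  "('v, 'e) metric_graph \<Rightarrow> (('v, 'e) point \<Rightarrow> real) \<Rightarrow> real \<Rightarrow> (('v, 'e) point \<Rightarrow> real) set" where
  "op_domain \<Gamma> a \<alpha> = {u.
     continuous_on_graph \<Gamma> u \<and>
     (\<forall>e\<in>edges \<Gamma>. H2_interval (elen \<Gamma> e) (on_edge \<Gamma> u e)) \<and>
     (\<forall>v\<in>vertices \<Gamma>.
        a (Vertex v) * ((\<Sum>e\<in>out_arcs (skel \<Gamma>) v. outward_deriv_tail \<Gamma> u e) +
                        (\<Sum>e\<in>in_arcs (skel \<Gamma>) v. outward_deriv_head \<Gamma> u e))
        = \<alpha> * u (Vertex v))}"

text \<open>The image of \<open>u\<close> in \<open>op_domain\<close> is an \<open>L\<^sub>2\<close> class, given here by a representative on every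
  edge.\<close>

definition graph_op ::
  "('v, 'e) metric_graph \<Rightarrow> (('v, 'e) point \<Rightarrow> real) \<Rightarrow> (('v, 'e) point \<Rightarrow> real) \<Rightarrow>
     (('v, 'e) point \<Rightarrow> real) \<Rightarrow> 'e \<Rightarrow> real \<Rightarrow> real" where
  "graph_op \<Gamma> \<kappa> a u e x =
     - weak_deriv (elen \<Gamma> e)
         (\<lambda>y. on_edge \<Gamma> a e y * weak_deriv (elen \<Gamma> e) (on_edge \<Gamma> u e) y) x
     + (on_edge \<Gamma> \<kappa> e x)\<^sup>2 * on_edge \<Gamma> u e x"

definition orthonormal_basis ::
  "('v, 'e) metric_graph \<Rightarrow> (nat \<Rightarrow> ('v, 'e) point \<Rightarrow> real) \<Rightarrow> bool" where
  "orthonormal_basis \<Gamma> b \<longleftrightarrow>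
     (\<forall>j. b j \<in> L2_graph \<Gamma>) \<and>
     (\<forall>i j. L2_inner \<Gamma> (b i) (b j) = (if i = j then 1 else 0)) \<and>
     (\<forall>f\<in>L2_graph \<Gamma>. series_converges_to \<Gamma> (\<lambda>j p. L2_inner \<Gamma> f (b j) * b j p) f)"

definition orthonormal_eigenbasis ::
  "('v, 'e) metric_graph \<Rightarrow> (('v, 'e) point \<Rightarrow> real) \<Rightarrow> (('v, 'e) point \<Rightarrow> real) \<Rightarrow> real \<Rightarrow>
     (nat \<Rightarrow> ('v, 'e) point \<Rightarrow> real) \<Rightarrow> (nat \<Rightarrow> real) \<Rightarrow> bool" where
  "orthonormal_eigenbasis \<Gamma> \<kappa> a \<alpha> b lam \<longleftrightarrow>
     orthonormal_basis \<Gamma> b \<and>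
     (\<forall>j. b j \<in> op_domain \<Gamma> a \<alpha> \<and>
        (\<forall>e\<in>edges \<Gamma>. AE x in lebesgue_on {0..elen \<Gamma> e}.
           graph_op \<Gamma> \<kappa> a (b j) e x = lam j * on_edge \<Gamma> (b j) e x))"

definition bilinear_form ::
  "('v, 'e) metric_graph \<Rightarrow> (('v, 'e) point \<Rightarrow> real) \<Rightarrow> (('v, 'e) point \<Rightarrow> real) \<Rightarrow> real \<Rightarrow>
     (('v, 'e) point \<Rightarrow> real) \<Rightarrow> (('v, 'e) point \<Rightarrow> real) \<Rightarrow> real" where
  "bilinear_form \<Gamma> \<kappa> a \<alpha> f g =
     L2_inner \<Gamma> (\<lambda>p. (\<kappa> p)\<^sup>2 * f p) g +
     (\<Sum>e\<in>edges \<Gamma>. LINT x|lebesgue_on {0..elen \<Gamma> e}.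
        on_edge \<Gamma> a e x * weak_deriv (elen \<Gamma> e) (on_edge \<Gamma> f e) x
                        * weak_deriv (elen \<Gamma> e) (on_edge \<Gamma> g e) x) +
     (\<Sum>v\<in>vertices \<Gamma>. \<alpha> * f (Vertex v) * g (Vertex v))"


section \<open>White noise\<close>

definition standard_normal_sequence :: "'w measure \<Rightarrow> (nat \<Rightarrow> 'w \<Rightarrow> real) \<Rightarrow> bool" where
  "standard_normal_sequence M \<xi> \<longleftrightarrow>
     prob_space M \<and>
     prob_space.indep_vars M (\<lambda>_. borel) \<xi> UNIV \<and>
     (\<forall>j. distributed M lborel (\<xi> j) (\<lambda>x. ennreal (std_normal_density x)))"

text \<open>
  White noise is the formal series of the \<open>\<xi> j\<close> times the \<open>b j\<close>, and the solution of the
  fractional equation is obtained by applying the negative power of the operator, defined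
  spectrally, term by term.  The series converges almost surely in \<open>L\<^sub>2\<close>.
\<close>

definition solution ::
  "('v, 'e) metric_graph \<Rightarrow> real \<Rightarrow> (nat \<Rightarrow> ('v, 'e) point \<Rightarrow> real) \<Rightarrow> (nat \<Rightarrow> real) \<Rightarrow>
     (nat \<Rightarrow> 'w \<Rightarrow> real) \<Rightarrow> 'w \<Rightarrow> ('v, 'e) point \<Rightarrow> real" where
  "solution \<Gamma> \<beta> b lam \<xi> \<omega> =
     series_sum \<Gamma> (L2_graph \<Gamma>) (\<lambda>j p. lam j powr (- \<beta>) * \<xi> j \<omega> * b j p)"


section \<open>Finite elements and quadrature\<close>

definition mesh_width :: "('v, 'e) metric_graph \<Rightarrow> ('e \<Rightarrow> nat) \<Rightarrow> 'e \<Rightarrow> real" where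
  "mesh_width \<Gamma> n e = elen \<Gamma> e / real (n e)"

definition max_mesh_width :: "('v, 'e) metric_graph \<Rightarrow> ('e \<Rightarrow> nat) \<Rightarrow> real" where
  "max_mesh_width \<Gamma> n = Max (mesh_width \<Gamma> n ` edges \<Gamma>)"

text \<open>
  Functions on \<open>\<Gamma>\<close> are total functions on the type of points; requiring the value \<open>0\<close> off
  \<open>\<Gamma>\<close> makes the elements of the finite element space unique.
\<close>

definition fem_space ::
  "('v, 'e) metric_graph \<Rightarrow> ('e \<Rightarrow> nat) \<Rightarrow> (('v, 'e) point \<Rightarrow> real) set" where
  "fem_space \<Gamma> n = {u.
     continuous_on_graph \<Gamma> u \<and>
     (\<forall>e\<in>edges \<Gamma>. \<forall>i<n e. \<exists>c d.
        \<forall>x\<in>{real i * mesh_width \<Gamma> n e..real (i + 1) * mesh_width \<Gamma> n e}.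
          on_edge \<Gamma> u e x = c + d * x) \<and>
     (\<forall>p. p \<notin> points \<Gamma> \<longrightarrow> u p = 0)}"

lemma vector_space_point_functions: "vector_space (\<lambda>(c::real) (u :: 'p \<Rightarrow> real) p. c * u p)"
  by unfold_locales (auto simp: fun_eq_iff algebra_simps)

definition fem_dim :: "('v, 'e) metric_graph \<Rightarrow> ('e \<Rightarrow> nat) \<Rightarrow> nat" where
  "fem_dim \<Gamma> n = vector_space.dim (\<lambda>(c::real) u p. c * u p) (fem_space \<Gamma> n)"

definition fem_proj ::
  "('v, 'e) metric_graph \<Rightarrow> ('e \<Rightarrow> nat) \<Rightarrow> (('v, 'e) point \<Rightarrow> real) \<Rightarrow> ('v, 'e) point \<Rightarrow> real"
  where
  "fem_proj \<Gamma> n f =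
     (THE u. u \<in> fem_space \<Gamma> n \<and> (\<forall>w\<in>fem_space \<Gamma> n. L2_inner \<Gamma> u w = L2_inner \<Gamma> f w))"

definition fem_op ::
  "('v, 'e) metric_graph \<Rightarrow> (('v, 'e) point \<Rightarrow> real) \<Rightarrow> (('v, 'e) point \<Rightarrow> real) \<Rightarrow> real \<Rightarrow>
     ('e \<Rightarrow> nat) \<Rightarrow> (('v, 'e) point \<Rightarrow> real) \<Rightarrow> ('v, 'e) point \<Rightarrow> real" where
  "fem_op \<Gamma> \<kappa> a \<alpha> n u =
     (THE z. z \<in> fem_space \<Gamma> n \<and>
        (\<forall>w\<in>fem_space \<Gamma> n. L2_inner \<Gamma> z w = bilinear_form \<Gamma> \<kappa> a \<alpha> u w))"

text \<open>The series is summed in the finite element space.\<close>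

definition fem_noise ::
  "('v, 'e) metric_graph \<Rightarrow> ('e \<Rightarrow> nat) \<Rightarrow> (nat \<Rightarrow> ('v, 'e) point \<Rightarrow> real) \<Rightarrow>
     (nat \<Rightarrow> 'w \<Rightarrow> real) \<Rightarrow> 'w \<Rightarrow> ('v, 'e) point \<Rightarrow> real" where
  "fem_noise \<Gamma> n b \<xi> \<omega> =
     series_sum \<Gamma> (fem_space \<Gamma> n) (\<lambda>j p. \<xi> j \<omega> * fem_proj \<Gamma> n (b j) p)"

definition fem_resolvent ::
  "('v, 'e) metric_graph \<Rightarrow> (('v, 'e) point \<Rightarrow> real) \<Rightarrow> (('v, 'e) point \<Rightarrow> real) \<Rightarrow> real \<Rightarrow>
     ('e \<Rightarrow> nat) \<Rightarrow> real \<Rightarrow> (('v, 'e) point \<Rightarrow> real) \<Rightarrow> ('v, 'e) point \<Rightarrow> real" where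
  "fem_resolvent \<Gamma> \<kappa> a \<alpha> n s =
     inv_into (fem_space \<Gamma> n) (\<lambda>u p. u p + s * fem_op \<Gamma> \<kappa> a \<alpha> n u p)"

definition quadrature ::
  "('v, 'e) metric_graph \<Rightarrow> (('v, 'e) point \<Rightarrow> real) \<Rightarrow> (('v, 'e) point \<Rightarrow> real) \<Rightarrow> real \<Rightarrow>
     ('e \<Rightarrow> nat) \<Rightarrow> real \<Rightarrow> real \<Rightarrow> (('v, 'e) point \<Rightarrow> real) \<Rightarrow> ('v, 'e) point \<Rightarrow> real" where
  "quadrature \<Gamma> \<kappa> a \<alpha> n k \<beta> f p =
     2 * k * sin (pi * \<beta>) / pi *
     (\<Sum>l\<in>{- \<lceil>pi\<^sup>2 / (4 * \<beta> * k\<^sup>2)\<rceil>..\<lceil>pi\<^sup>2 / (4 * (1 - \<beta>) * k\<^sup>2)\<rceil>}.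
        exp (2 * \<beta> * of_int l * k) * fem_resolvent \<Gamma> \<kappa> a \<alpha> n (exp (2 * of_int l * k)) f p)"

definition approx_solution ::
  "('v, 'e) metric_graph \<Rightarrow> (('v, 'e) point \<Rightarrow> real) \<Rightarrow> (('v, 'e) point \<Rightarrow> real) \<Rightarrow> real \<Rightarrow>
     ('e \<Rightarrow> nat) \<Rightarrow> real \<Rightarrow> real \<Rightarrow> (nat \<Rightarrow> ('v, 'e) point \<Rightarrow> real) \<Rightarrow> (nat \<Rightarrow> 'w \<Rightarrow> real) \<Rightarrow>
     'w \<Rightarrow> ('v, 'e) point \<Rightarrow> real" where
  "approx_solution \<Gamma> \<kappa> a \<alpha> n k \<beta> b \<xi> \<omega> =
     quadrature \<Gamma> \<kappa> a \<alpha> n k \<beta> (fem_noise \<Gamma> n b \<xi> \<omega>)"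

end

theory Submission
  imports Defs "HOL-Complex_Analysis.Complex_Analysis" "HOL-Real_Asymp.Real_Asymp"
begin

text \<open>
  The mean square error is the squared Hilbert--Schmidt norm of the difference between \<open>L\<^sup>-\<^sup>\<beta>\<close> and its
  discrete counterpart, the quadrature applied after the \<open>L\<^sub>2\<close> projection.  The trace inequality on an
  edge bounds the number of eigenvalues below \<open>\<Lambda>\<close> by a multiple of \<open>\<Lambda>\<^sup>1\<^sup>/\<^sup>2\<close>, so that
  the sum of \<open>\<lambda>\<^sub>j\<^sup>-\<^sup>s\<close> is finite for \<open>s > 1/2\<close>.  For a finite combination of eigenfunctions the flux \<open>a u'\<close>
  has a square integrable derivative on every edge; hence nodal interpolation has energy error of order \<open>h\<close>,
  and by duality the inverses of \<open>L\<close> and \<open>L\<^sub>h\<close> differ by \<open>h\<^sup>2\<close>.  The matrix of the discrete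
  eigenfunctions in the continuous eigenbasis carries this estimate over to the powers \<open>-\<beta>\<close>, one row at a
  time, which costs the factor \<open>N\<^sub>h\<^sup>1\<^sup>/\<^sup>2\<close>; the projection error contributes \<open>h\<^sup>2\<^sup>\<sigma>\<^sup>-\<^sup>1\<^sup>/\<^sup>2\<close>
  without that factor.  The quadrature is exponentially accurate on scalars, by shifting contours.
\<close>

section \<open>Test functions\<close>

text \<open>The operator is given through weak derivatives that are arbitrary representatives, on
  functions rather than classes, and \<open>a\<close> is only Lipschitz. Weak derivatives are
  therefore traded for functions that equal, at every point of an edge, the integral of a square
  integrable function; only then do vertex values and boundary terms have a meaning. That the flux
  \<open>a u'\<close> is again such a function is the one place where this takes measure theory: its
  increments are dominated by an integral.

  Duality is run on finite combinations of eigenfunctions, whose images under the operator are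
  explicit. The bounds do not depend on the number of terms and pass to the limit by Parseval.

  The constant depends on an upper bound \<open>k0\<close> of the step size. For large
  \<open>k\<close> the node 0 alone contributes a multiple of \<open>k\<close> to the quadrature,
  while the right-hand side stays bounded in \<open>k\<close>.\<close>

definition smooth_fun :: "(real \<Rightarrow> real) \<Rightarrow> bool" where
  "smooth_fun f \<longleftrightarrow> (\<forall>n x. (deriv ^^ n) f field_differentiable (at x))"

text \<open>A family that contains a derivative of each member contains all iterated derivatives.
  Smoothness of a concrete function is thus shown by naming such a family, with no formula for the
  n-th derivative.\<close>

lemma smooth_fun_coinduct:
  assumes "f \<in> A"
    and "\<And>g. g \<in> A \<Longrightarrow> \<exists>g'\<in>A. \<forall>x. (g has_field_derivative g' x) (at x)"
  shows "smooth_fun f"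
proof -
  have *: "deriv g \<in> A" if gA: "g \<in> A" for g
  proof -
    obtain g' where "g' \<in> A" "\<forall>x. (g has_field_derivative g' x) (at x)" using assms(2)[OF gA] by blast
    moreover from this have "deriv g = g'" by (auto intro!: DERIV_imp_deriv)
    ultimately show ?thesis by simp
  qed
  have "(deriv ^^ n) f \<in> A" for n by (induction n) (auto simp: assms(1) *)
  then show ?thesis
    unfolding smooth_fun_def field_differentiable_def using assms(2) by blast
qed

lemma smooth_fun_deriv: "smooth_fun f \<Longrightarrow> smooth_fun (deriv f)"
  unfolding smooth_fun_def by (metis comp_apply funpow_Suc_right)

lemma smooth_fun_DERIV: "smooth_fun f \<Longrightarrow> (f has_field_derivative deriv f x) (at x)"
  unfolding smooth_fun_def by (metis funpow_0 field_differentiable_derivI)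

lemma smooth_fun_continuous: "smooth_fun f \<Longrightarrow> continuous_on S f"
  by (meson DERIV_isCont continuous_at_imp_continuous_on smooth_fun_DERIV)

text \<open>The derivative of a product is a sum of products, so a set closed under both operations
  is stable under differentiation and \<open>smooth_fun_coinduct\<close> applies to it.\<close>

inductive_set smooth_algebra :: "(real \<Rightarrow> real) set" where
  base: "smooth_fun f \<Longrightarrow> f \<in> smooth_algebra"
| add: "f \<in> smooth_algebra \<Longrightarrow> g \<in> smooth_algebra \<Longrightarrow> (\<lambda>x. f x + g x) \<in> smooth_algebra"
| mult: "f \<in> smooth_algebra \<Longrightarrow> g \<in> smooth_algebra \<Longrightarrow> (\<lambda>x. f x * g x) \<in> smooth_algebra"

lemma smooth_algebra_smooth: assumes "f \<in> smooth_algebra" shows "smooth_fun f"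
proof (rule smooth_fun_coinduct[OF assms])
  fix g assume "g \<in> smooth_algebra"
  then show "\<exists>g'\<in>smooth_algebra. \<forall>x. (g has_field_derivative g' x) (at x)"
  proof induction
    case (base f)
    then show ?case using smooth_fun_deriv smooth_fun_DERIV smooth_algebra.base by blast
  next
    case (add f g)
    then obtain f' g' where "f' \<in> smooth_algebra" "g' \<in> smooth_algebra"
      "\<forall>x. (f has_field_derivative f' x) (at x)" "\<forall>x. (g has_field_derivative g' x) (at x)" by blast
    then show ?case
      by (intro bexI[of _ "\<lambda>x. f' x + g' x"]) (auto intro!: DERIV_add smooth_algebra.add)
  next
    case (mult f g)
    then obtain f' g' where *: "f' \<in> smooth_algebra" "g' \<in> smooth_algebra"
      "\<forall>x. (f has_field_derivative f' x) (at x)" "\<forall>x. (g has_field_derivative g' x) (at x)" by blast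
    show ?case
      using * mult.hyps
      by (intro bexI[of _ "\<lambda>x. f' x * g x + g' x * f x"])
        (auto intro!: DERIV_mult smooth_algebra.add smooth_algebra.mult)
  qed
qed

lemma smooth_fun_add: "smooth_fun f \<Longrightarrow> smooth_fun g \<Longrightarrow> smooth_fun (\<lambda>x. f x + g x)"
  by (rule smooth_algebra_smooth[OF smooth_algebra.add[OF smooth_algebra.base smooth_algebra.base]])

lemma smooth_fun_mult: "smooth_fun f \<Longrightarrow> smooth_fun g \<Longrightarrow> smooth_fun (\<lambda>x. f x * g x)"
  by (rule smooth_algebra_smooth[OF smooth_algebra.mult[OF smooth_algebra.base smooth_algebra.base]])

lemma smooth_fun_const: "smooth_fun (\<lambda>_. c)"
  by (rule smooth_fun_coinduct[of _ "{\<lambda>_. c, \<lambda>_. 0}"]) auto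

lemma smooth_fun_power: "smooth_fun f \<Longrightarrow> smooth_fun (\<lambda>x. f x ^ n)"
  by (induction n) (auto simp: smooth_fun_const intro!: smooth_fun_mult)

lemma smooth_fun_cmult: "smooth_fun f \<Longrightarrow> smooth_fun (\<lambda>x. c * f x)"
  by (intro smooth_fun_mult smooth_fun_const)

lemma smooth_fun_diff: "smooth_fun f \<Longrightarrow> smooth_fun g \<Longrightarrow> smooth_fun (\<lambda>x. f x - g x)"
  using smooth_fun_add[of f "\<lambda>x. (-1) * g x"] smooth_fun_cmult[of g "-1"] by simp

lemma smooth_fun_affine:
  assumes "smooth_fun f" shows "smooth_fun (\<lambda>x. f (c * x + d))"
\<comment> \<open>The factor \<open>e\<close> collects the powers of \<open>c\<close> that the chain
  rule produces.\<close>
proof (rule smooth_fun_coinduct[of _ "{\<lambda>x. e * f (c * x + d) | e f. smooth_fun f}"])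
  show "(\<lambda>x. f (c * x + d)) \<in> {\<lambda>x. e * f (c * x + d) | e f. smooth_fun f}"
    by (rule CollectI, rule exI[of _ 1], rule exI[of _ f]) (use assms in simp)
  fix g assume "g \<in> {\<lambda>x. e * f (c * x + d) | e f. smooth_fun f}"
  then obtain e f where g: "g = (\<lambda>x. e * f (c * x + d))" "smooth_fun f" by auto
  have "(g has_field_derivative (e * c) * deriv f (c * x + d)) (at x)" for x
  proof -
    have "((\<lambda>x. c * x + d) has_field_derivative c) (at x)" by (auto intro!: derivative_eq_intros)
    from DERIV_cmult[OF DERIV_chain2[OF smooth_fun_DERIV[OF g(2)] this], of e]
    show ?thesis unfolding g(1) by (simp add: mult_ac)
  qed
  then show "\<exists>g'\<in>{\<lambda>x. e * f (c * x + d) | e f. smooth_fun f}. \<forall>x. (g has_field_derivative g' x) (at x)"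
    using smooth_fun_deriv[OF g(2)] by (intro bexI[of _ "\<lambda>x. (e * c) * deriv f (c * x + d)"]) auto
qed

text \<open>The standard flat function \<open>exp (- 1 / x)\<close> times a polynomial in
  \<open>1 / x\<close>; carrying the polynomial makes the family stable under
  differentiation.\<close>

definition flat_exp :: "real poly \<Rightarrow> real \<Rightarrow> real" where
  "flat_exp p x = (if x > 0 then poly p (1 / x) * exp (- (1 / x)) else 0)"

lemma poly_exp_tendsto: "((\<lambda>y. poly p y * exp (- y)) \<longlongrightarrow> (0::real)) at_top"
proof -
  have *: "((\<lambda>y. y ^ i * exp (- y)) \<longlongrightarrow> (0::real)) at_top" for i
    using tendsto_power_div_exp_0[of i] by (simp add: exp_minus field_simps)
  have "((\<lambda>y. \<Sum>i\<le>Polynomial.degree p. coeff p i * (y ^ i * exp (- y))) \<longlongrightarrow> (\<Sum>i\<le>Polynomial.degree p. coeff p i * 0)) at_top"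
    by (intro tendsto_intros *)
  then show ?thesis by (simp add: poly_altdef sum_distrib_right mult.assoc)
qed

text \<open>For positive \<open>x\<close> the derivative is
  \<open>(p - p')(1 / x) * exp (- 1 / x) / x^2\<close>, and \<open>[:0,0,1:]\<close> is the square
  of the variable. At 0 the difference quotient carries one more factor \<open>1 / x\<close>, which
  the exponential still beats.\<close>

lemma flat_exp_DERIV:
  "(flat_exp p has_field_derivative flat_exp ([:0,0,1:] * (p - pderiv p)) x) (at x)"
proof -
  consider "x > 0" | "x < 0" | "x = 0" by linarith
  then show ?thesis
  proof cases
    case 1
    have d: "((\<lambda>x. poly p (1 / x) * exp (- (1 / x))) has_field_derivative
        flat_exp ([:0,0,1:] * (p - pderiv p)) x) (at x)"
      using 1 by (auto intro!: derivative_eq_intros simp: flat_exp_def field_simps power2_eq_square)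
    have "\<forall>\<^sub>F y in nhds x. poly p (1 / y) * exp (- (1 / y)) = flat_exp p y"
      using eventually_nhds_in_open[of "{0<..}" x] 1 by (auto elim!: eventually_mono simp: flat_exp_def)
    from DERIV_cong_ev[OF refl this refl] d show ?thesis by blast
  next
    case 2
    have d: "((\<lambda>x. 0) has_field_derivative flat_exp ([:0,0,1:] * (p - pderiv p)) x) (at x)"
      using 2 by (auto simp: flat_exp_def)
    have "\<forall>\<^sub>F y in nhds x. 0 = flat_exp p y"
      using eventually_nhds_in_open[of "{..<0}" x] 2 by (auto elim!: eventually_mono simp: flat_exp_def)
    from DERIV_cong_ev[OF refl this refl] d show ?thesis by blast
  next
    case 3
    have "((\<lambda>y. poly (pCons 0 p) (inverse y) * exp (- inverse y)) \<longlongrightarrow> 0) (at_right 0)"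
      by (rule filterlim_compose[OF poly_exp_tendsto filterlim_inverse_at_top_right])
    then have "((\<lambda>y. flat_exp p y / y) \<longlongrightarrow> 0) (at_right 0)"
      by (rule Lim_transform_eventually)
        (auto simp: eventually_at_filter flat_exp_def field_simps)
    moreover have "((\<lambda>y. flat_exp p y / y) \<longlongrightarrow> 0) (at_left 0)"
      by (rule tendsto_eventually) (auto simp: eventually_at_filter flat_exp_def)
    ultimately have "((\<lambda>y. flat_exp p y / y) \<longlongrightarrow> 0) (at 0)"
      by (simp add: filterlim_at_split)
    then show ?thesis using 3 by (simp add: DERIV_def flat_exp_def)
  qed
qed

lemma smooth_flat_exp: "smooth_fun (flat_exp p)"
  by (rule smooth_fun_coinduct[of _ "range flat_exp"]) (use flat_exp_DERIV in auto)

text \<open>Positivity exactly on the interval and the bound by 1 are what makes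
  \<open>1 - (1 - B x) ^ n\<close> increase to the indicator of the interval.\<close>

lemma bump_exists:
  assumes "s < t"
  obtains B where "smooth_fun B" "\<And>x. 0 \<le> B x" "\<And>x. B x \<le> 1" "\<And>x. 0 < B x \<longleftrightarrow> s < x \<and> x < t"
proof
  define B where "B = (\<lambda>x. flat_exp 1 (1 * x + (- s)) * flat_exp 1 ((- 1) * x + t))"
  show "smooth_fun B" unfolding B_def by (intro smooth_fun_mult smooth_fun_affine smooth_flat_exp)
  have f: "0 \<le> flat_exp 1 x" "flat_exp 1 x \<le> 1" "0 < flat_exp 1 x \<longleftrightarrow> 0 < x" for x
    by (auto simp: flat_exp_def)
  show "0 \<le> B x" "B x \<le> 1" for x unfolding B_def by (auto intro!: mult_nonneg_nonneg mult_le_one f)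
  show "0 < B x \<longleftrightarrow> s < x \<and> x < t" for x
    using f(3)[of "x - s"] f(3)[of "t - x"] f(1)[of "x - s"] f(1)[of "t - x"]
    unfolding B_def by (auto simp: zero_less_mult_iff)
qed

section \<open>Test functions detect null functions\<close>

lemma test_function_iff:
  "test_function l \<phi> \<longleftrightarrow> smooth_fun \<phi> \<and> (\<exists>c d. 0 < c \<and> d < l \<and> (\<forall>x. x \<notin> {c..d} \<longrightarrow> \<phi> x = 0))"
  by (simp add: test_function_def smooth_fun_def)

lemma borel_measurable_lebesgue_on:
  "f \<in> borel_measurable borel \<Longrightarrow> f \<in> borel_measurable (lebesgue_on S)"
  by (intro measurable_restrict_space1 measurable_completion) simp

lemma test_function_bounded_measurable:
  assumes "test_function l \<phi>"
  shows "\<phi> \<in> borel_measurable borel" "\<exists>C. \<forall>x. \<bar>\<phi> x\<bar> \<le> C"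
proof -
  obtain c d where sm: "smooth_fun \<phi>" and cd: "\<And>x. x \<notin> {c..d} \<Longrightarrow> \<phi> x = 0"
    using assms by (auto simp: test_function_iff)
  show "\<phi> \<in> borel_measurable borel"
    using smooth_fun_continuous[OF sm] by (rule borel_measurable_continuous_onI)
  have "bounded (\<phi> ` {c..d})"
    using compact_continuous_image[OF smooth_fun_continuous[OF sm]] compact_imp_bounded by blast
  then obtain C where "\<forall>x\<in>{c..d}. \<bar>\<phi> x\<bar> \<le> C" by (auto simp: bounded_iff)
  then have "\<bar>\<phi> x\<bar> \<le> max C 0" for x using cd[of x] by (cases "x \<in> {c..d}") (fastforce simp: max_def)+
  then show "\<exists>C. \<forall>x. \<bar>\<phi> x\<bar> \<le> C" by blast
qed

text \<open>The positive and the negative part of \<open>f\<close> are densities of two finite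
  measures that agree on all rays, hence agree; so the two parts coincide almost everywhere and both
  vanish. The Borel version \<open>g\<close> of the extension by zero moves the argument to
  \<open>lborel\<close>.\<close>

lemma AE_zero_of_intervals:
  fixes f :: "real \<Rightarrow> real"
  assumes f: "integrable (lebesgue_on {0..l}) f"
    and z: "\<And>x. (LINT y|lebesgue_on {0..l}. f y * indicator {x<..} y) = 0"
  shows "AE x in lebesgue_on {0..l}. f x = 0"
proof -
  define F where "F = (\<lambda>x. indicator {0..l} x * f x)"
  have F: "integrable lebesgue F"
    using f by (simp add: F_def integrable_restrict_space)
  then obtain g where g[measurable]: "g \<in> borel_measurable lborel" and "AE x in lborel. F x = g x"
    using completion_ex_borel_measurable_real[of F lborel] by auto
  then have Fg: "AE x in lebesgue. F x = g x" by (simp add: AE_completion)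
  have Fm[measurable]: "F \<in> borel_measurable lebesgue" and gm[measurable]: "g \<in> borel_measurable lebesgue"
    using F g by (auto intro: measurable_completion)
  have im[measurable]: "(indicator {x<..} :: real \<Rightarrow> real) \<in> borel_measurable lebesgue" for x
    by (intro measurable_completion) simp
  have "integrable lebesgue g" using F integrable_cong_AE[OF Fm gm Fg] by blast
  then have gi: "integrable lborel g" using g integrable_completion by blast
  have gz: "(LINT y|lborel. g y * indicator {x<..} y) = 0" for x :: real
  proof -
    have "(LINT y|lborel. g y * indicator {x<..} y) = (LINT y|lebesgue. g y * indicator {x<..} y)"
      by (intro integral_completion[symmetric]) measurable
    also have "\<dots> = (LINT y|lebesgue. F y * indicator {x<..} y)"
      using Fg by (intro integral_cong_AE borel_measurable_times Fm gm im) (auto elim: eventually_mono)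
    also have "\<dots> = (LINT y|lebesgue_on {0..l}. f y * indicator {x<..} y)"
      by (simp add: F_def integral_restrict_space mult_ac)
    finally show ?thesis using z by simp
  qed
  have "density lborel (\<lambda>x. ennreal (max 0 (g x))) = density lborel (\<lambda>x. ennreal (max 0 (- g x)))"
  proof (rule measure_eqI_lessThan)
    fix x :: real
    have em: "emeasure (density lborel (\<lambda>x. ennreal (max 0 (h x)))) {x<..}
       = ennreal (LINT y|lborel. max 0 (h y) * indicator {x<..} y)"
      if [measurable]: "h \<in> borel_measurable borel" and "integrable lborel h" for h :: "real \<Rightarrow> real"
    proof -
      have "integrable lborel (\<lambda>y. max 0 (h y) * indicator {x<..} y)"
        by (rule Bochner_Integration.integrable_bound[OF that(2)]) (auto simp: indicator_def)
      then show ?thesis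
        by (subst emeasure_density)
          (auto intro!: nn_integral_cong simp: nn_integral_eq_integral[symmetric] indicator_def)
    qed
    show "emeasure (density lborel (\<lambda>x. ennreal (max 0 (g x)))) {x<..} < \<infinity>"
      using g gi by (subst em) auto
    have "(LINT y|lborel. max 0 (g y) * indicator {x<..} y) - (LINT y|lborel. max 0 (- g y) * indicator {x<..} y)
       = (LINT y|lborel. max 0 (g y) * indicator {x<..} y - max 0 (- g y) * indicator {x<..} y)"
      by (intro Bochner_Integration.integral_diff[symmetric] Bochner_Integration.integrable_bound[OF gi])
        (use g in \<open>auto simp: indicator_def\<close>)
    also have "\<dots> = (LINT y|lborel. g y * indicator {x<..} y)"
      by (intro Bochner_Integration.integral_cong) (auto simp: indicator_def)
    finally have "(LINT y|lborel. max 0 (g y) * indicator {x<..} y) = (LINT y|lborel. max 0 (- g y) * indicator {x<..} y)"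
      using gz by simp
    then show "emeasure (density lborel (\<lambda>x. ennreal (max 0 (g x)))) {x<..} =
        emeasure (density lborel (\<lambda>x. ennreal (max 0 (- g x)))) {x<..}"
      using g gi by (subst (1 2) em) auto
  qed simp_all
  then have "AE x in lborel. ennreal (max 0 (g x)) = ennreal (max 0 (- g x))"
    using g by (intro sigma_finite_measure.density_unique[OF sigma_finite_lborel]) simp_all
  then have "AE x in lborel. g x = 0" by eventually_elim (auto simp: max_def split: if_splits)
  then have "AE x in lebesgue. g x = 0" by (rule AE_completion)
  with Fg have "AE x in lebesgue. F x = 0" by eventually_elim simp
  then show ?thesis by (auto simp: AE_restrict_space_iff F_def indicator_def elim!: eventually_mono)
qed

text \<open>Powers built from a bump approximate the indicator of an inner interval, and inner
  intervals exhaust the part of a ray in \<open>{0..l}\<close>; dominated convergence with the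
  modulus of \<open>f\<close> carries the hypothesis through both limits.\<close>

lemma AE_zero_of_test_functions:
  assumes f: "integrable (lebesgue_on {0..l}) f"
    and z: "\<And>\<phi>. test_function l \<phi> \<Longrightarrow> (LINT x|lebesgue_on {0..l}. f x * \<phi> x) = 0"
  shows "AE x in lebesgue_on {0..l}. f x = 0"
proof (rule AE_zero_of_intervals[OF f])
  fix x :: real
  have fm: "f \<in> borel_measurable (lebesgue_on {0..l})" using f by (rule borel_measurable_integrable)
  have fi: "(\<lambda>y. f y * indicator A y) \<in> borel_measurable (lebesgue_on {0..l})" if "A \<in> sets borel" for A
    using that by (intro borel_measurable_times fm borel_measurable_lebesgue_on borel_measurable_indicator)
  have inner: "(LINT y|lebesgue_on {0..l}. f y * indicator {s<..<t} y) = 0" if "0 < s" "s < t" "t < l" for s t :: real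
  proof -
    obtain B where B: "smooth_fun B" "\<And>x. 0 \<le> B x" "\<And>x. B x \<le> 1" "\<And>x. 0 < B x \<longleftrightarrow> s < x \<and> x < t"
      using bump_exists[OF \<open>s < t\<close>] by blast
    define \<phi> where "\<phi> n x = 1 - (1 - B x) ^ n" for n x
    have t: "test_function l (\<phi> n)" for n
      unfolding test_function_iff
    proof (intro conjI exI)
      show "smooth_fun (\<phi> n)"
        unfolding \<phi>_def by (intro smooth_fun_diff smooth_fun_const smooth_fun_power B(1))
      show "\<forall>x. x \<notin> {s..t} \<longrightarrow> \<phi> n x = 0" using B(2,4) by (fastforce simp: \<phi>_def less_le)
    qed (use that in auto)
    have 01: "0 \<le> \<phi> n x" "\<phi> n x \<le> 1" for n x
      using B(2)[of x] B(3)[of x] by (auto simp: \<phi>_def power_le_one)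
    have "(\<lambda>n. LINT y|lebesgue_on {0..l}. f y * \<phi> n y) \<longlonglongrightarrow> (LINT y|lebesgue_on {0..l}. f y * indicator {s<..<t} y)"
    proof (rule integral_dominated_convergence[where w="\<lambda>y. \<bar>f y\<bar>"])
      show "AE y in lebesgue_on {0..l}. (\<lambda>n. f y * \<phi> n y) \<longlonglongrightarrow> f y * indicator {s<..<t} y"
      proof (intro AE_I2 tendsto_mult tendsto_const)
        fix y
        show "(\<lambda>n. \<phi> n y) \<longlonglongrightarrow> indicator {s<..<t} y"
        proof (cases "0 < B y")
          case True
          then have "(\<lambda>n. 1 - (1 - B y) ^ n) \<longlonglongrightarrow> 1 - 0"
            using B(3)[of y] by (intro tendsto_intros LIMSEQ_realpow_zero) auto
          then show ?thesis using True B(4)[of y] by (simp add: \<phi>_def)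
        next
          case False
          then show ?thesis using B(2)[of y] B(4)[of y] by (auto simp: \<phi>_def indicator_def less_le)
        qed
      qed
      show "AE y in lebesgue_on {0..l}. norm (f y * \<phi> n y) \<le> \<bar>f y\<bar>" for n
        using 01 by (auto simp: abs_mult intro!: mult_left_le)
      show "(\<lambda>y. f y * \<phi> n y) \<in> borel_measurable (lebesgue_on {0..l})" for n
        by (intro borel_measurable_times fm borel_measurable_lebesgue_on test_function_bounded_measurable(1)[OF t])
    qed (use f fi in auto)
    then show ?thesis using z[OF t] by (simp add: LIMSEQ_const_iff)
  qed
  define s where "s = max x 0"
  show "(LINT y|lebesgue_on {0..l}. f y * indicator {x<..} y) = 0"
  proof (cases "s < l")
    case False
    have "AE y in lebesgue_on {0..l}. f y * indicator {x<..} y = 0"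
    proof -
      have "AE y in lebesgue. y \<noteq> l"
        by (intro AE_completion AE_lborel_singleton)
      then show ?thesis using False
        by (auto simp: AE_restrict_space_iff s_def indicator_def elim!: eventually_mono)
    qed
    then show ?thesis by (rule integral_eq_zero_AE)
  next
    case True
    \<comment> \<open>With a denominator of at least 3, \<open>s + r n\<close> stays below
      \<open>l - r n\<close>, so every term belongs to a nonempty inner interval.\<close>
    define r where "r n = (l - s) / real (n + 3)" for n :: nat
    have r: "0 < r n" "r n \<le> (l - s) / 3" for n
      unfolding r_def using True by (simp, intro divide_left_mono) auto
    have r0: "r \<longlonglongrightarrow> 0" unfolding r_def by real_asymp
    have "(\<lambda>n. LINT y|lebesgue_on {0..l}. f y * indicator {s + r n<..<l - r n} y)
       \<longlonglongrightarrow> (LINT y|lebesgue_on {0..l}. f y * indicator {x<..} y)"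
    proof (rule integral_dominated_convergence[where w="\<lambda>y. \<bar>f y\<bar>"])
      have "AE y in lebesgue. y \<noteq> l" "AE y in lebesgue. y \<noteq> 0"
        by (intro AE_completion AE_lborel_singleton)+
      then have "AE y in lebesgue. y \<in> {0..l} \<longrightarrow> y \<noteq> 0 \<and> y \<noteq> l \<and> 0 \<le> y \<and> y \<le> l"
        by eventually_elim auto
      then have "AE y in lebesgue_on {0..l}. y \<noteq> 0 \<and> y \<noteq> l \<and> 0 \<le> y \<and> y \<le> l"
        by (subst AE_restrict_space_iff) auto
      then show "AE y in lebesgue_on {0..l}. (\<lambda>n. f y * indicator {s + r n<..<l - r n} y) \<longlonglongrightarrow> f y * indicator {x<..} y"
      proof eventually_elim
        case (elim y)
        have "\<forall>\<^sub>F n in sequentially. (indicator {s + r n<..<l - r n} y :: real) = indicator {x<..} y"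
        proof (cases "x < y")
          case True
          then have "0 < min (y - s) (l - y)" using elim by (auto simp: s_def)
          from order_tendstoD(2)[OF r0 this] show ?thesis
            by eventually_elim (use True in \<open>auto simp: indicator_def\<close>)
        next
          case False
          then have "(indicator {s + r n<..<l - r n} y :: real) = indicator {x<..} y" for n
            using r(1)[of n] elim by (auto simp: indicator_def s_def)
          then show ?thesis by simp
        qed
        then show ?case by (intro tendsto_mult tendsto_const tendsto_eventually)
      qed
    qed (use f fi in \<open>auto simp: abs_mult intro!: mult_left_le\<close>)
    moreover have "s + r n < l - r n" "0 < s + r n" "l - r n < l" for n
      using r[of n] True by (auto simp: s_def max_def split: if_splits)
    ultimately show ?thesis using inner by (simp add: LIMSEQ_const_iff)
  qed
qed

section \<open>Weak derivatives on an interval\<close>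

abbreviation leb :: "real \<Rightarrow> real measure" where "leb l \<equiv> lebesgue_on {0..l}"

lemma finite_measure_interval: "finite_measure (lebesgue_on {a..b::real})"
  by (rule finite_measure_lebesgue_on) simp

lemma square_integrable_imp_integrable:
  assumes "square_integrable l f" shows "integrable (leb l) f"
proof (rule Bochner_Integration.integrable_bound)
  show "integrable (leb l) (\<lambda>x. 1 + (f x)\<^sup>2)"
    using assms by (intro Bochner_Integration.integrable_add finite_measure.integrable_const finite_measure_interval)
      (auto simp: square_integrable_def)
  have "\<bar>y\<bar> \<le> 1 + y\<^sup>2" for y :: real
    using sum_squares_bound[of "\<bar>y\<bar>" 1] abs_ge_zero[of y] by (simp del: abs_ge_zero)
  then show "AE x in leb l. norm (f x) \<le> norm (1 + (f x)\<^sup>2)" by auto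
qed (use assms in \<open>auto simp: square_integrable_def\<close>)

lemma square_integrable_mult_integrable:
  assumes "square_integrable l f" "square_integrable l g"
  shows "integrable (leb l) (\<lambda>x. f x * g x)"
proof (rule Bochner_Integration.integrable_bound)
  show "integrable (leb l) (\<lambda>x. (f x)\<^sup>2 + (g x)\<^sup>2)"
    using assms by (auto simp: square_integrable_def)
  have "\<bar>x * y\<bar> \<le> x\<^sup>2 + y\<^sup>2" for x y :: real
    using sum_squares_bound[of "\<bar>x\<bar>" "\<bar>y\<bar>"] mult_nonneg_nonneg[OF abs_ge_zero[of x] abs_ge_zero[of y]]
    unfolding abs_mult power2_abs by linarith
  then show "AE x in leb l. norm (f x * g x) \<le> norm ((f x)\<^sup>2 + (g x)\<^sup>2)" by auto
qed (use assms in \<open>auto simp: square_integrable_def\<close>)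

lemma square_integrable_lincomb:
  assumes "square_integrable l f" "square_integrable l g"
  shows "square_integrable l (\<lambda>x. c * f x + d * g x)"
proof -
  have "integrable (leb l) (\<lambda>x. c\<^sup>2 * (f x)\<^sup>2 + (2 * c * d) * (f x * g x) + d\<^sup>2 * (g x)\<^sup>2)"
    using assms square_integrable_mult_integrable[OF assms]
    by (intro Bochner_Integration.integrable_add integrable_mult_right) (auto simp: square_integrable_def)
  moreover have "(\<lambda>x. c\<^sup>2 * (f x)\<^sup>2 + (2 * c * d) * (f x * g x) + d\<^sup>2 * (g x)\<^sup>2) = (\<lambda>x. (c * f x + d * g x)\<^sup>2)"
    by (auto simp: power2_eq_square algebra_simps)
  ultimately show ?thesis using assms by (auto simp: square_integrable_def)
qed

lemma square_integrable_bounded_mult: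
  assumes "square_integrable l f" "b \<in> borel_measurable (leb l)"
    "AE x in leb l. \<bar>b x\<bar> \<le> B"
  shows "square_integrable l (\<lambda>x. b x * f x)"
proof -
  have "integrable (leb l) (\<lambda>x. (b x * f x)\<^sup>2)"
  proof (rule Bochner_Integration.integrable_bound)
    show "integrable (leb l) (\<lambda>x. B\<^sup>2 * (f x)\<^sup>2)"
      using assms by (auto simp: square_integrable_def)
    show "AE x in leb l. norm ((b x * f x)\<^sup>2) \<le> norm (B\<^sup>2 * (f x)\<^sup>2)"
      using assms(3)
    proof eventually_elim
      case (elim x)
      then have "(b x)\<^sup>2 \<le> B\<^sup>2" by (metis abs_ge_zero power2_abs power_mono)
      then show ?case by (simp add: power_mult_distrib mult_right_mono)
    qed
  qed (use assms in \<open>auto simp: square_integrable_def\<close>)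
  then show ?thesis using assms by (auto simp: square_integrable_def)
qed

lemma continuous_on_measurable_interval:
  fixes f :: "real \<Rightarrow> real"
  assumes "continuous_on {a..b} f" shows "f \<in> borel_measurable (lebesgue_on {a..b})"
  using continuous_imp_measurable_on_sets_lebesgue[OF assms] by simp

lemma square_integrable_continuous:
  assumes "continuous_on {0..l} f" shows "square_integrable l f"
  unfolding square_integrable_def
proof
  show "f \<in> borel_measurable (leb l)" using continuous_on_measurable_interval[OF assms] .
  have "continuous_on {0..l} (\<lambda>x. (f x)\<^sup>2)" using assms by (intro continuous_intros)
  then show "integrable (leb l) (\<lambda>x. (f x)\<^sup>2)"
    using absolutely_integrable_continuous_real[of 0 l "\<lambda>x. (f x)\<^sup>2"] by (simp add: integrable_restrict_space set_integrable_def)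
qed

lemma square_integrable_Cauchy_Schwarz:
  assumes f: "square_integrable l f" and g: "square_integrable l g"
  shows "(LINT x|leb l. f x * g x)\<^sup>2 \<le>
    (LINT x|leb l. (f x)\<^sup>2) * (LINT x|leb l. (g x)\<^sup>2)"
proof -
  define A where "A = (LINT x|leb l. (f x)\<^sup>2)"
  define B where "B = (LINT x|leb l. f x * g x)"
  define C where "C = (LINT x|leb l. (g x)\<^sup>2)"
  have fg: "integrable (leb l) (\<lambda>x. (f x)\<^sup>2)" "integrable (leb l) (\<lambda>x. (g x)\<^sup>2)"
    using f g by (auto simp: square_integrable_def)
  have q: "0 \<le> A + 2 * t * B + t\<^sup>2 * C" for t
  proof -
    have "0 \<le> (LINT x|leb l. (f x + t * g x)\<^sup>2)" by simp
    also have "\<dots> = (LINT x|leb l. (f x)\<^sup>2 + (2 * t) * (f x * g x) + t\<^sup>2 * (g x)\<^sup>2)"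
      by (intro Bochner_Integration.integral_cong) (auto simp: power2_eq_square algebra_simps)
    also have "\<dots> = A + 2 * t * B + t\<^sup>2 * C"
      unfolding A_def B_def C_def
      using fg square_integrable_mult_integrable[OF f g] by simp
    finally show ?thesis .
  qed
  have AC: "0 \<le> A" "0 \<le> C" by (simp_all add: A_def C_def)
  have "B\<^sup>2 \<le> A * C"
  proof (cases "C = 0")
    case True
    have "B = 0"
    proof (rule ccontr)
      assume "B \<noteq> 0"
      \<comment> \<open>For \<open>C = 0\<close> the expression in \<open>q\<close> is affine in
        \<open>t\<close>; at this \<open>t\<close> its value is -1.\<close>
      then have "2 * (- (A + 1) / (2 * B)) * B = - (A + 1)" by simp
      then show False using q[of "- (A + 1) / (2 * B)"] True by simp
    qed
    then show ?thesis using AC by simp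
  next
    case False
    then show ?thesis using q[of "- B / C"] AC
      by (simp add: field_simps power2_eq_square)
  qed
  then show ?thesis by (simp add: A_def B_def C_def)
qed

text \<open>Absolute continuity with square integrable derivative, in integrated form. Equality at
  every point of \<open>{0..l}\<close> selects the continuous representative, so that values at the
  ends of an edge are meaningful.\<close>

definition has_L2_deriv :: "real \<Rightarrow> (real \<Rightarrow> real) \<Rightarrow> (real \<Rightarrow> real) \<Rightarrow> bool" where
  "has_L2_deriv l f g \<longleftrightarrow> square_integrable l g \<and> (\<forall>x\<in>{0..l}. f x = f 0 + integral {0..x} g)"

lemma has_L2_derivI:
  "square_integrable l g \<Longrightarrow> (\<And>x. x \<in> {0..l} \<Longrightarrow> f x = f 0 + integral {0..x} g) \<Longrightarrow> has_L2_deriv l f g"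
  unfolding has_L2_deriv_def by blast

lemma has_L2_derivD:
  assumes "has_L2_deriv l f g"
  shows "square_integrable l g" "x \<in> {0..l} \<Longrightarrow> f x = f 0 + integral {0..x} g"
  using assms by (simp_all only: has_L2_deriv_def)

text \<open>Bridge between the Bochner integral over the whole edge and the gauge integral over a
  part of it: an indicator in the first becomes the domain of the second.\<close>

lemma integrable_imp_integrable_on:
  fixes g :: "real \<Rightarrow> real"
  assumes "integrable (leb l) g" "0 \<le> x" "y \<le> l"
  shows "g absolutely_integrable_on {x..y}" "g integrable_on {x..y}"
    "(LINT t|leb l. g t * indicator {x..y} t) = integral {x..y} g"
proof -
  have "set_integrable lebesgue {0..l} g" using assms(1) by (simp add: set_integrable_def integrable_restrict_space)
  then show *: "g absolutely_integrable_on {x..y}"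
    by (rule set_integrable_subset) (use assms in auto)
  then show "g integrable_on {x..y}" using set_lebesgue_integral_eq_integral(1) by blast
  have "(LINT t|leb l. g t * indicator {x..y} t) = (LINT t|lebesgue. indicator {x..y} t * g t)"
  proof -
    have "indicator {0..l} t * (g t * indicator {x..y} t) = indicator {x..y} t * g t" for t
      using assms(2,3) by (cases "t \<in> {x..y}") simp_all
    then show ?thesis by (subst integral_restrict_space) (simp, simp only: real_scaleR_def)
  qed
  then show "(LINT t|leb l. g t * indicator {x..y} t) = integral {x..y} g"
    using set_lebesgue_integral_eq_integral(2)[OF *] by (simp add: set_lebesgue_integral_def)
qed

lemma has_L2_deriv_diff:
  assumes "has_L2_deriv l f g" "0 \<le> x" "x \<le> y" "y \<le> l"
  shows "f y - f x = integral {x..y} g"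
proof -
  have i: "integrable (leb l) g"
    using assms square_integrable_imp_integrable has_L2_derivD(1) by blast+
  have "integral {0..x} g + integral {x..y} g = integral {0..y} g"
    using assms integrable_imp_integrable_on(2)[OF i, of 0 y] by (intro Henstock_Kurzweil_Integration.integral_combine) auto
  moreover have "f x = f 0 + integral {0..x} g" "f y = f 0 + integral {0..y} g"
    using assms by (auto intro!: has_L2_derivD(2)[OF assms(1)])
  ultimately show ?thesis by simp
qed

lemma has_L2_deriv_continuous:
  assumes "has_L2_deriv l f g" shows "continuous_on {0..l} f"
proof -
  have i: "integrable (leb l) g"
    using assms square_integrable_imp_integrable has_L2_derivD(1) by blast+
  have "continuous_on {0..l} (\<lambda>x. f 0 + integral {0..x} g)"
    using integrable_imp_integrable_on(2)[OF i, of 0 l] by (intro continuous_intros indefinite_integral_continuous_1) auto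
  moreover have "f 0 + integral {0..x} g = f x" if "x \<in> {0..l}" for x
    using has_L2_derivD(2)[OF assms that] by simp
  ultimately show ?thesis by (rule continuous_on_eq)
qed

lemma has_L2_deriv_lincomb:
  assumes "has_L2_deriv l f f'" "has_L2_deriv l g g'"
  shows "has_L2_deriv l (\<lambda>x. c * f x + d * g x) (\<lambda>x. c * f' x + d * g' x)"
  unfolding has_L2_deriv_def
proof (intro conjI ballI)
  show "square_integrable l (\<lambda>x. c * f' x + d * g' x)"
    using assms square_integrable_lincomb has_L2_derivD(1) by blast
  fix x assume x: "x \<in> {0..l}"
  have i: "integrable (leb l) f'" "integrable (leb l) g'"
    using assms square_integrable_imp_integrable has_L2_derivD(1) by blast+
  have "integral {0..x} (\<lambda>x. c * f' x + d * g' x) = c * integral {0..x} f' + d * integral {0..x} g'"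
    using integrable_imp_integrable_on(2)[OF i(1), of 0 x] integrable_imp_integrable_on(2)[OF i(2), of 0 x] x
    by (intro integral_unique has_integral_add has_integral_mult_right integrable_integral) auto
  moreover have "f x - f 0 = integral {0..x} f'" "g x - g 0 = integral {0..x} g'"
    using has_L2_deriv_diff[OF assms(1), of 0 x] has_L2_deriv_diff[OF assms(2), of 0 x] x by auto
  ultimately have "integral {0..x} (\<lambda>x. c * f' x + d * g' x) = c * (f x - f 0) + d * (g x - g 0)" by simp
  then show "c * f x + d * g x = c * f 0 + d * g 0 + integral {0..x} (\<lambda>x. c * f' x + d * g' x)"
    by (simp add: algebra_simps)
qed

text \<open>Fubini's theorem on the triangle below the diagonal of the square.\<close>

lemma has_L2_deriv_integration_by_parts:
  assumes l: "0 \<le> l" and f: "has_L2_deriv l f f'" and g: "has_L2_deriv l g g'"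
  shows "(LINT x|leb l. f x * g' x) = f l * g l - f 0 * g 0 - (LINT x|leb l. f' x * g x)"
proof -
  let ?M = "leb l"
  have sq: "square_integrable l f'" "square_integrable l g'" using f g has_L2_derivD(1) by blast+
  note i = square_integrable_imp_integrable[OF sq(1)] square_integrable_imp_integrable[OF sq(2)]
  have [measurable]: "f' \<in> borel_measurable ?M" "g' \<in> borel_measurable ?M" using sq by (auto simp: square_integrable_def)
  interpret M: finite_measure ?M by (rule finite_measure_interval)
  interpret P: pair_sigma_finite ?M ?M ..
  have id[measurable]: "(\<lambda>x. x) \<in> borel_measurable ?M" by (rule borel_measurable_lebesgue_on) simp
  define h where "h t x = f' t * g' x * of_bool (t \<le> x)" for t x
  have hm: "case_prod h \<in> borel_measurable (?M \<Otimes>\<^sub>M ?M)"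
  proof -
    have [measurable]: "fst \<in> borel_measurable (?M \<Otimes>\<^sub>M ?M)" "snd \<in> borel_measurable (?M \<Otimes>\<^sub>M ?M)"
      using measurable_compose[OF measurable_fst id] measurable_compose[OF measurable_snd id] by auto
    have "(\<lambda>p. f' (fst p) * g' (snd p) * of_bool (fst p \<le> snd p)) \<in> borel_measurable (?M \<Otimes>\<^sub>M ?M)"
      unfolding of_bool_def by measurable
    then show ?thesis by (simp add: h_def case_prod_beta')
  qed
  have bound: "\<bar>h t x\<bar> \<le> \<bar>f' t\<bar> * \<bar>g' x\<bar>" for t x by (auto simp: h_def abs_mult)
  have hi: "integrable (?M \<Otimes>\<^sub>M ?M) (case_prod h)"
  proof (rule Bochner_Integration.integrable_bound)
    have m: "(\<lambda>(t, x). \<bar>f' t\<bar> * \<bar>g' x\<bar>) \<in> borel_measurable (?M \<Otimes>\<^sub>M ?M)" by measurable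
    show "integrable (?M \<Otimes>\<^sub>M ?M) (\<lambda>(t, x). \<bar>f' t\<bar> * \<bar>g' x\<bar>)"
      by (rule P.Fubini_integrable[OF m]) (use i in \<open>auto simp: abs_mult\<close>)
  qed (use hm bound in auto)
  have G: "(LINT x|?M. h t x) = f' t * (g l - g t)" if "t \<in> {0..l}" for t
  proof -
    have "(LINT x|?M. h t x) = (LINT x|?M. f' t * (g' x * indicator {t..l} x))"
      by (intro Bochner_Integration.integral_cong) (auto simp: h_def indicator_def)
    also have "\<dots> = f' t * integral {t..l} g'"
      using that integrable_imp_integrable_on(3)[OF i(2), of t l] by simp
    finally show ?thesis using has_L2_deriv_diff[OF g, of t l] that by simp
  qed
  have F: "(LINT t|?M. h t x) = g' x * (f x - f 0)" if "x \<in> {0..l}" for x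
  proof -
    have "(LINT t|?M. h t x) = (LINT t|?M. g' x * (f' t * indicator {0..x} t))"
      by (intro Bochner_Integration.integral_cong) (auto simp: h_def indicator_def)
    also have "\<dots> = g' x * integral {0..x} f'"
      using that integrable_imp_integrable_on(3)[OF i(1), of 0 x] by simp
    finally show ?thesis using has_L2_deriv_diff[OF f, of 0 x] that by simp
  qed
  have c: "square_integrable l f" "square_integrable l g"
    using square_integrable_continuous has_L2_deriv_continuous f g by blast+
  have i': "integrable ?M (\<lambda>x. k x * indicator {0..l} x)" if "integrable ?M k" for k :: "real \<Rightarrow> real"
    using that by (subst Bochner_Integration.integrable_cong[where g=k]) auto
  have "(LINT x|?M. g' x * (f x - f 0)) = (LINT x|?M. (LINT t|?M. h t x))"
    by (intro Bochner_Integration.integral_cong) (auto simp: F)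
  also have "\<dots> = (LINT t|?M. (LINT x|?M. h t x))" by (rule P.Fubini_integral[OF hi])
  also have "\<dots> = (LINT t|?M. f' t * (g l - g t))"
    by (intro Bochner_Integration.integral_cong) (auto simp: G)
  finally have "(LINT x|?M. g' x * (f x - f 0)) = (LINT t|?M. f' t * (g l - g t))" .
  moreover have "(LINT x|?M. g' x * (f x - f 0)) = (LINT x|?M. f x * g' x) - f 0 * (g l - g 0)"
  proof -
    have "(LINT x|?M. g' x * (f x - f 0)) = (LINT x|?M. f x * g' x - f 0 * (g' x * indicator {0..l} x))"
      by (intro Bochner_Integration.integral_cong) (auto simp: algebra_simps)
    also have "\<dots> = (LINT x|?M. f x * g' x) - f 0 * (LINT x|?M. g' x * indicator {0..l} x)"
      using square_integrable_mult_integrable[OF c(1) sq(2)] i'[OF i(2)]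
      by (subst Bochner_Integration.integral_diff) auto
    finally show ?thesis
      using integrable_imp_integrable_on(3)[OF i(2), of 0 l] has_L2_deriv_diff[OF g, of 0 l] l by simp
  qed
  moreover have "(LINT t|?M. f' t * (g l - g t)) = g l * (f l - f 0) - (LINT x|?M. f' x * g x)"
  proof -
    have "(LINT t|?M. f' t * (g l - g t)) = (LINT t|?M. g l * (f' t * indicator {0..l} t) - f' t * g t)"
      by (intro Bochner_Integration.integral_cong) (auto simp: algebra_simps)
    also have "\<dots> = g l * (LINT x|?M. f' x * indicator {0..l} x) - (LINT x|?M. f' x * g x)"
      using square_integrable_mult_integrable[OF sq(1) c(2)] i'[OF i(1)]
      by (subst Bochner_Integration.integral_diff) auto
    finally show ?thesis
      using integrable_imp_integrable_on(3)[OF i(1), of 0 l] has_L2_deriv_diff[OF f, of 0 l] l by simp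
  qed
  ultimately show ?thesis by (simp add: algebra_simps)
qed

section \<open>Weak derivatives and integrated derivatives\<close>

lemma test_function_has_L2_deriv:
  assumes "test_function l \<phi>" shows "has_L2_deriv l \<phi> (deriv \<phi>)" "\<phi> 0 = 0" "\<phi> l = 0"
proof -
  obtain c d where sm: "smooth_fun \<phi>" and cd: "0 < c" "d < l" "\<And>x. x \<notin> {c..d} \<Longrightarrow> \<phi> x = 0"
    using assms by (auto simp: test_function_iff)
  show "\<phi> 0 = 0" "\<phi> l = 0" using cd by auto
  show "has_L2_deriv l \<phi> (deriv \<phi>)"
    unfolding has_L2_deriv_def
  proof (intro conjI ballI)
    show "square_integrable l (deriv \<phi>)"
      by (intro square_integrable_continuous smooth_fun_continuous smooth_fun_deriv sm)
    fix x assume "x \<in> {0..l}"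
    then have "(deriv \<phi> has_integral (\<phi> x - \<phi> 0)) {0..x}"
      using smooth_fun_DERIV[OF sm] by (intro fundamental_theorem_of_calculus)
        (auto simp: has_real_derivative_iff_has_vector_derivative[symmetric] intro: has_field_derivative_at_within)
    then show "\<phi> x = \<phi> 0 + integral {0..x} (deriv \<phi>)" by (simp add: integral_unique)
  qed
qed

lemma has_L2_deriv_is_weak_deriv:
  assumes "0 \<le> l" "has_L2_deriv l f g" shows "is_weak_deriv l f g"
  unfolding is_weak_deriv_def
proof (intro allI impI)
  fix \<phi> assume t: "test_function l \<phi>"
  show "(LINT x|leb l. f x * deriv \<phi> x) = - (LINT x|leb l. g x * \<phi> x)"
    using has_L2_deriv_integration_by_parts[OF assms test_function_has_L2_deriv(1)[OF t]]
      test_function_has_L2_deriv(2,3)[OF t] by simp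
qed

lemma has_L2_deriv_unique:
  assumes l: "0 \<le> l" and "is_weak_deriv l f g" "is_weak_deriv l f g'"
    "square_integrable l g" "square_integrable l g'"
  shows "AE x in leb l. g x = g' x"
proof -
  have "AE x in leb l. g x - g' x = 0"
  proof (rule AE_zero_of_test_functions)
    show "integrable (leb l) (\<lambda>x. g x - g' x)"
      using assms square_integrable_imp_integrable by auto
    fix \<phi> assume t: "test_function l \<phi>"
    have \<phi>: "square_integrable l \<phi>"
      using test_function_has_L2_deriv(1)[OF t] has_L2_deriv_continuous square_integrable_continuous by blast
    have "(LINT x|leb l. (g x - g' x) * \<phi> x)
       = (LINT x|leb l. g x * \<phi> x) - (LINT x|leb l. g' x * \<phi> x)"
      using square_integrable_mult_integrable[OF assms(4) \<phi>] square_integrable_mult_integrable[OF assms(5) \<phi>]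
      by (simp add: left_diff_distrib)
    then show "(LINT x|leb l. (g x - g' x) * \<phi> x) = 0"
      using assms(2,3)[unfolded is_weak_deriv_def, rule_format, OF t] by simp
  qed
  then show ?thesis by eventually_elim simp
qed

lemma has_L2_deriv_cong_AE:
  assumes "has_L2_deriv l f g" "AE x in leb l. g x = g' x" "square_integrable l g'"
  shows "has_L2_deriv l f g'"
proof -
  have "integral {0..x} g = integral {0..x} g'" if "x \<in> {0..l}" for x
  proof -
    have i: "integrable (leb l) g" "integrable (leb l) g'"
      using assms square_integrable_imp_integrable has_L2_derivD(1) by blast+
    have "(LINT t|leb l. g t * indicator {0..x} t) = (LINT t|leb l. g' t * indicator {0..x} t)"
      by (intro integral_cong_AE borel_measurable_times borel_measurable_lebesgue_on borel_measurable_indicator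
          borel_measurable_integrable i) (use assms(2) in \<open>auto elim!: eventually_mono\<close>)
    then show ?thesis
      using integrable_imp_integrable_on(3)[OF i(1), of 0 x] integrable_imp_integrable_on(3)[OF i(2), of 0 x] that
      by simp
  qed
  then show ?thesis
    by (intro has_L2_derivI[OF assms(3)]) (rule has_L2_derivD(2)[OF assms(1), THEN trans], simp_all)
qed

lemma smooth_antiderivative:
  assumes "smooth_fun f"
  obtains F where "smooth_fun F" "\<And>x. (F has_field_derivative f x) (at x)"
proof -
  have "\<exists>F. \<forall>x::real. -\<infinity> < ereal x \<longrightarrow> ereal x < \<infinity> \<longrightarrow> (F has_vector_derivative f x) (at x)"
    by (rule einterval_antiderivative) (use smooth_fun_DERIV[OF assms] DERIV_isCont in auto)
  then obtain F where F: "\<And>x. (F has_field_derivative f x) (at x)"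
    by (auto simp: has_real_derivative_iff_has_vector_derivative)
  moreover have "smooth_fun F"
    by (rule smooth_fun_coinduct[of _ "insert F {f. smooth_fun f}"])
      (use F assms smooth_fun_deriv smooth_fun_DERIV in blast)+
  ultimately show ?thesis using that by blast
qed

text \<open>The lemma of du Bois-Reymond. Each test function is a multiple of one fixed bump
  \<open>B\<close> plus the derivative of a test function; hence \<open>f\<close> acts on test
  functions like the constant \<open>K\<close>, its mean with weight \<open>B\<close>.\<close>

lemma weak_deriv_zero_imp_constant:
  assumes l: "0 < l" and f: "square_integrable l f"
    and z: "\<And>\<phi>. test_function l \<phi> \<Longrightarrow> (LINT x|leb l. f x * deriv \<phi> x) = 0"
  shows "\<exists>K. AE x in leb l. f x = K"
proof -
  let ?M = "leb l"
  have test_sq: "square_integrable l \<phi>" if "test_function l \<phi>" for \<phi>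
    using test_function_has_L2_deriv(1)[OF that] has_L2_deriv_continuous square_integrable_continuous by blast
  have "l/3 < 2*l/3" using l by simp
  then obtain B where B': "smooth_fun B" "\<And>x. 0 \<le> B x" "\<And>x. B x \<le> 1" "\<And>x. 0 < B x \<longleftrightarrow> l/3 < x \<and> x < 2*l/3"
    by (rule bump_exists[of "l/3" "2*l/3"]) blast
  note B = B'(1,2,4)
  have Bt: "test_function l B"
    unfolding test_function_iff
    by (intro conjI exI[of _ "l/3"] exI[of _ "2*l/3"] B(1)) (use l B(2,3) in \<open>auto simp: less_le\<close>)
  define m where "m = (LINT x|?M. B x)"
  have m: "m \<noteq> 0"
  proof
    assume "m = 0"
    then have "AE x in ?M. B x = 0"
      unfolding m_def
      using integral_nonneg_eq_0_iff_AE[OF square_integrable_imp_integrable[OF test_sq[OF Bt]]] B(2) by auto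
    then have "AE x in ?M. \<not> (l/3 < x \<and> x < 2*l/3)"
      by eventually_elim (use B(3) in force)
    then have "AE x in lebesgue. x \<notin> {l/3<..<2*l/3}"
      by (subst (asm) AE_restrict_space_iff) (use l in \<open>auto elim!: eventually_mono\<close>)
    then have "{l/3<..<2*l/3} \<in> null_sets lebesgue"
      by (subst AE_iff_null_sets) auto
    then have "emeasure lebesgue {l/3<..<2*l/3} = 0" by (rule null_setsD1)
    then show False using l by simp
  qed
  define K where "K = (LINT x|?M. f x * B x) / m"
  have "AE x in ?M. f x - K = 0"
  proof (rule AE_zero_of_test_functions)
    show "integrable ?M (\<lambda>x. f x - K)"
      using square_integrable_imp_integrable[OF f] finite_measure.integrable_const[OF finite_measure_interval] by auto
    fix \<phi> assume t: "test_function l \<phi>"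
    \<comment> \<open>This multiple of \<open>B\<close> gives \<open>\<eta>\<close> the integral
      zero, so that the primitive of \<open>\<eta>\<close> from 0 vanishes at \<open>l\<close> too
      and has compact support inside the interval.\<close>
    define c where "c = (LINT x|?M. \<phi> x) / m"
    define \<eta> where "\<eta> x = \<phi> x - c * B x" for x
    have \<eta>s: "smooth_fun \<eta>"
      unfolding \<eta>_def using t B(1) by (intro smooth_fun_diff smooth_fun_cmult) (auto simp: test_function_iff)
    obtain F where F: "smooth_fun F" "\<And>x. (F has_field_derivative \<eta> x) (at x)"
      using smooth_antiderivative[OF \<eta>s] by blast
    define \<Phi> where "\<Phi> x = F x - F 0" for x
    have \<Phi>d: "(\<Phi> has_field_derivative \<eta> x) (at x)" for x
      unfolding \<Phi>_def using F(2)[of x] by (auto intro!: derivative_eq_intros)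
    obtain p q where pq: "0 < p" "q < l" "\<And>x. x \<notin> {p..q} \<Longrightarrow> \<phi> x = 0" using t by (auto simp: test_function_iff)
    \<comment> \<open>The interval \<open>{p'..q'}\<close> encloses the supports of both
      \<open>\<phi>\<close> and \<open>B\<close>.\<close>
    define p' where "p' = min p (l/3)" define q' where "q' = max q (2*l/3)"
    have pq': "0 < p'" "q' < l" "p' < q'" using pq l by (auto simp: p'_def q'_def)
    have \<eta>0: "\<eta> x = 0" if "x < p' \<or> q' < x" for x
    proof -
      have "\<phi> x = 0" using that pq(3) by (auto simp: p'_def q'_def)
      moreover have "B x = 0" using that B(2,3)[of x] by (auto simp: p'_def q'_def less_le)
      ultimately show ?thesis by (simp add: \<eta>_def)
    qed
    have \<eta>int: "integrable ?M \<phi>" "integrable ?M B"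
      using test_sq[OF t] test_sq[OF Bt] square_integrable_imp_integrable by auto
    have "(\<eta> has_integral (\<Phi> l - \<Phi> 0)) {0..l}"
      using \<Phi>d l by (intro fundamental_theorem_of_calculus)
        (auto simp: has_real_derivative_iff_has_vector_derivative[symmetric] intro: has_field_derivative_at_within)
    moreover have "(LINT x|?M. \<eta> x) = 0"
      using \<eta>int m by (simp add: \<eta>_def c_def m_def)
    moreover have "(LINT x|?M. \<eta> x) = integral {0..l} \<eta>"
      using \<eta>int by (intro lebesgue_integral_eq_integral) (auto simp: \<eta>_def)
    ultimately have \<Phi>l: "\<Phi> l = 0" by (simp add: integral_unique \<Phi>_def)
    have 1: "\<Phi> x = 0" if "x < p'" for x
    proof -
      obtain C where "\<forall>y\<in>{..<p'}. \<Phi> y = C"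
        using has_field_derivative_zero_constant[of "{..<p'}" \<Phi>] \<eta>0 \<Phi>d
        by (metis has_field_derivative_at_within convex_real_interval(4) lessThan_iff)
      moreover have "\<Phi> 0 = 0" by (simp add: \<Phi>_def)
      ultimately show ?thesis using that pq' by (metis lessThan_iff)
    qed
    have 2: "\<Phi> x = 0" if "q' < x" for x
    proof -
      obtain C where "\<forall>y\<in>{q'<..}. \<Phi> y = C"
        using has_field_derivative_zero_constant[of "{q'<..}" \<Phi>] \<eta>0 \<Phi>d
        by (metis has_field_derivative_at_within convex_real_interval(3) greaterThan_iff)
      then show ?thesis using that pq' \<Phi>l by (metis greaterThan_iff)
    qed
    have "test_function l \<Phi>"
      unfolding test_function_iff
    proof (intro conjI exI)
      show "smooth_fun \<Phi>" unfolding \<Phi>_def by (intro smooth_fun_diff smooth_fun_const F(1))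
      show "\<forall>x. x \<notin> {p'..q'} \<longrightarrow> \<Phi> x = 0" using 1 2 by auto
    qed (use pq' in auto)
    moreover have "deriv \<Phi> = \<eta>" using \<Phi>d by (auto intro!: DERIV_imp_deriv)
    ultimately have "0 = (LINT x|?M. f x * \<eta> x)" using z by metis
    also have "\<dots> = (LINT x|?M. f x * \<phi> x) - c * (LINT x|?M. f x * B x)"
      using square_integrable_mult_integrable[OF f test_sq[OF t]] square_integrable_mult_integrable[OF f test_sq[OF Bt]]
      by (simp add: \<eta>_def right_diff_distrib mult.left_commute)
    also have "\<dots> = (LINT x|?M. f x * \<phi> x) - K * (LINT x|?M. \<phi> x)"
      by (simp add: c_def K_def)
    also have "\<dots> = (LINT x|?M. (f x - K) * \<phi> x)"
      using square_integrable_mult_integrable[OF f test_sq[OF t]] \<eta>int by (simp add: left_diff_distrib)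
    finally show "(LINT x|?M. (f x - K) * \<phi> x) = 0" by simp
  qed
  then have "AE x in ?M. f x = K" by eventually_elim simp
  then show ?thesis by blast
qed

text \<open>\<open>f\<close> minus the primitive of \<open>g\<close> has weak derivative zero, so it
  is constant almost everywhere; the primitive shifted by that constant is \<open>F\<close>.\<close>

lemma is_weak_deriv_imp_has_L2_deriv:
  assumes l: "0 < l" and f: "square_integrable l f" and g: "square_integrable l g" and w: "is_weak_deriv l f g"
  obtains F where "has_L2_deriv l F g" "AE x in leb l. f x = F x"
proof -
  let ?M = "leb l"
  define G where "G x = integral {0..x} g" for x
  have G: "has_L2_deriv l G g" using g by (simp add: has_L2_deriv_def G_def)
  then have Gs: "square_integrable l G" using has_L2_deriv_continuous square_integrable_continuous by blast
  have "\<exists>K. AE x in ?M. 1 * f x + (-1) * G x = K"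
  proof (rule weak_deriv_zero_imp_constant[OF l square_integrable_lincomb[OF f Gs]])
    fix \<phi> assume t: "test_function l \<phi>"
    have \<phi>: "square_integrable l (deriv \<phi>)" using test_function_has_L2_deriv(1)[OF t] by (simp add: has_L2_deriv_def)
    have "(LINT x|?M. (1 * f x + - 1 * G x) * deriv \<phi> x) = (LINT x|?M. f x * deriv \<phi> x) - (LINT x|?M. G x * deriv \<phi> x)"
      using square_integrable_mult_integrable[OF f \<phi>] square_integrable_mult_integrable[OF Gs \<phi>]
      by (simp add: left_diff_distrib)
    then show "(LINT x|?M. (1 * f x + - 1 * G x) * deriv \<phi> x) = 0"
      using w has_L2_deriv_is_weak_deriv[OF _ G] l t by (simp add: is_weak_deriv_def)
  qed
  then obtain K where K: "AE x in ?M. 1 * f x + (-1) * G x = K" by blast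
  show ?thesis
  proof
    show "has_L2_deriv l (\<lambda>x. K + G x) g" using g by (intro has_L2_derivI) (simp_all add: G_def)
    show "AE x in ?M. f x = K + G x" using K by eventually_elim simp
  qed
qed

lemma AE_eq_continuous_imp_eq:
  fixes f g :: "real \<Rightarrow> real"
  assumes l: "0 < l" and c: "continuous_on {0..l} f" "continuous_on {0..l} g"
    and ae: "AE x in leb l. f x = g x" and x: "x \<in> {0..l}"
  shows "f x = g x"
proof -
  have sq: "square_integrable l (\<lambda>x. 1 * f x + (-1) * g x)"
    by (intro square_integrable_lincomb square_integrable_continuous c)
  have "(\<lambda>x. \<bar>f x - g x\<bar>) integrable_on {0..l}"
    using c by (intro integrable_continuous_real continuous_intros)
  moreover have "integral {0..l} (\<lambda>x. \<bar>f x - g x\<bar>) = 0"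
  proof -
    have "integral {0..l} (\<lambda>x. \<bar>f x - g x\<bar>) = (LINT x|leb l. \<bar>f x - g x\<bar>)"
      using square_integrable_imp_integrable[OF sq] by (intro lebesgue_integral_eq_integral[symmetric]) auto
    also have "\<dots> = 0" using ae by (intro integral_eq_zero_AE) (auto elim!: eventually_mono)
    finally show ?thesis .
  qed
  ultimately have "((\<lambda>x. \<bar>f x - g x\<bar>) has_integral 0) (cbox 0 l)"
    by (metis cbox_interval integrable_integral)
  then have "\<bar>f x - g x\<bar> = 0"
    by (rule has_integral_0_cbox_imp_0[rotated 2]) (use c l x in \<open>auto intro!: continuous_intros simp: box_real\<close>)
  then show ?thesis by simp
qed

lemma weak_deriv_props:
  assumes "H1_interval l f"
  shows "square_integrable l (weak_deriv l f)" "is_weak_deriv l f (weak_deriv l f)"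
  using assms someI_ex[of "\<lambda>g. square_integrable l g \<and> is_weak_deriv l f g"]
  by (auto simp: H1_interval_def weak_deriv_def)

lemma has_L2_deriv_weak_deriv:
  assumes l: "0 < l" and f: "has_L2_deriv l f g"
  shows "H1_interval l f" "has_L2_deriv l f (weak_deriv l f)" "AE x in leb l. weak_deriv l f x = g x"
proof -
  have w: "is_weak_deriv l f g" using has_L2_deriv_is_weak_deriv f l by simp
  have g: "square_integrable l g" using f by (simp add: has_L2_deriv_def)
  show H: "H1_interval l f"
    using w g square_integrable_continuous[OF has_L2_deriv_continuous[OF f]] by (auto simp: H1_interval_def)
  show ae: "AE x in leb l. weak_deriv l f x = g x"
    using has_L2_deriv_unique[OF _ weak_deriv_props(2)[OF H] w weak_deriv_props(1)[OF H] g] l by simp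
  show "has_L2_deriv l f (weak_deriv l f)"
    by (rule has_L2_deriv_cong_AE[OF f _ weak_deriv_props(1)[OF H]]) (use ae in \<open>auto elim: eventually_mono\<close>)
qed

text \<open>Continuous functions that agree almost everywhere agree everywhere, so \<open>f\<close>
  coincides with its integrated representative, at the ends too. Continuity on the graph thereby
  gives the functions of \<open>H1\<close> usable vertex values.\<close>

lemma H1_continuous_has_L2_deriv:
  assumes l: "0 < l" and f: "H1_interval l f" "continuous_on {0..l} f"
  shows "has_L2_deriv l f (weak_deriv l f)"
proof -
  have "square_integrable l f" using f by (simp add: H1_interval_def)
  then obtain F where F: "has_L2_deriv l F (weak_deriv l f)" "AE x in leb l. f x = F x"
    using is_weak_deriv_imp_has_L2_deriv[OF l _ weak_deriv_props[OF f(1)]] by blast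
  have "f x = F x" if "x \<in> {0..l}" for x
    using AE_eq_continuous_imp_eq[OF l f(2) has_L2_deriv_continuous[OF F(1)] F(2) that] .
  then have "f 0 = F 0" "\<And>x. x \<in> {0..l} \<Longrightarrow> f x = F x" using l by auto
  then show ?thesis using has_L2_derivD[OF F(1)] by (intro has_L2_derivI) metis+
qed

section \<open>Products with Lipschitz functions\<close>

lemma sum_measure_exists:
  assumes "sets \<mu> = sets borel" "sets \<nu> = sets borel"
  obtains K :: "real measure" where "sets K = sets borel" "\<And>A. A \<in> sets borel \<Longrightarrow> emeasure K A = emeasure \<mu> A + emeasure \<nu> A"
proof
  define K where "K = measure_of (space borel) (sets borel) (\<lambda>A :: real set. emeasure \<mu> A + emeasure \<nu> A)"
  show s: "sets K = sets borel" using sets.sigma_sets_eq[of "borel :: real measure"] by (simp add: K_def)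
  fix A :: "real set" assume A: "A \<in> sets borel"
  show "emeasure K A = emeasure \<mu> A + emeasure \<nu> A"
  proof (rule emeasure_measure_of[OF K_def])
    show "countably_additive (sets K) (\<lambda>A. emeasure \<mu> A + emeasure \<nu> A)"
    proof (rule countably_additiveI)
      fix B :: "nat \<Rightarrow> real set" assume B: "range B \<subseteq> sets K" "disjoint_family B"
      show "(\<Sum>i. emeasure \<mu> (B i) + emeasure \<nu> (B i)) = emeasure \<mu> (\<Union> (range B)) + emeasure \<nu> (\<Union> (range B))"
        using B s assms suminf_emeasure[of B \<mu>] suminf_emeasure[of B \<nu>]
        by (simp add: suminf_add[symmetric])
    qed
  qed (use A s in \<open>auto simp: positive_def sets.space_closed\<close>)
qed

text \<open>With \<open>P\<close> the integral of \<open>m\<close>, the functions \<open>P + p\<close> and \<open>P - p\<close> are increasing; the measures that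
  they generate add up to \<open>2 m dx\<close>, so both have densities.\<close>

lemma dominated_increments_has_L2_deriv:
  fixes p m :: "real \<Rightarrow> real"
  assumes l: "0 < l" and m: "square_integrable l m" "\<And>x. 0 \<le> m x"
    and inc: "\<And>x y. 0 \<le> x \<Longrightarrow> x \<le> y \<Longrightarrow> y \<le> l \<Longrightarrow> \<bar>p y - p x\<bar> \<le> integral {x..y} m"
  shows "\<exists>g. has_L2_deriv l p g"
proof -
  have mi: "integrable (leb l) m" by (rule square_integrable_imp_integrable[OF m(1)])
  define P where "P x = integral {0..x} m" for x
  have P: "has_L2_deriv l P m" using m(1) by (intro has_L2_derivI) (simp_all add: P_def)
  have Pd: "P y - P x = integral {x..y} m" if "0 \<le> x" "x \<le> y" "y \<le> l" for x y
    using has_L2_deriv_diff[OF P that] .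
  have Pc: "continuous_on {0..l} P" by (rule has_L2_deriv_continuous[OF P])
  \<comment> \<open>Clamping to \<open>{0..l}\<close> extends the functions to the whole line with
    limits at both infinities, as distribution functions require.\<close>
  define c where "c x = max 0 (min l x)" for x
  have c: "c x \<in> {0..l}" "x \<le> y \<Longrightarrow> c x \<le> c y" for x y using l by (auto simp: c_def)
  have cc: "continuous_on S c" for S unfolding c_def by (intro continuous_intros)
  have pc: "continuous_on {0..l} p"
  proof (rule continuous_onI)
    fix x e :: real assume x: "x \<in> {0..l}" and e: "0 < e"
    then obtain d where d: "d > 0" "\<And>y. y \<in> {0..l} \<Longrightarrow> dist y x < d \<Longrightarrow> dist (P y) (P x) < e"
      using Pc unfolding continuous_on_iff by blast
    have "\<bar>p y - p x\<bar> \<le> \<bar>P y - P x\<bar>" if "y \<in> {0..l}" for y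
      using inc[of x y] inc[of y x] Pd[of x y] Pd[of y x] x that by (cases "x \<le> y") auto
    then show "\<exists>d>0. \<forall>x'\<in>{0..l}. dist x' x < d \<longrightarrow> dist (p x') (p x) \<le> e"
      using d by (intro exI[of _ d]) (fastforce simp: dist_real_def)
  qed
  have Pp: "\<bar>p (c y) - p (c x)\<bar> \<le> P (c y) - P (c x)" if "x \<le> y" for x y
    using inc[of "c x" "c y"] Pd[of "c x" "c y"] c[of x] c(1)[of y] c(2)[OF that] by auto
  \<comment> \<open>The sign \<open>s = 1\<close> gives \<open>P + p\<close> and
    \<open>s = -1\<close> gives \<open>P - p\<close>, normalized to vanish to the left of 0.\<close>
  define F where "F s x = P (c x) + s * (p (c x) - p 0)" for s x
  have Fm: "F s x \<le> F s y" if "x \<le> y" "\<bar>s\<bar> = 1" for s x y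
  proof -
    have "\<bar>s * (p (c y) - p (c x))\<bar> \<le> P (c y) - P (c x)" using Pp[OF that(1)] that(2) by (simp add: abs_mult)
    then show ?thesis by (simp add: F_def right_diff_distrib abs_le_iff)
  qed
  have Fc: "continuous_on UNIV (F s)" for s
    unfolding F_def using c(1)
    by (intro continuous_intros continuous_on_compose2[OF Pc] continuous_on_compose2[OF pc] cc) auto
  have Fr: "continuous (at_right x) (F s)" for s x
    using Fc[of s] by (simp add: continuous_on_eq_continuous_at continuous_at_imp_continuous_within)
  have P0: "P 0 = 0" by (simp add: P_def)
  have Fbot: "(F s \<longlongrightarrow> 0) at_bot" for s
    by (rule tendsto_eventually) (auto simp: eventually_at_bot_linorder F_def c_def P0 intro!: exI[of _ 0])
  have Ftop: "(F s \<longlongrightarrow> F s l) at_top" for s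
    using l by (intro tendsto_eventually) (auto simp: eventually_at_top_linorder F_def c_def intro!: exI[of _ l])
  define \<mu> where "\<mu> s = interval_measure (F s)" for s
  have \<mu>f: "finite_borel_measure (\<mu> s)" "cdf (\<mu> s) = F s" if "\<bar>s\<bar> = 1" for s
  proof -
    have "0 \<le> F s l" using Fm[of 0 l s] that l by (simp add: F_def c_def P0)
    then show "finite_borel_measure (\<mu> s)" "cdf (\<mu> s) = F s"
      unfolding \<mu>_def using Fm that Fr Fbot Ftop
      by (auto intro!: finite_borel_measure_interval_measure cdf_interval_measure)
  qed
  have \<mu>s: "sets (\<mu> s) = sets borel" for s by (simp add: \<mu>_def)
  obtain K where K: "sets K = sets borel" "\<And>A. A \<in> sets borel \<Longrightarrow> emeasure K A = emeasure (\<mu> 1) A + emeasure (\<mu> (-1)) A"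
    using sum_measure_exists[OF \<mu>s \<mu>s] by blast
  interpret M1: finite_borel_measure "\<mu> 1" by (rule \<mu>f) simp
  interpret M2: finite_borel_measure "\<mu> (-1)" by (rule \<mu>f) simp
  have Kf: "finite_borel_measure K"
  proof (intro finite_borel_measure.intro finite_measureI finite_borel_measure_axioms.intro)
    show "emeasure K (space K) \<noteq> \<infinity>" "sets K = sets borel"
      using K sets_eq_imp_space_eq[OF K(1)] M1.emeasure_finite[of UNIV] M2.emeasure_finite[of UNIV]
      by (auto simp: less_top)
  qed
  \<comment> \<open>A density with respect to \<open>lborel\<close> has to be Borel:
    \<open>m\<close> is extended by zero, replaced by a Borel version, and cut off at 0.\<close>
  define m1 where "m1 x = indicator {0..l} x * m x" for x
  have "integrable lebesgue m1" using mi unfolding m1_def[abs_def] by (simp add: integrable_restrict_space)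
  then obtain m2 where m2: "m2 \<in> borel_measurable lborel" "AE x in lborel. m1 x = m2 x"
    using completion_ex_borel_measurable_real[of m1 lborel] by auto
  define m' where "m' x = max 0 (m2 x)" for x
  have m'[measurable]: "m' \<in> borel_measurable borel" and m'0: "\<And>x. 0 \<le> m' x" using m2(1) by (simp_all add: m'_def[abs_def])
  have "AE x in lborel. m1 x = m' x" using m2(2)
  proof eventually_elim
    case (elim x)
    have "0 \<le> m1 x" using m(2)[of x] by (simp add: m1_def)
    then show ?case using elim by (simp add: m'_def)
  qed
  then have mm': "AE x in lebesgue. m1 x = m' x" by (rule AE_completion)
  have m'l: "m' \<in> borel_measurable lebesgue" by (intro measurable_completion) simp
  have "integrable lebesgue m'"
    using \<open>integrable lebesgue m1\<close> integrable_cong_AE[OF _ m'l mm'] by blast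
  then have m'i: "integrable lborel m'" using integrable_completion[of m' lborel] m' by simp
  define \<nu> where "\<nu> = density lborel (\<lambda>x. ennreal (2 * m' x))"
  have \<nu>i: "emeasure \<nu> A = ennreal (2 * (LINT x|lborel. m' x * indicator A x))" if "A \<in> sets borel" for A
  proof -
    have "integrable lborel (\<lambda>x. 2 * (m' x * indicator A x))"
      using that m'i by (intro integrable_mult_right integrable_real_mult_indicator) auto
    moreover have "emeasure \<nu> A = (\<integral>\<^sup>+x. ennreal (2 * (m' x * indicator A x)) \<partial>lborel)"
      unfolding \<nu>_def using that by (subst emeasure_density) (auto intro!: nn_integral_cong simp: indicator_def)
    ultimately show ?thesis
      by (subst (asm) nn_integral_eq_integral) (auto simp: m'0)
  qed
  have \<nu>f: "finite_borel_measure \<nu>"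
    by (intro finite_borel_measure.intro finite_measureI finite_borel_measure_axioms.intro)
      (use \<nu>i[of UNIV] in \<open>auto simp: \<nu>_def\<close>)
  \<comment> \<open>In the sum of the two distribution functions the terms with \<open>p\<close>
    cancel; the remaining \<open>2 * P\<close> is the distribution function of
    \<open>\<nu>\<close>.\<close>
  have "K = \<nu>"
  proof (rule cdf_unique'[OF Kf \<nu>f])
    interpret K: finite_borel_measure K by (rule Kf)
    show "cdf K = cdf \<nu>"
    proof
      fix x :: real
      have "emeasure K {..x} = ennreal (F 1 x) + ennreal (F (-1) x)"
        using \<mu>f(2)[of 1] \<mu>f(2)[of "-1"] K(2)[of "{..x}"]
        by (simp add: M1.emeasure_eq_measure M2.emeasure_eq_measure cdf_def fun_eq_iff)
      also have "\<dots> = ennreal (F 1 x + F (-1) x)"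
        using \<mu>f(2)[of 1] \<mu>f(2)[of "-1"] M1.cdf_nonneg[of x] M2.cdf_nonneg[of x]
        by (intro ennreal_plus[symmetric]) auto
      also have "F 1 x + F (-1) x = 2 * P (c x)" by (simp add: F_def)
      finally have 1: "emeasure K {..x} = ennreal (2 * P (c x))" .
      have "(LINT y|lborel. m' y * indicator {..x} y) = (LINT y|lebesgue. m' y * indicator {..x} y)"
        by (intro integral_completion[symmetric]) measurable
      also have "\<dots> = (LINT y|lebesgue. m1 y * indicator {..x} y)"
      proof (rule integral_cong_AE)
        have "(indicator {..x} :: real \<Rightarrow> real) \<in> borel_measurable lebesgue"
          by (intro measurable_completion) simp
        then show "(\<lambda>y. m' y * indicator {..x} y) \<in> borel_measurable lebesgue"
          "(\<lambda>y. m1 y * indicator {..x} y) \<in> borel_measurable lebesgue"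
          using \<open>integrable lebesgue m1\<close> by (auto intro!: borel_measurable_times m'l)
      qed (use mm' in \<open>auto elim!: eventually_mono\<close>)
      also have "\<dots> = (LINT y|lebesgue. indicator {0..l} y * (m y * indicator {..x} y))"
        by (simp add: m1_def mult.assoc)
      also have "\<dots> = (LINT y|leb l. m y * indicator {..x} y)"
        by (subst integral_restrict_space) auto
      also have "\<dots> = (LINT y|leb l. m y * indicator {0..c x} y)"
      proof (rule integral_cong_AE)
        have "AE y in lebesgue. y \<noteq> 0" by (intro AE_completion AE_lborel_singleton)
        then have "AE y in lebesgue. y \<in> {0..l} \<longrightarrow> m y * indicator {..x} y = m y * indicator {0..c x} y"
          by eventually_elim (auto simp: indicator_def c_def)
        then show "AE y in leb l. m y * indicator {..x} y = m y * indicator {0..c x} y"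
          by (subst AE_restrict_space_iff) auto
      qed (intro borel_measurable_times borel_measurable_integrable[OF mi] borel_measurable_lebesgue_on, simp)+
      also have "\<dots> = P (c x)" unfolding P_def using c(1)[of x] by (intro integrable_imp_integrable_on(3)[OF mi]) auto
      finally have "emeasure \<nu> {..x} = ennreal (2 * P (c x))" by (simp add: \<nu>i)
      then show "cdf K x = cdf \<nu> x" using 1 by (simp add: cdf_def measure_def)
    qed
  qed
  have ac: "absolutely_continuous lborel (\<mu> s)" if "s = 1 \<or> s = -1" for s
    unfolding absolutely_continuous_def
  proof
    fix A :: "real set" assume A: "A \<in> null_sets lborel"
    then have "emeasure \<nu> A = 0"
      using absolutely_continuousI_density[of "\<lambda>x. ennreal (2 * m' x)" lborel] by (auto simp: \<nu>_def absolutely_continuous_def)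
    then have "emeasure (\<mu> 1) A + emeasure (\<mu> (-1)) A = 0" using K(2)[of A] A \<open>K = \<nu>\<close> by auto
    then show "A \<in> null_sets (\<mu> s)" using that A by (auto simp: null_sets_def \<mu>s)
  qed
  obtain f1 where f1[measurable]: "f1 \<in> borel_measurable borel" and f1d: "density lborel f1 = \<mu> 1"
    using sigma_finite_measure.Radon_Nikodym[OF sigma_finite_lborel ac[of 1]] \<mu>s by auto
  obtain f2 where f2[measurable]: "f2 \<in> borel_measurable borel" and f2d: "density lborel f2 = \<mu> (-1)"
    using sigma_finite_measure.Radon_Nikodym[OF sigma_finite_lborel ac[of "-1"]] \<mu>s by auto
  have "density lborel (\<lambda>x. f1 x + f2 x) = \<nu>"
  proof (rule measure_eqI)
    fix A assume "A \<in> sets (density lborel (\<lambda>x. f1 x + f2 x))"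
    then have A[measurable]: "A \<in> sets borel" by simp
    have "emeasure (density lborel (\<lambda>x. f1 x + f2 x)) A = emeasure (density lborel f1) A + emeasure (density lborel f2) A"
      by (simp add: emeasure_density distrib_right nn_integral_add)
    then show "emeasure (density lborel (\<lambda>x. f1 x + f2 x)) A = emeasure \<nu> A"
      using K(2)[OF A] f1d f2d \<open>K = \<nu>\<close> by simp
  qed (simp add: \<nu>_def)
  then have ae: "AE x in lborel. f1 x + f2 x = ennreal (2 * m' x)"
    unfolding \<nu>_def by (intro sigma_finite_measure.density_unique[OF sigma_finite_lborel]) auto
  \<comment> \<open>The two densities add up to \<open>2 * m'\<close>, so each of them is finite
    almost everywhere and inherits square integrability from \<open>m\<close>.\<close>
  define h where "h x = enn2real (f1 x)" for x
  have h[measurable]: "h \<in> borel_measurable borel" by (simp add: h_def[abs_def])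
  have hm: "AE x in lborel. f1 x = ennreal (h x) \<and> h x \<le> 2 * m' x"
    using ae
  proof eventually_elim
    case (elim x)
    then have "f1 x \<le> ennreal (2 * m' x)" by (metis le_iff_add)
    then have "f1 x < \<top>" by (meson ennreal_less_top order_le_less_trans)
    then have 1: "f1 x = ennreal (h x)" by (simp add: h_def less_top)
    moreover have "h x \<le> 2 * m' x" using \<open>f1 x \<le> ennreal (2 * m' x)\<close> m'0[of x] unfolding 1 by (simp add: ennreal_le_iff)
    ultimately show ?case by simp
  qed
  have h0: "0 \<le> h x" for x by (simp add: h_def)
  have hi: "integrable lborel h"
    by (rule Bochner_Integration.integrable_bound[OF integrable_mult_right[OF m'i, of 2]])
      (use hm h0 m'0 in \<open>auto elim!: eventually_mono\<close>)
  have hsq: "square_integrable l h"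
  proof -
    have hl: "h \<in> borel_measurable (leb l)" by (rule borel_measurable_lebesgue_on[OF h])
    have "AE x in lebesgue. m1 x = m' x \<and> h x \<le> 2 * m' x" using mm' AE_completion[OF hm] by eventually_elim simp
    then have "AE x in lebesgue. x \<in> {0..l} \<longrightarrow> norm ((h x)\<^sup>2) \<le> norm (4 * (m x)\<^sup>2)"
    proof eventually_elim
      case (elim x)
      show ?case
      proof
        assume "x \<in> {0..l}"
        then have "h x \<le> 2 * m x" using elim by (simp add: m1_def)
        then have "(h x)\<^sup>2 \<le> (2 * m x)\<^sup>2" using h0[of x] by (rule power_mono)
        then show "norm ((h x)\<^sup>2) \<le> norm (4 * (m x)\<^sup>2)" by (simp add: power_mult_distrib)
      qed
    qed
    then have 1: "AE x in leb l. norm ((h x)\<^sup>2) \<le> norm (4 * (m x)\<^sup>2)"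
      by (subst AE_restrict_space_iff) auto
    have 2: "integrable (leb l) (\<lambda>x. 4 * (m x)\<^sup>2)" using m(1) by (simp add: square_integrable_def)
    have "integrable (leb l) (\<lambda>x. (h x)\<^sup>2)"
      by (rule Bochner_Integration.integrable_bound[OF 2 _ 1]) (use hl in simp)
    then show ?thesis using hl by (simp add: square_integrable_def)
  qed
  \<comment> \<open>\<open>P + p\<close> is the integral of \<open>h\<close>, and \<open>P\<close>
    that of \<open>m\<close>.\<close>
  have "has_L2_deriv l p (\<lambda>x. 1 * h x + (-1) * m x)"
  proof (rule has_L2_derivI)
    show "square_integrable l (\<lambda>x. 1 * h x + (-1) * m x)" by (rule square_integrable_lincomb[OF hsq m(1)])
    fix x assume x: "x \<in> {0..l}"
    note hi' = square_integrable_imp_integrable[OF hsq]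
    have "F 1 x - F 1 0 = measure (\<mu> 1) {0<..x}"
      using x Fm Fr unfolding \<mu>_def by (intro measure_interval_measure_Ioc[symmetric]) auto
    also have "emeasure (\<mu> 1) {0<..x} = (\<integral>\<^sup>+y. ennreal (h y * indicator {0..x} y) \<partial>lborel)"
    proof -
      have z: "AE y in lborel. y \<noteq> (0::real)" by (rule AE_lborel_singleton)
      show ?thesis
        unfolding f1d[symmetric] using hm z
        by (subst emeasure_density) (auto intro!: nn_integral_cong_AE elim!: eventually_elim2 simp: indicator_def)
    qed
    then have "measure (\<mu> 1) {0<..x} = (LINT y|lborel. h y * indicator {0..x} y)"
      using integrable_real_mult_indicator[OF _ hi, of "{0..x}"]
      by (subst (asm) nn_integral_eq_integral) (auto simp: h0 measure_def)
    also have "\<dots> = (LINT y|lebesgue. h y * indicator {0..x} y)"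
      by (intro integral_completion[symmetric]) measurable
    also have "\<dots> = (LINT y|leb l. h y * indicator {0..x} y)"
    proof -
      have "indicator {0..l} y * (h y * indicator {0..x} y) = h y * indicator {0..x} y" for y
        using x by (cases "y \<in> {0..x}") simp_all
      then show ?thesis by (subst integral_restrict_space) (simp, simp only: real_scaleR_def)
    qed
    also have "\<dots> = integral {0..x} h" using x by (intro integrable_imp_integrable_on(3)[OF hi']) auto
    finally have "F 1 x - F 1 0 = integral {0..x} h" .
    moreover have "F 1 x - F 1 0 = P x + (p x - p 0)" using x l by (simp add: F_def c_def P0)
    moreover have "integral {0..x} (\<lambda>x. 1 * h x + (-1) * m x) = 1 * integral {0..x} h + (-1) * integral {0..x} m"
      using integrable_imp_integrable_on(2)[OF hi', of 0 x] integrable_imp_integrable_on(2)[OF mi, of 0 x] x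
      by (intro integral_unique has_integral_add has_integral_mult_right integrable_integral) auto
    ultimately show "p x = p 0 + integral {0..x} (\<lambda>x. 1 * h x + (-1) * m x)" by (simp add: P_def)
  qed
  then show ?thesis by blast
qed

text \<open>The increment of the product splits into \<open>a y * (v y - v x)\<close> and
  \<open>v x * (a y - a x)\<close>. Both are dominated by the integral of one square integrable
  function, \<open>A\<close> times the modulus of \<open>v'\<close> plus
  \<open>V * L\<close>.\<close>

lemma Lipschitz_mult_has_L2_deriv:
  assumes l: "0 < l" and v: "has_L2_deriv l v v'"
    and a: "\<And>x y. x \<in> {0..l} \<Longrightarrow> y \<in> {0..l} \<Longrightarrow> \<bar>a x - a y\<bar> \<le> L * \<bar>x - y\<bar>" and L: "0 \<le> (L::real)"
  shows "\<exists>g. has_L2_deriv l (\<lambda>x. a x * v x) g"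
proof -
  have "bounded (v ` {0..l})"
    using compact_continuous_image[OF has_L2_deriv_continuous[OF v]] compact_imp_bounded by blast
  then obtain V where V: "0 < V" "\<And>x. x \<in> {0..l} \<Longrightarrow> \<bar>v x\<bar> \<le> V"
    by (auto simp: bounded_pos)
  define A where "A = \<bar>a 0\<bar> + L * l"
  have A: "\<bar>a x\<bar> \<le> A" if "x \<in> {0..l}" for x
  proof -
    have "L * \<bar>x - 0\<bar> \<le> L * l" using that L by (intro mult_left_mono) auto
    then show ?thesis using a[of x 0] that l by (simp add: A_def)
  qed
  have sq: "square_integrable l v'" using v by (rule has_L2_derivD)
  have sqa: "square_integrable l (\<lambda>x. \<bar>v' x\<bar>)" using sq by (auto simp: square_integrable_def)
  define m where "m x = A * \<bar>v' x\<bar> + (V * L) * 1" for x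
  have msq: "square_integrable l m"
    unfolding m_def by (intro square_integrable_lincomb sqa square_integrable_continuous continuous_intros)
  have A0: "0 \<le> A" using A[of 0] l by auto
  note i = square_integrable_imp_integrable
  show ?thesis
  proof (rule dominated_increments_has_L2_deriv[OF l msq])
    show "0 \<le> m x" for x using A0 V L by (simp add: m_def)
    fix x y assume xy: "0 \<le> x" "x \<le> y" "y \<le> l"
    have "integral {x..y} m = A * integral {x..y} (\<lambda>x. \<bar>v' x\<bar>) + V * L * (y - x)"
    proof -
      have "integral {x..y} m = A * integral {x..y} (\<lambda>x. \<bar>v' x\<bar>) + (V * L) * integral {x..y} (\<lambda>x. 1)"
        unfolding m_def using integrable_imp_integrable_on(2)[OF i[OF sqa]] xy
        by (intro integral_unique has_integral_add has_integral_mult_right integrable_integral) auto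
      then show ?thesis using xy by simp
    qed
    moreover have "\<bar>v y - v x\<bar> \<le> integral {x..y} (\<lambda>x. \<bar>v' x\<bar>)"
      unfolding has_L2_deriv_diff[OF v xy]
      using integral_norm_bound_integral[of v' "{x..y}" "\<lambda>x. \<bar>v' x\<bar>"] xy
        integrable_imp_integrable_on(2)[OF i[OF sq], of x y] integrable_imp_integrable_on(2)[OF i[OF sqa], of x y]
      by simp
    then have "A * \<bar>v y - v x\<bar> \<le> A * integral {x..y} (\<lambda>x. \<bar>v' x\<bar>)" using A0 by (rule mult_left_mono)
    moreover have "\<bar>a y * v y - a x * v x\<bar> \<le> A * \<bar>v y - v x\<bar> + V * L * (y - x)"
    proof -
      have "a y * v y - a x * v x = a y * (v y - v x) + v x * (a y - a x)" by (simp add: algebra_simps)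
      then have "\<bar>a y * v y - a x * v x\<bar> \<le> \<bar>a y\<bar> * \<bar>v y - v x\<bar> + \<bar>v x\<bar> * \<bar>a y - a x\<bar>"
        by (metis abs_mult abs_triangle_ineq)
      also have "\<dots> \<le> A * \<bar>v y - v x\<bar> + V * (L * (y - x))"
        using A[of y] V(2)[of x] a[of y x] xy V(1) by (intro add_mono mult_mono) auto
      finally show ?thesis by simp
    qed
    ultimately show "\<bar>a y * v y - a x * v x\<bar> \<le> integral {x..y} m" by linarith
  qed
qed

section \<open>Sinc quadrature for the fractional power\<close>

lemma residue_simple_pole_quotient:
  assumes "open s" "z \<in> s" "(\<lambda>w. f w / g w) holomorphic_on (s - {z})"
    and f: "isCont f z" and g: "(g has_field_derivative g') (at z)" "g z = 0" "g' \<noteq> 0"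
  shows "residue (\<lambda>w. f w / g w) z = f z / g'"
proof (rule residue_simple'[OF assms(1-3)])
  have "((\<lambda>w. (g w - g z) / (w - z)) \<longlongrightarrow> g') (at z)"
    using g(1) by (simp add: has_field_derivative_iff)
  then have "((\<lambda>w. f w / ((g w - g z) / (w - z))) \<longlongrightarrow> f z / g') (at z)"
    using f g(3) by (intro tendsto_divide) (auto simp: isCont_def)
  then show "((\<lambda>w. f w / g w * (w - z)) \<longlongrightarrow> f z / g') (at z)"
    by (simp add: g(2))
qed

text \<open>
  The integrand \<open>g z = exp (2 \<beta> z) / (1 + exp (2 z + s))\<close> satisfies
  \<open>g (z + \<i> pi) = exp (2 pi \<i> \<beta>) g z\<close>.  Hence, for the kernel \<open>1 / (1 - exp (- 2 pi \<i> z / k)) - c\<close>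
  with \<open>c = 1 / (1 - exp (2 pi \<i> \<beta>))\<close>, the integrals over the horizontal lines at heights \<open>- pi / 4\<close>
  and \<open>3 pi / 4\<close> nearly cancel, and the residues of the product are the terms of the
  quadrature sum, together with its limit.
\<close>

locale sinc_quadrature =
  fixes \<beta> k s :: real
  assumes \<beta>: "0 < \<beta>" "\<beta> < 1" and k: "0 < k"
begin

definition E :: "complex \<Rightarrow> complex" where "E z = exp (- (2 * of_real pi * \<i> / of_real k) * z)"
definition c :: complex where "c = 1 / (1 - exp (2 * of_real pi * \<i> * of_real \<beta>))"
text \<open>\<open>num\<close> and \<open>den\<close> are entire, and their quotient
  \<open>F\<close> is the integrand times the kernel; each residue is then \<open>num\<close> over
  the derivative of \<open>den\<close>.\<close>

definition den :: "complex \<Rightarrow> complex" where "den z = (1 + exp (2 * z + of_real s)) * (1 - E z)"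
definition num :: "complex \<Rightarrow> complex" where "num z = exp (2 * of_real \<beta> * z) * (1 - c * (1 - E z))"
definition F :: "complex \<Rightarrow> complex" where "F z = num z / den z"
text \<open>The only zero of \<open>1 + exp (2 * z + s)\<close> between the two horizontal
  lines.\<close>

definition y0 :: complex where "y0 = Complex (- s / 2) (pi / 2)"
text \<open>The modulus of \<open>E\<close> on the line at height \<open>- pi / 4\<close>; the rate
  of the quadrature error originates here.\<close>

definition q :: real where "q = exp (- pi\<^sup>2 / (2 * k))"

text \<open>The product is \<open>1 / (exp (- pi * \<i> * \<beta>) - exp (pi * \<i> *
  \<beta>))\<close>. It turns the part of the residue at \<open>y0\<close> that contains
  \<open>c\<close> into the real limit value.\<close>

lemma c_half_angle: "c * exp (of_real pi * \<i> * of_real \<beta>) = \<i> / of_real (2 * sin (pi * \<beta>))"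
proof -
  define w where "w = exp (of_real pi * \<i> * complex_of_real \<beta>)"
  define S where "S = complex_of_real (sin (pi * \<beta>))"
  have "sin (pi * \<beta>) > 0" using \<beta> by (intro sin_gt_zero) auto
  then have sn: "S \<noteq> 0" by (simp add: S_def)
  have w: "w \<noteq> 0" "exp (2 * of_real pi * \<i> * of_real \<beta>) = w * w"
    by (simp_all add: w_def exp_add[symmetric] algebra_simps)
  have "S = sin (of_real (pi * \<beta>))" by (simp only: S_def sin_of_real)
  moreover have "exp (\<i> * of_real (pi * \<beta>)) = w" "exp (- (\<i> * of_real (pi * \<beta>))) = inverse w"
    by (simp_all add: w_def exp_minus mult_ac)
  ultimately have "S = (w - inverse w) / (2 * \<i>)" by (metis sin_exp_eq)
  then have "w - inverse w = 2 * \<i> * S" by simp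
  then have "w * (w - inverse w) = w * (2 * \<i> * S)" by simp
  then have "w * w - 1 = w * (2 * \<i> * S)" using w(1) by (simp add: right_diff_distrib)
  then have *: "1 - w * w = - (w * (2 * \<i> * S))" by (metis minus_diff_eq)
  have "c * w = w / (- (w * (2 * \<i> * S)))"
    unfolding c_def w(2) * by simp
  also have "\<dots> = \<i> / (2 * S)"
    using w(1) sn by (simp add: field_simps)
  finally show ?thesis unfolding w_def S_def by simp
qed

lemma norm_E: "norm (E z) = exp (2 * pi * Im z / k)"
  by (simp add: E_def)

lemma E_eq_1_iff: "E z = 1 \<longleftrightarrow> (\<exists>l::int. z = of_real (of_int l * k))"
proof -
  have "E z = 1 \<longleftrightarrow> Im z = 0 \<and> (\<exists>n::int. - (2 * pi * Re z / k) = of_int (2 * n) * pi)"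
    using k by (simp add: E_def exp_eq_1)
  also have "\<dots> \<longleftrightarrow> Im z = 0 \<and> (\<exists>n::int. Re z = of_int (- n) * k)"
  proof -
    have "- (2 * pi * Re z / k) = of_int (2 * n) * pi \<longleftrightarrow> Re z = of_int (- n) * k" for n :: int
    proof -
      have "- (2 * pi * Re z / k) = of_int (2 * n) * pi \<longleftrightarrow> (2 * pi) * Re z = (2 * pi) * (of_int (- n) * k)"
        using k by (auto simp: field_simps)
      also have "\<dots> \<longleftrightarrow> Re z = of_int (- n) * k" by (subst mult_cancel_left) simp
      finally show ?thesis .
    qed
    then show ?thesis by simp
  qed
  also have "\<dots> \<longleftrightarrow> (\<exists>l::int. z = of_real (of_int l * k))"
    by (auto simp: complex_eq_iff) (metis of_int_minus minus_minus mult_minus_left, metis minus_minus of_int_minus mult_minus_left)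
  finally show ?thesis .
qed

lemma exp_pole_iff:
  "1 + exp (2 * z + of_real s) = 0 \<longleftrightarrow> (\<exists>n::int. z = Complex (- s / 2) (pi / 2 + of_int n * pi))"
proof -
  have "1 + exp (2 * z + of_real s) = 0 \<longleftrightarrow> exp (2 * z + of_real s) = exp (\<i> * of_real pi)"
    by (auto simp: add_eq_0_iff)
  also have "\<dots> \<longleftrightarrow> (\<exists>n::int. 2 * z + of_real s = \<i> * of_real pi + (of_int (2 * n) * of_real pi) * \<i>)"
    unfolding exp_eq by simp
  also have "\<dots> \<longleftrightarrow> (\<exists>n::int. z = Complex (- s / 2) (pi / 2 + of_int n * pi))"
    by (intro ex_cong1) (auto simp: complex_eq_iff)
  finally show ?thesis .
qed

lemma num_den_DERIV:
  "(den has_field_derivative (2 * exp (2 * z + of_real s)) * (1 - E z) +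
     (1 + exp (2 * z + of_real s)) * ((2 * of_real pi * \<i> / of_real k) * E z)) (at z)"
  "isCont num z"
proof -
  show "isCont num z" unfolding num_def E_def by (intro continuous_intros)
  show "(den has_field_derivative (2 * exp (2 * z + of_real s)) * (1 - E z) +
     (1 + exp (2 * z + of_real s)) * ((2 * of_real pi * \<i> / of_real k) * E z)) (at z)"
    unfolding den_def E_def by (rule derivative_eq_intros refl | simp)+
qed

lemma holo: "num holomorphic_on S" "den holomorphic_on S"
  unfolding num_def[abs_def] den_def[abs_def] E_def by (auto intro!: holomorphic_intros)

text \<open>The vertical sides run midway between two nodes, where \<open>E\<close> is negative and
  \<open>1 - E\<close> therefore has modulus at least 1.\<close>

definition X :: "nat \<Rightarrow> real" where "X L = (real L + 1 / 2) * k"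
text \<open>An open neighbourhood of the closed rectangle, wider by \<open>k / 4\<close> and higher
  by \<open>pi / 12\<close> on each side: too little to reach a further zero of
  \<open>den\<close>.\<close>

definition strip :: "nat \<Rightarrow> complex set" where
  "strip L = box (Complex (- X L - k / 4) (- pi / 3)) (Complex (X L + k / 4) (5 * pi / 6))"
definition poles :: "nat \<Rightarrow> complex set" where
  "poles L = insert y0 ((\<lambda>l::int. of_real (of_int l * k)) ` {- int L..int L})"

lemma den_zeros:
  assumes "z \<in> strip L" "den z = 0" shows "z \<in> poles L"
proof -
  consider "E z = 1" | "1 + exp (2 * z + of_real s) = 0" using assms(2) by (auto simp: den_def)
  then show ?thesis
  proof cases
    case 1
    then obtain l :: int where l: "z = of_real (of_int l * k)" using E_eq_1_iff by blast
    then have "\<bar>of_int l * k\<bar> < X L + k / 4" using assms(1) by (auto simp: strip_def in_box_complex_iff)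
    then have "\<bar>of_int l :: real\<bar> * k < (real L + 3 / 4) * k"
      using k by (simp add: X_def algebra_simps abs_mult)
    then have "\<bar>of_int l :: real\<bar> < real L + 3 / 4" using k by simp
    then have "l \<in> {- int L..int L}" by auto
    then show ?thesis unfolding poles_def l by blast
  next
    case 2
    then obtain n :: int where n: "z = Complex (- s / 2) (pi / 2 + of_int n * pi)" using exp_pole_iff by blast
    then have "- pi / 3 < pi / 2 + of_int n * pi" "pi / 2 + of_int n * pi < 5 * pi / 6"
      using assms(1) by (auto simp: strip_def in_box_complex_iff)
    then have "(-1) * pi < of_int n * pi" "of_int n * pi < 1 * pi" using pi_gt_zero by linarith+
    then have "-1 < (of_int n :: real)" "(of_int n :: real) < 1" by (simp_all only: mult_less_cancel_right_pos pi_gt_zero)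
    then have "n = 0" by linarith
    then show ?thesis using n by (simp add: poles_def y0_def)
  qed
qed

lemma residues:
  "E (of_real (of_int l * k)) = 1"
  "exp (2 * y0 + of_real s) = -1" "E y0 \<noteq> 1"
proof -
  show "E (of_real (of_int l * k)) = 1" using E_eq_1_iff by blast
  have "1 + exp (2 * y0 + of_real s) = 0" unfolding exp_pole_iff by (intro exI[of _ 0]) (simp add: y0_def)
  then show "exp (2 * y0 + of_real s) = -1" by (simp add: add_eq_0_iff)
  show "E y0 \<noteq> 1"
  proof
    assume "E y0 = 1"
    then show False using norm_E[of y0] k by (simp add: y0_def)
  qed
qed

lemma one_plus_exp_real_nonzero: "1 + exp (2 * of_real t + of_real s) \<noteq> (0::complex)"
proof -
  have "1 + exp (2 * of_real t + of_real s) = complex_of_real (1 + exp (2 * t + s))"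
    by (simp add: exp_of_real[symmetric])
  moreover have "1 + exp (2 * t + s) \<noteq> 0" using exp_gt_zero[of "2 * t + s"] by linarith
  ultimately show ?thesis by (metis of_real_eq_0_iff)
qed

lemma y0_not_real: "y0 \<noteq> of_real t"
  by (simp add: y0_def complex_eq_iff)

text \<open>At a node the derivative of \<open>den\<close> contains the factor
  \<open>2 * pi * \<i> / k\<close>, so the residue theorem returns \<open>k\<close> times the
  quadrature term. At \<open>y0\<close> the kernel contributes \<open>1 / (1 - E y0) - c\<close>;
  the part with \<open>c\<close> is the limit value, and the other one is kept as an exponentially
  small remainder.\<close>

lemma residue_sum:
  assumes L: "\<bar>s\<bar> / 2 < X L"
  shows "contour_integral (rectpath (Complex (- X L) (- pi / 4)) (Complex (X L) (3 * pi / 4))) F =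
    of_real (k * (\<Sum>l\<in>{- int L..int L}. exp (2 * \<beta> * of_int l * k) / (1 + exp (2 * of_int l * k + s)))
      - pi * exp (- \<beta> * s) / (2 * sin (pi * \<beta>)))
    - of_real pi * \<i> * exp (2 * of_real \<beta> * y0) / (1 - E y0)"
proof -
  let ?a1 = "Complex (- X L) (- pi / 4)" and ?a3 = "Complex (X L) (3 * pi / 4)"
  have X: "0 < X L" using k by (simp add: X_def)
  have inbox: "z \<in> box ?a1 ?a3" if "z \<in> poles L" for z
  proof -
    have "\<bar>of_int l * k\<bar> < X L" if "l \<in> {- int L..int L}" for l :: int
    proof -
      have "\<bar>of_int l :: real\<bar> \<le> real L" using that by auto
      then have "\<bar>of_int l\<bar> * k \<le> real L * k" using k by (intro mult_right_mono) auto
      moreover have "\<bar>of_int l * k\<bar> = \<bar>of_int l\<bar> * k" "X L = real L * k + k / 2"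
        using k by (simp_all add: X_def abs_mult algebra_simps)
      ultimately show ?thesis using k by linarith
    qed
    then have "of_int l * k < X L \<and> - X L < of_int l * k" if "l \<in> {- int L..int L}" for l :: int
    proof -
      have "\<bar>of_int l * k\<bar> < X L" using \<open>\<And>l. l \<in> {- int L..int L} \<Longrightarrow> \<bar>of_int l * k\<bar> < X L\<close> that by blast
      then show ?thesis by linarith
    qed
    moreover have "- (pi / 2) < pi" using pi_gt_zero by linarith
    moreover have "- s / 2 < X L" "- X L < - s / 2" using L by linarith+
    ultimately show ?thesis using that by (auto simp: poles_def y0_def in_box_complex_iff)
  qed
  have cb: "cbox ?a1 ?a3 \<subseteq> strip L"
  proof
    fix z assume "z \<in> cbox ?a1 ?a3"
    then have "- X L \<le> Re z" "Re z \<le> X L" "- pi / 4 \<le> Im z" "Im z \<le> 3 * pi / 4"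
      by (auto simp: in_cbox_complex_iff)
    moreover have "- X L - k / 4 < - X L" "X L < X L + k / 4" "- pi / 3 < - pi / 4" "3 * pi / 4 < 5 * pi / 6"
      using k pi_gt_zero by linarith+
    ultimately have "- X L - k / 4 < Re z" "Re z < X L + k / 4" "- pi / 3 < Im z" "Im z < 5 * pi / 6"
      by linarith+
    then show "z \<in> strip L" by (simp add: strip_def in_box_complex_iff)
  qed
  have fin: "finite (poles L)" by (simp add: poles_def)
  have hol: "F holomorphic_on strip L - poles L"
    unfolding F_def using den_zeros by (intro holomorphic_on_divide holo) auto
  have "contour_integral (rectpath ?a1 ?a3) F = of_real (2 * pi) * \<i> * (\<Sum>p\<in>poles L. winding_number (rectpath ?a1 ?a3) p * residue F p)"
  proof (rule Residue_theorem[OF _ _ fin hol])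
    show "open (strip L)" "topological_space_class.connected (strip L)"
      unfolding strip_def by (simp_all add: convex_connected open_box)
    have "path_image (rectpath ?a1 ?a3) = cbox ?a1 ?a3 - box ?a1 ?a3"
      using X by (intro path_image_rectpath_cbox_minus_box) auto
    then show "path_image (rectpath ?a1 ?a3) \<subseteq> strip L - poles L" using inbox cb by auto
    show "\<forall>z. z \<notin> strip L \<longrightarrow> winding_number (rectpath ?a1 ?a3) z = 0"
      using cb X by (intro allI impI winding_number_rectpath_outside) auto
  qed auto
  also have "(\<Sum>p\<in>poles L. winding_number (rectpath ?a1 ?a3) p * residue F p) = (\<Sum>p\<in>poles L. residue F p)"
    using winding_number_rectpath[OF inbox] by (intro sum.cong) auto
  also have "\<dots> = residue F y0 + (\<Sum>l\<in>{- int L..int L}. residue F (of_real (of_int l * k)))"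
  proof -
    have "inj_on (\<lambda>l::int. complex_of_real (of_int l * k)) {- int L..int L}"
      using k by (auto simp: inj_on_def)
    moreover have "y0 \<notin> (\<lambda>l::int. of_real (of_int l * k)) ` {- int L..int L}" using y0_not_real by blast
    ultimately show ?thesis unfolding poles_def by (subst sum.insert) (auto simp: sum.reindex)
  qed
  also have "complex_of_real (2 * pi) = 2 * of_real pi" by simp
  finally have ci: "contour_integral (rectpath ?a1 ?a3) F =
      2 * of_real pi * \<i> * (residue F y0 + (\<Sum>l\<in>{- int L..int L}. residue F (of_real (of_int l * k))))" .
  have res: "residue F p = num p / d" if "p \<in> poles L" "(den has_field_derivative d) (at p)" "den p = 0" "d \<noteq> 0" for p d
  proof -
    have "open (strip L - (poles L - {p}))"
      unfolding strip_def using fin by (intro open_Diff finite_imp_closed) auto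
    moreover have "p \<in> strip L - (poles L - {p})" using inbox[OF that(1)] cb box_subset_cbox[of ?a1 ?a3] by blast
    moreover have "strip L - (poles L - {p}) - {p} = strip L - poles L" using that(1) by blast
    ultimately show ?thesis
      unfolding F_def using hol that(2-4) num_den_DERIV(2)
      by (intro residue_simple_pole_quotient[where s="strip L - (poles L - {p})"]) (simp_all add: F_def[abs_def])
  qed
  have r0: "residue F y0 = - exp (2 * of_real \<beta> * y0) / 2 * (1 / (1 - E y0) - c)"
  proof -
    have "(den has_field_derivative (- 2 * (1 - E y0))) (at y0)"
      using num_den_DERIV(1)[of y0] residues(2) by simp
    then have "residue F y0 = num y0 / (- 2 * (1 - E y0))"
      using residues(2,3) by (intro res) (auto simp: poles_def den_def)
    then show ?thesis using residues(3) by (simp add: num_def field_simps)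
  qed
  have rl: "2 * of_real pi * \<i> * residue F (of_real (of_int l * k)) =
      of_real (k * (exp (2 * \<beta> * of_int l * k) / (1 + exp (2 * of_int l * k + s))))"
    if l: "l \<in> {- int L..int L}" for l :: int
  proof -
    define z where "z = complex_of_real (of_int l * k)"
    define D where "D = 1 + exp (2 * z + of_real s)"
    have D: "D \<noteq> 0" unfolding D_def z_def by (rule one_plus_exp_real_nonzero)
    have E1: "E z = 1" unfolding z_def by (rule residues)
    have "(den has_field_derivative D * (2 * of_real pi * \<i> / of_real k)) (at z)"
      using num_den_DERIV(1)[of z] E1 by (simp add: D_def)
    then have "residue F z = num z / (D * (2 * of_real pi * \<i> / of_real k))"
    proof (rule res[rotated])
      show "z \<in> poles L" using l unfolding poles_def z_def by blast
    qed (use E1 D k in \<open>auto simp: den_def\<close>)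
    moreover have "num z = exp (2 * of_real \<beta> * z)" using E1 by (simp add: num_def)
    ultimately have "2 * of_real pi * \<i> * residue F z = of_real k * (exp (2 * of_real \<beta> * z) / D)"
      using D k by (simp add: field_simps)
    also have "exp (2 * of_real \<beta> * z) = of_real (exp (2 * \<beta> * of_int l * k))"
      by (simp add: z_def exp_of_real[symmetric] mult_ac)
    also have "D = of_real (1 + exp (2 * of_int l * k + s))"
      by (simp add: D_def z_def exp_of_real[symmetric] mult_ac)
    finally show ?thesis by (simp add: z_def)
  qed
  have e0: "exp (2 * of_real \<beta> * y0) = of_real (exp (- \<beta> * s)) * exp (of_real pi * \<i> * of_real \<beta>)"
    by (simp add: y0_def exp_of_real[symmetric] exp_add[symmetric] Complex_eq algebra_simps)
  have "2 * of_real pi * \<i> * residue F y0 = - of_real pi * \<i> * exp (2 * of_real \<beta> * y0) / (1 - E y0) +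
      of_real pi * \<i> * (of_real (exp (- \<beta> * s)) * (c * exp (of_real pi * \<i> * of_real \<beta>)))"
  proof -
    have "2 * P * \<i> * (- w / 2 * (1 / D - c)) = - P * \<i> * w / D + P * \<i> * (c * w)" for P w D :: complex
      by (simp add: algebra_simps)
    moreover have "of_real (exp (- \<beta> * s)) * (c * exp (of_real pi * \<i> * of_real \<beta>)) = c * exp (2 * of_real \<beta> * y0)"
      unfolding e0 by (simp only: mult_ac)
    ultimately show ?thesis unfolding r0 by metis
  qed
  also have "of_real pi * \<i> * (of_real (exp (- \<beta> * s)) * (c * exp (of_real pi * \<i> * of_real \<beta>))) =
      - of_real (pi * exp (- \<beta> * s) / (2 * sin (pi * \<beta>)))"
    unfolding c_half_angle by (simp add: mult_ac)
  finally have "2 * of_real pi * \<i> * residue F y0 =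
      - of_real pi * \<i> * exp (2 * of_real \<beta> * y0) / (1 - E y0) - of_real (pi * exp (- \<beta> * s) / (2 * sin (pi * \<beta>)))"
    by (simp only: uminus_add_conv_diff diff_conv_add_uminus[of "- of_real pi * \<i> * exp (2 * of_real \<beta> * y0) / (1 - E y0)", symmetric])
  moreover have "2 * of_real pi * \<i> * (\<Sum>l\<in>{- int L..int L}. residue F (of_real (of_int l * k))) =
      of_real (k * (\<Sum>l\<in>{- int L..int L}. exp (2 * \<beta> * of_int l * k) / (1 + exp (2 * of_int l * k + s))))"
    unfolding sum_distrib_left of_real_sum by (intro sum.cong refl rl)
  ultimately show ?thesis unfolding ci distrib_left by (simp only: of_real_diff) (simp add: algebra_simps)
qed

section \<open>Bounds on the sides of the rectangle\<close>

definition decay :: "real \<Rightarrow> real" where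
  "decay x = min (exp (2 * \<beta> * x)) (exp (- 2 * (1 - \<beta>) * x - s))"

text \<open>On this line \<open>exp (2 * z + s)\<close> is purely imaginary, so the denominator has
  modulus \<open>sqrt (1 + r^2)\<close>, which is at least 1 and at least \<open>r\<close>. The two
  bounds are the two entries of \<open>decay\<close>.\<close>

lemma norm_integrand_horizontal:
  assumes "Im z = - pi / 4"
  shows "norm (exp (2 * of_real \<beta> * z) / (1 + exp (2 * z + of_real s))) \<le> decay (Re z)"
proof -
  define r where "r = exp (2 * Re z + s)"
  have r: "0 < r" by (simp add: r_def)
  have "exp (2 * z + of_real s) = of_real r * cis (- pi / 2)"
    using assms by (subst exp_eq_polar) (simp add: r_def)
  also have "cis (- pi / 2) = - \<i>" by (simp add: complex_eq_iff)
  finally have e: "exp (2 * z + of_real s) = - (\<i> * of_real r)" by simp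
  have n: "norm (1 + exp (2 * z + of_real s)) = sqrt (1 + r\<^sup>2)"
    unfolding e by (simp add: cmod_def)
  have n1: "1 \<le> sqrt (1 + r\<^sup>2)" "r \<le> sqrt (1 + r\<^sup>2)" by (intro real_le_rsqrt; simp)+
  have "norm (exp (2 * of_real \<beta> * z) / (1 + exp (2 * z + of_real s))) = exp (2 * \<beta> * Re z) / sqrt (1 + r\<^sup>2)"
    unfolding norm_divide n by simp
  moreover have "exp (2 * \<beta> * Re z) / sqrt (1 + r\<^sup>2) \<le> exp (2 * \<beta> * Re z) / 1"
    using n1 by (intro divide_left_mono mult_pos_pos) (linarith | simp)+
  moreover have "exp (2 * \<beta> * Re z) / sqrt (1 + r\<^sup>2) \<le> exp (2 * \<beta> * Re z) / r"
    using n1 r by (intro divide_left_mono mult_pos_pos) (linarith | simp)+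
  moreover have "exp (2 * \<beta> * Re z) / r = exp (- 2 * (1 - \<beta>) * Re z - s)"
    by (simp add: r_def exp_diff[symmetric] algebra_simps)
  ultimately show ?thesis by (simp add: decay_def)
qed

text \<open>Away from the pole the exponential has modulus at least \<open>exp 1 \<ge> 2\<close> or
  at most 1/2, so the denominator is at least 1/2 and at least \<open>r / 2\<close>; hence the
  factor 2.\<close>

lemma norm_integrand_vertical:
  assumes "\<bar>2 * Re z + s\<bar> \<ge> 1"
  shows "norm (exp (2 * of_real \<beta> * z) / (1 + exp (2 * z + of_real s))) \<le> 2 * decay (Re z)"
proof -
  define r where "r = exp (2 * Re z + s)"
  have r: "0 < r" by (simp add: r_def)
  have nr: "norm (exp (2 * z + of_real s)) = r" by (simp add: r_def)
  have e2: "2 \<le> exp (1::real)" using exp_ge_add_one_self[of 1] by simp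
  have "2 \<le> r \<or> r \<le> 1 / 2"
  proof (cases "2 * Re z + s \<ge> 0")
    case True
    then have "exp 1 \<le> r" using assms unfolding r_def by (subst exp_le_cancel_iff) auto
    then show ?thesis using e2 by simp
  next
    case False
    then have "r \<le> exp (-1)" using assms unfolding r_def by (subst exp_le_cancel_iff) auto
    also have "exp (-1::real) \<le> 1 / 2" using e2 by (simp add: exp_minus field_simps)
    finally show ?thesis by simp
  qed
  moreover have "\<bar>norm (1::complex) - norm (exp (2 * z + of_real s))\<bar> \<le> norm (1 + exp (2 * z + of_real s))"
    using norm_triangle_ineq3[of 1 "- exp (2 * z + of_real s)"] by simp
  ultimately have n1: "1 / 2 \<le> norm (1 + exp (2 * z + of_real s))" "r / 2 \<le> norm (1 + exp (2 * z + of_real s))"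
    unfolding nr by auto
  have "norm (exp (2 * of_real \<beta> * z) / (1 + exp (2 * z + of_real s))) = exp (2 * \<beta> * Re z) / norm (1 + exp (2 * z + of_real s))"
    unfolding norm_divide by simp
  moreover have "exp (2 * \<beta> * Re z) / norm (1 + exp (2 * z + of_real s)) \<le> exp (2 * \<beta> * Re z) / (1 / 2)"
    using n1 by (intro divide_left_mono mult_pos_pos) (linarith | simp)+
  moreover have "exp (2 * \<beta> * Re z) / norm (1 + exp (2 * z + of_real s)) \<le> exp (2 * \<beta> * Re z) / (r / 2)"
    using n1 r by (intro divide_left_mono mult_pos_pos) (linarith | simp)+
  moreover have "exp (2 * \<beta> * Re z) / r = exp (- 2 * (1 - \<beta>) * Re z - s)"
    by (simp add: r_def exp_diff[symmetric] algebra_simps)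
  moreover have "A / (r / 2) = 2 * (A / r)" for A by simp
  ultimately have "norm (exp (2 * of_real \<beta> * z) / (1 + exp (2 * z + of_real s))) \<le> 2 * exp (2 * \<beta> * Re z)"
    "norm (exp (2 * of_real \<beta> * z) / (1 + exp (2 * z + of_real s))) \<le> 2 * exp (- 2 * (1 - \<beta>) * Re z - s)"
    by (simp_all only:) (simp_all add: mult.commute)
  then show ?thesis unfolding decay_def min_def by (simp del: mult_minus_left)
qed

lemma q: "0 < q" "q < 1"
  using k by (simp_all add: q_def)

lemma F_eq: "E z \<noteq> 1 \<Longrightarrow> F z = exp (2 * of_real \<beta> * z) / (1 + exp (2 * z + of_real s)) * (1 / (1 - E z) - c)"
  by (simp add: F_def num_def den_def field_simps)

lemma norm_inverse_one_minus_E: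
  assumes "1 / q \<le> norm (E z)" shows "norm (1 / (1 - E z)) \<le> q / (1 - q)"
proof -
  have "1 / q - 1 \<le> norm (1 - E z)" using norm_triangle_ineq3[of "E z" 1] assms by (simp add: norm_minus_commute)
  moreover have "0 < 1 / q - 1" using q by simp
  ultimately have "1 / norm (1 - E z) \<le> 1 / (1 / q - 1)" by (intro divide_left_mono mult_pos_pos) linarith+
  also have "\<dots> = q / (1 - q)" using q by (simp add: field_simps)
  finally show ?thesis by (simp add: norm_divide)
qed

text \<open>The shift by \<open>\<i> * pi\<close> multiplies the integrand by \<open>w\<close>, and
  \<open>c * (1 - w) = 1\<close> cancels the constant parts of the two kernels. What is left is
  \<open>E / (1 - E)\<close> below, where \<open>E\<close> has modulus \<open>q\<close>, and
  \<open>1 / (1 - E)\<close> above, where it has modulus at least \<open>1 / q\<close>.\<close>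

lemma F_horizontal_diff:
  assumes "Im z = - pi / 4"
  shows "norm (F z - F (z + \<i> * of_real pi)) \<le> 2 * (q / (1 - q)) * decay (Re z)"
proof -
  define g where "g = exp (2 * of_real \<beta> * z) / (1 + exp (2 * z + of_real s))"
  define w where "w = exp (2 * of_real pi * \<i> * complex_of_real \<beta>)"
  have nE: "norm (E z) = q" using assms unfolding norm_E by (simp add: q_def power2_eq_square)
  have nE': "1 / q \<le> norm (E (z + \<i> * of_real pi))"
  proof -
    have "pi\<^sup>2 / (2 * k) \<le> 2 * pi * (3 * pi / 4) / k" using k by (simp add: field_simps power2_eq_square)
    moreover have "1 / q = exp (pi\<^sup>2 / (2 * k))" by (simp add: q_def exp_minus inverse_eq_divide)
    moreover have "Im (z + \<i> * of_real pi) = 3 * pi / 4" using assms by simp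
    ultimately show ?thesis unfolding norm_E by (simp only: exp_le_cancel_iff)
  qed
  have ne: "E z \<noteq> 1" using nE q by auto
  have "1 < 1 / q" using q by simp
  then have ne': "E (z + \<i> * of_real pi) \<noteq> 1" using nE' by auto
  have "w \<noteq> 1"
  proof
    assume "w = 1"
    then obtain n :: int where "2 * pi * \<beta> = of_int (2 * n) * pi"
      using exp_eq_1[of "2 * of_real pi * \<i> * complex_of_real \<beta>"] by (auto simp: w_def)
    then have "\<beta> = of_int n" by simp
    with \<beta> have "0 < n" "n < 1" by simp_all
    then show False by simp
  qed
  then have cw: "c * (1 - w) = 1" by (simp add: c_def w_def)
  have "exp (2 * (z + \<i> * of_real pi) + of_real s) = exp (2 * z + of_real s)"
    by (subst exp_eq) (auto simp: algebra_simps intro!: exI[of _ 1])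
  moreover have "exp (2 * of_real \<beta> * (z + \<i> * of_real pi)) = w * exp (2 * of_real \<beta> * z)"
    by (simp add: w_def exp_add[symmetric] algebra_simps)
  ultimately have "F (z + \<i> * of_real pi) = w * g * (1 / (1 - E (z + \<i> * of_real pi)) - c)"
    unfolding F_eq[OF ne'] g_def by simp
  then have "F z - F (z + \<i> * of_real pi) = g * (1 / (1 - E z) - c * (1 - w) - w * (1 / (1 - E (z + \<i> * of_real pi))))"
    unfolding F_eq[OF ne] g_def[symmetric] by (simp add: algebra_simps)
  also have "\<dots> = g * (E z / (1 - E z) - w * (1 / (1 - E (z + \<i> * of_real pi))))"
    unfolding cw using ne by (simp add: field_simps)
  also have "norm \<dots> \<le> decay (Re z) * (q / (1 - q) + q / (1 - q))"
    unfolding norm_mult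
  proof (rule mult_mono)
    show "norm g \<le> decay (Re z)" unfolding g_def by (rule norm_integrand_horizontal[OF assms])
    have nw: "norm w = 1" by (simp add: w_def)
    have "norm (E z / (1 - E z)) \<le> q / (1 - q)"
    proof -
      have "1 - q \<le> norm (1 - E z)" using norm_triangle_ineq3[of 1 "E z"] nE by simp
      then show ?thesis
        unfolding norm_divide nE using q by (intro divide_left_mono mult_pos_pos) linarith+
    qed
    moreover have "norm (w * (1 / (1 - E (z + \<i> * of_real pi)))) \<le> q / (1 - q)"
      unfolding norm_mult nw using norm_inverse_one_minus_E[OF nE'] by simp
    ultimately show "norm (E z / (1 - E z) - w * (1 / (1 - E (z + \<i> * of_real pi)))) \<le> q / (1 - q) + q / (1 - q)"
      by (meson add_mono norm_triangle_ineq4 order_trans)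
  qed (auto simp: decay_def)
  finally show ?thesis by (simp add: mult_ac)
qed

lemma E_X: "norm (1 / (1 - E (Complex (X L) y))) \<le> 1" "norm (1 / (1 - E (Complex (- X L) y))) \<le> 1"
proof -
  have *: "norm (1 / (1 - E (Complex x y))) \<le> 1" if x: "x = X L \<or> x = - X L" for x
  proof -
    have "E (Complex x y) = of_real (exp (2 * pi * y / k)) * cis (- (2 * pi * x / k))"
      unfolding E_def by (subst exp_eq_polar) (simp add: cis.code)
    also have "cis (- (2 * pi * x / k)) = -1"
    proof -
      have "2 * pi * X L / k = pi + 2 * pi * real L" using k by (simp add: X_def field_simps)
      then have "cos (2 * pi * X L / k) = -1" "sin (2 * pi * X L / k) = 0"
        using cos_npi[of "2 * L"] sin_npi[of "2 * L"]
        by (auto simp: cos_add sin_add mult_ac)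
      then have "cos (2 * pi * x / k) = -1" "sin (2 * pi * x / k) = 0" using x by auto
      then show ?thesis by (simp add: complex_eq_iff)
    qed
    finally have "1 - E (Complex x y) = of_real (1 + exp (2 * pi * y / k))" by simp
    then have "norm (1 - E (Complex x y)) = 1 + exp (2 * pi * y / k)"
      using add_pos_pos[OF zero_less_one exp_gt_zero[of "2 * pi * y / k"]] by (simp only: norm_of_real abs_of_pos)
    then show ?thesis
      using add_pos_pos[OF zero_less_one exp_gt_zero[of "2 * pi * y / k"]] by (simp add: norm_divide divide_simps not_less)
  qed
  then show "norm (1 / (1 - E (Complex (X L) y))) \<le> 1" "norm (1 / (1 - E (Complex (- X L) y))) \<le> 1" by auto
qed

text \<open>\<open>exp s\<close> is the eigenvalue to which the quadrature is applied; the lower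
  bound \<open>lam0\<close> makes the estimate uniform over the spectrum.\<close>

lemma decay_le:
  assumes "0 < lam0" "lam0 \<le> exp s"
  defines "\<gamma> \<equiv> min (2 * \<beta>) (2 * (1 - \<beta>))"
  shows "decay x \<le> max 1 (1 / lam0) * exp (- \<gamma> * \<bar>x\<bar>)"
proof (cases "x \<le> 0")
  case True
  have "decay x \<le> 1 * exp (2 * \<beta> * x)" by (simp add: decay_def)
  also have "\<dots> \<le> max 1 (1 / lam0) * exp (- \<gamma> * \<bar>x\<bar>)"
  proof (rule mult_mono)
    have "2 * \<beta> * x \<le> \<gamma> * x" using True by (intro mult_right_mono_neg) (auto simp: \<gamma>_def)
    then show "exp (2 * \<beta> * x) \<le> exp (- \<gamma> * \<bar>x\<bar>)" using True by simp
  qed auto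
  finally show ?thesis .
next
  case False
  have "decay x \<le> exp (- s) * exp (- (2 * (1 - \<beta>) * x))"
    by (simp add: decay_def exp_add[symmetric] min_le_iff_disj algebra_simps)
  also have "\<dots> \<le> max 1 (1 / lam0) * exp (- \<gamma> * \<bar>x\<bar>)"
  proof (rule mult_mono)
    have "exp (- s) \<le> 1 / lam0" using assms(1,2) by (simp add: exp_minus field_simps)
    then show "exp (- s) \<le> max 1 (1 / lam0)" by simp
    have "\<gamma> * x \<le> 2 * (1 - \<beta>) * x" using False by (intro mult_right_mono) (auto simp: \<gamma>_def)
    then show "exp (- (2 * (1 - \<beta>) * x)) \<le> exp (- \<gamma> * \<bar>x\<bar>)" using False by simp
  qed auto
  finally show ?thesis .
qed

text \<open>Exchanging the exponential for \<open>1 / (1 + x^2)\<close> gives the primitive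
  \<open>arctan\<close>, so the integral over any segment is at most a multiple of
  \<open>pi\<close>.\<close>

lemma exp_neg_abs_le:
  assumes "0 < (\<gamma>::real)"
  shows "exp (- \<gamma> * \<bar>x\<bar>) \<le> max 1 (2 / \<gamma>\<^sup>2) * (1 / (1 + x\<^sup>2))"
proof -
  have "1 + x\<^sup>2 \<le> max 1 (2 / \<gamma>\<^sup>2) * (1 + \<gamma> * \<bar>x\<bar> + (\<gamma> * \<bar>x\<bar>)\<^sup>2 / 2)"
  proof -
    have "1 * 1 + (2 / \<gamma>\<^sup>2) * ((\<gamma> * \<bar>x\<bar>)\<^sup>2 / 2) \<le> max 1 (2 / \<gamma>\<^sup>2) * (1 + \<gamma> * \<bar>x\<bar>) + max 1 (2 / \<gamma>\<^sup>2) * ((\<gamma> * \<bar>x\<bar>)\<^sup>2 / 2)"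
      using assms by (intro add_mono mult_mono) auto
    then show ?thesis using assms by (simp add: power_mult_distrib distrib_left)
  qed
  also have "\<dots> \<le> max 1 (2 / \<gamma>\<^sup>2) * exp (\<gamma> * \<bar>x\<bar>)"
    using assms by (intro mult_left_mono exp_lower_Taylor_quadratic) auto
  finally have "(1 + x\<^sup>2) * exp (- (\<gamma> * \<bar>x\<bar>)) \<le> max 1 (2 / \<gamma>\<^sup>2) * exp (\<gamma> * \<bar>x\<bar>) * exp (- (\<gamma> * \<bar>x\<bar>))"
    by (intro mult_right_mono) auto
  then have "(1 + x\<^sup>2) * exp (- (\<gamma> * \<bar>x\<bar>)) \<le> max 1 (2 / \<gamma>\<^sup>2)"
    by (simp add: mult.assoc exp_add[symmetric])
  then show ?thesis by (simp add: pos_le_divide_eq mult.commute add_pos_nonneg)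
qed

text \<open>The first term comes from the pair of horizontal sides and is independent of
  \<open>L\<close>; the second one comes from the vertical sides and vanishes as \<open>L\<close>
  grows.\<close>

lemma contour_bound:
  assumes lam0: "0 < lam0" "lam0 \<le> exp s" and L: "1 \<le> 2 * X L - \<bar>s\<bar>"
  defines "\<gamma> \<equiv> min (2 * \<beta>) (2 * (1 - \<beta>))"
  shows "norm (contour_integral (rectpath (Complex (- X L) (- pi / 4)) (Complex (X L) (3 * pi / 4))) F) \<le>
    2 * (q / (1 - q)) * (max 1 (1 / lam0) * max 1 (2 / \<gamma>\<^sup>2)) * pi
    + 4 * pi * (1 + norm c) * (max 1 (1 / lam0) * exp (- \<gamma> * X L))"
proof -
  let ?a1 = "Complex (- X L) (- pi / 4)" and ?a3 = "Complex (X L) (3 * pi / 4)"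
  let ?a2 = "Complex (X L) (- pi / 4)" and ?a4 = "Complex (- X L) (3 * pi / 4)"
  have X: "0 < X L" using k by (simp add: X_def)
  have \<gamma>: "0 < \<gamma>" using \<beta> by (simp add: \<gamma>_def)
  have pim: "path_image (rectpath ?a1 ?a3) = closed_segment ?a1 ?a2 \<union> closed_segment ?a2 ?a3 \<union> closed_segment ?a3 ?a4 \<union> closed_segment ?a4 ?a1"
    by (simp add: rectpath_def Let_def path_image_join Un_assoc)
  have inpi: "Re z \<in> {- X L, X L} \<and> Im z \<in> {- pi / 4..3 * pi / 4} \<or> Im z \<in> {- pi / 4, 3 * pi / 4} \<and> Re z \<in> {- X L..X L}"
    if "z \<in> path_image (rectpath ?a1 ?a3)" for z
    using that X by (subst (asm) path_image_rectpath) auto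
  have Cx: "z = Complex x (Im z)" if "Re z = x" for z x using that by (simp add: complex_eq_iff)
  have vert: "E z \<noteq> 1 \<and> 1 + exp (2 * z + of_real s) \<noteq> 0 \<and> norm (F z) \<le> 2 * (max 1 (1 / lam0) * exp (- \<gamma> * X L)) * (1 + norm c)"
    if "Re z = X L \<or> Re z = - X L" for z
  proof -
    have n1: "norm (1 / (1 - E z)) \<le> 1" using that E_X Cx by metis
    have E1: "E z \<noteq> 1"
    proof
      assume "E z = 1"
      then obtain l :: int where "z = of_real (of_int l * k)" using E_eq_1_iff by blast
      then have "\<bar>of_int l * k\<bar> = X L" using that X by auto
      then have "\<bar>of_int l :: real\<bar> * k = (real L + 1 / 2) * k" using k by (simp add: X_def abs_mult)
      then have "\<bar>of_int l :: real\<bar> = real L + 1 / 2" using k by simp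
      then have "real_of_int (2 * \<bar>l\<bar>) = real_of_int (2 * int L + 1)" by simp
      then have "2 * \<bar>l\<bar> = 2 * int L + 1" by linarith
      then show False by presburger
    qed
    have r: "1 \<le> \<bar>2 * Re z + s\<bar>" using that L by auto
    have p: "1 + exp (2 * z + of_real s) \<noteq> 0"
    proof
      assume "1 + exp (2 * z + of_real s) = 0"
      then have "Re z = - s / 2" unfolding exp_pole_iff by auto
      then show False using r by simp
    qed
    have "norm (F z) \<le> 2 * decay (Re z) * (1 + norm c)"
      unfolding F_eq[OF E1] norm_mult
    proof (rule mult_mono[OF norm_integrand_vertical[OF r]])
      show "norm (1 / (1 - E z) - c) \<le> 1 + norm c" using norm_triangle_ineq4[of "1 / (1 - E z)" c] n1 by simp
    qed (auto simp: decay_def)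
    also have "\<dots> \<le> 2 * (max 1 (1 / lam0) * exp (- \<gamma> * X L)) * (1 + norm c)"
      using decay_le[OF lam0, of "Re z", folded \<gamma>_def] that X by (intro mult_right_mono mult_left_mono) auto
    finally show ?thesis using E1 p by simp
  qed
  have hor: "E z \<noteq> 1 \<and> 1 + exp (2 * z + of_real s) \<noteq> 0" if "Im z = - pi / 4 \<or> Im z = 3 * pi / 4" for z
  proof
    have "Im z \<noteq> 0" using that by auto
    then show "E z \<noteq> 1" unfolding E_eq_1_iff by auto
    have "pi / 2 + of_int n * pi \<noteq> - pi / 4" "pi / 2 + of_int n * pi \<noteq> 3 * pi / 4" for n :: int
    proof -
      have "(pi / 2 + of_int n * pi = - pi / 4) = ((4 * of_int n + 3) * pi = 0 * pi)" by (auto simp: field_simps)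
      also have "\<dots> \<longleftrightarrow> 4 * real_of_int n + 3 = 0" by (subst mult_cancel_right) simp
      also have "\<dots> \<longleftrightarrow> real_of_int (4 * n + 3) = real_of_int 0" by simp
      also have "\<dots> \<longleftrightarrow> 4 * n + 3 = 0" by (rule of_int_eq_iff)
      also have "\<not> \<dots>" by presburger
      finally show "pi / 2 + of_int n * pi \<noteq> - pi / 4" .
      have "(pi / 2 + of_int n * pi = 3 * pi / 4) = ((4 * of_int n - 1) * pi = 0 * pi)" by (auto simp: field_simps)
      also have "\<dots> \<longleftrightarrow> 4 * real_of_int n - 1 = 0" by (subst mult_cancel_right) simp
      also have "\<dots> \<longleftrightarrow> real_of_int (4 * n - 1) = real_of_int 0" by simp
      also have "\<dots> \<longleftrightarrow> 4 * n - 1 = 0" by (rule of_int_eq_iff)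
      also have "\<not> \<dots>" by presburger
      finally show "pi / 2 + of_int n * pi \<noteq> 3 * pi / 4" .
    qed
    then show "1 + exp (2 * z + of_real s) \<noteq> 0" using that unfolding exp_pole_iff by auto
  qed
  have "continuous_on (path_image (rectpath ?a1 ?a3)) F"
    unfolding F_def
  proof (intro continuous_on_divide ballI)
    show "continuous_on (path_image (rectpath ?a1 ?a3)) num" "continuous_on (path_image (rectpath ?a1 ?a3)) den"
      using holo holomorphic_on_imp_continuous_on by blast+
    fix z assume "z \<in> path_image (rectpath ?a1 ?a3)"
    then have "Re z = X L \<or> Re z = - X L \<or> Im z = - pi / 4 \<or> Im z = 3 * pi / 4" using inpi by blast
    then show "den z \<noteq> 0" using vert[of z] hor[of z] by (auto simp: den_def)
  qed
  then have cont: "continuous_on (closed_segment ?a1 ?a2) F" "continuous_on (closed_segment ?a2 ?a3) F"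
    "continuous_on (closed_segment ?a3 ?a4) F" "continuous_on (closed_segment ?a4 ?a1) F"
    unfolding pim by (auto elim: continuous_on_subset)
  note ci = contour_integrable_continuous_linepath[OF cont(1)] contour_integrable_continuous_linepath[OF cont(2)]
    contour_integrable_continuous_linepath[OF cont(3)] contour_integrable_continuous_linepath[OF cont(4)]
  have split: "contour_integral (rectpath ?a1 ?a3) F =
      (contour_integral (linepath ?a1 ?a2) F - contour_integral (linepath ?a4 ?a3) F)
      + contour_integral (linepath ?a2 ?a3) F + contour_integral (linepath ?a4 ?a1) F"
    using ci contour_integral_reverse_linepath[OF cont(3)]
    by (simp add: rectpath_def Let_def contour_integrable_join)
  have segV: "Re z = X L \<or> Re z = - X L" if "z \<in> closed_segment ?a2 ?a3 \<union> closed_segment ?a4 ?a1" for z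
    using that by (auto simp: closed_segment_same_Re)
  have v: "norm (contour_integral (linepath p r) F) \<le> 2 * (max 1 (1 / lam0) * exp (- \<gamma> * X L)) * (1 + norm c) * pi"
    if "F contour_integrable_on linepath p r" "\<And>z. z \<in> closed_segment p r \<Longrightarrow> Re z = X L \<or> Re z = - X L" "norm (r - p) = pi" for p r
    using contour_integral_bound_linepath[OF that(1), of "2 * (max 1 (1 / lam0) * exp (- \<gamma> * X L)) * (1 + norm c)"] vert that(2,3) by simp
  have n23: "norm (?a3 - ?a2) = pi" "norm (?a1 - ?a4) = pi" by (simp_all add: cmod_def)
  have v1: "norm (contour_integral (linepath ?a2 ?a3) F) \<le> 2 * (max 1 (1 / lam0) * exp (- \<gamma> * X L)) * (1 + norm c) * pi"
    using segV by (intro v[OF ci(2)] n23) auto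
  have v2: "norm (contour_integral (linepath ?a4 ?a1) F) \<le> 2 * (max 1 (1 / lam0) * exp (- \<gamma> * X L)) * (1 + norm c) * pi"
    using segV by (intro v[OF ci(4)] n23) auto
  define D where "D = 2 * (q / (1 - q)) * (max 1 (1 / lam0) * max 1 (2 / \<gamma>\<^sup>2))"
  have D: "0 \<le> D" using q by (simp add: D_def)
  have h: "norm (contour_integral (linepath ?a1 ?a2) F - contour_integral (linepath ?a4 ?a3) F) \<le> D * pi"
  proof -
    define z where "z t = linepath ?a1 ?a2 t" for t
    define x where "x t = - X L + 2 * X L * t" for t
    have z: "Re (z t) = x t" "Im (z t) = - pi / 4" "linepath ?a4 ?a3 t = z t + \<i> * of_real pi" for t
      by (simp_all add: z_def x_def linepath_def algebra_simps complex_eq_iff)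
    have d: "?a2 - ?a1 = of_real (2 * X L)" "?a3 - ?a4 = of_real (2 * X L)" by (simp_all add: complex_eq_iff)
    have hi: "((\<lambda>t. F (z t) * of_real (2 * X L)) has_integral contour_integral (linepath ?a1 ?a2) F) {0..1}"
      using has_contour_integral_integral[OF ci(1)] unfolding has_contour_integral_linepath d z_def .
    have "F contour_integrable_on (linepath ?a4 ?a3)"
      using cont(3) by (intro contour_integrable_continuous_linepath) (simp add: closed_segment_commute)
    then have hi2: "((\<lambda>t. F (z t + \<i> * of_real pi) * of_real (2 * X L)) has_integral contour_integral (linepath ?a4 ?a3) F) {0..1}"
      using has_contour_integral_integral[of F "linepath ?a4 ?a3"] unfolding has_contour_integral_linepath d z(3) by simp
    have "((\<lambda>t. D * (2 * X L / (1 + (x t)\<^sup>2))) has_integral D * (arctan (x 1) - arctan (x 0))) {0..1}"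
    proof (intro has_integral_mult_right fundamental_theorem_of_calculus)
      fix t :: real
      have "((\<lambda>t. arctan (x t)) has_field_derivative inverse (1 + (x t)\<^sup>2) * (2 * X L)) (at t within {0..1})"
        unfolding x_def by (auto intro!: derivative_eq_intros)
      then show "((\<lambda>t. arctan (x t)) has_vector_derivative 2 * X L / (1 + (x t)\<^sup>2)) (at t within {0..1})"
        by (simp add: has_real_derivative_iff_has_vector_derivative[symmetric] divide_inverse mult.commute)
    qed simp
    moreover have "norm (F (z t) * of_real (2 * X L) - F (z t + \<i> * of_real pi) * of_real (2 * X L)) \<le> D * (2 * X L / (1 + (x t)\<^sup>2))" for t
    proof -
      have "norm (F (z t) - F (z t + \<i> * of_real pi)) \<le> 2 * (q / (1 - q)) * decay (x t)"
        using F_horizontal_diff[OF z(2)[of t]] unfolding z(1) .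
      also have "\<dots> \<le> 2 * (q / (1 - q)) * (max 1 (1 / lam0) * (max 1 (2 / \<gamma>\<^sup>2) * (1 / (1 + (x t)\<^sup>2))))"
        using q order_trans[OF decay_le[OF lam0, of "x t", folded \<gamma>_def] mult_left_mono[OF exp_neg_abs_le[OF \<gamma>, of "x t"], of "max 1 (1 / lam0)"]]
        by (intro mult_left_mono) (auto simp: le_max_iff_disj)
      finally have "norm (F (z t) - F (z t + \<i> * of_real pi)) * (2 * X L) \<le> 2 * (q / (1 - q)) * (max 1 (1 / lam0) * (max 1 (2 / \<gamma>\<^sup>2) * (1 / (1 + (x t)\<^sup>2)))) * (2 * X L)"
        using X by (intro mult_right_mono) auto
      also have "\<dots> = D * (2 * X L / (1 + (x t)\<^sup>2))" by (simp add: D_def)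
      finally show ?thesis using X by (simp add: left_diff_distrib[symmetric] norm_mult)
    qed
    ultimately have "norm (contour_integral (linepath ?a1 ?a2) F - contour_integral (linepath ?a4 ?a3) F) \<le> D * (arctan (x 1) - arctan (x 0))"
      using integral_norm_bound_integral[OF has_integral_integrable[OF has_integral_diff[OF hi hi2]], of "\<lambda>t. D * (2 * X L / (1 + (x t)\<^sup>2))"]
        integral_unique[OF has_integral_diff[OF hi hi2]]
      by (metis (no_types, lifting) has_integral_integrable integral_unique)
    also have "\<dots> \<le> D * pi"
      using D arctan_ubound[of "x 1"] arctan_lbound[of "x 0"] by (intro mult_left_mono) linarith+
    finally show ?thesis .
  qed
  have "norm (contour_integral (rectpath ?a1 ?a3) F) \<le> D * pi + 2 * (max 1 (1 / lam0) * exp (- \<gamma> * X L)) * (1 + norm c) * pi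
     + 2 * (max 1 (1 / lam0) * exp (- \<gamma> * X L)) * (1 + norm c) * pi"
    unfolding split using h v1 v2 by (meson add_mono norm_triangle_le order_trans norm_triangle_ineq)
  then show ?thesis unfolding D_def by (simp add: algebra_simps)
qed

text \<open>The limit in \<open>L\<close> removes the vertical sides. The four remaining terms are
  the discrepancy of the horizontal sides, the remainder of the residue at \<open>y0\<close>, and
  the tails of the sum below \<open>- K1\<close> and above \<open>K2\<close>. The lower bounds on
  \<open>K1\<close> and \<open>K2\<close> are just what makes the tails of order
  \<open>q\<close>.\<close>

lemma truncated_sum_bound:
  assumes lam0: "0 < lam0" "lam0 \<le> exp s"
    and K: "pi\<^sup>2 / (4 * \<beta> * k\<^sup>2) \<le> of_int K1" "pi\<^sup>2 / (4 * (1 - \<beta>) * k\<^sup>2) \<le> of_int K2"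
  defines "\<gamma> \<equiv> min (2 * \<beta>) (2 * (1 - \<beta>))"
  shows "\<bar>k * (\<Sum>l\<in>{- K1..K2}. exp (2 * \<beta> * of_int l * k) / (1 + exp (2 * of_int l * k + s))) - pi * exp (- \<beta> * s) / (2 * sin (pi * \<beta>))\<bar>
    \<le> 2 * (q / (1 - q)) * (max 1 (1 / lam0) * max 1 (2 / \<gamma>\<^sup>2)) * pi + pi * exp (- \<beta> * s) * (q / (1 - q))
      + q / (2 * \<beta>) + q / (2 * (1 - \<beta>) * lam0)" (is "_ \<le> ?B")
proof -
  define G where "G l = exp (2 * \<beta> * of_int l * k) / (1 + exp (2 * of_int l * k + s))" for l :: int
  define I where "I = pi * exp (- \<beta> * s) / (2 * sin (pi * \<beta>))"
  define V where "V L = 4 * pi * (1 + norm c) * (max 1 (1 / lam0) * exp (- \<gamma> * X L))" for L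
  have K0: "0 \<le> K1" "0 \<le> K2"
  proof -
    have "0 \<le> pi\<^sup>2 / (4 * \<beta> * k\<^sup>2)" "0 \<le> pi\<^sup>2 / (4 * (1 - \<beta>) * k\<^sup>2)" using \<beta> by simp_all
    then show "0 \<le> K1" "0 \<le> K2" using K by linarith+
  qed
  \<comment> \<open>Comparison with the integral of the exponential: by
    \<open>a * k \<le> exp (a * k) - 1\<close>, each term is at most a telescoping
    difference.\<close>
  have tail: "k * (\<Sum>l\<in>{K + 1..L}. exp (- a * of_int l * k)) \<le> exp (- a * of_int K * k) / a"
    if "0 < a" "K \<le> L" for a :: real and K L :: int
  proof -
    have "k * (\<Sum>l\<in>{K + 1..L}. exp (- a * of_int l * k)) \<le> (exp (- a * of_int K * k) - exp (- a * of_int L * k)) / a"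
      using \<open>K \<le> L\<close>
    proof (induction L rule: int_ge_induct)
      case (step L)
      have "{K + 1..L + 1} = insert (L + 1) {K + 1..L}" using step.hyps by auto
      then have "k * (\<Sum>l\<in>{K + 1..L + 1}. exp (- a * of_int l * k)) =
          k * exp (- a * of_int (L + 1) * k) + k * (\<Sum>l\<in>{K + 1..L}. exp (- a * of_int l * k))"
        by (simp only:) (subst sum.insert, simp, simp, simp only: distrib_left)
      moreover have "k * exp (- a * of_int (L + 1) * k) \<le> (exp (- a * of_int L * k) - exp (- a * of_int (L + 1) * k)) / a"
      proof -
        have "a * k * exp (- a * of_int (L + 1) * k) \<le> (exp (a * k) - 1) * exp (- a * of_int (L + 1) * k)"
        proof (rule mult_right_mono)
          show "a * k \<le> exp (a * k) - 1" using exp_ge_add_one_self[of "a * k"] by linarith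
        qed simp
        also have "\<dots> = exp (- a * of_int L * k) - exp (- a * of_int (L + 1) * k)"
          by (simp add: left_diff_distrib exp_add[symmetric] algebra_simps)
        finally show ?thesis using that(1) by (simp add: field_simps)
      qed
      ultimately show ?case using step.IH by (simp add: diff_divide_distrib)
    qed simp
    also have "\<dots> \<le> exp (- a * of_int K * k) / a" using that(1) by (intro divide_right_mono) auto
    finally show ?thesis .
  qed
  have G0: "0 \<le> G l" for l by (simp add: G_def add_nonneg_nonneg)
  have Gl: "G l \<le> exp (2 * \<beta> * of_int l * k)" for l
  proof -
    have "G l \<le> exp (2 * \<beta> * of_int l * k) / 1"
      unfolding G_def by (intro divide_left_mono) (auto simp: add_pos_pos)
    then show ?thesis by simp
  qed
  have Gr: "G l \<le> exp (- (2 * (1 - \<beta>)) * of_int l * k) / lam0" for l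
  proof -
    have "G l \<le> exp (2 * \<beta> * of_int l * k) / exp (2 * of_int l * k + s)"
      unfolding G_def by (intro divide_left_mono) (auto simp: add_pos_pos)
    also have "\<dots> = exp (- (2 * (1 - \<beta>)) * of_int l * k) / exp s"
      by (simp add: exp_diff[symmetric] exp_add[symmetric] algebra_simps)
    also have "\<dots> \<le> exp (- (2 * (1 - \<beta>)) * of_int l * k) / lam0"
      using lam0 by (intro divide_left_mono) auto
    finally show ?thesis .
  qed
  have qK: "exp (- (2 * \<beta>) * of_int K1 * k) \<le> q" "exp (- (2 * (1 - \<beta>)) * of_int K2 * k) \<le> q"
  proof -
    have *: "exp (- (2 * b) * of_int K * k) \<le> q" if b: "0 < b" "pi\<^sup>2 / (4 * b * k\<^sup>2) \<le> of_int K" for b and K :: int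
    proof -
      have "pi\<^sup>2 / (2 * k) = 2 * b * k * (pi\<^sup>2 / (4 * b * k\<^sup>2))" using b k by (simp add: power2_eq_square)
      also have "\<dots> \<le> 2 * b * k * of_int K" using b k by (intro mult_left_mono) auto
      finally have "- (2 * b * k * of_int K) \<le> - (pi\<^sup>2 / (2 * k))" by (rule le_imp_neg_le)
      moreover have "- (2 * b) * of_int K * k = - (2 * b * k * of_int K)" by simp
      ultimately show ?thesis by (simp only: q_def exp_le_cancel_iff minus_divide_left)
    qed
    show "exp (- (2 * \<beta>) * of_int K1 * k) \<le> q" by (rule *[OF \<beta>(1) K(1)])
    show "exp (- (2 * (1 - \<beta>)) * of_int K2 * k) \<le> q" by (rule *[OF _ K(2)]) (use \<beta> in simp)
  qed
  have main: "\<bar>k * (\<Sum>l\<in>{- K1..K2}. G l) - I\<bar> \<le> ?B + V L"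
    if L: "1 \<le> 2 * X L - \<bar>s\<bar>" "K1 \<le> int L" "K2 \<le> int L" for L
  proof -
    have "of_real (k * (\<Sum>l\<in>{- int L..int L}. G l) - I) =
      contour_integral (rectpath (Complex (- X L) (- pi / 4)) (Complex (X L) (3 * pi / 4))) F
      + of_real pi * \<i> * exp (2 * of_real \<beta> * y0) * (1 / (1 - E y0))"
      using residue_sum[of L] L(1) by (simp add: G_def I_def)
    then have "\<bar>k * (\<Sum>l\<in>{- int L..int L}. G l) - I\<bar> =
      norm (contour_integral (rectpath (Complex (- X L) (- pi / 4)) (Complex (X L) (3 * pi / 4))) F
      + of_real pi * \<i> * exp (2 * of_real \<beta> * y0) * (1 / (1 - E y0)))"
      by (metis norm_of_real)
    also have "\<dots> \<le> (2 * (q / (1 - q)) * (max 1 (1 / lam0) * max 1 (2 / \<gamma>\<^sup>2)) * pi + V L) + pi * exp (- \<beta> * s) * (q / (1 - q))"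
    proof (rule order_trans[OF norm_triangle_ineq add_mono])
      show "norm (contour_integral (rectpath (Complex (- X L) (- pi / 4)) (Complex (X L) (3 * pi / 4))) F)
         \<le> 2 * (q / (1 - q)) * (max 1 (1 / lam0) * max 1 (2 / \<gamma>\<^sup>2)) * pi + V L"
        unfolding V_def \<gamma>_def by (rule contour_bound[OF lam0 L(1)])
      have "1 / q \<le> norm (E y0)"
      proof -
        have "1 / q = exp (pi\<^sup>2 / (2 * k))" by (simp add: q_def exp_minus inverse_eq_divide)
        moreover have "2 * pi * Im y0 / k = pi\<^sup>2 / k" by (simp add: y0_def power2_eq_square)
        moreover have "pi\<^sup>2 / (2 * k) \<le> pi\<^sup>2 / k" using k by (intro divide_left_mono) auto
        ultimately show ?thesis unfolding norm_E by (simp only: exp_le_cancel_iff)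
      qed
      from norm_inverse_one_minus_E[OF this] show "norm (of_real pi * \<i> * exp (2 * of_real \<beta> * y0) * (1 / (1 - E y0))) \<le> pi * exp (- \<beta> * s) * (q / (1 - q))"
        unfolding norm_mult by (intro mult_mono) (auto simp: y0_def)
    qed
    finally have 1: "\<bar>k * (\<Sum>l\<in>{- int L..int L}. G l) - I\<bar> \<le> (2 * (q / (1 - q)) * (max 1 (1 / lam0) * max 1 (2 / \<gamma>\<^sup>2)) * pi + V L) + pi * exp (- \<beta> * s) * (q / (1 - q))" .
    have "{- int L..int L} = ({- int L..- K1 - 1} \<union> {- K1..K2}) \<union> {K2 + 1..int L}" using L K0 by auto
    then have "(\<Sum>l\<in>{- int L..int L}. G l) = (\<Sum>l\<in>{- int L..- K1 - 1}. G l) + (\<Sum>l\<in>{- K1..K2}. G l) + (\<Sum>l\<in>{K2 + 1..int L}. G l)"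
      using K0 by (simp only:) (subst sum.union_disjoint, auto)+
    then have 2: "k * (\<Sum>l\<in>{- int L..int L}. G l) - k * (\<Sum>l\<in>{- K1..K2}. G l) = k * (\<Sum>l\<in>{- int L..- K1 - 1}. G l) + k * (\<Sum>l\<in>{K2 + 1..int L}. G l)"
      by (simp add: algebra_simps)
    have "k * (\<Sum>l\<in>{- int L..- K1 - 1}. G l) \<le> k * (\<Sum>l\<in>{- int L..- K1 - 1}. exp (2 * \<beta> * of_int l * k))"
      using k by (intro mult_left_mono sum_mono Gl) auto
    also have "(\<Sum>l\<in>{- int L..- K1 - 1}. exp (2 * \<beta> * of_int l * k)) = (\<Sum>l\<in>{K1 + 1..int L}. exp (- (2 * \<beta>) * of_int l * k))"
      by (rule sum.reindex_bij_witness[of _ uminus uminus]) auto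
    also have "k * \<dots> \<le> exp (- (2 * \<beta>) * of_int K1 * k) / (2 * \<beta>)" using \<beta> L by (intro tail) auto
    also have "\<dots> \<le> q / (2 * \<beta>)" using qK(1) \<beta> by (intro divide_right_mono) auto
    finally have 3: "k * (\<Sum>l\<in>{- int L..- K1 - 1}. G l) \<le> q / (2 * \<beta>)" .
    have "k * (\<Sum>l\<in>{K2 + 1..int L}. G l) \<le> k * (\<Sum>l\<in>{K2 + 1..int L}. exp (- (2 * (1 - \<beta>)) * of_int l * k) / lam0)"
      using k by (intro mult_left_mono sum_mono Gr) auto
    also have "\<dots> = k * (\<Sum>l\<in>{K2 + 1..int L}. exp (- (2 * (1 - \<beta>)) * of_int l * k)) / lam0"
      by (simp only: sum_divide_distrib[symmetric] times_divide_eq_right)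
    also have "\<dots> \<le> (exp (- (2 * (1 - \<beta>)) * of_int K2 * k) / (2 * (1 - \<beta>))) / lam0"
      using \<beta> L lam0 by (intro divide_right_mono tail) auto
    also have "\<dots> \<le> (q / (2 * (1 - \<beta>))) / lam0" using qK(2) \<beta> lam0 by (intro divide_right_mono) auto
    finally have 4: "k * (\<Sum>l\<in>{K2 + 1..int L}. G l) \<le> q / (2 * (1 - \<beta>) * lam0)" by simp
    have "0 \<le> k * (\<Sum>l\<in>{- int L..- K1 - 1}. G l)" "0 \<le> k * (\<Sum>l\<in>{K2 + 1..int L}. G l)"
      using k by (auto intro!: mult_nonneg_nonneg sum_nonneg G0)
    with 1 2 3 4 show ?thesis by linarith
  qed
  have Xlim: "filterlim X at_top sequentially"
    unfolding X_def using k by real_asymp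
  have "\<forall>\<^sub>F L in sequentially. max ((1 + \<bar>s\<bar>) / 2) 0 \<le> X L" using Xlim unfolding filterlim_at_top by blast
  then have ev: "\<forall>\<^sub>F L in sequentially. \<bar>k * (\<Sum>l\<in>{- K1..K2}. G l) - I\<bar> \<le> ?B + V L"
    using eventually_ge_at_top[of "nat K1"] eventually_ge_at_top[of "nat K2"]
    by eventually_elim (rule main, auto)
  have "V \<longlonglongrightarrow> 4 * pi * (1 + norm c) * (max 1 (1 / lam0) * 0)"
  proof -
    have \<gamma>: "0 < \<gamma>" using \<beta> by (simp add: \<gamma>_def)
    have "filterlim (\<lambda>L. - \<gamma> * X L) at_bot sequentially"
      using filterlim_tendsto_neg_mult_at_bot[OF tendsto_const _ Xlim, of "- \<gamma>"] \<gamma> by simp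
    then have "(\<lambda>L. exp (- \<gamma> * X L)) \<longlonglongrightarrow> 0" by (rule filterlim_compose[OF exp_at_bot])
    then show ?thesis unfolding V_def by (intro tendsto_intros)
  qed
  then have "(\<lambda>L. ?B + V L) \<longlonglongrightarrow> ?B + 4 * pi * (1 + norm c) * (max 1 (1 / lam0) * 0)"
    by (intro tendsto_intros)
  from tendsto_lowerbound[OF this ev] show ?thesis by (simp add: G_def I_def)
qed

end

text \<open>One constant has to serve all discrete eigenvalues, so only their lower bound
  \<open>lam0\<close> enters it. The restriction \<open>k \<le> k0\<close> keeps \<open>q\<close>
  below \<open>q0 < 1\<close>, which bounds \<open>q / (1 - q)\<close> by a fixed multiple of
  \<open>q\<close>.\<close>

theorem sinc_quadrature_error:
  assumes \<beta>: "0 < \<beta>" "\<beta> < (1::real)" and lam0: "0 < lam0" and k0: "0 < k0"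
  shows "\<exists>C\<ge>0. \<forall>k lam. 0 < k \<and> k \<le> k0 \<and> lam0 \<le> lam \<longrightarrow>
    \<bar>lam powr (- \<beta>) - 2 * k * sin (pi * \<beta>) / pi *
      (\<Sum>l\<in>{- \<lceil>pi\<^sup>2 / (4 * \<beta> * k\<^sup>2)\<rceil>..\<lceil>pi\<^sup>2 / (4 * (1 - \<beta>) * k\<^sup>2)\<rceil>}.
        exp (2 * \<beta> * of_int l * k) / (1 + exp (2 * of_int l * k) * lam))\<bar> \<le> C * exp (- pi\<^sup>2 / (2 * k))"
proof -
  define q0 where "q0 = exp (- pi\<^sup>2 / (2 * k0))"
  have q0: "q0 < 1" using k0 by (simp add: q0_def)
  define M where "M = max 1 (1 / lam0) * max 1 (2 / (min (2 * \<beta>) (2 * (1 - \<beta>)))\<^sup>2)"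
  define C where "C = 2 * M * pi / (1 - q0) + pi * lam0 powr (- \<beta>) / (1 - q0) + 1 / (2 * \<beta>) + 1 / (2 * (1 - \<beta>) * lam0)"
  have M: "0 \<le> M" by (simp add: M_def le_max_iff_disj)
  have C: "0 \<le> C" unfolding C_def using \<beta> lam0 q0 M by (intro add_nonneg_nonneg) auto
  have "\<bar>lam powr (- \<beta>) - 2 * k * sin (pi * \<beta>) / pi *
      (\<Sum>l\<in>{- \<lceil>pi\<^sup>2 / (4 * \<beta> * k\<^sup>2)\<rceil>..\<lceil>pi\<^sup>2 / (4 * (1 - \<beta>) * k\<^sup>2)\<rceil>}.
        exp (2 * \<beta> * of_int l * k) / (1 + exp (2 * of_int l * k) * lam))\<bar> \<le> C * exp (- pi\<^sup>2 / (2 * k))"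
    if "0 < k" "k \<le> k0" "lam0 \<le> lam" for k lam
  proof -
    define s where "s = ln lam"
    have lam: "0 < lam" using that lam0 by linarith
    have es: "exp s = lam" using lam by (simp add: s_def)
    interpret sinc_quadrature \<beta> k s by unfold_locales (use \<beta> that in auto)
    have sn: "0 < sin (pi * \<beta>)" using \<beta> by (intro sin_gt_zero) auto
    have ls: "exp (- \<beta> * s) = lam powr (- \<beta>)" using lam by (simp add: s_def powr_def)
    have ll: "lam powr (- \<beta>) \<le> lam0 powr (- \<beta>)" using lam0 that \<beta> by (intro powr_mono2') auto
    have "q \<le> q0" using that k0 by (simp add: q_def q0_def frac_le)
    then have qq: "q / (1 - q) \<le> q / (1 - q0)" using q q0 by (intro divide_left_mono) auto
    define T where "T = (\<Sum>l\<in>{- \<lceil>pi\<^sup>2 / (4 * \<beta> * k\<^sup>2)\<rceil>..\<lceil>pi\<^sup>2 / (4 * (1 - \<beta>) * k\<^sup>2)\<rceil>}.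
        exp (2 * \<beta> * of_int l * k) / (1 + exp (2 * of_int l * k) * lam))"
    have T: "T = (\<Sum>l\<in>{- \<lceil>pi\<^sup>2 / (4 * \<beta> * k\<^sup>2)\<rceil>..\<lceil>pi\<^sup>2 / (4 * (1 - \<beta>) * k\<^sup>2)\<rceil>}.
        exp (2 * \<beta> * of_int l * k) / (1 + exp (2 * of_int l * k + s)))"
      by (simp add: T_def exp_add es)
    have "\<bar>k * T - pi * exp (- \<beta> * s) / (2 * sin (pi * \<beta>))\<bar> \<le>
        2 * (q / (1 - q)) * M * pi + pi * exp (- \<beta> * s) * (q / (1 - q)) + q / (2 * \<beta>) + q / (2 * (1 - \<beta>) * lam0)"
      unfolding T M_def using lam0 that(3) by (intro truncated_sum_bound le_of_int_ceiling) (auto simp: es)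
    also have "\<dots> \<le> 2 * (q / (1 - q0)) * M * pi + pi * lam0 powr (- \<beta>) * (q / (1 - q0)) + q / (2 * \<beta>) + q / (2 * (1 - \<beta>) * lam0)"
      unfolding ls using qq M ll q q0 by (intro add_mono mult_mono order_refl) auto
    also have "\<dots> = C * q" by (simp add: C_def field_simps)
    finally have 1: "\<bar>k * T - pi * lam powr (- \<beta>) / (2 * sin (pi * \<beta>))\<bar> \<le> C * q" unfolding ls .
    have "lam powr (- \<beta>) - 2 * k * sin (pi * \<beta>) / pi * T = - (2 * sin (pi * \<beta>) / pi) * (k * T - pi * lam powr (- \<beta>) / (2 * sin (pi * \<beta>)))"
      using sn by (simp add: field_simps)
    then have "\<bar>lam powr (- \<beta>) - 2 * k * sin (pi * \<beta>) / pi * T\<bar> = (2 * sin (pi * \<beta>) / pi) * \<bar>k * T - pi * lam powr (- \<beta>) / (2 * sin (pi * \<beta>))\<bar>"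
      using sn by (simp add: abs_mult)
    also have "\<dots> \<le> 1 * (C * q)"
    proof (rule mult_mono[OF _ 1])
      show "2 * sin (pi * \<beta>) / pi \<le> 1" proof -
        have "2 * sin (pi * \<beta>) \<le> pi" using sin_le_one[of "pi * \<beta>"] pi_gt3 by linarith
        then show ?thesis by (simp add: divide_le_eq)
      qed
    qed auto
    finally show ?thesis by (simp add: T_def q_def)
  qed
  then show ?thesis using C by blast
qed

section \<open>Series in independent normal variables\<close>

lemma standard_normal_sequence_moments:
  assumes "standard_normal_sequence M \<xi>"
  shows "prob_space M" "\<xi> j \<in> borel_measurable M" "integrable M (\<xi> j)" "integrable M (\<lambda>\<omega>. (\<xi> j \<omega>)\<^sup>2)"
    "(LINT \<omega>|M. (\<xi> j \<omega>)\<^sup>2) = 1"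
    "i \<noteq> j \<Longrightarrow> (LINT \<omega>|M. \<xi> i \<omega> * \<xi> j \<omega>) = 0"
proof -
  show ps: "prob_space M" using assms by (simp add: standard_normal_sequence_def)
  interpret prob_space M by fact
  have d: "distributed M lborel (\<xi> j) std_normal_density" for j
    using assms by (simp add: standard_normal_sequence_def)
  show m: "\<xi> j \<in> borel_measurable M" for j using distributed_measurable[OF d[of j]] by simp
  have i1: "has_bochner_integral lborel (\<lambda>x. std_normal_density x * x) 0"
    using std_normal_moment_odd[of 0] by simp
  have i2: "has_bochner_integral lborel (\<lambda>x. std_normal_density x * x\<^sup>2) 1"
    using std_normal_moment_even[of 1] by (simp add: fact_2 eval_nat_numeral)
  show int: "integrable M (\<xi> j)" for j
    using distributed_integrable[OF d[of j], of "\<lambda>x. x"] i1 by (simp add: has_bochner_integral_iff)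
  show int2: "integrable M (\<lambda>\<omega>. (\<xi> j \<omega>)\<^sup>2)" for j
    using distributed_integrable[OF d[of j], of "\<lambda>x. x\<^sup>2"] i2 by (simp add: has_bochner_integral_iff)
  show "(LINT \<omega>|M. (\<xi> j \<omega>)\<^sup>2) = 1"
    using distributed_integral[OF d[of j], of "\<lambda>x. x\<^sup>2"] i2 by (simp add: has_bochner_integral_iff)
  have e0: "(LINT \<omega>|M. \<xi> j \<omega>) = 0" for j
    using distributed_integral[OF d[of j], of "\<lambda>x. x"] i1 by (simp add: has_bochner_integral_iff)
  assume ij: "i \<noteq> j"
  have "indep_vars (\<lambda>_. borel) \<xi> {i, j}"
    using assms indep_vars_subset[of "\<lambda>_. borel" \<xi> UNIV "{i, j}"] by (simp add: standard_normal_sequence_def)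
  from indep_vars_lebesgue_integral[OF _ this int] ij show "(LINT \<omega>|M. \<xi> i \<omega> * \<xi> j \<omega>) = 0"
    by (simp add: e0)
qed

locale normal_sequence =
  fixes M :: "'w measure" and \<xi> :: "nat \<Rightarrow> 'w \<Rightarrow> real"
  assumes std: "standard_normal_sequence M \<xi>"
begin

sublocale prob_space M by (rule standard_normal_sequence_moments(1)[OF std])

lemmas meas[measurable] = standard_normal_sequence_moments(2)[OF std]
lemmas int2 = standard_normal_sequence_moments(4)[OF std]
lemmas exp2 = standard_normal_sequence_moments(5)[OF std]
lemmas exp_mult = standard_normal_sequence_moments(6)[OF std]

lemma int_mult: "integrable M (\<lambda>\<omega>. \<xi> i \<omega> * \<xi> j \<omega>)"
proof (rule Bochner_Integration.integrable_bound)
  show "integrable M (\<lambda>\<omega>. (\<xi> i \<omega>)\<^sup>2 + (\<xi> j \<omega>)\<^sup>2)" using int2 by simp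
  have "\<bar>x * y\<bar> \<le> x\<^sup>2 + y\<^sup>2" for x y :: real
    using sum_squares_bound[of "\<bar>x\<bar>" "\<bar>y\<bar>"] mult_nonneg_nonneg[OF abs_ge_zero[of x] abs_ge_zero[of y]]
    unfolding abs_mult power2_abs by linarith
  then show "AE \<omega> in M. norm (\<xi> i \<omega> * \<xi> j \<omega>) \<le> norm ((\<xi> i \<omega>)\<^sup>2 + (\<xi> j \<omega>)\<^sup>2)" by auto
qed (intro borel_measurable_times meas)

lemma square_series:
  assumes "summable x" "\<And>j. 0 \<le> x j"
  shows "AE \<omega> in M. summable (\<lambda>j. x j * (\<xi> j \<omega>)\<^sup>2)"
    "integrable M (\<lambda>\<omega>. \<Sum>j. x j * (\<xi> j \<omega>)\<^sup>2)"
    "(LINT \<omega>|M. (\<Sum>j. x j * (\<xi> j \<omega>)\<^sup>2)) = (\<Sum>j. x j)"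
proof -
  have i: "integrable M (\<lambda>\<omega>. x j * (\<xi> j \<omega>)\<^sup>2)" for j using int2 by simp
  have "(\<Sum>j. nn_integral M (\<lambda>\<omega>. ennreal (x j * (\<xi> j \<omega>)\<^sup>2))) = (\<Sum>j. ennreal (x j))"
    using assms(2) by (intro suminf_cong) (simp add: nn_integral_eq_integral[OF i] exp2)
  also have "\<dots> < \<infinity>" using assms by (simp add: suminf_ennreal2)
  finally have "nn_integral M (\<lambda>\<omega>. \<Sum>j. ennreal (x j * (\<xi> j \<omega>)\<^sup>2)) < \<infinity>"
    by (subst nn_integral_suminf) auto
  then have "AE \<omega> in M. (\<Sum>j. ennreal (x j * (\<xi> j \<omega>)\<^sup>2)) \<noteq> \<infinity>"
    by (intro nn_integral_PInf_AE) auto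
  then show ae: "AE \<omega> in M. summable (\<lambda>j. x j * (\<xi> j \<omega>)\<^sup>2)"
    by eventually_elim (rule summable_suminf_not_top, use assms in auto)
  have s: "summable (\<lambda>j. LINT \<omega>|M. norm (x j * (\<xi> j \<omega>)\<^sup>2))"
    using assms by (simp add: abs_mult exp2)
  have ae': "AE \<omega> in M. summable (\<lambda>j. norm (x j * (\<xi> j \<omega>)\<^sup>2))"
    using ae by eventually_elim (use assms in \<open>simp add: abs_mult\<close>)
  show "integrable M (\<lambda>\<omega>. \<Sum>j. x j * (\<xi> j \<omega>)\<^sup>2)" by (rule integrable_suminf[OF i ae' s])
  show "(LINT \<omega>|M. (\<Sum>j. x j * (\<xi> j \<omega>)\<^sup>2)) = (\<Sum>j. x j)"
    using integral_suminf[OF i ae' s] by (simp add: exp2)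
qed

text \<open>With the modulus of \<open>x j\<close> split into two square roots, Cauchy-Schwarz
  bounds the square of the series by a random variable of finite mean. It becomes the majorant for
  dominated convergence.\<close>

lemma abs_series:
  assumes "summable (\<lambda>j. \<bar>x j\<bar>)"
  shows "AE \<omega> in M. summable (\<lambda>j. \<bar>x j * \<xi> j \<omega>\<bar>) \<and> (\<Sum>j. \<bar>x j * \<xi> j \<omega>\<bar>)\<^sup>2 \<le> (\<Sum>j. \<bar>x j\<bar>) * (\<Sum>j. \<bar>x j\<bar> * (\<xi> j \<omega>)\<^sup>2)"
  using square_series(1)[OF assms abs_ge_zero]
proof (rule AE_mp, intro AE_I2 impI)
  fix \<omega> assume s2: "summable (\<lambda>j. \<bar>x j\<bar> * (\<xi> j \<omega>)\<^sup>2)"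
  have "\<bar>t\<bar> \<le> 1 + t\<^sup>2" for t :: real
    using sum_squares_bound[of "\<bar>t\<bar>" 1] abs_ge_zero[of t] by (simp del: abs_ge_zero)
  then have "\<bar>x j * \<xi> j \<omega>\<bar> \<le> \<bar>x j\<bar> * (1 + (\<xi> j \<omega>)\<^sup>2)" for j
    unfolding abs_mult by (intro mult_left_mono) auto
  then have "norm \<bar>x j * \<xi> j \<omega>\<bar> \<le> \<bar>x j\<bar> + \<bar>x j\<bar> * (\<xi> j \<omega>)\<^sup>2" for j
    by (simp add: distrib_left)
  then have s1: "summable (\<lambda>j. \<bar>x j * \<xi> j \<omega>\<bar>)"
    using summable_comparison_test'[OF summable_add[OF assms s2], of 0 "\<lambda>j. \<bar>x j * \<xi> j \<omega>\<bar>"] by blast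
  have "(\<lambda>n. (\<Sum>j<n. \<bar>x j * \<xi> j \<omega>\<bar>)\<^sup>2) \<longlonglongrightarrow> (\<Sum>j. \<bar>x j * \<xi> j \<omega>\<bar>)\<^sup>2"
    by (intro tendsto_power summable_LIMSEQ s1)
  moreover have "(\<Sum>j<n. \<bar>x j * \<xi> j \<omega>\<bar>)\<^sup>2 \<le> (\<Sum>j. \<bar>x j\<bar>) * (\<Sum>j. \<bar>x j\<bar> * (\<xi> j \<omega>)\<^sup>2)" for n
  proof -
    have "(\<Sum>j<n. \<bar>x j * \<xi> j \<omega>\<bar>)\<^sup>2 = (\<Sum>j<n. sqrt \<bar>x j\<bar> * (sqrt \<bar>x j\<bar> * \<bar>\<xi> j \<omega>\<bar>))\<^sup>2"
      by (simp add: abs_mult mult.assoc[symmetric])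
    also have "\<dots> \<le> (\<Sum>j<n. (sqrt \<bar>x j\<bar>)\<^sup>2) * (\<Sum>j<n. (sqrt \<bar>x j\<bar> * \<bar>\<xi> j \<omega>\<bar>)\<^sup>2)"
      by (rule Cauchy_Schwarz_ineq_sum)
    also have "\<dots> = (\<Sum>j<n. \<bar>x j\<bar>) * (\<Sum>j<n. \<bar>x j\<bar> * (\<xi> j \<omega>)\<^sup>2)" by (simp add: power_mult_distrib)
    also have "\<dots> \<le> (\<Sum>j. \<bar>x j\<bar>) * (\<Sum>j. \<bar>x j\<bar> * (\<xi> j \<omega>)\<^sup>2)"
      using assms s2 by (intro mult_mono sum_le_suminf sum_nonneg suminf_nonneg) auto
    finally show ?thesis .
  qed
  ultimately have "(\<Sum>j. \<bar>x j * \<xi> j \<omega>\<bar>)\<^sup>2 \<le> (\<Sum>j. \<bar>x j\<bar>) * (\<Sum>j. \<bar>x j\<bar> * (\<xi> j \<omega>)\<^sup>2)"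
    using LIMSEQ_le_const2 by blast
  with s1 show "summable (\<lambda>j. \<bar>x j * \<xi> j \<omega>\<bar>) \<and> (\<Sum>j. \<bar>x j * \<xi> j \<omega>\<bar>)\<^sup>2 \<le> (\<Sum>j. \<bar>x j\<bar>) * (\<Sum>j. \<bar>x j\<bar> * (\<xi> j \<omega>)\<^sup>2)" by simp
qed

text \<open>Orthogonality of the \<open>\<xi> j\<close> settles the partial sums, and the majorants
  of \<open>abs_series\<close> for both factors allow the limit under the expectation.\<close>

lemma linear_series_product:
  assumes x: "summable (\<lambda>j. \<bar>x j\<bar>)" and y: "summable (\<lambda>j. \<bar>y j\<bar>)"
  shows "integrable M (\<lambda>\<omega>. (\<Sum>j. x j * \<xi> j \<omega>) * (\<Sum>j. y j * \<xi> j \<omega>))"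
    "(LINT \<omega>|M. (\<Sum>j. x j * \<xi> j \<omega>) * (\<Sum>j. y j * \<xi> j \<omega>)) = (\<Sum>j. x j * y j)"
proof -
  define W where "W z \<omega> = (\<Sum>j. \<bar>z j\<bar>) * (\<Sum>j. \<bar>z j\<bar> * (\<xi> j \<omega>)\<^sup>2)" for z \<omega>
  have W: "integrable M (\<lambda>\<omega>. W x \<omega> + W y \<omega>)"
    unfolding W_def using square_series(2)[OF x abs_ge_zero] square_series(2)[OF y abs_ge_zero] by simp
  have lim: "AE \<omega> in M. (\<lambda>n. (\<Sum>j<n. x j * \<xi> j \<omega>) * (\<Sum>j<n. y j * \<xi> j \<omega>)) \<longlonglongrightarrow> (\<Sum>j. x j * \<xi> j \<omega>) * (\<Sum>j. y j * \<xi> j \<omega>)"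
    using abs_series[OF x] abs_series[OF y]
  proof eventually_elim
    case (elim \<omega>)
    show ?case
      using summable_rabs_cancel[OF conjunct1[OF elim(1)]] summable_rabs_cancel[OF conjunct1[OF elim(2)]]
      by (intro tendsto_mult summable_LIMSEQ)
  qed
  have bound: "AE \<omega> in M. norm ((\<Sum>j<n. x j * \<xi> j \<omega>) * (\<Sum>j<n. y j * \<xi> j \<omega>)) \<le> W x \<omega> + W y \<omega>" for n
    using abs_series[OF x] abs_series[OF y]
  proof eventually_elim
    case (elim \<omega>)
    have *: "(\<Sum>j<n. z j * \<xi> j \<omega>)\<^sup>2 \<le> W z \<omega>"
      if "summable (\<lambda>j. \<bar>z j * \<xi> j \<omega>\<bar>) \<and> (\<Sum>j. \<bar>z j * \<xi> j \<omega>\<bar>)\<^sup>2 \<le> (\<Sum>j. \<bar>z j\<bar>) * (\<Sum>j. \<bar>z j\<bar> * (\<xi> j \<omega>)\<^sup>2)" for z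
    proof -
      have "\<bar>\<Sum>j<n. z j * \<xi> j \<omega>\<bar> \<le> (\<Sum>j<n. \<bar>z j * \<xi> j \<omega>\<bar>)" by (rule sum_abs)
      also have "\<dots> \<le> (\<Sum>j. \<bar>z j * \<xi> j \<omega>\<bar>)" using that by (intro sum_le_suminf) auto
      finally have "\<bar>\<Sum>j<n. z j * \<xi> j \<omega>\<bar>\<^sup>2 \<le> (\<Sum>j. \<bar>z j * \<xi> j \<omega>\<bar>)\<^sup>2" by (intro power_mono) auto
      then show ?thesis using that by (simp add: W_def)
    qed
    have "\<bar>u * v\<bar> \<le> u\<^sup>2 + v\<^sup>2" for u v :: real
      using sum_squares_bound[of "\<bar>u\<bar>" "\<bar>v\<bar>"] mult_nonneg_nonneg[OF abs_ge_zero[of u] abs_ge_zero[of v]]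
      unfolding abs_mult power2_abs by linarith
    then show ?case using *[OF elim(1)] *[OF elim(2)] by (simp only: real_norm_def) (meson add_mono order_trans)
  qed
  have m: "(\<lambda>\<omega>. \<Sum>j<n. z j * \<xi> j \<omega>) \<in> borel_measurable M" "(\<lambda>\<omega>. \<Sum>j. z j * \<xi> j \<omega>) \<in> borel_measurable M" for z :: "nat \<Rightarrow> real" and n :: nat
    by measurable
  show "integrable M (\<lambda>\<omega>. (\<Sum>j. x j * \<xi> j \<omega>) * (\<Sum>j. y j * \<xi> j \<omega>))"
    by (rule integrable_dominated_convergence[where w="\<lambda>\<omega>. W x \<omega> + W y \<omega>" and s="\<lambda>n \<omega>. (\<Sum>j<n. x j * \<xi> j \<omega>) * (\<Sum>j<n. y j * \<xi> j \<omega>)"])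
      (intro borel_measurable_times m W lim bound)+
  have "(\<lambda>n. LINT \<omega>|M. (\<Sum>j<n. x j * \<xi> j \<omega>) * (\<Sum>j<n. y j * \<xi> j \<omega>)) \<longlonglongrightarrow> (LINT \<omega>|M. (\<Sum>j. x j * \<xi> j \<omega>) * (\<Sum>j. y j * \<xi> j \<omega>))"
    by (rule integral_dominated_convergence[where w="\<lambda>\<omega>. W x \<omega> + W y \<omega>"])
      (intro borel_measurable_times m W lim bound)+
  moreover have "(LINT \<omega>|M. (\<Sum>j<n. x j * \<xi> j \<omega>) * (\<Sum>j<n. y j * \<xi> j \<omega>)) = (\<Sum>j<n. x j * y j)" for n
  proof -
    have e: "(LINT \<omega>|M. \<xi> i \<omega> * \<xi> j \<omega>) = (if i = j then 1 else 0)" for i j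
      using exp2[of j] exp_mult[of i j] by (simp add: power2_eq_square)
    have "(LINT \<omega>|M. (\<Sum>j<n. x j * \<xi> j \<omega>) * (\<Sum>j<n. y j * \<xi> j \<omega>)) = (LINT \<omega>|M. (\<Sum>i<n. \<Sum>j<n. (x i * y j) * (\<xi> i \<omega> * \<xi> j \<omega>)))"
      by (simp add: sum_product mult_ac)
    also have "\<dots> = (\<Sum>i<n. \<Sum>j<n. (x i * y j) * (if i = j then 1 else 0))"
      using int_mult by (simp add: e)
    finally show ?thesis by (simp add: if_distrib[of "\<lambda>t. _ * t"] cong: if_cong)
  qed
  ultimately have "(\<lambda>n. \<Sum>j<n. x j * y j) \<longlonglongrightarrow> (LINT \<omega>|M. (\<Sum>j. x j * \<xi> j \<omega>) * (\<Sum>j. y j * \<xi> j \<omega>))" by simp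
  then show "(LINT \<omega>|M. (\<Sum>j. x j * \<xi> j \<omega>) * (\<Sum>j. y j * \<xi> j \<omega>)) = (\<Sum>j. x j * y j)"
    by (simp add: sums_def sums_unique)
qed

end

section \<open>Finite-dimensional pairs of forms\<close>

text \<open>Only semidefinite, since functions stand for their classes: a nonzero function can have
  norm zero. The \<open>L2\<close> product and the energy form are both instances.\<close>

locale semi_inner =
  fixes X :: "('p \<Rightarrow> real) set" and ip :: "('p \<Rightarrow> real) \<Rightarrow> ('p \<Rightarrow> real) \<Rightarrow> real"
  assumes zero: "(\<lambda>_. 0) \<in> X"
    and lincomb: "u \<in> X \<Longrightarrow> v \<in> X \<Longrightarrow> (\<lambda>p. c * u p + d * v p) \<in> X"
    and sym: "u \<in> X \<Longrightarrow> v \<in> X \<Longrightarrow> ip u v = ip v u"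
    and lincomb_left: "u \<in> X \<Longrightarrow> v \<in> X \<Longrightarrow> w \<in> X \<Longrightarrow> ip (\<lambda>p. c * u p + d * v p) w = c * ip u w + d * ip v w"
    and pos: "u \<in> X \<Longrightarrow> 0 \<le> ip u u"
begin

lemma lincomb_right:
  "u \<in> X \<Longrightarrow> v \<in> X \<Longrightarrow> w \<in> X \<Longrightarrow> ip w (\<lambda>p. c * u p + d * v p) = c * ip w u + d * ip w v"
  using lincomb_left[of u v w c d] sym[of w "\<lambda>p. c * u p + d * v p"] sym[of w u] sym[of w v] lincomb[of u v c d]
  by simp

lemma diff: "u \<in> X \<Longrightarrow> v \<in> X \<Longrightarrow> (\<lambda>p. u p - v p) \<in> X"
  using lincomb[of u v 1 "-1"] by simp

lemma diff_left: "u \<in> X \<Longrightarrow> v \<in> X \<Longrightarrow> w \<in> X \<Longrightarrow> ip (\<lambda>p. u p - v p) w = ip u w - ip v w"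
  using lincomb_left[of u v w 1 "-1"] by simp

lemma diff_right: "u \<in> X \<Longrightarrow> v \<in> X \<Longrightarrow> w \<in> X \<Longrightarrow> ip w (\<lambda>p. u p - v p) = ip w u - ip w v"
  using lincomb_right[of u v w 1 "-1"] by simp

lemma zero_left: "w \<in> X \<Longrightarrow> ip (\<lambda>_. 0) w = 0"
  using lincomb_left[of w w w 0 0] by simp

lemma
  assumes "finite I" "\<And>i. i \<in> I \<Longrightarrow> f i \<in> X"
  shows sum_mem: "(\<lambda>p. \<Sum>i\<in>I. c i * f i p) \<in> X"
    and sum_left: "w \<in> X \<Longrightarrow> ip (\<lambda>p. \<Sum>i\<in>I. c i * f i p) w = (\<Sum>i\<in>I. c i * ip (f i) w)"
proof -
  have "(\<lambda>p. \<Sum>i\<in>I. c i * f i p) \<in> X \<and> (w \<in> X \<longrightarrow> ip (\<lambda>p. \<Sum>i\<in>I. c i * f i p) w = (\<Sum>i\<in>I. c i * ip (f i) w))" for w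
    using assms
  proof (induction I)
    case (insert i I)
    then have 1: "f i \<in> X" "(\<lambda>p. \<Sum>i\<in>I. c i * f i p) \<in> X" by auto
    show ?case
      using insert lincomb[OF 1, of "c i" 1] lincomb_left[OF 1, of w "c i" 1] by simp
  qed (simp add: zero zero_left)
  then show "(\<lambda>p. \<Sum>i\<in>I. c i * f i p) \<in> X" "w \<in> X \<Longrightarrow> ip (\<lambda>p. \<Sum>i\<in>I. c i * f i p) w = (\<Sum>i\<in>I. c i * ip (f i) w)"
    by blast+
qed

lemma sum_right:
  assumes "finite I" "\<And>i. i \<in> I \<Longrightarrow> f i \<in> X" "w \<in> X"
  shows "ip w (\<lambda>p. \<Sum>i\<in>I. c i * f i p) = (\<Sum>i\<in>I. c i * ip w (f i))"
  using sum_left[OF assms] sym[OF assms(3) sum_mem[OF assms(1,2)]] sym[OF assms(3) assms(2)] by simp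

lemma diff_self:
  "u \<in> X \<Longrightarrow> v \<in> X \<Longrightarrow> ip (\<lambda>p. u p - v p) (\<lambda>p. u p - v p) = ip u u - 2 * ip u v + ip v v"
  using sym[of u v] by (simp add: diff diff_left diff_right)

lemma lincomb_self:
  "u \<in> X \<Longrightarrow> v \<in> X \<Longrightarrow> ip (\<lambda>p. c * u p + d * v p) (\<lambda>p. c * u p + d * v p) = c\<^sup>2 * ip u u + 2 * c * d * ip u v + d\<^sup>2 * ip v v"
  using sym[of u v] by (simp add: lincomb lincomb_left lincomb_right power2_eq_square algebra_simps)

lemma Cauchy_Schwarz:
  assumes "u \<in> X" "v \<in> X" shows "(ip u v)\<^sup>2 \<le> ip u u * ip v v"
proof -
  have q: "0 \<le> ip u u + 2 * t * ip u v + t\<^sup>2 * ip v v" for t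
    using pos[OF lincomb[OF assms, of 1 t]] lincomb_self[OF assms, of 1 t] by simp
  show ?thesis
  proof (cases "ip v v = 0")
    case True
    have "ip u v = 0"
    proof (rule ccontr)
      assume "ip u v \<noteq> 0"
      then have "2 * (- (ip u u + 1) / (2 * ip u v)) * ip u v = - (ip u u + 1)" by simp
      then show False using q[of "- (ip u u + 1) / (2 * ip u v)"] True by simp
    qed
    then show ?thesis using True by simp
  next
    case False
    then have "0 < ip v v" using pos[OF assms(2)] by simp
    then show ?thesis using q[of "- ip u v / ip v v"] by (simp add: field_simps power2_eq_square)
  qed
qed

lemma Cauchy_Schwarz_abs:
  assumes "u \<in> X" "v \<in> X" shows "\<bar>ip u v\<bar> \<le> sqrt (ip u u) * sqrt (ip v v)"
  using real_sqrt_le_mono[OF Cauchy_Schwarz[OF assms]] by (simp add: real_sqrt_mult)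

lemma triangle:
  assumes "u \<in> X" "v \<in> X"
  shows "sqrt (ip (\<lambda>p. u p + v p) (\<lambda>p. u p + v p)) \<le> sqrt (ip u u) + sqrt (ip v v)"
proof (rule real_le_lsqrt)
  have "ip (\<lambda>p. u p + v p) (\<lambda>p. u p + v p) = ip u u + 2 * ip u v + ip v v"
    using lincomb_self[OF assms, of 1 1] by simp
  also have "\<dots> \<le> ip u u + 2 * (sqrt (ip u u) * sqrt (ip v v)) + ip v v"
    using Cauchy_Schwarz_abs[OF assms] by simp
  also have "\<dots> = (sqrt (ip u u) + sqrt (ip v v))\<^sup>2"
    using pos assms by (simp add: power2_sum)
  finally show "ip (\<lambda>p. u p + v p) (\<lambda>p. u p + v p) \<le> (sqrt (ip u u) + sqrt (ip v v))\<^sup>2" .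
qed (use pos assms in auto)

lemma tendsto_left:
  assumes "u \<in> X" "w \<in> X" "\<And>n. S n \<in> X" "(\<lambda>n. ip (\<lambda>p. u p - S n p) (\<lambda>p. u p - S n p)) \<longlonglongrightarrow> 0"
  shows "(\<lambda>n. ip (S n) w) \<longlonglongrightarrow> ip u w"
proof -
  have "(\<lambda>n. ip u w - ip (S n) w) \<longlonglongrightarrow> 0"
  proof (rule Lim_null_comparison)
    show "\<forall>\<^sub>F n in sequentially. norm (ip u w - ip (S n) w) \<le> sqrt (ip (\<lambda>p. u p - S n p) (\<lambda>p. u p - S n p)) * sqrt (ip w w)"
      using Cauchy_Schwarz_abs[OF diff[OF assms(1,3)] assms(2)] assms by (simp add: diff_left)
    show "(\<lambda>n. sqrt (ip (\<lambda>p. u p - S n p) (\<lambda>p. u p - S n p)) * sqrt (ip w w)) \<longlonglongrightarrow> 0"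
      using tendsto_mult_left_zero[OF tendsto_real_sqrt[OF assms(4), unfolded real_sqrt_zero]] .
  qed
  from tendsto_diff[OF tendsto_const[of "ip u w"] this] show ?thesis by simp
qed

definition orthonormal :: "nat set \<Rightarrow> (nat \<Rightarrow> 'p \<Rightarrow> real) \<Rightarrow> bool" where
  "orthonormal I b \<longleftrightarrow> (\<forall>i\<in>I. b i \<in> X) \<and> (\<forall>i\<in>I. \<forall>j\<in>I. ip (b i) (b j) = (if i = j then 1 else 0))"

lemma orthonormal_sum:
  assumes "orthonormal J b" "finite I" "I \<subseteq> J"
  shows "(\<lambda>p. \<Sum>i\<in>I. c i * b i p) \<in> X"
    and "j \<in> J \<Longrightarrow> ip (\<lambda>p. \<Sum>i\<in>I. c i * b i p) (b j) = (if j \<in> I then c j else 0)"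
    and "ip (\<lambda>p. \<Sum>i\<in>I. c i * b i p) (\<lambda>p. \<Sum>i\<in>I. d i * b i p) = (\<Sum>i\<in>I. c i * d i)"
proof -
  have b: "\<And>i. i \<in> I \<Longrightarrow> b i \<in> X" "\<And>i. i \<in> J \<Longrightarrow> b i \<in> X" using assms by (auto simp: orthonormal_def)
  show m: "(\<lambda>p. \<Sum>i\<in>I. c i * b i p) \<in> X" for c using sum_mem[OF assms(2) b(1)] by simp
  have coef: "ip (\<lambda>p. \<Sum>i\<in>I. c i * b i p) (b j) = (if j \<in> I then c j else 0)" if "j \<in> J" for j c
  proof -
    have "ip (\<lambda>p. \<Sum>i\<in>I. c i * b i p) (b j) = (\<Sum>i\<in>I. c i * ip (b i) (b j))"
      using sum_left[OF assms(2) b(1) b(2)[OF that]] by simp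
    also have "\<dots> = (\<Sum>i\<in>I. if i = j then c i else 0)"
      using assms that by (intro sum.cong) (auto simp: orthonormal_def)
    finally show ?thesis using assms(2) by simp
  qed
  then show "j \<in> J \<Longrightarrow> ip (\<lambda>p. \<Sum>i\<in>I. c i * b i p) (b j) = (if j \<in> I then c j else 0)" .
  show "ip (\<lambda>p. \<Sum>i\<in>I. c i * b i p) (\<lambda>p. \<Sum>i\<in>I. d i * b i p) = (\<Sum>i\<in>I. c i * d i)"
    using sum_right[OF assms(2) b(1) m, of "\<lambda>i. i" d] coef assms(3)
    by (auto simp: sum_right[OF assms(2) b(1) m] mult.commute intro!: sum.cong)
qed

text \<open>Pythagoras for arbitrary coefficients: the last sum is the excess over the orthogonal
  projection. It is used with Fourier coefficients and with those of the Ritz projection.\<close>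

lemma orthonormal_residual:
  assumes "orthonormal J b" "finite I" "I \<subseteq> J" "f \<in> X"
  shows "ip (\<lambda>p. f p - (\<Sum>i\<in>I. c i * b i p)) (\<lambda>p. f p - (\<Sum>i\<in>I. c i * b i p)) =
     ip f f - (\<Sum>i\<in>I. (ip f (b i))\<^sup>2) + (\<Sum>i\<in>I. (c i - ip f (b i))\<^sup>2)"
proof -
  note o = orthonormal_sum[OF assms(1-3)]
  have b: "\<And>i. i \<in> I \<Longrightarrow> b i \<in> X" using assms by (auto simp: orthonormal_def)
  have "ip (\<lambda>p. f p - (\<Sum>i\<in>I. c i * b i p)) (\<lambda>p. f p - (\<Sum>i\<in>I. c i * b i p)) =
     ip f f - 2 * (\<Sum>i\<in>I. c i * ip f (b i)) + (\<Sum>i\<in>I. c i * c i)"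
    using diff_self[OF assms(4) o(1)] sum_right[OF assms(2) b assms(4)] o(3) by simp
  also have "\<dots> = ip f f - (\<Sum>i\<in>I. (ip f (b i))\<^sup>2) + (\<Sum>i\<in>I. (c i - ip f (b i))\<^sup>2)"
    by (simp add: power2_eq_square algebra_simps sum.distrib sum_subtractf sum_distrib_left)
  finally show ?thesis .
qed

lemma Parseval:
  assumes "orthonormal UNIV b" "f \<in> X"
    "(\<lambda>n. ip (\<lambda>p. f p - (\<Sum>j<n. ip f (b j) * b j p)) (\<lambda>p. f p - (\<Sum>j<n. ip f (b j) * b j p))) \<longlonglongrightarrow> 0"
  shows "(\<lambda>j. (ip f (b j))\<^sup>2) sums ip f f"
proof -
  have "(\<lambda>n. ip f f - (\<Sum>j<n. (ip f (b j))\<^sup>2)) \<longlonglongrightarrow> 0"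
    using assms(3) orthonormal_residual[OF assms(1) _ _ assms(2), of "{..<n}" "\<lambda>j. ip f (b j)" for n] by simp
  from tendsto_diff[OF tendsto_const[of "ip f f"] this] show ?thesis by (simp add: sums_def)
qed

lemma sub: assumes "(\<lambda>_. 0) \<in> Y" "\<And>u v c d. u \<in> Y \<Longrightarrow> v \<in> Y \<Longrightarrow> (\<lambda>p. c * u p + d * v p) \<in> Y" "Y \<subseteq> X"
  shows "semi_inner Y ip"
proof
  show "(\<lambda>_. 0) \<in> Y" by (rule assms(1))
  fix u v w :: "'p \<Rightarrow> real" and c d :: real
  assume u: "u \<in> Y"
  then have uX: "u \<in> X" using assms(3) by blast
  show "0 \<le> ip u u" by (rule pos[OF uX])
  assume v: "v \<in> Y"
  then have vX: "v \<in> X" using assms(3) by blast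
  show "(\<lambda>p. c * u p + d * v p) \<in> Y" by (rule assms(2)[OF u v])
  show "ip u v = ip v u" by (rule sym[OF uX vX])
  assume "w \<in> Y"
  then have "w \<in> X" using assms(3) by blast
  then show "ip (\<lambda>p. c * u p + d * v p) w = c * ip u w + d * ip v w" by (rule lincomb_left[OF uX vX])
qed

end

interpretation pointwise: vector_space "\<lambda>(c::real) (u :: 'p \<Rightarrow> real) p. c * u p"
  by (rule vector_space_point_functions)

lemma sum_fun_apply: "(\<Sum>i\<in>I. f i) p = (\<Sum>i\<in>I. f i p)" for f :: "'i \<Rightarrow> 'p \<Rightarrow> real"
  by (induction I rule: infinite_finite_induct) auto

text \<open>For a short step the linear term outweighs the quadratic one; adding 1 to
  \<open>b\<close> covers the case \<open>b = 0\<close>.\<close>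

lemma quadratic_descent:
  assumes "0 \<le> b" "a \<noteq> (0::real)" shows "2 * (- a / (b + 1)) * a + (- a / (b + 1))\<^sup>2 * b < 0"
proof -
  define d where "d = b + 1"
  have d: "0 < d" "b = d - 1" using assms by (auto simp: d_def)
  have "2 * (- a / d) * a + (- a / d)\<^sup>2 * (d - 1) = - (a\<^sup>2 / d + a\<^sup>2 / d\<^sup>2)"
    using d(1) by (simp add: field_simps power2_eq_square)
  also have "\<dots> < 0"
  proof -
    have "0 < a\<^sup>2 / d" "0 < a\<^sup>2 / d\<^sup>2" using assms d(1) by simp_all
    then show ?thesis by linarith
  qed
  finally show ?thesis unfolding d(2) by simp
qed

text \<open>Coefficient vectors are stored as sequences that vanish from \<open>N\<close> on, so
  Tychonoff's theorem supplies the compactness for minimizing over a finite-dimensional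
  sphere.\<close>

lemma compact_cube: "compact {c :: nat \<Rightarrow> real. \<forall>k. \<bar>c k\<bar> \<le> (if k < N then 1 else 0)}"
proof -
  have "compactin (product_topology (\<lambda>_. euclidean) UNIV) (PiE UNIV (\<lambda>k::nat. if k < N then {-1..1} else {0::real}))"
    by (subst compactin_PiE) (auto simp: compactin_euclidean_iff)
  then have "compact (PiE UNIV (\<lambda>k::nat. if k < N then {-1..1} else {0::real}))"
    unfolding euclidean_product_topology compactin_euclidean_iff .
  moreover have "PiE UNIV (\<lambda>k::nat. if k < N then {-1..1} else {0::real}) = {c. \<forall>k. \<bar>c k\<bar> \<le> (if k < N then 1 else 0)}"
  proof -
    have "(c k \<in> (if k < N then {-1..1} else {0})) = (\<bar>c k\<bar> \<le> (if k < N then 1 else 0))" for c :: "nat \<Rightarrow> real" and k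
      by (auto simp: abs_le_iff)
    then show ?thesis by (simp only: PiE_UNIV_domain Pi_def) simp
  qed
  ultimately show ?thesis by simp
qed

locale form_pair = L: semi_inner X ip + B: semi_inner V B
  for X V :: "('p \<Rightarrow> real) set" and ip B +
  assumes VX: "V \<subseteq> X"
    and definite: "v \<in> V \<Longrightarrow> ip v v = 0 \<Longrightarrow> v = (\<lambda>_. 0)"
    and fin: "\<exists>S. finite S \<and> V \<subseteq> pointwise.span S"
begin

lemma subspace: "pointwise.subspace V"
  unfolding pointwise.subspace_def
proof (intro conjI ballI allI)
  show "0 \<in> V" using B.zero by (simp add: zero_fun_def)
  show "x + y \<in> V" if "x \<in> V" "y \<in> V" for x y using B.lincomb[OF that, of 1 1] by (simp add: plus_fun_def)
  show "(\<lambda>p. c * x p) \<in> V" if "x \<in> V" for c x using B.lincomb[OF that that, of c 0] by simp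
qed

lemma basis:
  obtains bs where "\<And>k. k < pointwise.dim V \<Longrightarrow> bs k \<in> V" "inj_on bs {..<pointwise.dim V}"
    "pointwise.independent (bs ` {..<pointwise.dim V})" "V = pointwise.span (bs ` {..<pointwise.dim V})"
proof -
  obtain S where S: "finite S" "V \<subseteq> pointwise.span S" using fin by blast
  obtain Bs where Bs: "Bs \<subseteq> V" "pointwise.independent Bs" "V \<subseteq> pointwise.span Bs" "card Bs = pointwise.dim V"
    using pointwise.basis_exists[of V] by blast
  have "finite Bs"
    using pointwise.independent_span_bound[OF S(1) Bs(2)] Bs(1) S(2) by blast
  then obtain f where f: "bij_betw f {..<pointwise.dim V} Bs"
    using ex_bij_betw_nat_finite[of Bs] Bs(4) by (auto simp: atLeast0LessThan)
  then have im: "f ` {..<pointwise.dim V} = Bs" by (simp add: bij_betw_def)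
  show thesis
  proof (rule that[of f])
    show "V = pointwise.span (f ` {..<pointwise.dim V})"
      unfolding im using Bs pointwise.span_minimal[OF Bs(1) subspace] by blast
  qed (use f im Bs in \<open>auto simp: bij_betw_def\<close>)
qed

definition eigenfamily :: "nat \<Rightarrow> (nat \<Rightarrow> 'p \<Rightarrow> real) \<Rightarrow> (nat \<Rightarrow> real) \<Rightarrow> bool" where
  "eigenfamily m e \<theta> \<longleftrightarrow> (\<forall>i<m. e i \<in> V) \<and> L.orthonormal {..<m} e \<and> (\<forall>i<m. \<forall>v\<in>V. B (e i) v = \<theta> i * ip (e i) v)"

text \<open>The next eigenvector minimizes the Rayleigh quotient on the orthogonal complement of the previous ones.\<close>

lemma eigenfamily_extend:
  assumes e: "eigenfamily m e \<theta>" and m: "m < pointwise.dim V"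
  shows "\<exists>e' \<theta>'. eigenfamily (Suc m) e' \<theta>'"
proof -
  let ?N = "pointwise.dim V"
  obtain bs where bs: "\<And>k. k < ?N \<Longrightarrow> bs k \<in> V" "inj_on bs {..<?N}"
    "pointwise.independent (bs ` {..<?N})" "V = pointwise.span (bs ` {..<?N})"
    using basis by blast
  have eV: "\<And>i. i < m \<Longrightarrow> e i \<in> V" and eo: "L.orthonormal {..<m} e"
    and eB: "\<And>i v. i < m \<Longrightarrow> v \<in> V \<Longrightarrow> B (e i) v = \<theta> i * ip (e i) v"
    using e by (auto simp: eigenfamily_def)
  define u where "u c p = (\<Sum>k<?N. c k * bs k p)" for c p
  have uV: "u c \<in> V" for c unfolding u_def[abs_def] by (intro B.sum_mem bs) auto
  have usurj: "\<exists>c. v = u c" if "v \<in> V" for v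
  proof -
    have "v \<in> range (\<lambda>c. \<Sum>b\<in>bs ` {..<?N}. (\<lambda>p. c b * b p))"
      using that pointwise.span_finite[of "bs ` {..<?N}"] bs(4) by auto
    then obtain c where "v = (\<Sum>b\<in>bs ` {..<?N}. (\<lambda>p. c b * b p))" by auto
    then have "v = u (\<lambda>k. c (bs k))" by (auto simp: u_def fun_eq_iff sum_fun_apply sum.reindex[OF bs(2)])
    then show ?thesis by blast
  qed
  have u_nonzero: "c k = 0" if "u c = (\<lambda>_. 0)" "k < ?N" for c k
  proof -
    have "(\<Sum>b\<in>bs ` {..<?N}. (\<lambda>p. c (the_inv_into {..<?N} bs b) * b p)) = 0"
      using that(1) by (auto simp: u_def fun_eq_iff sum_fun_apply sum.reindex[OF bs(2)] the_inv_into_f_f[OF bs(2)])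
    then have "c (the_inv_into {..<?N} bs (bs k)) = 0"
      using pointwise.independentD[OF bs(3), of "bs ` {..<?N}" "\<lambda>b. c (the_inv_into {..<?N} bs b)" "bs k"] that(2) by auto
    then show ?thesis using the_inv_into_f_f[OF bs(2)] that(2) by simp
  qed
  have VX': "v \<in> V \<Longrightarrow> v \<in> X" for v using VX by blast
  have quad: "H (u c) (u c) = (\<Sum>k<?N. c k * (\<Sum>k'<?N. c k' * H (bs k) (bs k')))" if "semi_inner V H" for H c
  proof -
    interpret H: semi_inner V H by fact
    have "H (u c) (u c) = (\<Sum>k<?N. c k * H (bs k) (u c))"
      using H.sum_left[OF _ bs(1) uV[of c], of "{..<?N}" "\<lambda>k. k" c] by (simp add: u_def[abs_def])
    also have "\<dots> = (\<Sum>k<?N. c k * (\<Sum>k'<?N. c k' * H (bs k) (bs k')))"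
      using H.sum_right[OF _ bs(1) bs(1), of "{..<?N}" "\<lambda>k. k" _ c] by (simp add: u_def[abs_def])
    finally show ?thesis .
  qed
  have Lsub: "semi_inner V ip" by (rule L.sub[OF B.zero B.lincomb VX])
  have contq: "continuous_on UNIV (\<lambda>c. H (u c) (u c))" if "semi_inner V H" for H
    unfolding quad[OF that] by (intro continuous_intros continuous_on_product_coordinates)
  have lin: "ip (u c) (e i) = (\<Sum>k<?N. c k * ip (bs k) (e i))" if "i < m" for c i
    unfolding u_def[abs_def] by (intro L.sum_left VX' bs eV that) auto
  \<comment> \<open>The sphere is taken in the coefficients, where compactness is at hand. The
    minimized quantity is therefore the quotient of \<open>B\<close> and \<open>ip\<close>, which is
    invariant under scaling.\<close>
  define Z where "Z = {c :: nat \<Rightarrow> real. \<forall>k. \<bar>c k\<bar> \<le> (if k < ?N then 1 else 0)}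
      \<inter> ({c. (\<Sum>k<?N. (c k)\<^sup>2) = 1} \<inter> {c. \<forall>i<m. (\<Sum>k<?N. c k * ip (bs k) (e i)) = 0})"
  have cZ: "compact Z"
    unfolding Z_def
  proof (rule compact_Int_closed[OF compact_cube closed_Int])
    show "closed {c :: nat \<Rightarrow> real. (\<Sum>k<?N. (c k)\<^sup>2) = 1}"
      by (intro closed_Collect_eq continuous_intros continuous_on_product_coordinates)
    have "{c :: nat \<Rightarrow> real. \<forall>i<m. (\<Sum>k<?N. c k * ip (bs k) (e i)) = 0} = (\<Inter>i\<in>{..<m}. {c. (\<Sum>k<?N. c k * ip (bs k) (e i)) = 0})"
      by auto
    also have "closed \<dots>"
      by (intro closed_INT ballI closed_Collect_eq continuous_intros continuous_on_product_coordinates)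
    finally show "closed {c :: nat \<Rightarrow> real. \<forall>i<m. (\<Sum>k<?N. c k * ip (bs k) (e i)) = 0}" .
  qed
  have scale: "\<exists>c\<in>Z. \<exists>r>0. u c = (\<lambda>p. r * v p)" if v: "v \<in> V" "v \<noteq> (\<lambda>_. 0)" "\<And>i. i < m \<Longrightarrow> ip v (e i) = 0" for v
  proof -
    obtain c where c: "v = u c" using usurj[OF v(1)] by blast
    have "\<exists>k<?N. c k \<noteq> 0" using v(2) unfolding c u_def[abs_def] by (metis (no_types, lifting) lessThan_iff mult_zero_left sum.neutral)
    then have s: "0 < (\<Sum>k<?N. (c k)\<^sup>2)" by (metis (no_types, lifting) finite_lessThan lessThan_iff sum_pos2 zero_le_power2 zero_less_power2)
    define r where "r = 1 / sqrt (\<Sum>k<?N. (c k)\<^sup>2)"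
    have r: "0 < r" "r\<^sup>2 * (\<Sum>k<?N. (c k)\<^sup>2) = 1" using s by (auto simp: r_def power_divide)
    define c' where "c' k = (if k < ?N then r * c k else 0)" for k
    have u': "u c' = (\<lambda>p. r * v p)" by (auto simp: c u_def c'_def fun_eq_iff sum_distrib_left mult.assoc)
    have n1: "(\<Sum>k<?N. (c' k)\<^sup>2) = 1" using r(2) by (simp add: c'_def power_mult_distrib sum_distrib_left)
    have "\<bar>c' k\<bar> \<le> 1" if "k < ?N" for k
    proof -
      have "(c' k)\<^sup>2 \<le> (\<Sum>k<?N. (c' k)\<^sup>2)" using that by (intro member_le_sum) auto
      then show ?thesis using n1 by (simp add: abs_square_le_1)
    qed
    moreover have "(\<Sum>k<?N. c' k * ip (bs k) (e i)) = 0" if "i < m" for i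
    proof -
      have "(\<Sum>k<?N. c' k * ip (bs k) (e i)) = ip (u c') (e i)" using lin[OF that] by simp
      also have "\<dots> = r * ip v (e i)" unfolding u' using L.lincomb_left[of v v "e i" r 0] v(1) VX' eV that by simp
      finally show ?thesis using v(3)[OF that] by simp
    qed
    ultimately have "c' \<in> Z" unfolding Z_def using n1 by (auto simp: c'_def)
    then show ?thesis using u' r(1) by blast
  qed
  have orth: "ip (\<lambda>p. v p - (\<Sum>i<m. ip v (e i) * e i p)) (e j) = 0" "(\<lambda>p. v p - (\<Sum>i<m. ip v (e i) * e i p)) \<in> V"
    if "v \<in> V" "j < m" for v j
  proof -
    show "ip (\<lambda>p. v p - (\<Sum>i<m. ip v (e i) * e i p)) (e j) = 0"
      using L.diff_left[OF VX'[OF that(1)] L.orthonormal_sum(1)[OF eo] VX'[OF eV[OF that(2)]], of "{..<m}" "\<lambda>i. ip v (e i)"]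
        L.orthonormal_sum(2)[OF eo, of "{..<m}" j] that(2) by simp
  qed (intro B.diff B.sum_mem that eV, auto)
  have projV: "(\<lambda>p. v p - (\<Sum>i<m. ip v (e i) * e i p)) \<in> V" if "v \<in> V" for v
    by (intro B.diff B.sum_mem that eV) auto
  \<comment> \<open>By dimension some vector lies outside the span of the previous eigenvectors; its
    component orthogonal to them shows that \<open>Z\<close> is nonempty.\<close>
  obtain v0 where v0: "v0 \<in> V" "v0 \<notin> pointwise.span (e ` {..<m})"
  proof -
    have "\<not> V \<subseteq> pointwise.span (e ` {..<m})"
    proof
      assume "V \<subseteq> pointwise.span (e ` {..<m})"
      then have "?N \<le> card (e ` {..<m})" by (rule pointwise.dim_le_card) simp
      also have "\<dots> \<le> m" using card_image_le[of "{..<m}" e] by simp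
      finally show False using m by simp
    qed
    then show ?thesis using that by blast
  qed
  have "Z \<noteq> {}"
  proof -
    let ?w = "\<lambda>p. v0 p - (\<Sum>i<m. ip v0 (e i) * e i p)"
    have "?w \<noteq> (\<lambda>_. 0)"
    proof
      assume "?w = (\<lambda>_. 0)"
      then have "v0 = (\<Sum>i<m. (\<lambda>p. ip v0 (e i) * e i p))" by (auto simp: fun_eq_iff sum_fun_apply)
      also have "\<dots> \<in> pointwise.span (e ` {..<m})"
        by (intro pointwise.span_sum pointwise.span_scale pointwise.span_base) auto
      finally show False using v0(2) by simp
    qed
    then show ?thesis using scale[OF projV[OF v0(1)]] orth(1)[OF v0(1)] by blast
  qed
  moreover have "continuous_on Z (\<lambda>c. B (u c) (u c) / ip (u c) (u c))"
  proof (intro continuous_on_divide continuous_on_subset[OF contq[OF Lsub]] continuous_on_subset[OF contq[OF B.semi_inner_axioms]] ballI)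
    fix c assume "c \<in> Z"
    then have "(\<Sum>k<?N. (c k)\<^sup>2) = 1" by (simp add: Z_def)
    then have "\<exists>k<?N. c k \<noteq> 0" by (metis (no_types, lifting) lessThan_iff power_zero_numeral sum.neutral zero_neq_one)
    then show "ip (u c) (u c) \<noteq> 0" using definite[OF uV] u_nonzero by blast
  qed auto
  ultimately obtain c0 where c0: "c0 \<in> Z" "\<And>c. c \<in> Z \<Longrightarrow> B (u c0) (u c0) / ip (u c0) (u c0) \<le> B (u c) (u c) / ip (u c) (u c)"
    using continuous_attains_inf[OF cZ] by blast
  define t where "t = B (u c0) (u c0) / ip (u c0) (u c0)"
  have nz: "u c0 \<noteq> (\<lambda>_. 0)"
  proof
    assume "u c0 = (\<lambda>_. 0)"
    from u_nonzero[OF this] have "(\<Sum>k<?N. (c0 k)\<^sup>2) = 0" by simp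
    then show False using c0(1) by (simp add: Z_def)
  qed
  have ippos: "0 < ip v v" if "v \<in> V" "v \<noteq> (\<lambda>_. 0)" for v
    using definite that L.pos[OF VX'[OF that(1)]] by fastforce
  have u0e: "ip (u c0) (e i) = 0" if "i < m" for i using c0(1) lin[OF that] that by (simp add: Z_def)
  have Rayleigh: "t * ip v v \<le> B v v" if v: "v \<in> V" "\<And>i. i < m \<Longrightarrow> ip v (e i) = 0" for v
  proof (cases "v = (\<lambda>_. 0)")
    case True
    then show ?thesis using L.zero_left[OF L.zero] B.zero_left[OF B.zero] by simp
  next
    case False
    then obtain c r where c: "c \<in> Z" "0 < r" "u c = (\<lambda>p. r * v p)" using scale[OF v(1) _ v(2)] by blast
    have "H (u c) (u c) = r\<^sup>2 * H v v" if "semi_inner V H" for H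
      using semi_inner.lincomb_self[OF that v(1) v(1), of r 0] by (simp add: c(3))
    then have "t \<le> (r\<^sup>2 * B v v) / (r\<^sup>2 * ip v v)" using c0(2)[OF c(1)] Lsub B.semi_inner_axioms by (simp add: t_def)
    also have "\<dots> = B v v / ip v v" using c(2) by simp
    finally show ?thesis using ippos[OF v(1) False] by (simp add: field_simps)
  qed
  have t0: "B (u c0) (u c0) = t * ip (u c0) (u c0)" using ippos[OF uV nz] by (simp add: t_def)
  \<comment> \<open>First variation: all \<open>u c0 + r v\<close> satisfy the constraints, so a
    quadratic polynomial in \<open>r\<close> without constant term is nonnegative, and its linear
    coefficient has to vanish.\<close>
  have crit: "B (u c0) v = t * ip (u c0) v" if v: "v \<in> V" "\<And>i. i < m \<Longrightarrow> ip v (e i) = 0" for v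
  proof -
    let ?a = "B (u c0) v - t * ip (u c0) v" and ?b = "B v v - t * ip v v"
    have q: "0 \<le> 2 * r * ?a + r\<^sup>2 * ?b" for r
    proof -
      have "t * ip (\<lambda>p. 1 * u c0 p + r * v p) (\<lambda>p. 1 * u c0 p + r * v p) \<le> B (\<lambda>p. 1 * u c0 p + r * v p) (\<lambda>p. 1 * u c0 p + r * v p)"
      proof (rule Rayleigh)
        show "(\<lambda>p. 1 * u c0 p + r * v p) \<in> V" by (rule B.lincomb[OF uV v(1)])
        show "ip (\<lambda>p. 1 * u c0 p + r * v p) (e i) = 0" if "i < m" for i
          using L.lincomb_left[OF VX'[OF uV] VX'[OF v(1)] VX'[OF eV[OF that]], of 1 c0 r] u0e[OF that] v(2)[OF that] by simp
      qed
      then show ?thesis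
        unfolding L.lincomb_self[OF VX'[OF uV] VX'[OF v(1)]] B.lincomb_self[OF uV v(1)]
        using t0 by (simp add: algebra_simps)
    qed
    have b0: "0 \<le> ?b" using Rayleigh[OF v] by simp
    have "?a = 0"
    proof (rule ccontr)
      assume a: "?a \<noteq> 0"
      have "2 * (- ?a / (?b + 1)) * ?a + (- ?a / (?b + 1))\<^sup>2 * ?b < 0"
        by (rule quadratic_descent[OF b0 a])
      then show False using q[of "- ?a / (?b + 1)"] by simp
    qed
    then show ?thesis by simp
  qed
  define r where "r = 1 / sqrt (ip (u c0) (u c0))"
  have r: "0 < r" "r\<^sup>2 * ip (u c0) (u c0) = 1" using ippos[OF uV nz] by (auto simp: r_def power_divide)
  define e' where "e' i = (if i = m then (\<lambda>p. r * u c0 p) else e i)" for i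
  define \<theta>' where "\<theta>' i = (if i = m then t else \<theta> i)" for i
  have e'V: "(\<lambda>p. r * u c0 p) \<in> V" using B.lincomb[OF uV uV, of r _ 0] by simp
  have ipm: "ip (\<lambda>p. r * u c0 p) v = r * ip (u c0) v" if "v \<in> V" for v
    using L.lincomb_left[OF VX'[OF uV] VX'[OF uV] VX'[OF that], of r _ 0] by simp
  have Bm: "B (\<lambda>p. r * u c0 p) v = r * B (u c0) v" if "v \<in> V" for v
    using B.lincomb_left[OF uV uV that, of r _ 0] by simp
  have "eigenfamily (Suc m) e' \<theta>'"
    unfolding eigenfamily_def
  proof (intro conjI allI impI ballI)
    show V': "e' i \<in> V" if "i < Suc m" for i using that e'V eV by (auto simp: e'_def)
    have mm: "ip (e' m) (e' m) = 1"
      using L.lincomb_self[OF VX'[OF uV] VX'[OF uV], of r _ 0] r(2) by (simp add: e'_def)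
    have me: "ip (e' m) (e' j) = 0" "ip (e' j) (e' m) = 0" if "j < m" for j
    proof -
      show "ip (e' m) (e' j) = 0" using that u0e ipm[OF eV[OF that]] by (simp add: e'_def)
      then show "ip (e' j) (e' m) = 0" using L.sym[OF VX'[OF V'] VX'[OF V'], of j m] that by simp
    qed
    show "L.orthonormal {..<Suc m} e'"
      unfolding L.orthonormal_def
    proof (intro conjI ballI)
      fix i j assume "i \<in> {..<Suc m}" "j \<in> {..<Suc m}"
      then consider "i = m" "j = m" | "i = m" "j < m" | "i < m" "j = m" | "i < m" "j < m" by fastforce
      then show "ip (e' i) (e' j) = (if i = j then 1 else 0)"
        using mm me eo by cases (auto simp: L.orthonormal_def e'_def)
    qed (use V' VX in auto)
    fix i v assume i: "i < Suc m" and v: "v \<in> V"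
    show "B (e' i) v = \<theta>' i * ip (e' i) v"
    proof (cases "i = m")
      case True
      \<comment> \<open>A general \<open>v\<close> is reduced to an admissible one by splitting off
        its part \<open>?P\<close> along the previous eigenvectors, to which the minimizer is
        orthogonal in both forms.\<close>
      let ?P = "\<lambda>p. \<Sum>i<m. ip v (e i) * e i p"
      have P: "?P \<in> V" by (intro B.sum_mem eV) auto
      have "B (u c0) ?P = (\<Sum>i<m. ip v (e i) * B (u c0) (e i))" by (intro B.sum_right eV uV) auto
      also have "\<dots> = 0"
        using eB[OF _ uV] B.sym[OF uV eV] L.sym[OF VX'[OF uV] VX'[OF eV]] u0e by (intro sum.neutral) auto
      finally have B0: "B (u c0) ?P = 0" .
      have "ip (u c0) ?P = (\<Sum>i<m. ip v (e i) * ip (u c0) (e i))" by (intro L.sum_right VX' eV uV) auto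
      then have i0: "ip (u c0) ?P = 0" using u0e by simp
      have "B (u c0) (\<lambda>p. v p - ?P p) = t * ip (u c0) (\<lambda>p. v p - ?P p)"
        using orth(1)[OF v] by (intro crit projV v) auto
      then have "B (u c0) v = t * ip (u c0) v"
        using B.diff_right[OF v P uV] L.diff_right[OF VX'[OF v] VX'[OF P] VX'[OF uV]] B0 i0 by simp
      then show ?thesis using True ipm[OF v] Bm[OF v] by (simp add: e'_def \<theta>'_def)
    next
      case False
      then show ?thesis using i eB v by (simp add: e'_def \<theta>'_def)
    qed
  qed
  then show ?thesis by blast
qed

lemma eigenbasis_exists:
  obtains e \<theta> where "\<And>i. i < pointwise.dim V \<Longrightarrow> e i \<in> V" "L.orthonormal {..<pointwise.dim V} e"
    "\<And>i v. i < pointwise.dim V \<Longrightarrow> v \<in> V \<Longrightarrow> B (e i) v = \<theta> i * ip (e i) v"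
    "\<And>v. v \<in> V \<Longrightarrow> v = (\<lambda>p. \<Sum>i<pointwise.dim V. ip v (e i) * e i p)"
proof -
  let ?N = "pointwise.dim V"
  have "\<exists>e \<theta>. eigenfamily m e \<theta>" if "m \<le> ?N" for m
    using that
  proof (induction m)
    case 0
    show ?case by (auto simp: eigenfamily_def L.orthonormal_def)
  next
    case (Suc m)
    then show ?case using eigenfamily_extend by (meson Suc_le_eq less_imp_le)
  qed
  then obtain e \<theta> where e: "eigenfamily ?N e \<theta>" by blast
  have eV: "\<And>i. i < ?N \<Longrightarrow> e i \<in> V" and eo: "L.orthonormal {..<?N} e" using e by (auto simp: eigenfamily_def)
  have expand: "v = (\<lambda>p. \<Sum>i<?N. ip v (e i) * e i p)" if v: "v \<in> V" for v
  proof (rule ccontr)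
    assume ne: "v \<noteq> (\<lambda>p. \<Sum>i<?N. ip v (e i) * e i p)"
    let ?w = "\<lambda>p. v p - (\<Sum>i<?N. ip v (e i) * e i p)"
    have w: "?w \<in> V" by (intro B.diff B.sum_mem v eV) auto
    have wn: "?w \<noteq> (\<lambda>_. 0)" using ne by (auto simp: fun_eq_iff)
    have wo: "ip ?w (e j) = 0" if "j < ?N" for j
      using L.diff_left[OF _ L.orthonormal_sum(1)[OF eo], of v "{..<?N}" "e j" "\<lambda>i. ip v (e i)"]
        L.orthonormal_sum(2)[OF eo, of "{..<?N}" j] that v VX eV by auto
    have wp: "0 < ip ?w ?w" using definite[OF w] wn L.pos[of ?w] w VX by fastforce
    \<comment> \<open>The nonzero residual \<open>?w\<close> is appended to the family as its member
      with index \<open>?N\<close>; more orthogonal nonzero vectors than the dimension allows would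
      result.\<close>
    define f where "f i = (if i = ?N then ?w else e i)" for i
    have fz: "(\<And>i. i \<le> ?N \<Longrightarrow> c i = 0)" if z: "(\<Sum>i\<le>?N. (\<lambda>p. c i * f i p)) = 0" for c :: "nat \<Rightarrow> real"
    proof -
      fix i assume i: "i \<le> ?N"
      have fV: "f j \<in> V" if "j \<le> ?N" for j using that w eV by (auto simp: f_def)
      have fo: "ip (f j) (f i) = (if j = i then ip (f i) (f i) else 0)" if "j \<le> ?N" for j
      proof -
        have "ip (e j) (e i) = (if j = i then ip (e i) (e i) else 0)" if "j < ?N" "i < ?N"
          using that eo by (auto simp: L.orthonormal_def)
        moreover have "ip (e j) ?w = 0" if "j < ?N" using wo[OF that] L.sym[of ?w "e j"] w eV[OF that] VX by auto
        ultimately show ?thesis using wo i \<open>j \<le> ?N\<close> unfolding f_def by auto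
      qed
      have "(\<lambda>p. \<Sum>j\<le>?N. c j * f j p) = (\<lambda>_. 0)" using z by (auto simp: fun_eq_iff sum_fun_apply)
      then have "0 = ip (\<lambda>p. \<Sum>j\<le>?N. c j * f j p) (f i)" using L.zero_left[OF subsetD[OF VX fV[OF i]]] by (simp only:)
      also have "\<dots> = (\<Sum>j\<le>?N. c j * ip (f j) (f i))" proof (rule L.sum_left)
        show "f j \<in> X" if "j \<in> {..?N}" for j using subsetD[OF VX fV] that by simp
        show "f i \<in> X" by (rule subsetD[OF VX fV[OF i]])
      qed simp
      also have "\<dots> = (\<Sum>j\<le>?N. if j = i then c i * ip (f i) (f i) else 0)" by (intro sum.cong refl, subst fo, simp, simp)
      also have "\<dots> = c i * ip (f i) (f i)" using i by simp
      finally show "c i = 0" using wp eo i by (auto simp: f_def L.orthonormal_def split: if_splits)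
    qed
    have inj: "inj_on f {..?N}"
    proof (rule inj_onI, rule ccontr)
      fix i j assume ij: "i \<in> {..?N}" "j \<in> {..?N}" "f i = f j" "i \<noteq> j"
      have "(\<Sum>k\<le>?N. (\<lambda>p. (if k = i then 1 else if k = j then -1 else 0) * f k p)) = 0"
      proof -
        have "(\<Sum>k\<le>?N. (if k = i then 1 else if k = j then -1 else 0) * f k p) = (\<Sum>k\<in>{i, j}. (if k = i then 1 else if k = j then -1 else 0) * f k p)" for p
          using ij by (intro sum.mono_neutral_right) auto
        then show ?thesis using ij by (auto simp: fun_eq_iff sum_fun_apply)
      qed
      from fz[OF this, of i] ij show False by simp
    qed
    have "pointwise.independent (f ` {..?N})"
    proof (subst pointwise.independent_if_scalars_zero)
      show "g b = 0" if "(\<Sum>x\<in>f ` {..?N}. (\<lambda>p. g x * x p)) = 0" "b \<in> f ` {..?N}" for g b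
      proof -
        have "(\<Sum>i\<le>?N. (\<lambda>p. g (f i) * f i p)) = 0" using that(1) by (simp add: sum.reindex[OF inj])
        from fz[OF this] that(2) show ?thesis by auto
      qed
    qed auto
    moreover have "f ` {..?N} \<subseteq> V" using w eV by (auto simp: f_def)
    moreover obtain Bs where "Bs \<subseteq> V" "pointwise.independent Bs" "V \<subseteq> pointwise.span Bs" "card Bs = ?N" "finite Bs"
    proof -
      obtain bs where bs: "\<And>k. k < ?N \<Longrightarrow> bs k \<in> V" "inj_on bs {..<?N}"
        "pointwise.independent (bs ` {..<?N})" "V = pointwise.span (bs ` {..<?N})" using basis by blast
      then show ?thesis by (intro that[of "bs ` {..<?N}"]) (auto simp: card_image)
    qed
    ultimately have "card (f ` {..?N}) \<le> ?N"
      using pointwise.independent_span_bound[of Bs "f ` {..?N}"] by auto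
    then show False using inj by (simp add: card_image)
  qed
  show thesis
    using that[of e \<theta>] e eV eo expand by (auto simp: eigenfamily_def)
qed

end

section \<open>The abstract Hilbert--Schmidt error\<close>

lemma self_le_powr:
  fixes u \<beta> :: real
  assumes "0 \<le> u" "u \<le> 1" "\<beta> \<le> 1" shows "u \<le> u powr \<beta>"
proof -
  have "u = u powr 1" using assms(1) by (rule powr_one[symmetric])
  also have "u powr 1 \<le> u powr \<beta>" using assms by (intro powr_mono') auto
  finally show ?thesis .
qed

text \<open>On the unit interval \<open>t \<le> t powr \<beta>\<close>; this is applied to the
  shares of \<open>x\<close> and \<open>y\<close> in \<open>x + y\<close>, which add up to
  1.\<close>

lemma powr_add_le:
  fixes x y \<beta> :: real
  assumes "0 \<le> x" "0 \<le> y" "0 < \<beta>" "\<beta> \<le> 1"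
  shows "(x + y) powr \<beta> \<le> x powr \<beta> + y powr \<beta>"
proof (cases "x + y = 0")
  case False
  then have s: "0 < x + y" using assms by simp
  have *: "t / (x + y) \<le> (t / (x + y)) powr \<beta>" if "0 \<le> t" "t \<le> x + y" for t
    by (rule self_le_powr) (use that s assms in auto)
  have "1 = x / (x + y) + y / (x + y)" using s unfolding add_divide_distrib[symmetric] by simp
  also have "\<dots> \<le> (x / (x + y)) powr \<beta> + (y / (x + y)) powr \<beta>" using assms by (intro add_mono *) auto
  also have "\<dots> = (x powr \<beta> + y powr \<beta>) / (x + y) powr \<beta>"
    using assms s by (simp add: powr_divide add_divide_distrib)
  finally show ?thesis using s by (simp add: field_simps)
qed (use assms in simp)

lemma powr_diff_le:
  fixes x y \<beta> :: real
  assumes "0 \<le> x" "0 \<le> y" "0 < \<beta>" "\<beta> \<le> 1"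
  shows "\<bar>x powr \<beta> - y powr \<beta>\<bar> \<le> \<bar>x - y\<bar> powr \<beta>"
proof -
  have *: "\<bar>x powr \<beta> - y powr \<beta>\<bar> \<le> \<bar>x - y\<bar> powr \<beta>" if "0 \<le> y" "y \<le> x" for x y :: real
    using powr_add_le[of y "x - y" \<beta>] powr_mono2[of \<beta> y x] that assms(3,4) by simp
  show ?thesis using *[of y x] *[of x y] assms(1,2) by (cases "y \<le> x") (auto simp: abs_minus_commute)
qed

text \<open>A linear bound for a concave power at the scale \<open>D\<close>. Taken at the square of
  the Galerkin constant, it reduces sums of powers to the sums for exponent 1.\<close>

lemma powr_tangent_bound:
  fixes x D \<beta> :: real
  assumes "0 \<le> x" "0 < D" "0 < \<beta>" "\<beta> \<le> 1"
  shows "x powr \<beta> \<le> D powr \<beta> * (1 + x / D)"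
proof -
  have "x powr \<beta> = D powr \<beta> * (x / D) powr \<beta>" using assms by (simp add: powr_divide)
  also have "(x / D) powr \<beta> \<le> (1 + x / D) powr \<beta>" using assms by (intro powr_mono2) auto
  also have "\<dots> \<le> (1 + x / D) powr 1" using assms by (intro powr_mono) auto
  finally show ?thesis using assms by (simp add: mult_left_mono)
qed

text \<open>\<open>Y\<close> carries the energy form, \<open>V\<close> is the discrete space, and
  \<open>\<kappa>\<close> stands for a multiple of \<open>h^2\<close>. The numbers
  \<open>lam j * c j\<close> in \<open>approx\<close> are the coefficients of the operator applied
  to the combination, so the bound is \<open>\<kappa>\<close> times the squared norm of that
  image.\<close>

locale galerkin = form_pair X V ip B + BY: semi_inner Y B
  for X V :: "('p \<Rightarrow> real) set" and ip B and Y :: "('p \<Rightarrow> real) set" +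
  fixes b :: "nat \<Rightarrow> 'p \<Rightarrow> real" and lam :: "nat \<Rightarrow> real" and \<kappa> \<delta> :: real
    and e :: "nat \<Rightarrow> 'p \<Rightarrow> real" and \<theta> :: "nat \<Rightarrow> real" and N :: nat
  assumes VY: "V \<subseteq> Y" and YX: "Y \<subseteq> X"
    and bY: "b j \<in> Y"
    and b_on: "L.orthonormal UNIV b"
    and b_complete: "f \<in> X \<Longrightarrow> (\<lambda>j. (ip f (b j))\<^sup>2) sums ip f f"
    and b_eigen: "w \<in> Y \<Longrightarrow> B w (b j) = lam j * ip w (b j)"
    and \<delta>: "0 < \<delta>" and coercive: "u \<in> Y \<Longrightarrow> \<delta> * ip u u \<le> B u u"
    and \<kappa>: "0 \<le> \<kappa>"
    and approx: "\<exists>w\<in>V. B (\<lambda>p. (\<Sum>j<n. c j * b j p) - w p) (\<lambda>p. (\<Sum>j<n. c j * b j p) - w p)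
       \<le> \<kappa> * (\<Sum>j<n. (lam j * c j)\<^sup>2)"
    and eV: "i < N \<Longrightarrow> e i \<in> V" and e_on: "L.orthonormal {..<N} e"
    and e_eigen: "i < N \<Longrightarrow> v \<in> V \<Longrightarrow> B (e i) v = \<theta> i * ip (e i) v"
    and e_span: "v \<in> V \<Longrightarrow> v = (\<lambda>p. \<Sum>i<N. ip v (e i) * e i p)"
begin

definition coef :: "nat \<Rightarrow> nat \<Rightarrow> real" where "coef j i = ip (b j) (e i)"

lemma eY: "i < N \<Longrightarrow> e i \<in> Y" and eX: "i < N \<Longrightarrow> e i \<in> X" and bX: "b j \<in> X"
  using eV VY YX bY by blast+

lemma coef_sym: "i < N \<Longrightarrow> ip (e i) (b j) = coef j i"
  unfolding coef_def by (rule L.sym[OF eX bX])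

lemma b_self: "ip (b j) (b j) = 1" using b_on by (simp add: L.orthonormal_def)

lemma e_self: "i < N \<Longrightarrow> ip (e i) (e i) = 1" using e_on by (simp add: L.orthonormal_def)

lemma lam_ge: "\<delta> \<le> lam j"
  using coercive[OF bY[of j]] b_eigen[OF bY[of j], of j] by (simp add: b_self)

lemma lam_pos: "0 < lam j" using lam_ge[of j] \<delta> by linarith

lemma \<theta>_ge: "i < N \<Longrightarrow> \<delta> \<le> \<theta> i"
  using coercive[OF eY, of i] e_eigen[OF _ eV, of i i] e_self[of i] by simp

lemma \<theta>_pos: "i < N \<Longrightarrow> 0 < \<theta> i" using \<theta>_ge[of i] \<delta> by linarith

lemma coef_sums: "i < N \<Longrightarrow> (\<lambda>j. (coef j i)\<^sup>2) sums 1"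
  using b_complete[OF eX, of i] by (simp add: coef_sym e_self)

lemma b_sum_mem: "(\<lambda>p. \<Sum>j<n. c j * b j p) \<in> Y"
  by (intro BY.sum_mem bY) auto

lemma B_sum_left: "w \<in> Y \<Longrightarrow> B w (\<lambda>p. \<Sum>j<n. c j * b j p) = (\<Sum>j<n. c j * (lam j * ip w (b j)))"
  by (subst BY.sum_right) (auto simp: bY b_eigen)

lemma ip_sum_b: "w \<in> X \<Longrightarrow> ip w (\<lambda>p. \<Sum>j<n. c j * b j p) = (\<Sum>j<n. c j * ip w (b j))"
  by (intro L.sum_right bX) auto

text \<open>Bessel's inequality in the energy product: for the partial sum \<open>?s\<close> of
  \<open>e i\<close>, the values \<open>B (e i) ?s\<close> and \<open>B ?s ?s\<close> coincide. The
  rows of \<open>coef\<close> will be absolutely summable because of it.\<close>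

lemma coef_energy:
  assumes "i < N" shows "(\<Sum>j<n. lam j * (coef j i)\<^sup>2) \<le> \<theta> i"
proof -
  let ?s = "\<lambda>p. \<Sum>j<n. coef j i * b j p"
  have s: "?s \<in> Y" by (rule b_sum_mem)
  have sb: "ip ?s (b j) = coef j i" if "j < n" for j
    using L.orthonormal_sum(2)[OF b_on, of "{..<n}" j "\<lambda>j. coef j i"] that by simp
  have "0 \<le> B (\<lambda>p. e i p - ?s p) (\<lambda>p. e i p - ?s p)" by (intro BY.pos BY.diff eY s assms)
  also have "\<dots> = B (e i) (e i) - 2 * B (e i) ?s + B ?s ?s" by (intro BY.diff_self eY s assms)
  also have "B (e i) (e i) = \<theta> i" using e_eigen[OF assms eV[OF assms]] e_self[OF assms] by simp
  also have "B (e i) ?s = (\<Sum>j<n. lam j * (coef j i)\<^sup>2)"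
    unfolding B_sum_left[OF eY[OF assms]] by (simp add: coef_sym[OF assms] power2_eq_square mult_ac)
  also have "B ?s ?s = (\<Sum>j<n. lam j * (coef j i)\<^sup>2)"
    unfolding B_sum_left[OF s] using sb by (simp add: power2_eq_square mult_ac)
  finally show ?thesis by simp
qed

text \<open>The \<open>B\<close>-orthogonal projection onto \<open>V\<close>; dividing by
  \<open>\<theta> i\<close>, the energy of \<open>e i\<close>, normalizes the basis.\<close>

definition ritz :: "('p \<Rightarrow> real) \<Rightarrow> 'p \<Rightarrow> real" where
  "ritz z p = (\<Sum>i<N. (B z (e i) / \<theta> i) * e i p)"

lemma ritz_mem: "ritz z \<in> V"
  unfolding ritz_def[abs_def] by (intro B.sum_mem eV) auto

lemma ritz_orth:
  assumes "z \<in> Y" "v \<in> V" shows "B (\<lambda>p. z p - ritz z p) v = 0"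
proof -
  have r: "ritz z \<in> Y" using ritz_mem VY by blast
  have "B (\<lambda>p. z p - ritz z p) (e i) = 0" if i: "i < N" for i
  proof -
    have "B (ritz z) (e i) = B (e i) (ritz z)" using BY.sym[OF r eY[OF i]] .
    also have "\<dots> = \<theta> i * ip (ritz z) (e i)"
      using e_eigen[OF i ritz_mem] L.sym[of "e i" "ritz z"] eX[OF i] r YX by auto
    also have "ip (ritz z) (e i) = B z (e i) / \<theta> i"
      using L.orthonormal_sum(2)[OF e_on, of "{..<N}" i "\<lambda>i. B z (e i) / \<theta> i"] i by (simp add: ritz_def[abs_def])
    finally show ?thesis using BY.diff_left[OF assms(1) r eY[OF i]] \<theta>_pos[OF i] by simp
  qed
  moreover have "B (\<lambda>p. z p - ritz z p) v = (\<Sum>i<N. ip v (e i) * B (\<lambda>p. z p - ritz z p) (e i))"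
    using BY.sum_right[of "{..<N}" e "\<lambda>p. z p - ritz z p" "\<lambda>i. ip v (e i)"] e_span[OF assms(2)] eY BY.diff[OF assms(1) r]
    by auto
  ultimately show ?thesis by simp
qed

lemma ritz_energy:
  assumes "z \<in> Y" "w \<in> V"
  shows "B (\<lambda>p. z p - ritz z p) (\<lambda>p. z p - ritz z p) \<le> B (\<lambda>p. z p - w p) (\<lambda>p. z p - w p)"
proof -
  let ?r = "\<lambda>p. z p - ritz z p" and ?d = "\<lambda>p. w p - ritz z p"
  have r: "?r \<in> Y" using BY.diff[OF assms(1)] ritz_mem VY by blast
  have d: "?d \<in> V" by (rule B.diff[OF assms(2) ritz_mem])
  have "B (\<lambda>p. ?r p - ?d p) (\<lambda>p. ?r p - ?d p) = B ?r ?r - 2 * B ?r ?d + B ?d ?d"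
    using BY.diff_self[OF r] d VY by blast
  moreover have "B ?r ?d = 0" by (rule ritz_orth[OF assms(1) d])
  moreover have "0 \<le> B ?d ?d" by (rule B.pos[OF d])
  ultimately show ?thesis by simp
qed

text \<open>The Aubin-Nitsche duality argument.\<close>

lemma ritz_L2:
  defines "z \<equiv> \<lambda>c n p. \<Sum>j<n. c j * b j p"
  shows "ip (\<lambda>p. z c n p - ritz (z c n) p) (\<lambda>p. z c n p - ritz (z c n) p) \<le> \<kappa>\<^sup>2 * (\<Sum>j<n. (lam j * c j)\<^sup>2)"
proof -
  have zY: "z c n \<in> Y" for c n unfolding z_def by (rule b_sum_mem)
  define err where "err c n p = z c n p - ritz (z c n) p" for c n p
  have eYY: "err c n \<in> Y" for c n
    unfolding err_def[abs_def] using BY.diff[OF zY] ritz_mem VY by blast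
  have en: "B (err c n) (err c n) \<le> \<kappa> * (\<Sum>j<n. (lam j * c j)\<^sup>2)" for c n
  proof -
    obtain w where "w \<in> V" "B (\<lambda>p. z c n p - w p) (\<lambda>p. z c n p - w p) \<le> \<kappa> * (\<Sum>j<n. (lam j * c j)\<^sup>2)"
      using approx[where n=n and c=c] unfolding z_def by blast
    then show ?thesis using ritz_energy[OF zY] unfolding err_def[abs_def] by (meson order_trans)
  qed
  define A where "A = (\<Sum>j<n. (lam j * c j)\<^sup>2)"
  have A: "0 \<le> A" by (simp add: A_def sum_nonneg)
  have part: "(\<Sum>j<m. (ip (err c n) (b j))\<^sup>2) \<le> \<kappa>\<^sup>2 * A" for m
  proof -
    define S where "S = (\<Sum>j<m. (ip (err c n) (b j))\<^sup>2)"
    \<comment> \<open>\<open>z g m\<close> solves the dual problem whose right-hand side is the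
      error cut off after \<open>m\<close> modes.\<close>
    define g where "g j = ip (err c n) (b j) / lam j" for j
    have S: "0 \<le> S" by (simp add: S_def sum_nonneg)
    have "S = (\<Sum>j<m. g j * (lam j * ip (err c n) (b j)))"
      unfolding S_def using lam_pos by (intro sum.cong) (auto simp: g_def power2_eq_square less_imp_neq[symmetric])
    also have "\<dots> = B (err c n) (z g m)" unfolding z_def B_sum_left[OF eYY] ..
    \<comment> \<open>Galerkin orthogonality allows the Ritz projection of the dual solution to be
      subtracted, so the energy estimate is used twice.\<close>
    also have "\<dots> = B (err c n) (err g m)"
    proof -
      have "B (err c n) (ritz (z g m)) = 0"
        unfolding err_def[abs_def] by (rule ritz_orth[OF zY ritz_mem])
      moreover have "ritz (z g m) \<in> Y" using ritz_mem VY by blast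
      ultimately show ?thesis
        using BY.diff_right[OF zY[of g m] _ eYY[of c n], of "ritz (z g m)"] unfolding err_def[abs_def] by simp
    qed
    finally have "S\<^sup>2 = (B (err c n) (err g m))\<^sup>2" by simp
    also have "\<dots> \<le> B (err c n) (err c n) * B (err g m) (err g m)" by (rule BY.Cauchy_Schwarz[OF eYY eYY])
    also have "\<dots> \<le> (\<kappa> * A) * (\<kappa> * S)"
    proof (rule mult_mono)
      show "B (err c n) (err c n) \<le> \<kappa> * A" unfolding A_def by (rule en)
      have "(\<Sum>j<m. (lam j * g j)\<^sup>2) = S"
        unfolding S_def using lam_pos by (intro sum.cong) (auto simp: g_def less_imp_neq[symmetric])
      then show "B (err g m) (err g m) \<le> \<kappa> * S" using en[of g m] by simp
    qed (use \<kappa> A S BY.pos[OF eYY] in auto)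
    finally have "S * S \<le> (\<kappa>\<^sup>2 * A) * S" by (simp add: power2_eq_square mult_ac)
    then show ?thesis using S A \<kappa> unfolding S_def[symmetric]
      by (cases "S = 0") (auto simp: mult_le_cancel_right)
  qed
  have "err c n \<in> X" using eYY YX by blast
  from b_complete[OF this] have "(\<lambda>m. \<Sum>j<m. (ip (err c n) (b j))\<^sup>2) \<longlonglongrightarrow> ip (err c n) (err c n)" by (simp add: sums_def)
  from LIMSEQ_le_const2[OF this] part have "ip (err c n) (err c n) \<le> \<kappa>\<^sup>2 * A" by blast
  then show ?thesis unfolding err_def[abs_def] A_def .
qed

text \<open>The left-hand side is the squared distance of \<open>b j\<close> from \<open>V\<close>.
  The orthogonal projection attains it, so the Ritz projection of \<open>b j\<close> can only be
  farther away.\<close>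

lemma projection_error: "1 - (\<Sum>i<N. (coef j i)\<^sup>2) \<le> \<kappa>\<^sup>2 * (lam j)\<^sup>2"
proof -
  let ?c = "\<lambda>k. if k = j then 1 else 0 :: real"
  have z: "(\<lambda>p. \<Sum>k<Suc j. ?c k * b k p) = b j" by (auto simp: fun_eq_iff if_distrib[of "\<lambda>x. x * _"] cong: if_cong)
  have "(\<Sum>k<Suc j. (lam k * ?c k)\<^sup>2) = (\<Sum>k<Suc j. if k = j then (lam j)\<^sup>2 else 0)" by (intro sum.cong) auto
  then have "(\<Sum>k<Suc j. (lam k * ?c k)\<^sup>2) = (lam j)\<^sup>2" by simp
  then have 1: "ip (\<lambda>p. b j p - ritz (b j) p) (\<lambda>p. b j p - ritz (b j) p) \<le> \<kappa>\<^sup>2 * (lam j)\<^sup>2"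
    using ritz_L2[where c="?c" and n="Suc j"] unfolding z by simp
  have "ip (\<lambda>p. b j p - ritz (b j) p) (\<lambda>p. b j p - ritz (b j) p) =
      ip (b j) (b j) - (\<Sum>i<N. (coef j i)\<^sup>2) + (\<Sum>i<N. (B (b j) (e i) / \<theta> i - coef j i)\<^sup>2)"
    using L.orthonormal_residual[OF e_on _ order_refl bX, of j "\<lambda>i. B (b j) (e i) / \<theta> i"]
    by (simp add: ritz_def coef_def)
  then have "1 - (\<Sum>i<N. (coef j i)\<^sup>2) \<le> ip (\<lambda>p. b j p - ritz (b j) p) (\<lambda>p. b j p - ritz (b j) p)"
    by (simp add: b_self sum_nonneg)
  with 1 show ?thesis by simp
qed

text \<open>The numbers \<open>g j\<close> are the coefficients of the inverse operator minus the
  discrete inverse, applied to \<open>e i\<close>; the discrete one gives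
  \<open>e i / \<theta> i\<close>. Their square sum \<open>S\<close> equals \<open>e i\<close>
  tested with the Ritz error of \<open>?z\<close>, the inverse operator applied to \<open>g\<close>,
  so \<open>ritz_L2\<close> bounds \<open>S^2\<close> by \<open>\<kappa>^2 * S\<close>.\<close>

lemma inverse_error:
  assumes i: "i < N" shows "(\<Sum>j<n. (1 / lam j - 1 / \<theta> i)\<^sup>2 * (coef j i)\<^sup>2) \<le> \<kappa>\<^sup>2"
proof -
  define S where "S = (\<Sum>j<n. (1 / lam j - 1 / \<theta> i)\<^sup>2 * (coef j i)\<^sup>2)"
  define g where "g j = (1 / lam j - 1 / \<theta> i) * coef j i" for j
  let ?z = "\<lambda>p. \<Sum>j<n. (g j / lam j) * b j p"
  have z: "?z \<in> Y" by (rule b_sum_mem)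
  have S0: "0 \<le> S" unfolding S_def by (intro sum_nonneg) auto
  have Sg: "S = (\<Sum>j<n. (g j)\<^sup>2)" by (simp add: S_def g_def power_mult_distrib)
  have rY: "ritz ?z \<in> Y" using ritz_mem VY by blast
  have "S = (\<Sum>j<n. (g j / lam j) * coef j i) - (\<Sum>j<n. g j * coef j i) / \<theta> i"
    unfolding S_def sum_divide_distrib sum_subtractf[symmetric]
    by (intro sum.cong) (auto simp: g_def power2_eq_square algebra_simps)
  also have "(\<Sum>j<n. (g j / lam j) * coef j i) = ip (e i) ?z"
    unfolding ip_sum_b[OF eX[OF i]] by (simp add: coef_sym[OF i])
  also have "(\<Sum>j<n. g j * coef j i) / \<theta> i = ip (e i) (ritz ?z)"
  proof -
    have "B ?z (e i) = B (e i) ?z" using BY.sym[OF z eY[OF i]] .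
    also have "\<dots> = (\<Sum>j<n. g j * coef j i)"
      unfolding B_sum_left[OF eY[OF i]] using lam_pos by (intro sum.cong) (auto simp: coef_sym[OF i] less_imp_neq[symmetric])
    finally have "(\<Sum>j<n. g j * coef j i) / \<theta> i = ip (ritz ?z) (e i)"
      using L.orthonormal_sum(2)[OF e_on, of "{..<N}" i "\<lambda>i. B ?z (e i) / \<theta> i"] i by (simp add: ritz_def[abs_def])
    then show ?thesis using L.sym[of "ritz ?z" "e i"] rY YX eX[OF i] by auto
  qed
  also have "ip (e i) ?z - ip (e i) (ritz ?z) = ip (e i) (\<lambda>p. ?z p - ritz ?z p)"
    by (rule L.diff_right[OF subsetD[OF YX z] subsetD[OF YX rY] eX[OF i], symmetric])
  finally have "S\<^sup>2 = (ip (e i) (\<lambda>p. ?z p - ritz ?z p))\<^sup>2" by simp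
  also have "\<dots> \<le> ip (e i) (e i) * ip (\<lambda>p. ?z p - ritz ?z p) (\<lambda>p. ?z p - ritz ?z p)"
    using BY.diff[OF z rY] YX by (intro L.Cauchy_Schwarz eX i) auto
  also have "\<dots> \<le> 1 * (\<kappa>\<^sup>2 * (\<Sum>j<n. (lam j * (g j / lam j))\<^sup>2))"
    unfolding e_self[OF i] using ritz_L2[where c="\<lambda>j. g j / lam j" and n=n] by simp
  also have "(\<Sum>j<n. (lam j * (g j / lam j))\<^sup>2) = S"
    unfolding Sg using lam_pos by (intro sum.cong) (auto simp: less_imp_neq[symmetric])
  finally have "S * S \<le> \<kappa>\<^sup>2 * S" by (simp add: power2_eq_square)
  then show ?thesis using S0 unfolding S_def[symmetric]
    by (cases "S = 0") (auto simp: mult_le_cancel_right)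
qed

text \<open>
  With respect to the two eigenbases, the difference of the fractional powers is the pointwise product of
  the matrix \<open>coef\<close> and the differences of the powers of the eigenvalues; this and
  \<open>\<bar>x\<^sup>\<beta> - y\<^sup>\<beta>\<bar> \<le> \<bar>x - y\<bar>\<^sup>\<beta>\<close> reduce the error to the case \<open>\<beta> = 1\<close>.
\<close>

lemma fractional_error:
  assumes i: "i < N" and \<beta>: "0 < \<beta>" "\<beta> \<le> 1" and \<kappa>: "0 < \<kappa>"
  shows "(\<Sum>j<n. (lam j powr (- \<beta>) - \<theta> i powr (- \<beta>))\<^sup>2 * (coef j i)\<^sup>2) \<le> 2 * \<kappa> powr (2 * \<beta>)"
proof -
  have "(\<Sum>j<n. (lam j powr (- \<beta>) - \<theta> i powr (- \<beta>))\<^sup>2 * (coef j i)\<^sup>2) \<le>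
      (\<Sum>j<n. \<kappa> powr (2 * \<beta>) * ((coef j i)\<^sup>2 + ((1 / lam j - 1 / \<theta> i)\<^sup>2 * (coef j i)\<^sup>2) / \<kappa>\<^sup>2))"
  proof (rule sum_mono)
    fix j
    define x where "x = (1 / lam j - 1 / \<theta> i)\<^sup>2"
    have p: "lam j powr (- \<beta>) = (1 / lam j) powr \<beta>" "\<theta> i powr (- \<beta>) = (1 / \<theta> i) powr \<beta>"
      using lam_pos[of j] \<theta>_pos[OF i] by (simp_all add: powr_minus_divide powr_divide)
    have "\<bar>lam j powr (- \<beta>) - \<theta> i powr (- \<beta>)\<bar> \<le> \<bar>1 / lam j - 1 / \<theta> i\<bar> powr \<beta>"
      unfolding p using lam_pos[of j] \<theta>_pos[OF i] \<beta> by (intro powr_diff_le) auto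
    then have "(lam j powr (- \<beta>) - \<theta> i powr (- \<beta>))\<^sup>2 \<le> (\<bar>1 / lam j - 1 / \<theta> i\<bar> powr \<beta>)\<^sup>2"
      by (metis abs_ge_zero power2_abs power_mono)
    also have "\<dots> = x powr \<beta>"
    proof -
      have "(t powr \<beta>)\<^sup>2 = (t\<^sup>2) powr \<beta>" if "0 \<le> t" for t :: real
        using that by (simp add: power2_eq_square powr_mult)
      from this[of "\<bar>1 / lam j - 1 / \<theta> i\<bar>"] show ?thesis by (simp add: x_def)
    qed
    also have "\<dots> \<le> (\<kappa>\<^sup>2) powr \<beta> * (1 + x / \<kappa>\<^sup>2)"
      using \<kappa> \<beta> by (intro powr_tangent_bound) (auto simp: x_def)
    also have "(\<kappa>\<^sup>2) powr \<beta> = \<kappa> powr (2 * \<beta>)"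
      using \<kappa> by (simp add: powr_powr[symmetric])
    finally have "(lam j powr (- \<beta>) - \<theta> i powr (- \<beta>))\<^sup>2 * (coef j i)\<^sup>2 \<le> \<kappa> powr (2 * \<beta>) * (1 + x / \<kappa>\<^sup>2) * (coef j i)\<^sup>2"
      by (rule mult_right_mono) simp
    then show "(lam j powr (- \<beta>) - \<theta> i powr (- \<beta>))\<^sup>2 * (coef j i)\<^sup>2 \<le>
       \<kappa> powr (2 * \<beta>) * ((coef j i)\<^sup>2 + ((1 / lam j - 1 / \<theta> i)\<^sup>2 * (coef j i)\<^sup>2) / \<kappa>\<^sup>2)"
      by (simp add: x_def algebra_simps)
  qed
  also have "\<dots> = \<kappa> powr (2 * \<beta>) * ((\<Sum>j<n. (coef j i)\<^sup>2) + (\<Sum>j<n. (1 / lam j - 1 / \<theta> i)\<^sup>2 * (coef j i)\<^sup>2) / \<kappa>\<^sup>2)"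
    by (simp only: sum_distrib_left[symmetric] sum.distrib sum_divide_distrib[symmetric])
  also have "\<dots> \<le> \<kappa> powr (2 * \<beta>) * (1 + 1)"
  proof (intro mult_left_mono add_mono)
    show "(\<Sum>j<n. (coef j i)\<^sup>2) \<le> 1"
      using sum_le_suminf[OF sums_summable[OF coef_sums[OF i]], of "{..<n}"] sums_unique[OF coef_sums[OF i]] by simp
    show "(\<Sum>j<n. (1 / lam j - 1 / \<theta> i)\<^sup>2 * (coef j i)\<^sup>2) / \<kappa>\<^sup>2 \<le> 1"
      using inverse_error[OF i] \<kappa> by (simp add: divide_le_eq)
  qed auto
  finally show ?thesis by simp
qed

lemma coef_powr_summable:
  assumes i: "i < N" and \<beta>: "0 < \<beta>"
  shows "summable (\<lambda>j. lam j powr (- \<beta>) * (coef j i)\<^sup>2)"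
proof (rule summable_comparison_test')
  show "summable (\<lambda>j. \<delta> powr (- \<beta>) * (coef j i)\<^sup>2)"
    using coef_sums[OF i] by (intro summable_mult sums_summable)
  show "norm (lam j powr (- \<beta>) * (coef j i)\<^sup>2) \<le> \<delta> powr (- \<beta>) * (coef j i)\<^sup>2" for j
    using powr_mono2'[of "- \<beta>" \<delta> "lam j"] lam_ge[of j] \<delta> \<beta> by (simp add: mult_right_mono)
qed

text \<open>The expression on the left is the squared Hilbert-Schmidt norm of the error operator.\<close>

lemma Hilbert_Schmidt_error:
  assumes \<beta>: "0 < \<beta>" "\<beta> \<le> 1" and \<kappa>: "0 < \<kappa>" and r: "0 \<le> r" "r \<le> 1"
    and s1: "summable (\<lambda>j. lam j powr (- 2 * \<beta>))" and s2: "(\<lambda>j. lam j powr (- 2 * \<beta> + 2 * r)) sums C1"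
    and qi: "\<And>i. i < N \<Longrightarrow> \<bar>\<theta> i powr (- \<beta>) - q i\<bar> \<le> \<epsilon>"
  shows "(\<Sum>j. lam j powr (- 2 * \<beta>)) - 2 * (\<Sum>i<N. q i * (\<Sum>j. lam j powr (- \<beta>) * (coef j i)\<^sup>2)) + (\<Sum>i<N. (q i)\<^sup>2)
      \<le> C1 * \<kappa> powr (2 * r) + N * (4 * \<kappa> powr (2 * \<beta>) + 2 * \<epsilon>\<^sup>2)"
proof -
  note sc = coef_powr_summable[OF _ \<beta>(1)]
  \<comment> \<open>\<open>T j\<close> is the squared norm of the error operator applied to
    \<open>b j\<close>.\<close>
  define T where "T j = lam j powr (- 2 * \<beta>) - 2 * (\<Sum>i<N. q i * (lam j powr (- \<beta>) * (coef j i)\<^sup>2)) + (\<Sum>i<N. (q i)\<^sup>2 * (coef j i)\<^sup>2)" for j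
  have Ts: "T sums ((\<Sum>j. lam j powr (- 2 * \<beta>)) - 2 * (\<Sum>i<N. q i * (\<Sum>j. lam j powr (- \<beta>) * (coef j i)\<^sup>2)) + (\<Sum>i<N. (q i)\<^sup>2 * 1))"
    unfolding T_def
    by (intro sums_add sums_diff sums_mult sums_sum summable_sums s1 sc coef_sums) auto
  \<comment> \<open>Completing the square separates the part of \<open>b j\<close> outside
    \<open>V\<close> from the error inside \<open>V\<close>.\<close>
  have Tj: "T j = lam j powr (- 2 * \<beta>) * (1 - (\<Sum>i<N. (coef j i)\<^sup>2)) + (\<Sum>i<N. (lam j powr (- \<beta>) - q i)\<^sup>2 * (coef j i)\<^sup>2)" for j
  proof -
    have "lam j powr (- 2 * \<beta>) = (lam j powr (- \<beta>))\<^sup>2" by (simp add: power2_eq_square powr_add[symmetric])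
    then show ?thesis
      by (simp add: T_def power2_eq_square algebra_simps sum.distrib sum_subtractf sum_distrib_left)
  qed
  have "(\<Sum>j<n. T j) \<le> C1 * \<kappa> powr (2 * r) + N * (4 * \<kappa> powr (2 * \<beta>) + 2 * \<epsilon>\<^sup>2)" for n
  proof -
    have 1: "(\<Sum>j<n. lam j powr (- 2 * \<beta>) * (1 - (\<Sum>i<N. (coef j i)\<^sup>2))) \<le> C1 * \<kappa> powr (2 * r)"
    proof -
      have "(\<Sum>j<n. lam j powr (- 2 * \<beta>) * (1 - (\<Sum>i<N. (coef j i)\<^sup>2))) \<le> (\<Sum>j<n. lam j powr (- 2 * \<beta> + 2 * r) * \<kappa> powr (2 * r))"
      proof (rule sum_mono)
        fix j
        have lk: "0 < \<kappa> * lam j" using \<kappa> lam_pos by simp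
        \<comment> \<open>The defect is bounded both by 1 and by the square of
          \<open>\<kappa> * lam j\<close>; every power \<open>2 * r\<close> with \<open>r\<close> in
          the unit interval lies above the smaller of the two.\<close>
        have "1 - (\<Sum>i<N. (coef j i)\<^sup>2) \<le> (\<kappa> * lam j) powr (2 * r)"
        proof (cases "\<kappa> * lam j \<le> 1")
          case True
          have "1 - (\<Sum>i<N. (coef j i)\<^sup>2) \<le> (\<kappa> * lam j)\<^sup>2" using projection_error[of j] by (simp add: power_mult_distrib)
          also have "\<dots> = (\<kappa> * lam j) powr 2" using lk by simp
          also have "\<dots> \<le> (\<kappa> * lam j) powr (2 * r)" using True lk r by (intro powr_mono') auto
          finally show ?thesis .
        next
          case False
          have "1 - (\<Sum>i<N. (coef j i)\<^sup>2) \<le> 1" by (simp add: sum_nonneg)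
          also have "1 \<le> (\<kappa> * lam j) powr (2 * r)" using False r by (intro ge_one_powr_ge_zero) auto
          finally show ?thesis .
        qed
        then have "lam j powr (- 2 * \<beta>) * (1 - (\<Sum>i<N. (coef j i)\<^sup>2)) \<le> lam j powr (- 2 * \<beta>) * (\<kappa> * lam j) powr (2 * r)"
          by (rule mult_left_mono) simp
        also have "\<dots> = lam j powr (- 2 * \<beta> + 2 * r) * \<kappa> powr (2 * r)"
          using \<kappa> lam_pos[of j] by (simp only: powr_add powr_mult less_imp_le) (simp add: mult_ac)
        finally show "lam j powr (- 2 * \<beta>) * (1 - (\<Sum>i<N. (coef j i)\<^sup>2)) \<le> lam j powr (- 2 * \<beta> + 2 * r) * \<kappa> powr (2 * r)" .
      qed
      also have "\<dots> = (\<Sum>j<n. lam j powr (- 2 * \<beta> + 2 * r)) * \<kappa> powr (2 * r)" by (simp add: sum_distrib_right)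
      also have "\<dots> \<le> C1 * \<kappa> powr (2 * r)"
        using sum_le_suminf[OF sums_summable[OF s2], of "{..<n}"] sums_unique[OF s2] by (intro mult_right_mono) auto
      finally show ?thesis .
    qed
    have 2: "(\<Sum>j<n. (lam j powr (- \<beta>) - q i)\<^sup>2 * (coef j i)\<^sup>2) \<le> 4 * \<kappa> powr (2 * \<beta>) + 2 * \<epsilon>\<^sup>2" if i: "i < N" for i
    proof -
      have "(\<Sum>j<n. (lam j powr (- \<beta>) - q i)\<^sup>2 * (coef j i)\<^sup>2) \<le>
        (\<Sum>j<n. 2 * ((lam j powr (- \<beta>) - \<theta> i powr (- \<beta>))\<^sup>2 * (coef j i)\<^sup>2) + 2 * \<epsilon>\<^sup>2 * (coef j i)\<^sup>2)"
      proof (rule sum_mono)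
        fix j
        have ab: "(x + y)\<^sup>2 \<le> 2 * x\<^sup>2 + 2 * y\<^sup>2" for x y :: real
          using sum_squares_bound[of x y] by (simp add: power2_sum)
        have "(lam j powr (- \<beta>) - q i)\<^sup>2 \<le> 2 * (lam j powr (- \<beta>) - \<theta> i powr (- \<beta>))\<^sup>2 + 2 * (\<theta> i powr (- \<beta>) - q i)\<^sup>2"
          using ab[of "lam j powr (- \<beta>) - \<theta> i powr (- \<beta>)" "\<theta> i powr (- \<beta>) - q i"] by simp
        also have "(\<theta> i powr (- \<beta>) - q i)\<^sup>2 \<le> \<epsilon>\<^sup>2" using qi[OF i] by (metis abs_ge_zero power2_abs power_mono)
        finally have "(lam j powr (- \<beta>) - q i)\<^sup>2 \<le> 2 * (lam j powr (- \<beta>) - \<theta> i powr (- \<beta>))\<^sup>2 + 2 * \<epsilon>\<^sup>2" by simp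
        from mult_right_mono[OF this, of "(coef j i)\<^sup>2"]
        show "(lam j powr (- \<beta>) - q i)\<^sup>2 * (coef j i)\<^sup>2 \<le> 2 * ((lam j powr (- \<beta>) - \<theta> i powr (- \<beta>))\<^sup>2 * (coef j i)\<^sup>2) + 2 * \<epsilon>\<^sup>2 * (coef j i)\<^sup>2"
          by (simp add: algebra_simps)
      qed
      also have "\<dots> = 2 * (\<Sum>j<n. (lam j powr (- \<beta>) - \<theta> i powr (- \<beta>))\<^sup>2 * (coef j i)\<^sup>2) + 2 * \<epsilon>\<^sup>2 * (\<Sum>j<n. (coef j i)\<^sup>2)"
        by (simp add: sum.distrib sum_distrib_left)
      also have "\<dots> \<le> 2 * (2 * \<kappa> powr (2 * \<beta>)) + 2 * \<epsilon>\<^sup>2 * 1"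
      proof (intro add_mono mult_left_mono fractional_error[OF i \<beta> \<kappa>])
        show "(\<Sum>j<n. (coef j i)\<^sup>2) \<le> 1"
          using sum_le_suminf[OF sums_summable[OF coef_sums[OF i]], of "{..<n}"] sums_unique[OF coef_sums[OF i]] by simp
      qed auto
      finally show ?thesis by simp
    qed
    have "(\<Sum>j<n. T j) = (\<Sum>j<n. lam j powr (- 2 * \<beta>) * (1 - (\<Sum>i<N. (coef j i)\<^sup>2))) + (\<Sum>i<N. \<Sum>j<n. (lam j powr (- \<beta>) - q i)\<^sup>2 * (coef j i)\<^sup>2)"
      unfolding Tj sum.distrib by (subst sum.swap[of _ "{..<N}"]) simp
    also have "\<dots> \<le> C1 * \<kappa> powr (2 * r) + (\<Sum>i<N. 4 * \<kappa> powr (2 * \<beta>) + 2 * \<epsilon>\<^sup>2)"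
      using 1 2 by (intro add_mono sum_mono) auto
    finally show ?thesis by simp
  qed
  from LIMSEQ_le_const2[OF Ts[unfolded sums_def]] this
  show "(\<Sum>j. lam j powr (- 2 * \<beta>)) - 2 * (\<Sum>i<N. q i * (\<Sum>j. lam j powr (- \<beta>) * (coef j i)\<^sup>2)) + (\<Sum>i<N. (q i)\<^sup>2)
      \<le> C1 * \<kappa> powr (2 * r) + N * (4 * \<kappa> powr (2 * \<beta>) + 2 * \<epsilon>\<^sup>2)" by simp
qed

end

section \<open>Function spaces on the graph\<close>

lemma on_edge_lincomb: "on_edge \<Gamma> (\<lambda>p. c * u p + d * v p) e = (\<lambda>x. c * on_edge \<Gamma> u e x + d * on_edge \<Gamma> v e x)"
  by (simp add: on_edge_def)

text \<open>Cauchy-Schwarz for the derivative and the indicator of the segment between the two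
  points. Localizing to \<open>{p..q}\<close> makes the estimate summable over mesh cells.\<close>

lemma has_L2_deriv_increment_square:
  assumes f: "has_L2_deriv l f g" and x: "0 \<le> p" "p \<le> x" "x \<le> q" "p \<le> y" "y \<le> q" "q \<le> l"
  shows "(f x - f y)\<^sup>2 \<le> (q - p) * integral {p..q} (\<lambda>t. (g t)\<^sup>2)"
proof -
  have main: "(f y - f x)\<^sup>2 \<le> (q - p) * integral {p..q} (\<lambda>t. (g t)\<^sup>2)"
    if x: "p \<le> x" "x \<le> y" "y \<le> q" for x y
  proof -
    let ?M = "leb l"
    have gs: "square_integrable l g" by (rule has_L2_derivD[OF f])
    have xy: "0 \<le> x" "y \<le> l" "0 \<le> p" "q \<le> l" using x assms by auto
    have g2: "integrable ?M (\<lambda>t. (g t)\<^sup>2)" using gs by (simp add: square_integrable_def)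
    have isq: "square_integrable l (indicator {x..y})"
      by (auto simp: square_integrable_def power2_eq_square indicator_inter_arith[symmetric]
          intro!: borel_measurable_lebesgue_on finite_measure.integrable_const_bound[OF finite_measure_interval, of _ 1])
    have gi: "square_integrable l (\<lambda>t. indicator {x..y} t * g t)"
      by (rule square_integrable_bounded_mult[OF gs, of _ 1]) (auto intro!: borel_measurable_lebesgue_on)
    have "f y - f x = (LINT t|?M. g t * indicator {x..y} t)"
      using has_L2_deriv_diff[OF f xy(1) x(2) xy(2)]
        integrable_imp_integrable_on(3)[OF square_integrable_imp_integrable[OF gs] xy(1,2)] by simp
    also have "\<dots> = (LINT t|?M. (indicator {x..y} t * g t) * indicator {x..y} t)"
      by (intro Bochner_Integration.integral_cong) (auto simp: indicator_def)
    finally have "(f y - f x)\<^sup>2 \<le> (LINT t|?M. (indicator {x..y} t * g t)\<^sup>2) * (LINT t|?M. (indicator {x..y} t)\<^sup>2)"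
      using square_integrable_Cauchy_Schwarz[OF gi isq] by simp
    also have "(LINT t|?M. (indicator {x..y} t :: real)\<^sup>2) = (LINT t|?M. 1 * indicator {x..y} t)"
      by (intro Bochner_Integration.integral_cong) (auto simp: indicator_def)
    also have "\<dots> = y - x"
    proof -
      have "integrable ?M (\<lambda>_. 1 :: real)" by (rule finite_measure.integrable_const[OF finite_measure_interval])
      from integrable_imp_integrable_on(3)[OF this, of x y] show ?thesis using x xy by (simp only: integral_const_real content_real real_scaleR_def mult_1_right)
    qed
    also have "(LINT t|?M. (indicator {x..y} t * g t)\<^sup>2) = (LINT t|?M. (g t)\<^sup>2 * indicator {x..y} t)"
      by (intro Bochner_Integration.integral_cong) (auto simp: indicator_def)
    also have "\<dots> = integral {x..y} (\<lambda>t. (g t)\<^sup>2)" by (rule integrable_imp_integrable_on(3)[OF g2 xy(1,2)])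
    also have "integral {x..y} (\<lambda>t. (g t)\<^sup>2) * (y - x) \<le> integral {p..q} (\<lambda>t. (g t)\<^sup>2) * (q - p)"
    proof (rule mult_mono)
      show "integral {x..y} (\<lambda>t. (g t)\<^sup>2) \<le> integral {p..q} (\<lambda>t. (g t)\<^sup>2)"
        using x by (intro integral_subset_le integrable_imp_integrable_on(2)[OF g2] xy) auto
      show "0 \<le> integral {p..q} (\<lambda>t. (g t)\<^sup>2)" by (intro integral_nonneg integrable_imp_integrable_on(2)[OF g2] xy) auto
    qed (use x in auto)
    finally show ?thesis by (simp add: mult.commute)
  qed
  show ?thesis using main[of x y] main[of y x] x by (cases "x \<le> y") (auto simp: power2_commute)
qed

text \<open>An average over a segment with end \<open>y\<close>: the square of
  \<open>f x + (f y - f x)\<close> is split with weight \<open>s\<close>, and the mean distance to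
  \<open>y\<close> is \<open>r / 2\<close>. The free \<open>s\<close> serves the sharp constants of
  coercivity, the free \<open>r\<close> the short segments of eigenvalue counting.\<close>

lemma L2_interval_trace:
  assumes l: "0 \<le> l" and f: "has_L2_deriv l f g" and c: "0 \<le> c" "0 < r" "c + r \<le> l" and y: "y = c \<or> y = c + r" and s: "0 < s"
  shows "(f y)\<^sup>2 \<le> (1 + s) / r * (LINT x|leb l. (f x)\<^sup>2) + (1 + 1 / s) * (r / 2) * (LINT x|leb l. (g x)\<^sup>2)"
proof -
  let ?M = "leb l"
  define G where "G = (LINT x|?M. (g x)\<^sup>2)"
  have gs: "square_integrable l g" by (rule has_L2_derivD[OF f])
  have cf: "continuous_on {0..l} f" by (rule has_L2_deriv_continuous[OF f])
  have inc: "(f q - f p)\<^sup>2 \<le> (q - p) * G" if "0 \<le> p" "p \<le> q" "q \<le> l" for p q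
  proof -
    have g2: "integrable ?M (\<lambda>t. (g t)\<^sup>2)" using gs by (simp add: square_integrable_def)
    have "(f q - f p)\<^sup>2 \<le> (q - p) * integral {p..q} (\<lambda>t. (g t)\<^sup>2)"
      by (rule has_L2_deriv_increment_square[OF f]) (use that in auto)
    also have "integral {p..q} (\<lambda>t. (g t)\<^sup>2) \<le> integral {0..l} (\<lambda>t. (g t)\<^sup>2)"
      using that l by (intro integral_subset_le integrable_imp_integrable_on(2)[OF g2]) auto
    also have "\<dots> = G" unfolding G_def by (rule lebesgue_integral_eq_integral[symmetric]) (use g2 in auto)
    finally show ?thesis using that by (simp add: mult_left_mono)
  qed
  have y0: "0 \<le> y" "y \<le> l" using y c by auto
  have pt: "(f y)\<^sup>2 \<le> (1 + s) * (f x)\<^sup>2 + (1 + 1 / s) * (\<bar>y - x\<bar> * G)" if "x \<in> {c..c + r}" for x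
  proof -
    have "(f y - f x)\<^sup>2 \<le> \<bar>y - x\<bar> * G"
      using inc[of x y] inc[of y x] that y0 c by (cases "x \<le> y") (auto simp: power2_commute)
    then have "(1 + 1 / s) * (f y - f x)\<^sup>2 \<le> (1 + 1 / s) * (\<bar>y - x\<bar> * G)" using s by (intro mult_left_mono) auto
    moreover have "(f y)\<^sup>2 \<le> (1 + s) * (f x)\<^sup>2 + (1 + 1 / s) * (f y - f x)\<^sup>2"
    proof -
      have "0 \<le> (s * f x - (f y - f x))\<^sup>2 / s" using s by simp
      also have "\<dots> = s * (f x)\<^sup>2 - 2 * f x * (f y - f x) + (f y - f x)\<^sup>2 / s"
        using s by (simp add: field_simps power2_eq_square)
      finally show ?thesis by (simp add: power2_eq_square algebra_simps)
    qed
    ultimately show ?thesis by linarith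
  qed
  have ci: "continuous_on {c..c + r} f" using cf c by (auto elim: continuous_on_subset)
  have "((\<lambda>x. \<bar>y - x\<bar>) has_integral r\<^sup>2 / 2) {c..c + r}"
  proof (cases "y = c")
    case True
    have "((\<lambda>x. x - c) has_integral ((c + r - c)\<^sup>2 / 2 - (c - c)\<^sup>2 / 2)) {c..c + r}"
      using c by (intro fundamental_theorem_of_calculus)
        (auto simp: has_real_derivative_iff_has_vector_derivative[symmetric] intro!: derivative_eq_intros)
    then have "((\<lambda>x. x - c) has_integral r\<^sup>2 / 2) {c..c + r}" by simp
    then show ?thesis by (rule has_integral_eq[rotated]) (use True in auto)
  next
    case False
    then have yc: "y = c + r" using y by simp
    have "((\<lambda>x. c + r - x) has_integral (- ((c + r - (c + r))\<^sup>2 / 2) - - ((c + r - c)\<^sup>2 / 2))) {c..c + r}"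
      using c by (intro fundamental_theorem_of_calculus)
        (auto simp: has_real_derivative_iff_has_vector_derivative[symmetric] field_simps intro!: derivative_eq_intros)
    then have "((\<lambda>x. c + r - x) has_integral r\<^sup>2 / 2) {c..c + r}" by simp
    then show ?thesis by (rule has_integral_eq[rotated]) (use yc in auto)
  qed
  then have ya: "((\<lambda>x. (1 + s) * (f x)\<^sup>2 + (1 + 1 / s) * (\<bar>y - x\<bar> * G)) has_integral
      (1 + s) * integral {c..c + r} (\<lambda>x. (f x)\<^sup>2) + (1 + 1 / s) * (r\<^sup>2 / 2 * G)) {c..c + r}"
    using ci by (intro has_integral_add has_integral_mult_right has_integral_mult_left integrable_integral
        integrable_continuous_real continuous_intros)
  have "r * (f y)\<^sup>2 = integral {c..c + r} (\<lambda>x. (f y)\<^sup>2)" using c by simp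
  also have "\<dots> \<le> (1 + s) * integral {c..c + r} (\<lambda>x. (f x)\<^sup>2) + (1 + 1 / s) * (r\<^sup>2 / 2 * G)"
    using pt by (intro has_integral_le[OF integrable_integral ya]) auto
  also have "\<dots> \<le> (1 + s) * (LINT x|?M. (f x)\<^sup>2) + (1 + 1 / s) * (r\<^sup>2 / 2 * G)"
  proof (intro add_right_mono mult_left_mono)
    have c2: "continuous_on {0..l} (\<lambda>x. (f x)\<^sup>2)" using cf by (intro continuous_intros)
    have "integral {c..c + r} (\<lambda>x. (f x)\<^sup>2) \<le> integral {0..l} (\<lambda>x. (f x)\<^sup>2)"
      using c by (intro integral_subset_le integrable_continuous_real continuous_on_subset[OF c2]) auto
    also have "\<dots> = (LINT x|?M. (f x)\<^sup>2)"
      using square_integrable_continuous[OF cf] by (intro lebesgue_integral_eq_integral[symmetric]) (auto simp: square_integrable_def)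
    finally show "integral {c..c + r} (\<lambda>x. (f x)\<^sup>2) \<le> (LINT x|?M. (f x)\<^sup>2)" .
  qed (use s in auto)
  finally have "r * (f y)\<^sup>2 / r \<le> ((1 + s) * (LINT x|?M. (f x)\<^sup>2) + (1 + 1 / s) * (r\<^sup>2 / 2 * G)) / r"
    using c by (intro divide_right_mono) auto
  moreover have "r * (f y)\<^sup>2 / r = (f y)\<^sup>2" using c by simp
  moreover have "(A * I + B * (r\<^sup>2 / 2 * G)) / r = A / r * I + B * (r / 2) * G" for A B I
    using c by (simp add: field_simps power2_eq_square)
  ultimately show ?thesis by (simp only: G_def)
qed

section \<open>Functions on the whole graph\<close>

locale metric_graph_locale =
  fixes \<Gamma> :: "('v, 'e) metric_graph"
  assumes compact: "compact_metric_graph \<Gamma>" and conn: "connected_graph \<Gamma>"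
begin

abbreviation len :: "'e \<Rightarrow> real" where "len \<equiv> elen \<Gamma>"
abbreviation edge :: "(('v, 'e) point \<Rightarrow> real) \<Rightarrow> 'e \<Rightarrow> real \<Rightarrow> real" where "edge \<equiv> on_edge \<Gamma>"
abbreviation ip :: "(('v, 'e) point \<Rightarrow> real) \<Rightarrow> (('v, 'e) point \<Rightarrow> real) \<Rightarrow> real" where "ip \<equiv> L2_inner \<Gamma>"
abbreviation Leb :: "'e \<Rightarrow> real measure" where "Leb e \<equiv> leb (elen \<Gamma> e)"

lemma fin_edges: "finite (edges \<Gamma>)" and edges_ne: "edges \<Gamma> \<noteq> {}" and fin_verts: "finite (vertices \<Gamma>)"
  and elen_pos: "\<And>e. e \<in> edges \<Gamma> \<Longrightarrow> 0 < len e"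
  using compact by (auto simp: compact_metric_graph_def fin_digraph_def fin_digraph_axioms_def)

lemma end_verts: "e \<in> edges \<Gamma> \<Longrightarrow> tail (skel \<Gamma>) e \<in> vertices \<Gamma>" "e \<in> edges \<Gamma> \<Longrightarrow> head (skel \<Gamma>) e \<in> vertices \<Gamma>"
proof -
  interpret fin_digraph "skel \<Gamma>" using compact by (simp add: compact_metric_graph_def)
  show "e \<in> edges \<Gamma> \<Longrightarrow> tail (skel \<Gamma>) e \<in> vertices \<Gamma>" "e \<in> edges \<Gamma> \<Longrightarrow> head (skel \<Gamma>) e \<in> vertices \<Gamma>" by auto
qed

lemma on_edge_ends:
  assumes "e \<in> edges \<Gamma>"
  shows "edge u e 0 = u (Vertex (tail (skel \<Gamma>) e))" "edge u e (len e) = u (Vertex (head (skel \<Gamma>) e))"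
  using elen_pos[OF assms] by (simp_all add: on_edge_def edge_point_def)

lemma semi_inner_L2: "semi_inner (L2_graph \<Gamma>) (ip)"
proof
  show "(\<lambda>_. 0) \<in> L2_graph \<Gamma>" by (simp add: L2_graph_def square_integrable_def on_edge_def)
  fix u v w :: "('v, 'e) point \<Rightarrow> real" and c d :: real
  assume u: "u \<in> L2_graph \<Gamma>"
  show "0 \<le> ip u u" unfolding L2_inner_def by (intro sum_nonneg integral_nonneg_AE) auto
  assume v: "v \<in> L2_graph \<Gamma>"
  show "(\<lambda>p. c * u p + d * v p) \<in> L2_graph \<Gamma>"
    using u v square_integrable_lincomb by (auto simp: L2_graph_def on_edge_lincomb)
  show "ip u v = ip v u" by (simp add: L2_inner_def mult.commute)
  assume w: "w \<in> L2_graph \<Gamma>"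
  have "(LINT x|Leb e. (c * edge u e x + d * edge v e x) * edge w e x)
    = c * (LINT x|Leb e. edge u e x * edge w e x)
    + d * (LINT x|Leb e. edge v e x * edge w e x)" if "e \<in> edges \<Gamma>" for e
  proof -
    have "integrable (Leb e) (\<lambda>x. edge u e x * edge w e x)"
      "integrable (Leb e) (\<lambda>x. edge v e x * edge w e x)"
      using u v w that by (auto simp: L2_graph_def intro!: square_integrable_mult_integrable)
    then show ?thesis by (simp add: distrib_right mult.assoc)
  qed
  then show "ip (\<lambda>p. c * u p + d * v p) w = c * ip u w + d * ip v w"
    by (simp add: L2_inner_def on_edge_lincomb sum.distrib sum_distrib_left)
qed

sublocale L2: semi_inner "L2_graph \<Gamma>" "ip" by (rule semi_inner_L2)

lemma graph_dist_le: "graph_path \<Gamma> p q s \<Longrightarrow> graph_dist \<Gamma> p q \<le> s"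
  using path_in[OF compact] path_nonneg by (auto simp: graph_dist_def intro!: cInf_lower bdd_belowI[of _ 0])

lemma graph_dist_edge:
  assumes "e \<in> edges \<Gamma>" "x \<in> {0..len e}" "y \<in> {0..len e}"
  shows "graph_dist \<Gamma> (edge_point \<Gamma> e x) (edge_point \<Gamma> e y) \<le> \<bar>x - y\<bar>"
  using graph_dist_le[OF graph_path.step[OF graph_path.nil[OF edge_point_in[OF compact assms(1)]] assms(1,2,3)]] by simp

lemma continuous_on_edge:
  assumes "continuous_on_graph \<Gamma> u" "e \<in> edges \<Gamma>" shows "continuous_on {0..len e} (edge u e)"
proof -
  have "Lipschitz_continuous_map (submetric euclidean_metric {0..len e}) (graph_metric \<Gamma>) (edge_point \<Gamma> e)"
    unfolding Lipschitz_continuous_map_def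
    using graph_dist_edge[OF assms(2)] edge_point_in[OF compact assms(2)]
    by (auto simp: mspace_graph_metric[OF compact conn] mdist_graph_metric[OF compact conn] dist_real_def intro!: exI[of _ 1])
  then have "continuous_map (top_of_set {0..len e}) (mtopology_of (graph_metric \<Gamma>)) (edge_point \<Gamma> e)"
    using Lipschitz_continuous_imp_continuous_map by (fastforce simp: mtopology_of_submetric)
  from continuous_map_compose[OF this assms(1)[unfolded continuous_on_graph_def]]
  show ?thesis by (simp add: on_edge_def[abs_def] o_def)
qed

text \<open>Bounds on the edges add up along paths, and the distance is the infimum of the path
  lengths. \<open>K'\<close> is positive, so that \<open>path_Lipschitz\<close> can be applied to
  \<open>f\<close> divided by it.\<close>

lemma Lipschitz_edgewise_continuous:
  assumes "\<And>e x y. e \<in> edges \<Gamma> \<Longrightarrow> x \<in> {0..len e} \<Longrightarrow> y \<in> {0..len e} \<Longrightarrow> \<bar>edge f e x - edge f e y\<bar> \<le> K * \<bar>x - y\<bar>"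
  shows "continuous_on_graph \<Gamma> f"
proof -
  define K' where "K' = max K 1"
  have K': "0 < K'" by (simp add: K'_def)
  have *: "\<bar>f p - f q\<bar> \<le> K' * graph_dist \<Gamma> p q" if pq: "p \<in> points \<Gamma>" "q \<in> points \<Gamma>" for p q
  proof -
    have "\<bar>f p / K' - f q / K'\<bar> \<le> t" if "graph_path \<Gamma> p q t" for t
    proof (rule path_Lipschitz[OF that, of "\<lambda>p. f p / K'"])
      fix e x y assume e: "e \<in> edges \<Gamma>" "x \<in> {0..len e}" "y \<in> {0..len e}"
      have "\<bar>f (edge_point \<Gamma> e x) - f (edge_point \<Gamma> e y)\<bar> \<le> K' * \<bar>x - y\<bar>"
        using assms[OF e] mult_right_mono[of K K' "\<bar>x - y\<bar>"] by (simp add: on_edge_def K'_def)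
      then show "\<bar>f (edge_point \<Gamma> e x) / K' - f (edge_point \<Gamma> e y) / K'\<bar> \<le> \<bar>x - y\<bar>"
        using K' by (simp add: diff_divide_distrib[symmetric] pos_divide_le_eq mult.commute)
    qed
    then have "\<bar>f p / K' - f q / K'\<bar> \<le> graph_dist \<Gamma> p q"
      using path_exists[OF compact conn pq] pq by (auto simp: graph_dist_def intro!: cInf_greatest)
    then show ?thesis using K' by (simp add: diff_divide_distrib[symmetric] pos_divide_le_eq mult.commute)
  qed
  have "Lipschitz_continuous_map (graph_metric \<Gamma>) euclidean_metric f"
    unfolding Lipschitz_continuous_map_def
    using * by (auto simp: mspace_graph_metric[OF compact conn] mdist_graph_metric[OF compact conn] dist_real_def)
  then show ?thesis
    unfolding continuous_on_graph_def using Lipschitz_continuous_imp_continuous_map by fastforce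
qed

lemma Lipschitz_on_edges:
  assumes "Lipschitz_on_graph \<Gamma> a"
  obtains L where "0 \<le> L" "\<And>e x y. e \<in> edges \<Gamma> \<Longrightarrow> x \<in> {0..len e} \<Longrightarrow> y \<in> {0..len e} \<Longrightarrow> \<bar>edge a e x - edge a e y\<bar> \<le> L * \<bar>x - y\<bar>"
proof -
  obtain B where B: "\<And>p q. p \<in> points \<Gamma> \<Longrightarrow> q \<in> points \<Gamma> \<Longrightarrow> \<bar>a p - a q\<bar> \<le> B * graph_dist \<Gamma> p q"
    using assms unfolding Lipschitz_on_graph_def Lipschitz_continuous_map_def
    by (auto simp: mspace_graph_metric[OF compact conn] mdist_graph_metric[OF compact conn] dist_real_def)
  show thesis
  proof (rule that[of "max B 0"])
    fix e x y assume e: "e \<in> edges \<Gamma>" "x \<in> {0..len e}" "y \<in> {0..len e}"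
    have "0 \<le> graph_dist \<Gamma> (edge_point \<Gamma> e x) (edge_point \<Gamma> e y)"
      using Metric_space.nonneg[OF Metric_space_graph_dist[OF compact conn]] by blast
    then have "B * graph_dist \<Gamma> (edge_point \<Gamma> e x) (edge_point \<Gamma> e y) \<le> max B 0 * \<bar>x - y\<bar>"
      using graph_dist_edge[OF e] by (intro mult_mono) auto
    then show "\<bar>edge a e x - edge a e y\<bar> \<le> max B 0 * \<bar>x - y\<bar>"
      using B[OF edge_point_in[OF compact e(1)] edge_point_in[OF compact e(1)], of x y] by (simp add: on_edge_def)
  qed simp
qed

definition H1_graph :: "(('v, 'e) point \<Rightarrow> real) set" where
  "H1_graph = {u. continuous_on_graph \<Gamma> u \<and> (\<forall>e\<in>edges \<Gamma>. H1_interval (len e) (edge u e))}"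

definition dv :: "(('v, 'e) point \<Rightarrow> real) \<Rightarrow> 'e \<Rightarrow> real \<Rightarrow> real" where
  "dv u e = weak_deriv (len e) (edge u e)"

definition energy :: "(('v, 'e) point \<Rightarrow> real) \<Rightarrow> real" where
  "energy u = (\<Sum>e\<in>edges \<Gamma>. LINT x|Leb e. (dv u e x)\<^sup>2)"

lemma H1_deriv:
  assumes "u \<in> H1_graph" "e \<in> edges \<Gamma>" shows "has_L2_deriv (len e) (edge u e) (dv u e)"
  using assms continuous_on_edge elen_pos unfolding H1_graph_def dv_def
  by (auto intro!: H1_continuous_has_L2_deriv)

lemma H1_graphI:
  assumes "continuous_on_graph \<Gamma> u" "\<And>e. e \<in> edges \<Gamma> \<Longrightarrow> \<exists>g. has_L2_deriv (len e) (edge u e) g"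
  shows "u \<in> H1_graph"
  using assms has_L2_deriv_weak_deriv(1) elen_pos unfolding H1_graph_def by blast

lemma dv_unique:
  assumes "e \<in> edges \<Gamma>" "has_L2_deriv (len e) (edge u e) g"
  shows "AE x in Leb e. dv u e x = g x"
  unfolding dv_def using has_L2_deriv_weak_deriv(3)[OF elen_pos] assms by blast

lemma H1_subset_L2: "H1_graph \<subseteq> L2_graph \<Gamma>"
  unfolding H1_graph_def L2_graph_def H1_interval_def by auto

lemma H1_lincomb:
  assumes "u \<in> H1_graph" "v \<in> H1_graph" shows "(\<lambda>p. c * u p + d * v p) \<in> H1_graph"
    and "e \<in> edges \<Gamma> \<Longrightarrow> AE x in Leb e. dv (\<lambda>p. c * u p + d * v p) e x = c * dv u e x + d * dv v e x"
proof -
  have l: "has_L2_deriv (len e) (edge (\<lambda>p. c * u p + d * v p) e) (\<lambda>x. c * dv u e x + d * dv v e x)"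
    if "e \<in> edges \<Gamma>" for e
    unfolding on_edge_lincomb by (intro has_L2_deriv_lincomb H1_deriv assms that)
  then show "e \<in> edges \<Gamma> \<Longrightarrow> AE x in Leb e. dv (\<lambda>p. c * u p + d * v p) e x = c * dv u e x + d * dv v e x"
    by (rule dv_unique[rotated])
  have "continuous_on_graph \<Gamma> (\<lambda>p. c * u p + d * v p)"
    using assms unfolding H1_graph_def continuous_on_graph_def
    by (auto intro!: continuous_map_add continuous_map_real_mult_left)
  then show "(\<lambda>p. c * u p + d * v p) \<in> H1_graph" using l by (intro H1_graphI) auto
qed

lemma dv_sq: "u \<in> H1_graph \<Longrightarrow> e \<in> edges \<Gamma> \<Longrightarrow> square_integrable (len e) (dv u e)"
  using has_L2_derivD(1)[OF H1_deriv] .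

text \<open>No path leaves an isolated vertex, whereas connectedness joins every vertex to an end of
  some edge. Positivity gives sense to the division by \<open>d0\<close>.\<close>

lemma degree_pos: "v \<in> vertices \<Gamma> \<Longrightarrow> 0 < degree \<Gamma> v"
proof (rule ccontr)
  assume v: "v \<in> vertices \<Gamma>" and "\<not> 0 < degree \<Gamma> v"
  interpret fin_digraph "skel \<Gamma>" using compact by (simp add: compact_metric_graph_def)
  have "out_arcs (skel \<Gamma>) v = {}" "in_arcs (skel \<Gamma>) v = {}"
    using \<open>\<not> 0 < degree \<Gamma> v\<close> finite_subset[of "out_arcs (skel \<Gamma>) v" "edges \<Gamma>"] finite_subset[of "in_arcs (skel \<Gamma>) v" "edges \<Gamma>"] fin_edges
    by (auto simp: degree_def out_degree_def in_degree_def out_arcs_def in_arcs_def)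
  then have no: "tail (skel \<Gamma>) e \<noteq> v" "head (skel \<Gamma>) e \<noteq> v" if "e \<in> edges \<Gamma>" for e
    using that by (auto simp: out_arcs_def in_arcs_def)
  have stay: "q = Vertex v" if "graph_path \<Gamma> (Vertex v) q t" for q t
    using that
  proof induction
    case (step e x t y)
    then show ?case using no[of e] by (auto simp: edge_point_def split: if_splits)
  qed simp
  obtain e where e: "e \<in> edges \<Gamma>" using edges_ne by blast
  then obtain t where "graph_path \<Gamma> (Vertex v) (Vertex (tail (skel \<Gamma>) e)) t"
    using path_exists_vertices[OF compact conn v] end_verts by blast
  from stay[OF this] no(1)[OF e] show False by simp
qed

lemma sum_out_arcs: "(\<Sum>v\<in>vertices \<Gamma>. \<Sum>e\<in>out_arcs (skel \<Gamma>) v. h e) = (\<Sum>e\<in>edges \<Gamma>. h e :: real)"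
proof -
  have "out_arcs (skel \<Gamma>) v = {e \<in> edges \<Gamma>. tail (skel \<Gamma>) e = v}" for v by (auto simp: out_arcs_def)
  then show ?thesis using end_verts by (simp add: sum.group[OF fin_edges fin_verts, of "tail (skel \<Gamma>)"] image_subset_iff)
qed

lemma sum_in_arcs: "(\<Sum>v\<in>vertices \<Gamma>. \<Sum>e\<in>in_arcs (skel \<Gamma>) v. h e) = (\<Sum>e\<in>edges \<Gamma>. h e :: real)"
proof -
  have "in_arcs (skel \<Gamma>) v = {e \<in> edges \<Gamma>. head (skel \<Gamma>) e = v}" for v by (auto simp: in_arcs_def)
  then show ?thesis using end_verts by (simp add: sum.group[OF fin_edges fin_verts, of "head (skel \<Gamma>)"] image_subset_iff)
qed

text \<open>Each edge is counted at both of its ends; a loop occurs in both arc sets of its vertex,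
  in accordance with its double weight in \<open>degree\<close>.\<close>

lemma sum_degree:
  "(\<Sum>v\<in>vertices \<Gamma>. real (degree \<Gamma> v) * h v) = (\<Sum>e\<in>edges \<Gamma>. h (tail (skel \<Gamma>) e) + h (head (skel \<Gamma>) e))"
proof -
  have "(\<Sum>v\<in>vertices \<Gamma>. real (degree \<Gamma> v) * h v) =
      (\<Sum>v\<in>vertices \<Gamma>. (\<Sum>e\<in>out_arcs (skel \<Gamma>) v. h (tail (skel \<Gamma>) e)) + (\<Sum>e\<in>in_arcs (skel \<Gamma>) v. h (head (skel \<Gamma>) e)))"
    by (intro sum.cong) (auto simp: degree_def out_degree_def in_degree_def distrib_right)
  then show ?thesis unfolding sum.distrib sum_out_arcs sum_in_arcs .
qed

end

section \<open>Coercivity of the form with vertex terms\<close>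

locale kirchhoff_graph = metric_graph_locale \<Gamma>
  for \<Gamma> :: "('v, 'e) metric_graph" +
  fixes \<kappa> a :: "('v, 'e) point \<Rightarrow> real" and \<kappa>0 a0 \<alpha> S :: real and d0 :: nat
  assumes kappa: "\<kappa> \<in> Linfty_graph \<Gamma>" "0 < \<kappa>0"
      "\<forall>e\<in>edges \<Gamma>. AE x in Leb e. \<kappa>0 \<le> edge \<kappa> e x"
    and a: "Lipschitz_on_graph \<Gamma> a" "\<forall>p\<in>points \<Gamma>. 0 < a p"
      "a0 \<in> a ` points \<Gamma>" "\<forall>p\<in>points \<Gamma>. a0 \<le> a p"
    and d0: "d0 = Min (degree \<Gamma> ` vertices \<Gamma>)"
    and S: "S = \<bar>\<alpha>\<bar> / real d0"
    and alpha: "0 \<le> \<alpha> \<or>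
      (\<kappa>0\<^sup>2 > 4 * S / Min (len ` edges \<Gamma>) \<and> 2 * S * Max (len ` edges \<Gamma>) \<le> a0)"
begin

definition form :: "(('v, 'e) point \<Rightarrow> real) \<Rightarrow> (('v, 'e) point \<Rightarrow> real) \<Rightarrow> real" where
  "form = bilinear_form \<Gamma> \<kappa> a \<alpha>"

lemma a0_pos: "0 < a0" using a by auto

lemma a_edge: "e \<in> edges \<Gamma> \<Longrightarrow> a0 \<le> edge a e x"
  using a(4) edge_point_in[OF compact] by (simp add: on_edge_def)

lemma a_cont: "e \<in> edges \<Gamma> \<Longrightarrow> continuous_on {0..len e} (edge a e)"
proof (rule continuous_on_edge)
  show "continuous_on_graph \<Gamma> a"
    using a(1) Lipschitz_continuous_imp_continuous_map unfolding continuous_on_graph_def Lipschitz_on_graph_def by fastforce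
qed

lemma a_bound: obtains A where "\<And>e x. e \<in> edges \<Gamma> \<Longrightarrow> x \<in> {0..len e} \<Longrightarrow> \<bar>edge a e x\<bar> \<le> A"
proof -
  have "\<exists>A. \<forall>x\<in>{0..len e}. \<bar>edge a e x\<bar> \<le> A" if "e \<in> edges \<Gamma>" for e
    using compact_imp_bounded[OF compact_continuous_image[OF a_cont[OF that]]] by (auto simp: bounded_iff)
  then obtain A where A: "\<And>e x. e \<in> edges \<Gamma> \<Longrightarrow> x \<in> {0..len e} \<Longrightarrow> \<bar>edge a e x\<bar> \<le> A e"
    by metis
  show thesis
  proof (rule that[of "Max (A ` edges \<Gamma>)"])
    fix e x assume e: "e \<in> edges \<Gamma>" "x \<in> {0..len e}"
    have "A e \<le> Max (A ` edges \<Gamma>)" using fin_edges e by simp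
    then show "\<bar>edge a e x\<bar> \<le> Max (A ` edges \<Gamma>)" using A[OF e] by linarith
  qed
qed

lemma a_sq:
  assumes "e \<in> edges \<Gamma>" "square_integrable (len e) g"
  shows "square_integrable (len e) (\<lambda>x. edge a e x * g x)"
proof -
  obtain A where "\<And>x. x \<in> {0..len e} \<Longrightarrow> \<bar>edge a e x\<bar> \<le> A" using a_bound assms(1) by metis
  then show ?thesis
    by (intro square_integrable_bounded_mult[OF assms(2) continuous_on_measurable_interval[OF a_cont[OF assms(1)]], of A]) auto
qed

lemma kappa_sq_bound:
  obtains K where "0 \<le> K" "\<And>e. e \<in> edges \<Gamma> \<Longrightarrow> AE x in Leb e. \<bar>(edge \<kappa> e x)\<^sup>2\<bar> \<le> K"
proof -
  have "\<exists>B. AE x in Leb e. \<bar>edge \<kappa> e x\<bar> \<le> B" if "e \<in> edges \<Gamma>" for e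
    using kappa(1) that by (auto simp: Linfty_graph_def)
  then obtain B where B: "\<And>e. e \<in> edges \<Gamma> \<Longrightarrow> AE x in Leb e. \<bar>edge \<kappa> e x\<bar> \<le> B e" by metis
  define K where "K = (\<Sum>e\<in>edges \<Gamma>. (B e)\<^sup>2)"
  show thesis
  proof (rule that[of K])
    fix e assume e: "e \<in> edges \<Gamma>"
    have BK: "(B e)\<^sup>2 \<le> K" unfolding K_def using fin_edges e by (intro member_le_sum) auto
    show "AE x in Leb e. \<bar>(edge \<kappa> e x)\<^sup>2\<bar> \<le> K"
      using B[OF e]
    proof eventually_elim
      case (elim x)
      then have "(edge \<kappa> e x)\<^sup>2 \<le> (B e)\<^sup>2" by (metis abs_ge_zero power2_abs power_mono)
      then show ?case using BK by simp
    qed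
  qed (auto simp: K_def sum_nonneg)
qed

lemma kappa_meas: "e \<in> edges \<Gamma> \<Longrightarrow> edge \<kappa> e \<in> borel_measurable (Leb e)"
  using kappa(1) by (auto simp: Linfty_graph_def)

lemma kappa_sq:
  assumes "e \<in> edges \<Gamma>" "square_integrable (len e) g"
  shows "square_integrable (len e) (\<lambda>x. (edge \<kappa> e x)\<^sup>2 * g x)"
proof -
  obtain K where K: "\<And>e. e \<in> edges \<Gamma> \<Longrightarrow> AE x in Leb e. \<bar>(edge \<kappa> e x)\<^sup>2\<bar> \<le> K"
    using kappa_sq_bound by blast
  show ?thesis
    using kappa_meas[OF assms(1)] by (intro square_integrable_bounded_mult[OF assms(2) _ K[OF assms(1)]]) auto
qed

lemma kappa_L2: "u \<in> L2_graph \<Gamma> \<Longrightarrow> (\<lambda>p. (\<kappa> p)\<^sup>2 * u p) \<in> L2_graph \<Gamma>"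
  using kappa_sq by (auto simp: L2_graph_def on_edge_def)

lemma form_eq:
  "form f g = ip (\<lambda>p. (\<kappa> p)\<^sup>2 * f p) g +
     (\<Sum>e\<in>edges \<Gamma>. LINT x|Leb e. edge a e x * dv f e x * dv g e x) +
     (\<Sum>v\<in>vertices \<Gamma>. \<alpha> * f (Vertex v) * g (Vertex v))"
  by (simp add: form_def bilinear_form_def dv_def)

lemma d0_pos: "0 < d0"
proof -
  have "vertices \<Gamma> \<noteq> {}" using edges_ne end_verts by blast
  then have "d0 \<in> degree \<Gamma> ` vertices \<Gamma>" unfolding d0 using fin_verts by (intro Min_in) auto
  then show ?thesis using degree_pos by auto
qed

text \<open>Since \<open>S * d0\<close> is the modulus of \<open>\<alpha>\<close> and
  \<open>d0\<close> is the least degree, each vertex term can be distributed over the incident edge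
  ends, with weight at most \<open>S\<close> at each.\<close>

lemma vertex_sum_bound:
  assumes "u \<in> H1_graph"
  shows "\<bar>\<alpha>\<bar> * (\<Sum>v\<in>vertices \<Gamma>. (u (Vertex v))\<^sup>2) \<le> S * (\<Sum>e\<in>edges \<Gamma>. (edge u e 0)\<^sup>2 + (edge u e (len e))\<^sup>2)"
proof -
  have "real d0 * (\<Sum>v\<in>vertices \<Gamma>. (u (Vertex v))\<^sup>2) \<le> (\<Sum>v\<in>vertices \<Gamma>. real (degree \<Gamma> v) * (u (Vertex v))\<^sup>2)"
    unfolding sum_distrib_left using fin_verts by (intro sum_mono mult_right_mono) (auto simp: d0)
  also have "\<dots> = (\<Sum>e\<in>edges \<Gamma>. (edge u e 0)\<^sup>2 + (edge u e (len e))\<^sup>2)"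
    unfolding sum_degree by (intro sum.cong) (auto simp: on_edge_ends)
  finally have "S * (real d0 * (\<Sum>v\<in>vertices \<Gamma>. (u (Vertex v))\<^sup>2)) \<le> S * (\<Sum>e\<in>edges \<Gamma>. (edge u e 0)\<^sup>2 + (edge u e (len e))\<^sup>2)"
    by (rule mult_left_mono) (simp add: S)
  moreover have "S * (real d0 * t) = \<bar>\<alpha>\<bar> * t" for t using d0_pos by (simp add: S)
  ultimately show ?thesis by simp
qed

lemma L2_self: "ip u u = (\<Sum>e\<in>edges \<Gamma>. LINT x|Leb e. (edge u e x)\<^sup>2)"
  by (simp add: L2_inner_def power2_eq_square)

lemma energy_nonneg: "0 \<le> energy u" unfolding energy_def by (intro sum_nonneg) simp

text \<open>The trace inequality with the whole edge as segment, used at both ends.\<close>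

lemma edge_trace:
  assumes u: "u \<in> H1_graph" and s: "0 < s"
  shows "(\<Sum>e\<in>edges \<Gamma>. (edge u e 0)\<^sup>2 + (edge u e (len e))\<^sup>2)
    \<le> 2 * (1 + s) / Min (len ` edges \<Gamma>) * ip u u + (1 + 1 / s) * Max (len ` edges \<Gamma>) * energy u"
  unfolding L2_self energy_def sum_distrib_left sum.distrib[symmetric]
proof (rule sum_mono)
  fix e assume e: "e \<in> edges \<Gamma>"
  let ?l = "len e"
  define I where "I = (LINT x|leb ?l. (edge u e x)\<^sup>2)"
  define J where "J = (LINT x|leb ?l. (dv u e x)\<^sup>2)"
  have l: "0 < ?l" using elen_pos[OF e] .
  note t = L2_interval_trace[OF less_imp_le[OF l] H1_deriv[OF u e] order_refl l, simplified, OF _ s]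
  have "(edge u e 0)\<^sup>2 \<le> (1 + s) / ?l * I + (1 + 1 / s) * (?l / 2) * J"
    "(edge u e ?l)\<^sup>2 \<le> (1 + s) / ?l * I + (1 + 1 / s) * (?l / 2) * J"
    using t[of 0] t[of ?l] by (simp_all add: I_def J_def)
  then have "(edge u e 0)\<^sup>2 + (edge u e ?l)\<^sup>2 \<le> 2 * ((1 + s) / ?l * I + (1 + 1 / s) * (?l / 2) * J)"
    unfolding mult_2 by (rule add_mono)
  also have "\<dots> = 2 * (1 + s) / ?l * I + (1 + 1 / s) * ?l * J" by (simp add: distrib_left)
  also have "\<dots> \<le> 2 * (1 + s) / Min (len ` edges \<Gamma>) * I + (1 + 1 / s) * Max (len ` edges \<Gamma>) * J"
  proof -
    have mn: "Min (len ` edges \<Gamma>) \<le> ?l" "?l \<le> Max (len ` edges \<Gamma>)" using fin_edges e by auto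
    have "0 < Min (len ` edges \<Gamma>)" using fin_edges edges_ne elen_pos by simp
    then show ?thesis
      using mn l s by (intro add_mono mult_right_mono divide_left_mono mult_left_mono) (auto simp: I_def J_def)
  qed
  finally show "(edge u e 0)\<^sup>2 + (edge u e ?l)\<^sup>2 \<le>
     2 * (1 + s) / Min (len ` edges \<Gamma>) * (LINT x|leb ?l. (edge u e x)\<^sup>2)
     + (1 + 1 / s) * Max (len ` edges \<Gamma>) * (LINT x|leb ?l. (dv u e x)\<^sup>2)"
    by (simp add: I_def J_def)
qed

lemma form_lower:
  assumes u: "u \<in> H1_graph"
  shows "\<kappa>0\<^sup>2 * ip u u + a0 * energy u + \<alpha> * (\<Sum>v\<in>vertices \<Gamma>. (u (Vertex v))\<^sup>2) \<le> form u u"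
proof -
  have uL: "u \<in> L2_graph \<Gamma>" using u H1_subset_L2 by blast
  have sq: "square_integrable (len e) (edge u e)" if "e \<in> edges \<Gamma>" for e using uL that by (simp add: L2_graph_def)
  have 1: "\<kappa>0\<^sup>2 * ip u u \<le> ip (\<lambda>p. (\<kappa> p)\<^sup>2 * u p) u"
    unfolding L2_self L2_inner_def[of \<Gamma> "\<lambda>p. (\<kappa> p)\<^sup>2 * u p"] sum_distrib_left
  proof (rule sum_mono)
    fix e assume e: "e \<in> edges \<Gamma>"
    let ?M = "Leb e"
    have oe: "edge (\<lambda>p. (\<kappa> p)\<^sup>2 * u p) e = (\<lambda>x. (edge \<kappa> e x)\<^sup>2 * edge u e x)" by (simp add: on_edge_def)
    have "\<kappa>0\<^sup>2 * (LINT x|?M. (edge u e x)\<^sup>2) = (LINT x|?M. \<kappa>0\<^sup>2 * (edge u e x)\<^sup>2)" by simp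
    also have "\<dots> \<le> (LINT x|?M. (edge \<kappa> e x)\<^sup>2 * edge u e x * edge u e x)"
    proof (rule integral_mono_AE)
      show "integrable ?M (\<lambda>x. (edge \<kappa> e x)\<^sup>2 * edge u e x * edge u e x)"
        by (intro square_integrable_mult_integrable kappa_sq sq e)
      show "AE x in ?M. \<kappa>0\<^sup>2 * (edge u e x)\<^sup>2 \<le> (edge \<kappa> e x)\<^sup>2 * edge u e x * edge u e x"
        using kappa(3)[rule_format, OF e]
      proof eventually_elim
        case (elim x)
        then have "\<kappa>0\<^sup>2 \<le> (edge \<kappa> e x)\<^sup>2" using kappa(2) by (intro power_mono) auto
        then have "\<kappa>0\<^sup>2 * (edge u e x)\<^sup>2 \<le> (edge \<kappa> e x)\<^sup>2 * (edge u e x)\<^sup>2" by (rule mult_right_mono) simp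
        then show ?case by (simp add: power2_eq_square mult.assoc)
      qed
    qed (use sq[OF e] in \<open>auto simp: square_integrable_def\<close>)
    finally show "\<kappa>0\<^sup>2 * (LINT x|?M. (edge u e x)\<^sup>2) \<le> (LINT x|?M. edge (\<lambda>p. (\<kappa> p)\<^sup>2 * u p) e x * edge u e x)"
      unfolding oe .
  qed
  have 2: "a0 * energy u \<le> (\<Sum>e\<in>edges \<Gamma>. LINT x|Leb e. edge a e x * dv u e x * dv u e x)"
    unfolding energy_def sum_distrib_left
  proof (rule sum_mono)
    fix e assume e: "e \<in> edges \<Gamma>"
    let ?M = "Leb e"
    have "a0 * (LINT x|?M. (dv u e x)\<^sup>2) = (LINT x|?M. a0 * (dv u e x)\<^sup>2)" by simp
    also have "\<dots> \<le> (LINT x|?M. edge a e x * dv u e x * dv u e x)"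
    proof (rule integral_mono)
      show "integrable ?M (\<lambda>x. edge a e x * dv u e x * dv u e x)"
        by (intro square_integrable_mult_integrable a_sq dv_sq u e)
      show "a0 * (dv u e x)\<^sup>2 \<le> edge a e x * dv u e x * dv u e x" for x
        using mult_right_mono[OF a_edge[OF e], of "(dv u e x)\<^sup>2" x] by (simp add: power2_eq_square mult.assoc)
    qed (use dv_sq[OF u e] in \<open>auto simp: square_integrable_def\<close>)
    finally show "a0 * (LINT x|?M. (dv u e x)\<^sup>2) \<le> (LINT x|?M. edge a e x * dv u e x * dv u e x)" .
  qed
  show ?thesis using 1 2 by (simp add: form_eq sum_distrib_left power2_eq_square mult.assoc)
qed

text \<open>For negative \<open>\<alpha>\<close>, the trace bound with \<open>s = 1\<close>
  reproduces exactly the constants of the hypothesis. Only the first of its two inequalities is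
  strict, so a part of its slack is spent on moving \<open>s\<close> above 1, which makes the second
  one strict as well.\<close>

lemma form_coercive:
  obtains \<delta> where "0 < \<delta>" "\<And>u. u \<in> H1_graph \<Longrightarrow> \<delta> * (ip u u + energy u) \<le> form u u"
proof (cases "0 \<le> \<alpha>")
  case True
  show thesis
  proof (rule that[of "min (\<kappa>0\<^sup>2) a0"])
    show "0 < min (\<kappa>0\<^sup>2) a0" using kappa(2) a0_pos by simp
    fix u assume u: "u \<in> H1_graph"
    have uL: "u \<in> L2_graph \<Gamma>" using u H1_subset_L2 by blast
    have "0 \<le> \<alpha> * (\<Sum>v\<in>vertices \<Gamma>. (u (Vertex v))\<^sup>2)" using True by (intro mult_nonneg_nonneg sum_nonneg) auto
    moreover have "min (\<kappa>0\<^sup>2) a0 * (ip u u + energy u) \<le> \<kappa>0\<^sup>2 * ip u u + a0 * energy u"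
      unfolding distrib_left using L2.pos[OF uL] energy_nonneg[of u] by (intro add_mono mult_right_mono) auto
    ultimately show "min (\<kappa>0\<^sup>2) a0 * (ip u u + energy u) \<le> form u u" using form_lower[OF u] by linarith
  qed
next
  case False
  let ?m = "Min (len ` edges \<Gamma>)" and ?X = "Max (len ` edges \<Gamma>)"
  have m: "0 < ?m" using fin_edges edges_ne elen_pos by simp
  obtain e where e: "e \<in> edges \<Gamma>" using edges_ne by blast
  have "len e \<le> ?X" using fin_edges e by simp
  then have X: "0 < ?X" using elen_pos[OF e] by linarith
  have Sp: "0 < S" unfolding S using False d0_pos by (intro divide_pos_pos) auto
  have al: "4 * S / ?m < \<kappa>0\<^sup>2" "2 * S * ?X \<le> a0" using alpha False by auto
  \<comment> \<open>With this value \<open>S * (2 * (1 + s) / ?m)\<close> is the midpoint of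
    \<open>4 * S / ?m\<close> and \<open>\<kappa>0\<^sup>2\<close>.\<close>
  define s where "s = 1 + (\<kappa>0\<^sup>2 * ?m / S - 4) / 4"
  have "4 * S < \<kappa>0\<^sup>2 * ?m" using al(1) m by (simp add: field_simps)
  then have s1: "1 < s" using Sp by (simp add: s_def field_simps)
  have c1: "S * (2 * (1 + s) / ?m) = 2 * S / ?m + \<kappa>0\<^sup>2 / 2" using Sp m by (simp add: s_def field_simps)
  have c1': "0 < \<kappa>0\<^sup>2 - S * (2 * (1 + s) / ?m)" using al(1) unfolding c1 by (simp add: field_simps)
  have "S * ((1 + 1 / s) * ?X) < S * (2 * ?X)"
    using s1 Sp X by (intro mult_strict_left_mono mult_strict_right_mono) auto
  then have c2': "0 < a0 - S * ((1 + 1 / s) * ?X)" using al(2) by simp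
  define \<delta> where "\<delta> = min (\<kappa>0\<^sup>2 - S * (2 * (1 + s) / ?m)) (a0 - S * ((1 + 1 / s) * ?X))"
  show thesis
  proof (rule that[of \<delta>])
    show "0 < \<delta>" using c1' c2' by (simp add: \<delta>_def)
    fix u assume u: "u \<in> H1_graph"
    have uL: "u \<in> L2_graph \<Gamma>" using u H1_subset_L2 by blast
    have "\<bar>\<alpha>\<bar> * (\<Sum>v\<in>vertices \<Gamma>. (u (Vertex v))\<^sup>2) \<le> S * (2 * (1 + s) / ?m * ip u u + (1 + 1 / s) * ?X * energy u)"
      using vertex_sum_bound[OF u] mult_left_mono[OF edge_trace[OF u, of s], of S] s1 Sp by linarith
    then have "\<alpha> * (\<Sum>v\<in>vertices \<Gamma>. (u (Vertex v))\<^sup>2) \<ge> - (S * (2 * (1 + s) / ?m)) * ip u u - S * ((1 + 1 / s) * ?X) * energy u"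
      using False by (simp add: algebra_simps)
    moreover have "\<delta> * (ip u u + energy u) \<le> (\<kappa>0\<^sup>2 - S * (2 * (1 + s) / ?m)) * ip u u + (a0 - S * ((1 + 1 / s) * ?X)) * energy u"
      unfolding distrib_left using L2.pos[OF uL] energy_nonneg[of u] by (intro add_mono mult_right_mono) (auto simp: \<delta>_def)
    ultimately show "\<delta> * (ip u u + energy u) \<le> form u u"
      using form_lower[OF u] by (simp add: left_diff_distrib)
  qed
qed

lemma semi_inner_form: "semi_inner H1_graph form"
proof
  have "has_L2_deriv (len e) (edge (\<lambda>_. 0) e) (\<lambda>_. 0)" for e
    by (intro has_L2_derivI) (auto simp: on_edge_def square_integrable_def)
  then show "(\<lambda>_. 0) \<in> H1_graph" by (intro H1_graphI) (auto simp: continuous_on_graph_def)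
  fix u v w :: "('v, 'e) point \<Rightarrow> real" and c d :: real
  assume u: "u \<in> H1_graph"
  then have uL: "u \<in> L2_graph \<Gamma>" using H1_subset_L2 by blast
  obtain \<delta> where \<delta>: "0 < \<delta>" "\<delta> * (ip u u + energy u) \<le> form u u" using form_coercive u by metis
  have "0 \<le> \<delta> * (ip u u + energy u)" using \<delta>(1) L2.pos[OF uL] energy_nonneg by (intro mult_nonneg_nonneg add_nonneg_nonneg) auto
  then show "0 \<le> form u u" using \<delta>(2) by linarith
  assume v: "v \<in> H1_graph"
  then have vL: "v \<in> L2_graph \<Gamma>" using H1_subset_L2 by blast
  show uv: "(\<lambda>p. c * u p + d * v p) \<in> H1_graph" by (rule H1_lincomb(1)[OF u v])
  show "form u v = form v u" by (simp add: form_eq L2_inner_def on_edge_def mult_ac)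
  assume w: "w \<in> H1_graph"
  then have wL: "w \<in> L2_graph \<Gamma>" using H1_subset_L2 by blast
  have "ip (\<lambda>p. (\<kappa> p)\<^sup>2 * (c * u p + d * v p)) w = ip (\<lambda>p. c * ((\<kappa> p)\<^sup>2 * u p) + d * ((\<kappa> p)\<^sup>2 * v p)) w"
    by (simp add: algebra_simps)
  then have 1: "ip (\<lambda>p. (\<kappa> p)\<^sup>2 * (c * u p + d * v p)) w = c * ip (\<lambda>p. (\<kappa> p)\<^sup>2 * u p) w + d * ip (\<lambda>p. (\<kappa> p)\<^sup>2 * v p) w"
    using L2.lincomb_left[OF kappa_L2[OF uL] kappa_L2[OF vL] wL] by simp
  have 2: "(LINT x|Leb e. edge a e x * dv (\<lambda>p. c * u p + d * v p) e x * dv w e x) =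
      c * (LINT x|Leb e. edge a e x * dv u e x * dv w e x) +
      d * (LINT x|Leb e. edge a e x * dv v e x * dv w e x)" if e: "e \<in> edges \<Gamma>" for e
  proof -
    let ?M = "Leb e"
    have i: "integrable ?M (\<lambda>x. edge a e x * dv z e x * dv w e x)" if "z \<in> H1_graph" for z
      by (intro square_integrable_mult_integrable a_sq dv_sq that w e)
    have "(LINT x|?M. edge a e x * dv (\<lambda>p. c * u p + d * v p) e x * dv w e x) =
        (LINT x|?M. c * (edge a e x * dv u e x * dv w e x) + d * (edge a e x * dv v e x * dv w e x))"
    proof (rule integral_cong_AE)
      show "AE x in ?M. edge a e x * dv (\<lambda>p. c * u p + d * v p) e x * dv w e x =
          c * (edge a e x * dv u e x * dv w e x) + d * (edge a e x * dv v e x * dv w e x)"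
        using H1_lincomb(2)[OF u v e, of c d]
      proof eventually_elim
        case (elim x)
        show ?case unfolding elim by (simp add: algebra_simps)
      qed
    qed (use i[OF uv] i[OF u] i[OF v] in auto)
    also have "\<dots> = c * (LINT x|?M. edge a e x * dv u e x * dv w e x) + d * (LINT x|?M. edge a e x * dv v e x * dv w e x)"
      using i[OF u] i[OF v] by simp
    finally show ?thesis .
  qed
  have 3: "(\<Sum>q\<in>vertices \<Gamma>. \<alpha> * (c * u (Vertex q) + d * v (Vertex q)) * w (Vertex q)) =
      c * (\<Sum>q\<in>vertices \<Gamma>. \<alpha> * u (Vertex q) * w (Vertex q)) + d * (\<Sum>q\<in>vertices \<Gamma>. \<alpha> * v (Vertex q) * w (Vertex q))"
    by (simp add: sum_distrib_left sum.distrib[symmetric] algebra_simps)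
  show "form (\<lambda>p. c * u p + d * v p) w = c * form u w + d * form v w"
    unfolding form_eq 1 3 by (simp add: 2 sum.distrib sum_distrib_left[symmetric] distrib_left)
qed

sublocale H1: semi_inner H1_graph form by (rule semi_inner_form)

end

section \<open>Finite elements\<close>

text \<open>Induction on the functionals: the kernel of one of them has codimension at most 1, so
  each costs one more spanning vector. For finite elements they are the nodal values.\<close>

lemma finite_functionals_span:
  fixes V :: "('p \<Rightarrow> real) set"
  assumes "finite I" "pointwise.subspace V"
    and lin: "\<And>i u v c. i \<in> I \<Longrightarrow> f i (\<lambda>p. u p - c * v p) = f i u - c * (f i v :: real)"
    and "\<And>v. v \<in> V \<Longrightarrow> (\<And>i. i \<in> I \<Longrightarrow> f i v = 0) \<Longrightarrow> v = (\<lambda>_. 0)"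
  shows "\<exists>S. finite S \<and> V \<subseteq> pointwise.span S"
  using assms
proof (induction I arbitrary: V)
  case empty
  have "v = 0" if "v \<in> V" for v
    using empty.prems(3)[OF that] by (simp add: zero_fun_def)
  then have "V \<subseteq> pointwise.span {}" by (simp add: subset_iff)
  then show ?case by blast
next
  case (insert i I)
  let ?W = "{v \<in> V. f i v = 0}"
  have "\<exists>S. finite S \<and> ?W \<subseteq> pointwise.span S"
  proof (rule insert.IH)
    show "pointwise.subspace ?W"
      unfolding pointwise.subspace_def
    proof (intro conjI ballI allI)
      have z: "(\<lambda>_. 0) \<in> V" using insert.prems(1) unfolding pointwise.subspace_def by (simp add: zero_fun_def)
      have f0: "f i (\<lambda>_. 0) = 0" using insert.prems(2)[of i "\<lambda>_. 0" 1 "\<lambda>_. 0"] by simp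
      then show "0 \<in> ?W" using z by (simp add: zero_fun_def)
      have fs: "f i (\<lambda>p. c * x p) = c * f i x" for c x
        using insert.prems(2)[of i "\<lambda>_. 0" "- c" x] f0 by simp
      show "x + y \<in> ?W" if "x \<in> ?W" "y \<in> ?W" for x y
        using that insert.prems(1) insert.prems(2)[of i x "-1" y] unfolding pointwise.subspace_def by (simp add: plus_fun_def)
      show "(\<lambda>p. c * x p) \<in> ?W" if "x \<in> ?W" for c x
        using that insert.prems(1) fs unfolding pointwise.subspace_def by simp
    qed
    show "\<And>j u v c. j \<in> I \<Longrightarrow> f j (\<lambda>p. u p - c * v p) = f j u - c * f j v" using insert.prems(2) by blast
    show "\<And>v. v \<in> ?W \<Longrightarrow> (\<And>j. j \<in> I \<Longrightarrow> f j v = 0) \<Longrightarrow> v = (\<lambda>_. 0)" using insert.prems(3) by blast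
  qed
  then obtain S where S: "finite S" "?W \<subseteq> pointwise.span S" by blast
  show ?case
  proof (cases "\<exists>v\<in>V. f i v \<noteq> 0")
    case False
    then show ?thesis using S by blast
  next
    case True
    then obtain v where v: "v \<in> V" "f i v \<noteq> 0" by blast
    have "V \<subseteq> pointwise.span (insert v S)"
    proof
      fix u assume u: "u \<in> V"
      define c where "c = f i u / f i v"
      have "(\<lambda>p. (- c) * v p) \<in> V" using insert.prems(1) v(1) unfolding pointwise.subspace_def by blast
      then have "u + (\<lambda>p. (- c) * v p) \<in> V" using insert.prems(1) u unfolding pointwise.subspace_def by blast
      moreover have "u + (\<lambda>p. (- c) * v p) = (\<lambda>p. u p - c * v p)" by (auto simp: fun_eq_iff)
      ultimately have "(\<lambda>p. u p - c * v p) \<in> ?W" using insert.prems(2)[of i u c v] v(2) by (simp add: c_def)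
      then have "(\<lambda>p. u p - c * v p) \<in> pointwise.span (insert v S)"
        using S(2) pointwise.span_mono[of S "insert v S"] by blast
      moreover have "(\<lambda>p. c * v p) \<in> pointwise.span (insert v S)"
        by (rule pointwise.span_scale[OF pointwise.span_base]) simp
      ultimately have "(\<lambda>p. u p - c * v p) + (\<lambda>p. c * v p) \<in> pointwise.span (insert v S)"
        by (rule pointwise.span_add)
      moreover have "(\<lambda>p. u p - c * v p) + (\<lambda>p. c * v p) = u" by (auto simp: fun_eq_iff)
      ultimately show "u \<in> pointwise.span (insert v S)" by simp
    qed
    then show ?thesis using S(1) by blast
  qed
qed

lemma cell_exists:
  assumes "0 < h" "0 < (n::nat)" "x \<in> {0..real n * h}"
  obtains i where "i < n" "x \<in> {real i * h..real (i + 1) * h}"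
\<comment> \<open>At the right end the floor of \<open>x / h\<close> would be \<open>n\<close>,
  which is not the index of a cell; the last cell is taken.\<close>
proof (cases "x = real n * h")
  case True
  then show ?thesis using assms by (intro that[of "n - 1"]) (auto simp: of_nat_diff)
next
  case False
  define i where "i = nat \<lfloor>x / h\<rfloor>"
  have x: "0 \<le> x / h" using assms by simp
  then have i: "real i \<le> x / h" "x / h < real i + 1" by (auto simp: i_def)
  have "x / h < real n" using assms False by (simp add: field_simps)
  then have "i < n" using i(1) by linarith
  then show ?thesis using i assms(1) by (intro that[of i]) (auto simp: field_simps)
qed

text \<open>The floor formula is the derivative except at finitely many nodes, which the fundamental
  theorem tolerates for a continuous function.\<close>

lemma piecewise_affine_has_L2_deriv:
  assumes h: "0 < h" and n: "0 < (n::nat)" and l: "l = real n * h"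
    and aff: "\<And>i x. i < n \<Longrightarrow> x \<in> {real i * h..real (i + 1) * h} \<Longrightarrow> u x = c i + d i * x"
  shows "has_L2_deriv l u (\<lambda>x. d (nat \<lfloor>x / h\<rfloor>))"
proof -
  have cells: "{0..l} = (\<Union>i<n. {real i * h..real (i + 1) * h})"
  proof
    show "{0..l} \<subseteq> (\<Union>i<n. {real i * h..real (i + 1) * h})"
    proof
      fix x assume "x \<in> {0..l}"
      then obtain i where "i < n" "x \<in> {real i * h..real (i + 1) * h}" using cell_exists[OF h n] unfolding l by blast
      then show "x \<in> (\<Union>i<n. {real i * h..real (i + 1) * h})" by blast
    qed
    have "{real i * h..real (i + 1) * h} \<subseteq> {0..l}" if "i < n" for i
    proof -
      have "real (i + 1) * h \<le> l" unfolding l using that h by (intro mult_right_mono) auto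
      moreover have "0 \<le> real i * h" using h by simp
      ultimately show ?thesis by (simp only: atLeastatMost_subset_iff simp_thms)
    qed
    then show "(\<Union>i<n. {real i * h..real (i + 1) * h}) \<subseteq> {0..l}" by blast
  qed
  have cont: "continuous_on {0..l} u"
    unfolding cells
  proof (rule continuous_on_closed_Union)
    fix i assume "i \<in> {..<n}"
    then have "continuous_on {real i * h..real (i + 1) * h} u \<longleftrightarrow> continuous_on {real i * h..real (i + 1) * h} (\<lambda>x. c i + d i * x)"
      using aff by (intro continuous_on_cong) auto
    then show "continuous_on {real i * h..real (i + 1) * h} u" by (auto intro!: continuous_intros)
  qed auto
  have meas: "(\<lambda>x. d (nat \<lfloor>x / h\<rfloor>)) \<in> borel_measurable borel"
    by measurable
  \<comment> \<open>The index \<open>n\<close> is included, because the floor of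
    \<open>x / h\<close> equals \<open>n\<close> at \<open>x = l\<close>.\<close>
  define D where "D = (\<Sum>i\<le>n. \<bar>d i\<bar>)"
  have D: "\<bar>d (nat \<lfloor>x / h\<rfloor>)\<bar> \<le> D" if "x \<in> {0..l}" for x
  proof -
    have "x / h \<le> real n" using that h unfolding l by (simp add: field_simps)
    then have "nat \<lfloor>x / h\<rfloor> \<le> n" by linarith
    then show ?thesis unfolding D_def by (intro member_le_sum) auto
  qed
  show ?thesis
  proof (rule has_L2_derivI)
    have "square_integrable l (\<lambda>x. d (nat \<lfloor>x / h\<rfloor>) * 1)"
    proof (rule square_integrable_bounded_mult[where B=D])
      show "square_integrable l (\<lambda>_. 1)" by (intro square_integrable_continuous continuous_on_const)
      show "(\<lambda>x. d (nat \<lfloor>x / h\<rfloor>)) \<in> borel_measurable (lebesgue_on {0..l})" by (rule borel_measurable_lebesgue_on[OF meas])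
      show "AE x in lebesgue_on {0..l}. \<bar>d (nat \<lfloor>x / h\<rfloor>)\<bar> \<le> D" using D by (intro AE_I2) simp
    qed
    then show "square_integrable l (\<lambda>x. d (nat \<lfloor>x / h\<rfloor>))" by simp
    fix x assume x: "x \<in> {0..l}"
    have "((\<lambda>x. d (nat \<lfloor>x / h\<rfloor>)) has_integral (u x - u 0)) {0..x}"
    proof (rule fundamental_theorem_of_calculus_interior_strong[of "(\<lambda>i. real i * h) ` {..n}"])
      fix t assume t: "t \<in> {0<..<x} - (\<lambda>i. real i * h) ` {..n}"
      define i where "i = nat \<lfloor>t / h\<rfloor>"
      have t0: "0 < t" "t < l" using t x by auto
      have th: "0 \<le> t / h" "t / h < real n" using t0 h unfolding l by (auto simp: field_simps)
      have i: "real i \<le> t / h" "t / h < real i + 1" using th by (auto simp: i_def)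
      then have "i < n" using th by linarith
      have "real i \<noteq> t / h" using t \<open>i < n\<close> h by (auto simp: field_simps)
      then have ti: "t \<in> {real i * h<..<real (i + 1) * h}" using i h by (auto simp: field_simps less_le)
      have ev: "\<forall>\<^sub>F y in nhds t. c i + d i * y = u y"
        using eventually_nhds_in_open[OF open_greaterThanLessThan ti]
      proof eventually_elim
        case (elim y)
        then show ?case using aff[OF \<open>i < n\<close>, of y] by (simp add: less_imp_le)
      qed
      have der: "((\<lambda>x. c i + d i * x) has_field_derivative d i) (at t)" by (auto intro!: derivative_eq_intros)
      from DERIV_cong_ev[OF refl ev refl] der have "(u has_field_derivative d i) (at t)" by blast
      then show "(u has_vector_derivative d (nat \<lfloor>t / h\<rfloor>)) (at t)"
        by (simp add: i_def has_real_derivative_iff_has_vector_derivative)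
    qed (use x cont in \<open>auto elim: continuous_on_subset\<close>)
    then show "u x = u 0 + integral {0..x} (\<lambda>x. d (nat \<lfloor>x / h\<rfloor>))" by (simp add: integral_unique)
  qed
qed

section \<open>The finite element space\<close>

context metric_graph_locale
begin

lemma mesh_width_facts:
  assumes "e \<in> edges \<Gamma>" "0 < n e"
  shows "0 < mesh_width \<Gamma> n e" "len e = real (n e) * mesh_width \<Gamma> n e" "mesh_width \<Gamma> n e \<le> max_mesh_width \<Gamma> n"
    "mesh_width \<Gamma> n e \<le> len e"
proof -
  show 1: "0 < mesh_width \<Gamma> n e" "len e = real (n e) * mesh_width \<Gamma> n e"
    using elen_pos assms by (auto simp: mesh_width_def)
  show "mesh_width \<Gamma> n e \<le> max_mesh_width \<Gamma> n" using fin_edges assms by (simp add: max_mesh_width_def)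
  have "1 * mesh_width \<Gamma> n e \<le> real (n e) * mesh_width \<Gamma> n e" using assms 1(1) by (intro mult_right_mono) auto
  then show "mesh_width \<Gamma> n e \<le> len e" using 1(2) by simp
qed

lemma fem_on_edge:
  assumes "u \<in> fem_space \<Gamma> n" "e \<in> edges \<Gamma>" "0 < n e"
  obtains d where "has_L2_deriv (len e) (edge u e) d"
    "\<And>x. (\<And>i. i \<le> n e \<Longrightarrow> edge u e (real i * mesh_width \<Gamma> n e) = 0) \<Longrightarrow> x \<in> {0..len e} \<Longrightarrow> edge u e x = 0"
proof -
  let ?h = "mesh_width \<Gamma> n e"
  note m = mesh_width_facts[where n=n, OF assms(2,3)]
  have "\<forall>i. \<exists>c d. i < n e \<longrightarrow> (\<forall>x\<in>{real i * ?h..real (i + 1) * ?h}. edge u e x = c + d * x)"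
    using assms(1,2) unfolding fem_space_def by blast
  then obtain c d where cd: "\<And>i x. i < n e \<Longrightarrow> x \<in> {real i * ?h..real (i + 1) * ?h} \<Longrightarrow> edge u e x = c i + d i * x"
    by metis
  show thesis
  proof (rule that)
    show "has_L2_deriv (len e) (edge u e) (\<lambda>x. d (nat \<lfloor>x / ?h\<rfloor>))"
      by (rule piecewise_affine_has_L2_deriv[OF m(1) assms(3) m(2)]) (rule cd)
    fix x assume z: "\<And>i. i \<le> n e \<Longrightarrow> edge u e (real i * ?h) = 0" and x: "x \<in> {0..len e}"
    obtain i where i: "i < n e" "x \<in> {real i * ?h..real (i + 1) * ?h}"
      using cell_exists[OF m(1) assms(3)] x m(2) by metis
    have "real i * ?h \<le> real (i + 1) * ?h" using m(1) by (intro mult_right_mono) auto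
    then have 0: "c i + d i * (real i * ?h) = 0" "c i + d i * (real (i + 1) * ?h) = 0"
      using cd[OF i(1), of "real i * ?h"] cd[OF i(1), of "real (i + 1) * ?h"] z[of i] z[of "i + 1"] i(1) by simp_all
    have "(c i + d i * (real (i + 1) * ?h)) - (c i + d i * (real i * ?h)) = d i * ?h" by (simp add: algebra_simps)
    then have "d i = 0" using 0 m(1) by simp
    moreover from this have "c i = 0" using 0(1) by simp
    ultimately have "d i = 0" "c i = 0" by auto
    then show "edge u e x = 0" using cd[OF i] by simp
  qed
qed

lemma fem_subset_H1:
  assumes "\<And>e. e \<in> edges \<Gamma> \<Longrightarrow> 0 < n e" shows "fem_space \<Gamma> n \<subseteq> H1_graph"
proof
  fix u assume u: "u \<in> fem_space \<Gamma> n"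
  then have "continuous_on_graph \<Gamma> u" by (simp add: fem_space_def)
  then show "u \<in> H1_graph" using fem_on_edge[OF u _ assms] by (intro H1_graphI) blast+
qed

lemma fem_zero: "(\<lambda>_. 0) \<in> fem_space \<Gamma> n"
  by (auto simp: fem_space_def continuous_on_graph_def on_edge_def intro!: exI[of _ 0])

lemma fem_lincomb:
  assumes "u \<in> fem_space \<Gamma> n" "v \<in> fem_space \<Gamma> n" shows "(\<lambda>p. c * u p + d * v p) \<in> fem_space \<Gamma> n"
  unfolding fem_space_def
proof (intro CollectI conjI ballI allI impI)
  show "continuous_on_graph \<Gamma> (\<lambda>p. c * u p + d * v p)"
    using assms unfolding fem_space_def continuous_on_graph_def
    by (auto intro!: continuous_map_add continuous_map_real_mult_left)
  show "c * u p + d * v p = 0" if "p \<notin> points \<Gamma>" for p using assms that by (simp add: fem_space_def)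
  fix e i assume e: "e \<in> edges \<Gamma>" "i < n e"
  let ?I = "{real i * mesh_width \<Gamma> n e..real (i + 1) * mesh_width \<Gamma> n e}"
  obtain c1 d1 where 1: "\<forall>x\<in>?I. edge u e x = c1 + d1 * x" using assms(1) e unfolding fem_space_def by blast
  obtain c2 d2 where 2: "\<forall>x\<in>?I. edge v e x = c2 + d2 * x" using assms(2) e unfolding fem_space_def by blast
  show "\<exists>c' d'. \<forall>x\<in>?I. edge (\<lambda>p. c * u p + d * v p) e x = c' + d' * x"
    by (rule exI[of _ "c * c1 + d * c2"], rule exI[of _ "c * d1 + d * d2"])
      (use 1 2 in \<open>auto simp: on_edge_lincomb algebra_simps\<close>)
qed

lemma zero_on_edges_imp_zero:
  assumes "\<And>e x. e \<in> edges \<Gamma> \<Longrightarrow> x \<in> {0..len e} \<Longrightarrow> edge u e x = 0" "\<And>p. p \<notin> points \<Gamma> \<Longrightarrow> u p = 0"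
  shows "u = (\<lambda>_. 0)"
proof
  fix p
  show "u p = 0"
  proof (cases "p \<in> points \<Gamma>")
    case True
    then consider (v) v where "p = Vertex v" "v \<in> vertices \<Gamma>" | (i) e x where "p = Inner e x" "e \<in> edges \<Gamma>" "0 < x" "x < len e"
      by (auto simp: points_def)
    then show ?thesis
    proof cases
      case v
      have "out_arcs (skel \<Gamma>) v \<noteq> {} \<or> in_arcs (skel \<Gamma>) v \<noteq> {}"
        using degree_pos[OF v(2)] by (auto simp: degree_def out_degree_def in_degree_def)
      then obtain e where e: "e \<in> edges \<Gamma>" "tail (skel \<Gamma>) e = v \<or> head (skel \<Gamma>) e = v" by (auto simp: out_arcs_def in_arcs_def)
      have "0 \<in> {0..len e}" "len e \<in> {0..len e}" using elen_pos[OF e(1)] by auto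
      then show ?thesis
        using assms(1)[OF e(1)] on_edge_ends[OF e(1), of u] e(2) v(1) by metis
    next
      case i
      then show ?thesis using assms(1)[OF i(2), of x] by (simp add: on_edge_def edge_point_def)
    qed
  qed (rule assms(2))
qed

text \<open>Continuity turns a null function into zero on the edges, and the last hypothesis settles
  the points off the graph; on finite elements the \<open>L2\<close> product is therefore
  definite.\<close>

lemma L2_zero_imp:
  assumes u: "continuous_on_graph \<Gamma> u" "ip u u = 0" "\<And>p. p \<notin> points \<Gamma> \<Longrightarrow> u p = 0"
  shows "u = (\<lambda>_. 0)"
proof (rule zero_on_edges_imp_zero)
  fix e x assume e: "e \<in> edges \<Gamma>" "x \<in> {0..len e}"
  let ?M = "Leb e"
  have c: "continuous_on {0..len e} (edge u e)" by (rule continuous_on_edge[OF u(1) e(1)])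
  have "(LINT x|?M. (edge u e x)\<^sup>2) = 0"
    using u(2) fin_edges e(1) unfolding L2_inner_def
    by (subst (asm) sum_nonneg_eq_0_iff) (auto simp: power2_eq_square)
  then have "AE x in ?M. (edge u e x)\<^sup>2 = 0"
    using integral_nonneg_eq_0_iff_AE[of ?M "\<lambda>x. (edge u e x)\<^sup>2"] square_integrable_continuous[OF c]
    by (simp add: square_integrable_def)
  then have "AE x in ?M. edge u e x = 0" by eventually_elim simp
  then show "edge u e x = 0"
    using AE_eq_continuous_imp_eq[OF elen_pos[OF e(1)] c continuous_on_const _ e(2)] by blast
qed (rule u(3))

lemma fem_finite_span:
  assumes "\<And>e. e \<in> edges \<Gamma> \<Longrightarrow> 0 < n e"
  shows "\<exists>S. finite S \<and> fem_space \<Gamma> n \<subseteq> pointwise.span S"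
proof (rule finite_functionals_span)
  let ?I = "Sigma (edges \<Gamma>) (\<lambda>e. {..n e})"
  let ?f = "\<lambda>(e, i) u. edge u e (real i * mesh_width \<Gamma> n e)"
  show "finite ?I" using fin_edges by auto
  show "pointwise.subspace (fem_space \<Gamma> n)"
    unfolding pointwise.subspace_def
  proof (intro conjI ballI allI)
    show "0 \<in> fem_space \<Gamma> n" using fem_zero by (simp add: zero_fun_def)
    show "x + y \<in> fem_space \<Gamma> n" if "x \<in> fem_space \<Gamma> n" "y \<in> fem_space \<Gamma> n" for x y
      using fem_lincomb[OF that, of 1 1] by (simp add: plus_fun_def)
    show "(\<lambda>p. c * x p) \<in> fem_space \<Gamma> n" if "x \<in> fem_space \<Gamma> n" for c x
      using fem_lincomb[OF that that, of c 0] by simp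
  qed
  show "?f i (\<lambda>p. u p - c * v p) = ?f i u - c * ?f i v" for i u v c by (cases i) (simp add: on_edge_def)
  fix v assume v: "v \<in> fem_space \<Gamma> n" and z: "\<And>i. i \<in> ?I \<Longrightarrow> ?f i v = 0"
  show "v = (\<lambda>_. 0)"
  proof (rule zero_on_edges_imp_zero)
    fix e x assume e: "e \<in> edges \<Gamma>" "x \<in> {0..len e}"
    show "edge v e x = 0"
      using fem_on_edge[OF v e(1) assms[OF e(1)]] z[of "(e, _)"] e by (metis (no_types, lifting) SigmaI atMost_iff case_prod_conv)
  qed (use v in \<open>simp add: fem_space_def\<close>)
qed

section \<open>Nodal interpolation\<close>

definition slope :: "('e \<Rightarrow> nat) \<Rightarrow> (('v, 'e) point \<Rightarrow> real) \<Rightarrow> 'e \<Rightarrow> nat \<Rightarrow> real" where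
  "slope n z e i = (edge z e (real (i + 1) * mesh_width \<Gamma> n e) - edge z e (real i * mesh_width \<Gamma> n e)) / mesh_width \<Gamma> n e"

definition interp_edge :: "('e \<Rightarrow> nat) \<Rightarrow> (('v, 'e) point \<Rightarrow> real) \<Rightarrow> 'e \<Rightarrow> nat \<Rightarrow> real \<Rightarrow> real" where
  "interp_edge n z e i x = edge z e (real i * mesh_width \<Gamma> n e) + slope n z e i * (x - real i * mesh_width \<Gamma> n e)"

definition interpolant :: "('e \<Rightarrow> nat) \<Rightarrow> (('v, 'e) point \<Rightarrow> real) \<Rightarrow> ('v, 'e) point \<Rightarrow> real" where
  "interpolant n z p = (if p \<in> points \<Gamma> then
     (case p of Vertex v \<Rightarrow> z (Vertex v) | Inner e x \<Rightarrow> interp_edge n z e (nat \<lfloor>x / mesh_width \<Gamma> n e\<rfloor>) x) else 0)"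

text \<open>At an interior node the floor selects the cell to the right, and vertices take the value
  of \<open>z\<close> directly. The formula still holds on closed cells because neighbouring affine
  pieces agree at their common node.\<close>

lemma interpolant_on_cell:
  assumes e: "e \<in> edges \<Gamma>" "0 < n e" and i: "i < n e" "x \<in> {real i * mesh_width \<Gamma> n e..real (i + 1) * mesh_width \<Gamma> n e}"
  shows "edge (interpolant n z) e x = interp_edge n z e i x"
proof -
  let ?h = "mesh_width \<Gamma> n e"
  note m = mesh_width_facts[where n=n, OF e]
  have ends: "interp_edge n z e i (real i * ?h) = edge z e (real i * ?h)"
    "interp_edge n z e i (real (i + 1) * ?h) = edge z e (real (i + 1) * ?h)" for i
    using m(1) by (simp_all add: interp_edge_def slope_def field_simps)
  have V: "edge (interpolant n z) e 0 = edge z e 0" "edge (interpolant n z) e (len e) = edge z e (len e)"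
    using end_verts[OF e(1)] by (auto simp: on_edge_ends[OF e(1)] interpolant_def points_def)
  have "real (i + 1) * ?h \<le> real (n e) * ?h" using i(1) m(1) by (intro mult_right_mono) auto
  moreover have i0: "0 \<le> real i * ?h" using m(1) by simp
  moreover have ix: "real i * ?h \<le> x" "x \<le> real (i + 1) * ?h" using i(2) by simp_all
  ultimately have x: "0 \<le> x" "x \<le> len e" unfolding m(2) by linarith+
  consider "x = 0" | "x = len e" | "0 < x" "x < len e" using x by linarith
  then show ?thesis
  proof cases
    case 1
    then have "real i * ?h = 0" using ix(1) i0 by linarith
    then have "i = 0" using m(1) by simp
    then show ?thesis using V(1) ends(1)[of 0] 1 by simp
  next
    case 2
    then have "real (n e) * ?h \<le> real (i + 1) * ?h" using ix(2) m(2) by linarith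
    then have "real (n e) \<le> real (i + 1)" using m(1) by (rule mult_right_le_imp_le)
    then have "i + 1 = n e" using i(1) by linarith
    then have "x = real (i + 1) * ?h" using 2 m(2) by simp
    then show ?thesis using V(2) ends(2)[of i] 2 by simp
  next
    case 3
    then have "Inner e x \<in> points \<Gamma>" using e by (simp add: points_def)
    then have on: "edge (interpolant n z) e x = interp_edge n z e (nat \<lfloor>x / ?h\<rfloor>) x"
      using 3 by (simp add: on_edge_def edge_point_def interpolant_def)
    show ?thesis
    proof (cases "x = real (i + 1) * ?h")
      case True
      then have "x / ?h = real (i + 1)" using m(1) by simp
      then have "nat \<lfloor>x / ?h\<rfloor> = i + 1" by (simp only: floor_of_nat nat_int)
      then show ?thesis using on ends(1)[of "i + 1"] ends(2)[of i] True by simp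
    next
      case False
      then have "x < real (i + 1) * ?h" using ix(2) by linarith
      then have "x < (real i + 1) * ?h" by (simp add: add.commute)
      then have "real i \<le> x / ?h" "x / ?h < real i + 1" using ix(1) m(1) by (simp_all only: pos_le_divide_eq pos_divide_less_eq)
      then have "nat \<lfloor>x / ?h\<rfloor> = i" by linarith
      then show ?thesis using on by simp
    qed
  qed
qed

lemma interp_edge_affine:
  "interp_edge n z e i x = (edge z e (real i * mesh_width \<Gamma> n e) - slope n z e i * (real i * mesh_width \<Gamma> n e)) + slope n z e i * x"
  by (simp add: interp_edge_def right_diff_distrib)

lemma interpolant_deriv:
  assumes "e \<in> edges \<Gamma>" "0 < n e"
  shows "has_L2_deriv (len e) (edge (interpolant n z) e) (\<lambda>x. slope n z e (nat \<lfloor>x / mesh_width \<Gamma> n e\<rfloor>))"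
proof (rule piecewise_affine_has_L2_deriv[OF _ assms(2)])
  fix i x assume "i < n e" "x \<in> {real i * mesh_width \<Gamma> n e..real (i + 1) * mesh_width \<Gamma> n e}"
  from interpolant_on_cell[where n=n and z=z, OF assms this]
  show "edge (interpolant n z) e x = (edge z e (real i * mesh_width \<Gamma> n e) - slope n z e i * (real i * mesh_width \<Gamma> n e)) + slope n z e i * x"
    unfolding interp_edge_affine .
qed (rule mesh_width_facts[where n=n, OF assms])+

lemma interpolant_fem:
  assumes n: "\<And>e. e \<in> edges \<Gamma> \<Longrightarrow> 0 < n e"
  shows "interpolant n z \<in> fem_space \<Gamma> n"
  unfolding fem_space_def
proof (intro CollectI conjI ballI allI impI)
  fix e i assume e: "e \<in> edges \<Gamma>" "i < n e"
  show "\<exists>c d. \<forall>x\<in>{real i * mesh_width \<Gamma> n e..real (i + 1) * mesh_width \<Gamma> n e}. edge (interpolant n z) e x = c + d * x"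
    using interpolant_on_cell[where n=n and z=z, OF e(1) n[OF e(1)] e(2)] unfolding interp_edge_affine by blast
next
  show "interpolant n z p = 0" if "p \<notin> points \<Gamma>" for p using that by (simp add: interpolant_def)
next
  let ?D = "slope n z"
  \<comment> \<open>One Lipschitz constant for all edges; the index \<open>n e\<close> again
    accounts for the right end.\<close>
  define K where "K = (\<Sum>e\<in>edges \<Gamma>. \<Sum>i\<le>n e. \<bar>?D e i\<bar>)"
  show "continuous_on_graph \<Gamma> (interpolant n z)"
  proof (rule Lipschitz_edgewise_continuous[of _ K])
    fix e x y assume e: "e \<in> edges \<Gamma>" and x: "x \<in> {0..len e}" and y: "y \<in> {0..len e}"
    let ?h = "mesh_width \<Gamma> n e"
    note m = mesh_width_facts[where n=n, OF e n[OF e]]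
    have d: "has_L2_deriv (len e) (edge (interpolant n z) e) (\<lambda>x. ?D e (nat \<lfloor>x / ?h\<rfloor>))"
      using interpolant_deriv[where n=n and z=z, OF e n[OF e]] .
    have DK: "\<bar>?D e (nat \<lfloor>t / ?h\<rfloor>)\<bar> \<le> K" if "t \<in> {0..len e}" for t
    proof -
      have "t / ?h \<le> real (n e)" using that m(1) unfolding m(2) by (simp add: pos_divide_le_eq)
      then have "nat \<lfloor>t / ?h\<rfloor> \<le> n e" by linarith
      then have "\<bar>?D e (nat \<lfloor>t / ?h\<rfloor>)\<bar> \<le> (\<Sum>i\<le>n e. \<bar>?D e i\<bar>)" by (intro member_le_sum) auto
      also have "\<dots> \<le> K" unfolding K_def using fin_edges e by (intro member_le_sum) (auto intro: sum_nonneg)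
      finally show ?thesis .
    qed
    have *: "\<bar>edge (interpolant n z) e q - edge (interpolant n z) e p\<bar> \<le> K * (q - p)" if "0 \<le> p" "p \<le> q" "q \<le> len e" for p q
    proof -
      have i: "(\<lambda>x. ?D e (nat \<lfloor>x / ?h\<rfloor>)) integrable_on {p..q}"
        using integrable_imp_integrable_on(2)[OF square_integrable_imp_integrable[OF has_L2_derivD(1)[OF d]]] that by auto
      have "\<bar>integral {p..q} (\<lambda>x. ?D e (nat \<lfloor>x / ?h\<rfloor>))\<bar> \<le> integral {p..q} (\<lambda>x. K)"
        using integral_norm_bound_integral[OF i, of "\<lambda>_. K"] DK that by auto
      then show ?thesis using has_L2_deriv_diff[OF d that] that by (simp add: mult.commute)
    qed
    show "\<bar>edge (interpolant n z) e x - edge (interpolant n z) e y\<bar> \<le> K * \<bar>x - y\<bar>"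
      using *[of x y] *[of y x] x y by (cases "x \<le> y") (auto simp: abs_minus_commute)
  qed
qed

end

section \<open>Interpolation error\<close>

lemma square_sum_le: "(x + y)\<^sup>2 \<le> 2 * x\<^sup>2 + 2 * y\<^sup>2" for x y :: real
  using zero_le_power2[of "x - y"] by (simp add: power2_eq_square algebra_simps)

text \<open>\<open>d\<close> is the mean of \<open>v\<close>, so \<open>v x - d\<close> is the mean
  of the increments \<open>v x - v y\<close>.\<close>

lemma deviation_from_mean:
  fixes v :: "real \<Rightarrow> real"
  assumes h: "0 < h" and v: "v integrable_on {p..p + h}" and d: "integral {p..p + h} v = d * h"
    and D: "\<And>y. y \<in> {p..p + h} \<Longrightarrow> (v x - v y)\<^sup>2 \<le> D"
  shows "(v x - d)\<^sup>2 \<le> D"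
proof -
  have D0: "0 \<le> D" using D[of p] h order_trans[OF zero_le_power2] by fastforce
  have "\<bar>v x - v y\<bar> \<le> sqrt D" if "y \<in> {p..p + h}" for y
    using D[OF that] real_le_rsqrt by fastforce
  then have "norm (integral {p..p + h} (\<lambda>y. v x - v y)) \<le> integral {p..p + h} (\<lambda>y. sqrt D)"
    using v by (intro integral_norm_bound_integral) (auto intro!: integrable_diff)
  also have "\<dots> = h * sqrt D" using h by simp
  also have "integral {p..p + h} (\<lambda>y. v x - v y) = h * (v x - d)"
    using v h d by (subst integral_diff) (auto simp: algebra_simps)
  finally have "h * \<bar>v x - d\<bar> \<le> h * sqrt D" using h by (simp add: abs_mult)
  then have "\<bar>v x - d\<bar> \<le> sqrt D" using h by simp
  then have "\<bar>v x - d\<bar>\<^sup>2 \<le> (sqrt D)\<^sup>2" by (rule power_mono) simp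
  then show ?thesis using D0 by simp
qed

text \<open>The slope \<open>d k\<close> is the mean of \<open>v\<close> on its cell, so only the
  oscillation of \<open>v\<close> over a cell matters. It is read off from the flux
  \<open>a v\<close>, whose oscillation is controlled by \<open>q\<close>; dividing by
  \<open>a\<close> adds a term of order \<open>L * h\<close> times the size of the flux, which
  \<open>P\<close> bounds.\<close>

lemma interval_slope_error:
  assumes l: "0 < l" "l = real n * h" and h: "0 < h" and n: "0 < (n::nat)"
    and f: "has_L2_deriv l f v" and v: "has_L2_deriv l v v'" and q: "has_L2_deriv l (\<lambda>x. a x * v x) q"
    and a0: "0 < a0" and a: "\<And>x. x \<in> {0..l} \<Longrightarrow> a0 \<le> a x"
      "\<And>x y. x \<in> {0..l} \<Longrightarrow> y \<in> {0..l} \<Longrightarrow> \<bar>a x - a y\<bar> \<le> L * \<bar>x - y\<bar>" "0 \<le> L"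
    and P: "\<And>x. x \<in> {0..l} \<Longrightarrow> (a x * v x)\<^sup>2 \<le> P"
  defines "d \<equiv> \<lambda>i. (f (real (i + 1) * h) - f (real i * h)) / h"
  shows "integral {0..l} (\<lambda>x. (v x - d (nat \<lfloor>x / h\<rfloor>))\<^sup>2) \<le>
    h\<^sup>2 * (2 / a0\<^sup>2 * (LINT x|leb l. (q x)\<^sup>2) + 2 * P * L\<^sup>2 * l / a0 ^ 4)"
proof -
  let ?M = "leb l"
  have vc: "continuous_on {0..l} v" by (rule has_L2_deriv_continuous[OF v])
  have qs: "square_integrable l q" by (rule has_L2_derivD[OF q])
  have q2: "integrable ?M (\<lambda>t. (q t)\<^sup>2)" using qs by (simp add: square_integrable_def)
  define E where "E k = integral {real k * h..real (k + 1) * h} (\<lambda>t. (q t)\<^sup>2)" for k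
  define T where "T = 2 * P * L\<^sup>2 * h\<^sup>2 / a0 ^ 4"
  have kl: "0 \<le> real k * h" "real k * h \<le> real (k + 1) * h" "real (k + 1) * h = real k * h + h" for k
    using h by (simp_all add: algebra_simps)
  have kn: "real (k + 1) * h \<le> l" if "k < n" for k unfolding l(2) using that h by (intro mult_right_mono) auto
  have cell: "integral {real k * h..real (k + 1) * h} (\<lambda>x. (v x - d (nat \<lfloor>x / h\<rfloor>))\<^sup>2) \<le> h * (2 / a0\<^sup>2 * (h * E k) + T)"
    "(\<lambda>x. (v x - d (nat \<lfloor>x / h\<rfloor>))\<^sup>2) integrable_on {real k * h..real (k + 1) * h}" if k: "k < n" for k
  proof -
    let ?I = "{real k * h..real (k + 1) * h}"
    have I: "x \<in> {0..l}" if "x \<in> ?I" for x using that kl(1)[of k] kn[OF k] by simp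
    have vI: "continuous_on ?I v" by (rule continuous_on_subset[OF vc]) (use I in blast)
    have pt: "(v x - v y)\<^sup>2 \<le> 2 / a0\<^sup>2 * (h * E k) + T" if xy: "x \<in> ?I" "y \<in> ?I" for x y
    proof -
      \<comment> \<open>\<open>u\<close> carries the increment of the flux, \<open>w\<close> that of
        \<open>1 / a\<close>.\<close>
      define u where "u = (a x * v x - a y * v y) / a x"
      define w where "w = (a y * v y) * (a y - a x) / (a x * a y)"
      have ax: "a0 \<le> a x" "a0 \<le> a y" "0 < a x" "0 < a y" using a(1)[OF I[OF xy(1)]] a(1)[OF I[OF xy(2)]] a0 by auto
      have "v x - v y = u + w" using ax by (simp add: u_def w_def field_simps)
      then have "(v x - v y)\<^sup>2 \<le> 2 * u\<^sup>2 + 2 * w\<^sup>2" using square_sum_le[of u w] by simp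
      also have "u\<^sup>2 \<le> (h * E k) / a0\<^sup>2"
        unfolding u_def power_divide
      proof (rule frac_le)
        show "(a x * v x - a y * v y)\<^sup>2 \<le> h * E k"
          using has_L2_deriv_increment_square[OF q kl(1)[of k], of x "real (k + 1) * h" y] xy kn[OF k]
          by (simp add: E_def algebra_simps)
        show "a0\<^sup>2 \<le> (a x)\<^sup>2" using ax a0 by (intro power_mono) auto
        show "0 \<le> h * E k" unfolding E_def using h kn[OF k] kl(1)
          by (intro mult_nonneg_nonneg integral_nonneg integrable_imp_integrable_on(2)[OF q2]) auto
      qed (use a0 in auto)
      also have "w\<^sup>2 \<le> (P * (L\<^sup>2 * h\<^sup>2)) / a0 ^ 4"
        unfolding w_def power_divide power_mult_distrib
      proof (rule frac_le)
        have "\<bar>x - y\<bar> \<le> h" using xy kl(3)[of k] unfolding atLeastAtMost_iff by linarith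
        then have "\<bar>a y - a x\<bar> \<le> L * h"
          using a(2)[OF I[OF xy(2)] I[OF xy(1)]] mult_left_mono[OF _ a(3), of "\<bar>y - x\<bar>" h] by (simp add: abs_minus_commute)
        then have "\<bar>a y - a x\<bar>\<^sup>2 \<le> (L * h)\<^sup>2" by (rule power_mono) simp
        then have aL: "(a y - a x)\<^sup>2 \<le> L\<^sup>2 * h\<^sup>2" by (simp add: power_mult_distrib)
        have vP: "(a y)\<^sup>2 * (v y)\<^sup>2 \<le> P" using P[OF I[OF xy(2)]] by (simp add: power_mult_distrib)
        have P0: "0 \<le> P" using P[OF I[OF xy(2)]] by (rule order_trans[OF zero_le_power2])
        show "(a y)\<^sup>2 * (v y)\<^sup>2 * (a y - a x)\<^sup>2 \<le> P * (L\<^sup>2 * h\<^sup>2)"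
          by (rule mult_mono[OF vP aL P0 zero_le_power2])
        show "0 \<le> P * (L\<^sup>2 * h\<^sup>2)" using P0 by simp
        have "a0\<^sup>2 * a0\<^sup>2 \<le> (a x)\<^sup>2 * (a y)\<^sup>2" using ax a0 by (intro mult_mono power_mono) auto
        then show "a0 ^ 4 \<le> (a x)\<^sup>2 * (a y)\<^sup>2" by (simp add: power_add[symmetric])
      qed (use a0 in auto)
      finally show ?thesis by (simp add: T_def)
    qed
    have dk: "integral {real k * h..real k * h + h} v = d k * h"
      using has_L2_deriv_diff[OF f kl(1) kl(2) kn[OF k]] h unfolding kl(3)[of k, symmetric] by (simp add: d_def)
    have vd: "(v x - d k)\<^sup>2 \<le> 2 / a0\<^sup>2 * (h * E k) + T" if "x \<in> ?I" for x
    proof (rule deviation_from_mean[OF h _ dk])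
      show "v integrable_on {real k * h..real k * h + h}" using vI unfolding kl(3) by (rule integrable_continuous_real)
      show "(v x - v y)\<^sup>2 \<le> 2 / a0\<^sup>2 * (h * E k) + T" if "y \<in> {real k * h..real k * h + h}" for y
        using pt[OF \<open>x \<in> ?I\<close>, of y] that unfolding kl(3) by blast
    qed
    have ci: "(\<lambda>x. (v x - d k)\<^sup>2) integrable_on ?I" using vI by (intro integrable_continuous_real continuous_intros)
    have "((\<lambda>x. (v x - d (nat \<lfloor>x / h\<rfloor>))\<^sup>2) has_integral integral ?I (\<lambda>x. (v x - d k)\<^sup>2)) (cbox (real k * h) (real (k + 1) * h))"
    proof (rule has_integral_spike_interior)
      show "((\<lambda>x. (v x - d k)\<^sup>2) has_integral integral ?I (\<lambda>x. (v x - d k)\<^sup>2)) (cbox (real k * h) (real (k + 1) * h))"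
        using ci by (simp add: integrable_integral)
      fix x assume "x \<in> box (real k * h) (real (k + 1) * h)"
      then have "real k * h < x" "x < real (k + 1) * h" by (simp_all add: box_real)
      then have "real k \<le> x / h" "x / h < real (k + 1)" using h by (simp_all only: pos_le_divide_eq pos_divide_less_eq less_imp_le)
      then have "nat \<lfloor>x / h\<rfloor> = k" by linarith
      then show "(v x - d (nat \<lfloor>x / h\<rfloor>))\<^sup>2 = (v x - d k)\<^sup>2" by simp
    qed
    then have hi: "((\<lambda>x. (v x - d (nat \<lfloor>x / h\<rfloor>))\<^sup>2) has_integral integral ?I (\<lambda>x. (v x - d k)\<^sup>2)) ?I" by simp
    then show "(\<lambda>x. (v x - d (nat \<lfloor>x / h\<rfloor>))\<^sup>2) integrable_on ?I" by blast
    have "integral ?I (\<lambda>x. (v x - d (nat \<lfloor>x / h\<rfloor>))\<^sup>2) = integral ?I (\<lambda>x. (v x - d k)\<^sup>2)" using hi by (rule integral_unique)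
    also have "\<dots> \<le> integral ?I (\<lambda>x. 2 / a0\<^sup>2 * (h * E k) + T)" by (intro integral_le ci integrable_const_ivl vd)
    also have "\<dots> = h * (2 / a0\<^sup>2 * (h * E k) + T)" unfolding kl(3) using h by simp
    finally show "integral ?I (\<lambda>x. (v x - d (nat \<lfloor>x / h\<rfloor>))\<^sup>2) \<le> h * (2 / a0\<^sup>2 * (h * E k) + T)" .
  qed
  \<comment> \<open>The cells are added one at a time: the energies \<open>E k\<close> combine to
    the integral of \<open>q^2\<close>, and the \<open>n\<close> copies of \<open>h * T\<close>
    yield the factor \<open>l\<close>.\<close>
  have "k \<le> n \<Longrightarrow> (\<lambda>x. (v x - d (nat \<lfloor>x / h\<rfloor>))\<^sup>2) integrable_on {0..real k * h} \<and>
    integral {0..real k * h} (\<lambda>x. (v x - d (nat \<lfloor>x / h\<rfloor>))\<^sup>2)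
      \<le> h * (2 / a0\<^sup>2 * (h * integral {0..real k * h} (\<lambda>t. (q t)\<^sup>2)) + real k * T)" for k
  proof (induction k)
    case 0
    have "(\<lambda>x. (v x - d (nat \<lfloor>x / h\<rfloor>))\<^sup>2) integrable_on {0..0}"
      using integrable_on_refl[of _ "0::real"] by (simp only: cbox_interval)
    then show ?case by simp
  next
    case (Suc k)
    then have k: "k < n" by simp
    let ?g = "\<lambda>x. (v x - d (nat \<lfloor>x / h\<rfloor>))\<^sup>2"
    have le: "0 \<le> real k * h" "real k * h \<le> real (k + 1) * h" using kl by auto
    have gi: "?g integrable_on {0..real (k + 1) * h}"
      using Suc.IH k by (intro Henstock_Kurzweil_Integration.integrable_combine[OF le _ cell(2)[OF k]]) simp
    have qi: "(\<lambda>t. (q t)\<^sup>2) integrable_on {0..real (k + 1) * h}"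
      using kn[OF k] by (intro integrable_imp_integrable_on(2)[OF q2]) auto
    have "integral {0..real (k + 1) * h} ?g = integral {0..real k * h} ?g + integral {real k * h..real (k + 1) * h} ?g"
      by (rule Henstock_Kurzweil_Integration.integral_combine[OF le gi, symmetric])
    also have "\<dots> \<le> h * (2 / a0\<^sup>2 * (h * integral {0..real k * h} (\<lambda>t. (q t)\<^sup>2)) + real k * T) + h * (2 / a0\<^sup>2 * (h * E k) + T)"
      using Suc.IH k cell(1)[OF k] by (intro add_mono) auto
    also have "\<dots> = h * (2 / a0\<^sup>2 * (h * (integral {0..real k * h} (\<lambda>t. (q t)\<^sup>2) + E k)) + real (Suc k) * T)"
      by (simp add: distrib_left distrib_right)
    also have "integral {0..real k * h} (\<lambda>t. (q t)\<^sup>2) + E k = integral {0..real (k + 1) * h} (\<lambda>t. (q t)\<^sup>2)"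
      unfolding E_def by (rule Henstock_Kurzweil_Integration.integral_combine[OF le qi])
    finally show ?case using gi by simp
  qed
  from this[of n] have "integral {0..l} (\<lambda>x. (v x - d (nat \<lfloor>x / h\<rfloor>))\<^sup>2)
      \<le> h * (2 / a0\<^sup>2 * (h * integral {0..l} (\<lambda>t. (q t)\<^sup>2)) + real n * T)" unfolding l(2) by simp
  also have "integral {0..l} (\<lambda>t. (q t)\<^sup>2) = (LINT x|?M. (q x)\<^sup>2)"
    by (rule lebesgue_integral_eq_integral[symmetric]) (use q2 in auto)
  also have "h * (2 / a0\<^sup>2 * (h * X) + real n * T) = h\<^sup>2 * (2 / a0\<^sup>2 * X + 2 * P * L\<^sup>2 * l / a0 ^ 4)" for X
    unfolding T_def l(2) using a0 by (simp add: field_simps power2_eq_square)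
  finally show ?thesis .
qed

section \<open>The eigenfunctions\<close>

text \<open>This identifies the one-sided derivatives in the vertex conditions with end values of
  the continuous integrated derivative.\<close>

lemma has_L2_deriv_end_derivative:
  assumes l: "0 < l" and f: "has_L2_deriv l f v" and v: "continuous_on {0..l} v" and x: "x \<in> {0..l}"
  shows "vector_derivative f (at x within {0..l}) = v x"
proof -
  have "((\<lambda>u. integral {0..u} v) has_vector_derivative v x) (at x within {0..l})"
    by (rule integral_has_vector_derivative[OF v x])
  then have "((\<lambda>u. f 0 + integral {0..u} v) has_vector_derivative (0 + v x)) (at x within {0..l})"
    by (intro has_vector_derivative_add has_vector_derivative_const)
  then have "(f has_vector_derivative (0 + v x)) (at x within {0..l})"
    by (rule has_vector_derivative_transform[OF x, rotated]) (rule has_L2_derivD(2)[OF f])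
  then show ?thesis using vector_derivative_within_closed_interval[OF l x, of f "v x"] by simp
qed

context kirchhoff_graph
begin

text \<open>The functions \<open>v\<close> and \<open>q\<close> represent \<open>z'\<close> and \<open>(a z')'\<close>, where the operator maps \<open>z\<close> to \<open>g\<close>.\<close>

definition edge_flux :: "(('v, 'e) point \<Rightarrow> real) \<Rightarrow> (('v, 'e) point \<Rightarrow> real) \<Rightarrow> 'e \<Rightarrow> (real \<Rightarrow> real) \<Rightarrow> (real \<Rightarrow> real) \<Rightarrow> bool" where
  "edge_flux z g e v q \<longleftrightarrow> has_L2_deriv (len e) (edge z e) v \<and> (\<exists>v'. has_L2_deriv (len e) v v') \<and>
     has_L2_deriv (len e) (\<lambda>x. edge a e x * v x) q \<and>
     (AE x in Leb e. q x = (edge \<kappa> e x)\<^sup>2 * edge z e x - edge g e x)"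

lemma edge_fluxD:
  assumes "edge_flux z g e v q"
  shows "has_L2_deriv (len e) (edge z e) v" "\<exists>v'. has_L2_deriv (len e) v v'"
    "has_L2_deriv (len e) (\<lambda>x. edge a e x * v x) q"
    "AE x in Leb e. q x = (edge \<kappa> e x)\<^sup>2 * edge z e x - edge g e x"
    "continuous_on {0..len e} v"
  using assms has_L2_deriv_continuous unfolding edge_flux_def by blast+

lemma edge_flux_lincomb:
  assumes 1: "edge_flux z g e v q" and 2: "edge_flux z' g' e v' q'"
  shows "edge_flux (\<lambda>p. c * z p + d * z' p) (\<lambda>p. c * g p + d * g' p) e (\<lambda>x. c * v x + d * v' x) (\<lambda>x. c * q x + d * q' x)"
  unfolding edge_flux_def on_edge_lincomb
proof (intro conjI)
  obtain w w' where "has_L2_deriv (len e) v w" "has_L2_deriv (len e) v' w'"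
    using edge_fluxD(2)[OF 1] edge_fluxD(2)[OF 2] by blast
  then show "\<exists>w. has_L2_deriv (len e) (\<lambda>x. c * v x + d * v' x) w" using has_L2_deriv_lincomb by blast
  have "(\<lambda>x. edge a e x * (c * v x + d * v' x)) = (\<lambda>x. c * (edge a e x * v x) + d * (edge a e x * v' x))"
    by (simp add: algebra_simps)
  then show "has_L2_deriv (len e) (\<lambda>x. edge a e x * (c * v x + d * v' x)) (\<lambda>x. c * q x + d * q' x)"
    using has_L2_deriv_lincomb[OF edge_fluxD(3)[OF 1] edge_fluxD(3)[OF 2]] by simp
  show "AE x in Leb e. c * q x + d * q' x =
      (edge \<kappa> e x)\<^sup>2 * (c * edge z e x + d * edge z' e x) - (c * edge g e x + d * edge g' e x)"
    using edge_fluxD(4)[OF 1] edge_fluxD(4)[OF 2]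
  proof eventually_elim
    case (elim x)
    show ?case unfolding elim by (simp add: algebra_simps)
  qed
qed (intro has_L2_deriv_lincomb edge_fluxD(1)[OF 1] edge_fluxD(1)[OF 2])

lemma edge_flux_zero: "edge_flux (\<lambda>_. 0) (\<lambda>_. 0) e (\<lambda>_. 0) (\<lambda>_. 0)"
proof -
  have "has_L2_deriv (len e) (\<lambda>_. 0) (\<lambda>_. 0)" by (rule has_L2_derivI) (auto simp: square_integrable_def)
  then show ?thesis unfolding edge_flux_def on_edge_def by auto
qed

end

locale eigen_graph = kirchhoff_graph \<Gamma> \<kappa> a \<kappa>0 a0 \<alpha> S d0
  for \<Gamma> :: "('v, 'e) metric_graph" and \<kappa> a \<kappa>0 a0 \<alpha> S d0 +
  fixes b :: "nat \<Rightarrow> ('v, 'e) point \<Rightarrow> real" and lam :: "nat \<Rightarrow> real"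
  assumes eigenbasis: "orthonormal_eigenbasis \<Gamma> \<kappa> a \<alpha> b lam"
begin

lemma b_dom: "b j \<in> op_domain \<Gamma> a \<alpha>"
  and b_op: "e \<in> edges \<Gamma> \<Longrightarrow> AE x in Leb e. graph_op \<Gamma> \<kappa> a (b j) e x = lam j * edge (b j) e x"
  and b_orthonormal: "L2.orthonormal UNIV b"
  and b_series: "f \<in> L2_graph \<Gamma> \<Longrightarrow> series_converges_to \<Gamma> (\<lambda>j p. ip f (b j) * b j p) f"
  using eigenbasis by (auto simp: orthonormal_eigenbasis_def orthonormal_basis_def L2.orthonormal_def)

lemma b_complete: assumes "f \<in> L2_graph \<Gamma>" shows "(\<lambda>j. (ip f (b j))\<^sup>2) sums ip f f"
proof (rule L2.Parseval[OF b_orthonormal assms])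
  let ?r = "\<lambda>n p. f p - (\<Sum>j<n. ip f (b j) * b j p)"
  have r: "?r n \<in> L2_graph \<Gamma>" for n
    using b_orthonormal by (intro L2.diff assms L2.sum_mem) (auto simp: L2.orthonormal_def)
  have "(\<lambda>n. (L2_norm \<Gamma> (?r n))\<^sup>2) \<longlonglongrightarrow> 0\<^sup>2"
    using b_series[OF assms] unfolding series_converges_to_def by (rule tendsto_power)
  then show "(\<lambda>n. ip (?r n) (?r n)) \<longlonglongrightarrow> 0"
    using L2.pos[OF r] by (simp add: L2_norm_def)
qed

lemma b_continuous: "continuous_on_graph \<Gamma> (b j)"
  and b_H2: "e \<in> edges \<Gamma> \<Longrightarrow> H2_interval (len e) (edge (b j) e)"
  and b_kirchhoff: "v \<in> vertices \<Gamma> \<Longrightarrow> a (Vertex v) * ((\<Sum>e\<in>out_arcs (skel \<Gamma>) v. outward_deriv_tail \<Gamma> (b j) e) +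
        (\<Sum>e\<in>in_arcs (skel \<Gamma>) v. outward_deriv_head \<Gamma> (b j) e)) = \<alpha> * b j (Vertex v)"
  using b_dom[of j] by (auto simp: op_domain_def)

text \<open>\<open>weak_deriv\<close> is an arbitrary representative; its continuous version
  \<open>F\<close> is the genuine derivative on the edge. The Lipschitz product lemma gives
  \<open>a F\<close> a derivative \<open>q\<close>. As \<open>a F\<close> equals \<open>a\<close>
  times the chosen representative almost everywhere, \<open>q\<close> is also the weak derivative
  that occurs in \<open>graph_op\<close>.\<close>

lemma b_flux:
  assumes e: "e \<in> edges \<Gamma>"
  shows "\<exists>v q. edge_flux (b j) (\<lambda>p. lam j * b j p) e v q"
proof -
  let ?l = "len e" and ?f = "edge (b j) e" and ?a = "edge a e"
  let ?M = "leb ?l"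
  note l = elen_pos[OF e]
  define w where "w = weak_deriv ?l ?f"
  have fc: "continuous_on {0..?l} ?f" by (rule continuous_on_edge[OF b_continuous e])
  have H: "H1_interval ?l ?f" "H1_interval ?l w" using b_H2[OF e] by (auto simp: H2_interval_def w_def)
  have fw: "has_L2_deriv ?l ?f w" unfolding w_def by (rule H1_continuous_has_L2_deriv[OF l H(1) fc])
  note ws = has_L2_derivD(1)[OF fw]
  note wp = weak_deriv_props[OF H(2)]
  obtain F where F: "has_L2_deriv ?l F (weak_deriv ?l w)" "AE x in ?M. w x = F x"
    by (rule is_weak_deriv_imp_has_L2_deriv[OF l ws wp])
  have Fs: "square_integrable ?l F" by (rule square_integrable_continuous[OF has_L2_deriv_continuous[OF F(1)]])
  have fF: "has_L2_deriv ?l ?f F" by (rule has_L2_deriv_cong_AE[OF fw F(2) Fs])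
  obtain L where L: "0 \<le> L" "\<And>x y. x \<in> {0..?l} \<Longrightarrow> y \<in> {0..?l} \<Longrightarrow> \<bar>?a x - ?a y\<bar> \<le> L * \<bar>x - y\<bar>"
    using Lipschitz_on_edges[OF a(1)] e by metis
  obtain q where q: "has_L2_deriv ?l (\<lambda>x. ?a x * F x) q"
    using Lipschitz_mult_has_L2_deriv[OF l F(1) L(2) L(1)] by blast
  let ?aw = "\<lambda>x. ?a x * w x"
  have am: "?a \<in> borel_measurable ?M" by (rule continuous_on_measurable_interval[OF a_cont[OF e]])
  have "is_weak_deriv ?l (\<lambda>x. ?a x * F x) q" by (rule has_L2_deriv_is_weak_deriv[OF less_imp_le[OF l] q])
  moreover have "(LINT x|?M. ?aw x * deriv \<phi> x) = (LINT x|?M. ?a x * F x * deriv \<phi> x)" if "test_function ?l \<phi>" for \<phi>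
  proof (rule integral_cong_AE)
    have d: "deriv \<phi> \<in> borel_measurable ?M"
      using has_L2_derivD(1)[OF test_function_has_L2_deriv(1)[OF that]] by (simp add: square_integrable_def)
    show "(\<lambda>x. ?aw x * deriv \<phi> x) \<in> borel_measurable ?M" "(\<lambda>x. ?a x * F x * deriv \<phi> x) \<in> borel_measurable ?M"
      using am d ws Fs by (auto simp: square_integrable_def intro!: borel_measurable_times)
    show "AE x in ?M. ?aw x * deriv \<phi> x = ?a x * F x * deriv \<phi> x"
      using F(2) by eventually_elim simp
  qed
  ultimately have awq: "is_weak_deriv ?l ?aw q" unfolding is_weak_deriv_def by simp
  have qs: "square_integrable ?l q" by (rule has_L2_derivD(1)[OF q])
  have "H1_interval ?l ?aw" unfolding H1_interval_def using a_sq[OF e ws] qs awq by blast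
  from weak_deriv_props[OF this] has_L2_deriv_unique[OF less_imp_le[OF l] _ awq _ qs]
  have wq: "AE x in ?M. weak_deriv ?l ?aw x = q x" by blast
  have "AE x in ?M. q x = (edge \<kappa> e x)\<^sup>2 * ?f x - edge (\<lambda>p. lam j * b j p) e x"
    using wq b_op[OF e, of j]
  proof eventually_elim
    case (elim x)
    then show ?case by (simp add: graph_op_def w_def on_edge_def)
  qed
  then have "edge_flux (b j) (\<lambda>p. lam j * b j p) e F q"
    unfolding edge_flux_def using fF F(1) q by blast
  then show ?thesis by blast
qed

lemma b_H1: "b j \<in> H1_graph"
proof (rule H1_graphI[OF b_continuous])
  fix e assume "e \<in> edges \<Gamma>"
  then show "\<exists>g. has_L2_deriv (len e) (edge (b j) e) g" using b_flux edge_fluxD(1) by blast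
qed

lemma b_L2: "b j \<in> L2_graph \<Gamma>" using b_H1 H1_subset_L2 by blast

lemma combination_flux:
  assumes e: "e \<in> edges \<Gamma>"
  shows "\<exists>v q. edge_flux (\<lambda>p. \<Sum>j<n. c j * b j p) (\<lambda>p. \<Sum>j<n. lam j * c j * b j p) e v q"
proof (induction n)
  case 0
  show ?case using edge_flux_zero by auto
next
  case (Suc n)
  then obtain v q where "edge_flux (\<lambda>p. \<Sum>j<n. c j * b j p) (\<lambda>p. \<Sum>j<n. lam j * c j * b j p) e v q" by blast
  moreover obtain v' q' where "edge_flux (b n) (\<lambda>p. lam n * b n p) e v' q'" using b_flux[OF e] by blast
  ultimately have "edge_flux (\<lambda>p. 1 * (\<Sum>j<n. c j * b j p) + c n * b n p) (\<lambda>p. 1 * (\<Sum>j<n. lam j * c j * b j p) + c n * (lam n * b n p)) e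
    (\<lambda>x. 1 * v x + c n * v' x) (\<lambda>x. 1 * q x + c n * q' x)" by (rule edge_flux_lincomb)
  moreover have "(\<lambda>p. 1 * (\<Sum>j<n. lam j * c j * b j p) + c n * (lam n * b n p)) = (\<lambda>p. \<Sum>j<Suc n. lam j * c j * b j p)"
    "(\<lambda>p. 1 * (\<Sum>j<n. c j * b j p) + c n * b n p) = (\<lambda>p. \<Sum>j<Suc n. c j * b j p)" by (simp_all add: mult_ac)
  ultimately show ?case by metis
qed

text \<open>Green's formula: integration by parts on each edge leaves fluxes at its ends, and the
  Kirchhoff conditions make their total cancel the vertex sum of the form.\<close>

lemma form_eigen:
  assumes w: "w \<in> H1_graph"
  shows "form w (b j) = lam j * ip w (b j)"
proof -
  obtain F q where Fq: "\<And>e. e \<in> edges \<Gamma> \<Longrightarrow> edge_flux (b j) (\<lambda>p. lam j * b j p) e (F e) (q e)"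
    using b_flux[where j=j] by metis
  note Fd = edge_fluxD[OF Fq]
  define T where "T e x = edge w e x * (edge a e x * F e x)" for e x
  have wL: "square_integrable (len e) (edge w e)" if "e \<in> edges \<Gamma>" for e
    using w H1_subset_L2 that by (auto simp: L2_graph_def)
  have bL: "square_integrable (len e) (edge (b j) e)" if "e \<in> edges \<Gamma>" for e
    using b_L2 that by (auto simp: L2_graph_def)
  have edge: "(LINT x|Leb e. edge a e x * dv w e x * dv (b j) e x) =
      T e (len e) - T e 0 - (LINT x|Leb e. (edge \<kappa> e x)\<^sup>2 * edge w e x * edge (b j) e x)
      + lam j * (LINT x|Leb e. edge w e x * edge (b j) e x)" if e: "e \<in> edges \<Gamma>" for e
  proof -
    let ?l = "len e"
    let ?M = "leb ?l"
    note ws = wL[OF e] note bs = bL[OF e]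
    have dws: "square_integrable ?l (dv w e)" by (rule dv_sq[OF w e])
    have qs: "square_integrable ?l (q e)" by (rule has_L2_derivD(1)[OF Fd(3)[OF e]])
    have "AE x in ?M. dv (b j) e x = F e x" by (rule dv_unique[OF e Fd(1)[OF e]])
    then have "(LINT x|?M. edge a e x * dv w e x * dv (b j) e x) = (LINT x|?M. (edge a e x * F e x) * dv w e x)"
    proof (intro integral_cong_AE)
      show "(\<lambda>x. edge a e x * dv w e x * dv (b j) e x) \<in> borel_measurable ?M"
        using square_integrable_mult_integrable[OF a_sq[OF e dws] dv_sq[OF b_H1 e]] by blast
      show "(\<lambda>x. (edge a e x * F e x) * dv w e x) \<in> borel_measurable ?M"
        using square_integrable_mult_integrable[OF a_sq[OF e square_integrable_continuous[OF Fd(5)[OF e]]] dws] by blast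
      assume "AE x in ?M. dv (b j) e x = F e x"
      then show "AE x in ?M. edge a e x * dv w e x * dv (b j) e x = (edge a e x * F e x) * dv w e x"
        by eventually_elim simp
    qed
    also have "\<dots> = T e ?l - T e 0 - (LINT x|?M. q e x * edge w e x)"
      unfolding has_L2_deriv_integration_by_parts[OF less_imp_le[OF elen_pos[OF e]] Fd(3)[OF e] H1_deriv[OF w e]]
      by (simp add: T_def mult_ac)
    also have "(LINT x|?M. q e x * edge w e x) =
      (LINT x|?M. (edge \<kappa> e x)\<^sup>2 * edge w e x * edge (b j) e x - lam j * (edge w e x * edge (b j) e x))"
    proof (rule integral_cong_AE)
      have "integrable ?M (\<lambda>x. q e x * edge w e x)" by (intro square_integrable_mult_integrable qs ws)
      then show "(\<lambda>x. q e x * edge w e x) \<in> borel_measurable ?M" by blast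
      have "integrable ?M (\<lambda>x. (edge \<kappa> e x)\<^sup>2 * edge w e x * edge (b j) e x - lam j * (edge w e x * edge (b j) e x))"
        by (intro Bochner_Integration.integrable_diff integrable_mult_right square_integrable_mult_integrable kappa_sq ws bs e)
      then show "(\<lambda>x. (edge \<kappa> e x)\<^sup>2 * edge w e x * edge (b j) e x - lam j * (edge w e x * edge (b j) e x)) \<in> borel_measurable ?M" by blast
      show "AE x in ?M. q e x * edge w e x = (edge \<kappa> e x)\<^sup>2 * edge w e x * edge (b j) e x - lam j * (edge w e x * edge (b j) e x)"
        using Fd(4)[OF e]
      proof eventually_elim
        case (elim x)
        show ?case unfolding elim by (simp add: on_edge_def algebra_simps)
      qed
    qed
    also have "\<dots> = (LINT x|?M. (edge \<kappa> e x)\<^sup>2 * edge w e x * edge (b j) e x) - lam j * (LINT x|?M. edge w e x * edge (b j) e x)"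
      by (subst Bochner_Integration.integral_diff)
        (auto intro!: integrable_mult_right square_integrable_mult_integrable kappa_sq ws bs e)
    finally show ?thesis by simp
  qed
  have vert: "(\<Sum>v\<in>vertices \<Gamma>. \<alpha> * w (Vertex v) * b j (Vertex v)) = (\<Sum>e\<in>edges \<Gamma>. T e 0) - (\<Sum>e\<in>edges \<Gamma>. T e (len e))"
  proof -
    have "(\<Sum>v\<in>vertices \<Gamma>. \<alpha> * w (Vertex v) * b j (Vertex v)) =
      (\<Sum>v\<in>vertices \<Gamma>. (\<Sum>e\<in>out_arcs (skel \<Gamma>) v. T e 0) + (\<Sum>e\<in>in_arcs (skel \<Gamma>) v. - T e (len e)))"
    proof (intro sum.cong refl)
      fix v assume v: "v \<in> vertices \<Gamma>"
      \<comment> \<open>At the head the outward direction runs against the parametrization, hence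
        the sign.\<close>
      have "outward_deriv_tail \<Gamma> (b j) e = F e 0" "outward_deriv_head \<Gamma> (b j) e = - F e (len e)" if "e \<in> edges \<Gamma>" for e
        using elen_pos[OF that] has_L2_deriv_end_derivative[OF elen_pos[OF that] Fd(1)[OF that] Fd(5)[OF that]]
        by (simp_all add: outward_deriv_tail_def outward_deriv_head_def)
      then have o: "w (Vertex v) * a (Vertex v) * outward_deriv_tail \<Gamma> (b j) e = T e 0" if "e \<in> out_arcs (skel \<Gamma>) v" for e
        using that by (auto simp: T_def on_edge_ends)
      have i: "w (Vertex v) * a (Vertex v) * outward_deriv_head \<Gamma> (b j) e = - T e (len e)" if "e \<in> in_arcs (skel \<Gamma>) v" for e
        using that \<open>\<And>e. e \<in> edges \<Gamma> \<Longrightarrow> outward_deriv_head \<Gamma> (b j) e = - F e (len e)\<close> by (auto simp: T_def on_edge_ends)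
      have "\<alpha> * w (Vertex v) * b j (Vertex v) = w (Vertex v) * (a (Vertex v) * ((\<Sum>e\<in>out_arcs (skel \<Gamma>) v. outward_deriv_tail \<Gamma> (b j) e) +
        (\<Sum>e\<in>in_arcs (skel \<Gamma>) v. outward_deriv_head \<Gamma> (b j) e)))" unfolding b_kirchhoff[OF v] by simp
      also have "\<dots> = (\<Sum>e\<in>out_arcs (skel \<Gamma>) v. T e 0) + (\<Sum>e\<in>in_arcs (skel \<Gamma>) v. - T e (len e))"
        by (simp only: distrib_left sum_distrib_left mult.assoc[symmetric] o i cong: sum.cong)
      finally show "\<alpha> * w (Vertex v) * b j (Vertex v) = (\<Sum>e\<in>out_arcs (skel \<Gamma>) v. T e 0) + (\<Sum>e\<in>in_arcs (skel \<Gamma>) v. - T e (len e))" .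
    qed
    then show ?thesis unfolding sum.distrib sum_out_arcs sum_in_arcs by (simp add: sum_negf)
  qed
  have "form w (b j) = (\<Sum>e\<in>edges \<Gamma>. LINT x|Leb e. (edge \<kappa> e x)\<^sup>2 * edge w e x * edge (b j) e x)
     + (\<Sum>e\<in>edges \<Gamma>. LINT x|Leb e. edge a e x * dv w e x * dv (b j) e x)
     + (\<Sum>v\<in>vertices \<Gamma>. \<alpha> * w (Vertex v) * b j (Vertex v))"
    unfolding form_eq L2_inner_def by (simp add: on_edge_def)
  also have "\<dots> = lam j * ip w (b j)"
    unfolding vert L2_inner_def sum_distrib_left by (simp add: edge sum.distrib sum_subtractf)
  finally show ?thesis .
qed

lemma b_comb_H1: "finite J \<Longrightarrow> (\<lambda>p. \<Sum>j\<in>J. c j * b j p) \<in> H1_graph"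
  by (rule H1.sum_mem) (auto simp: b_H1)

lemma form_comb:
  assumes J: "finite J" shows "form (\<lambda>p. \<Sum>j\<in>J. c j * b j p) (\<lambda>p. \<Sum>j\<in>J. c j * b j p) = (\<Sum>j\<in>J. lam j * (c j)\<^sup>2)"
    "ip (\<lambda>p. \<Sum>j\<in>J. c j * b j p) (\<lambda>p. \<Sum>j\<in>J. c j * b j p) = (\<Sum>j\<in>J. (c j)\<^sup>2)"
proof -
  show "ip (\<lambda>p. \<Sum>j\<in>J. c j * b j p) (\<lambda>p. \<Sum>j\<in>J. c j * b j p) = (\<Sum>j\<in>J. (c j)\<^sup>2)"
    unfolding L2.orthonormal_sum(3)[OF b_orthonormal J subset_UNIV] by (simp add: power2_eq_square)
  have "form (\<lambda>p. \<Sum>j\<in>J. c j * b j p) (\<lambda>p. \<Sum>j\<in>J. c j * b j p) = (\<Sum>j\<in>J. c j * form (\<lambda>p. \<Sum>j\<in>J. c j * b j p) (b j))"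
    by (rule H1.sum_right[OF J b_H1 b_comb_H1[OF J]])
  also have "\<dots> = (\<Sum>j\<in>J. lam j * (c j)\<^sup>2)"
    unfolding form_eigen[OF b_comb_H1[OF J]]
    by (rule sum.cong) (simp_all add: L2.orthonormal_sum(2)[OF b_orthonormal J subset_UNIV] power2_eq_square)
  finally show "form (\<lambda>p. \<Sum>j\<in>J. c j * b j p) (\<lambda>p. \<Sum>j\<in>J. c j * b j p) = (\<Sum>j\<in>J. lam j * (c j)\<^sup>2)" .
qed

end

section \<open>Eigenvalue growth and approximation of eigenfunctions\<close>

text \<open>Dyadic shells: shell \<open>i\<close> holds at most
  \<open>C * sqrt (\<delta> * 2^i)\<close> indices, each contributing at most
  \<open>(\<delta> / 2 * 2^i) powr (- s)\<close>. The products are geometric with ratio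
  \<open>2 powr (1 / 2 - s)\<close>, below 1.\<close>

lemma summable_powr_of_counting:
  fixes lam :: "nat \<Rightarrow> real"
  assumes \<delta>: "0 < \<delta>" "\<And>j. \<delta> \<le> lam j" and C: "0 \<le> C"
    and count: "\<And>n \<Lambda>. \<delta> \<le> \<Lambda> \<Longrightarrow> real (card {j. j < n \<and> lam j \<le> \<Lambda>}) \<le> C * sqrt \<Lambda>"
    and s: "1 / 2 < s"
  shows "summable (\<lambda>j. lam j powr (- s))"
proof -
  have "\<exists>m. lam j \<le> \<delta> * 2 ^ m" for j
  proof -
    obtain m where "lam j / \<delta> < 2 ^ m" using real_arch_pow[of 2 "lam j / \<delta>"] by auto
    then show ?thesis using \<delta>(1) by (intro exI[of _ m]) (simp add: field_simps)
  qed
  define m where "m j = (LEAST m. lam j \<le> \<delta> * 2 ^ m)" for j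
  have m1: "lam j \<le> \<delta> * 2 ^ m j" for j unfolding m_def by (rule LeastI_ex) fact
  have m2: "\<delta> / 2 * 2 ^ m j \<le> lam j" for j
  proof (cases "m j")
    case 0
    then show ?thesis using \<delta>(2)[of j] \<delta>(1) by simp
  next
    case (Suc i)
    then have "\<not> lam j \<le> \<delta> * 2 ^ i" using not_less_Least[of i "\<lambda>m. lam j \<le> \<delta> * 2 ^ m"] by (simp add: m_def)
    then show ?thesis using Suc by simp
  qed
  define \<rho> where "\<rho> = sqrt 2 * 2 powr (- s)"
  define K where "K = C * sqrt \<delta> * (\<delta> / 2) powr (- s)"
  have K: "0 \<le> K" using C \<delta>(1) by (simp add: K_def)
  have "\<rho> = 2 powr (1 / 2 + (- s))" by (simp only: \<rho>_def powr_add powr_half_sqrt)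
  also have "\<dots> < 2 powr 0" using s by (intro powr_less_mono) auto
  finally have \<rho>: "0 \<le> \<rho>" "\<rho> < 1" by (auto simp: \<rho>_def)
  show ?thesis
  proof (rule summableI_nonneg_bounded[where x = "K * (1 / (1 - \<rho>))"])
    fix n
    define M where "M = Suc (Max (m ` {..<n} \<union> {0}))"
    have mM: "m ` {..<n} \<subseteq> {..<M}" by (auto simp: M_def less_Suc_eq_le)
    have "(\<Sum>j<n. lam j powr (- s)) = (\<Sum>i<M. \<Sum>j\<in>{j \<in> {..<n}. m j = i}. lam j powr (- s))"
      by (rule sum.group[symmetric]) (use mM in auto)
    also have "\<dots> \<le> (\<Sum>i<M. K * \<rho> ^ i)"
    proof (rule sum_mono)
      fix i
      have "(\<Sum>j\<in>{j \<in> {..<n}. m j = i}. lam j powr (- s)) \<le> (\<Sum>j\<in>{j \<in> {..<n}. m j = i}. (\<delta> / 2 * 2 ^ i) powr (- s))"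
      proof (rule sum_mono)
        fix j assume "j \<in> {j \<in> {..<n}. m j = i}"
        then show "lam j powr (- s) \<le> (\<delta> / 2 * 2 ^ i) powr (- s)"
          using m2[of j] \<delta>(1) s by (intro powr_mono2') auto
      qed
      also have "\<dots> = real (card {j \<in> {..<n}. m j = i}) * (\<delta> / 2 * 2 ^ i) powr (- s)" by simp
      also have "\<dots> \<le> (C * sqrt (\<delta> * 2 ^ i)) * (\<delta> / 2 * 2 ^ i) powr (- s)"
      proof (rule mult_right_mono)
        have "{j \<in> {..<n}. m j = i} \<subseteq> {j. j < n \<and> lam j \<le> \<delta> * 2 ^ i}" using m1 by auto
        then have "card {j \<in> {..<n}. m j = i} \<le> card {j. j < n \<and> lam j \<le> \<delta> * 2 ^ i}" by (intro card_mono) auto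
        moreover have "\<delta> * 1 \<le> \<delta> * 2 ^ i" using \<delta>(1) by (intro mult_left_mono) auto
        ultimately show "real (card {j \<in> {..<n}. m j = i}) \<le> C * sqrt (\<delta> * 2 ^ i)"
          using count[of "\<delta> * 2 ^ i" n] by linarith
      qed simp
      also have "\<dots> = K * \<rho> ^ i"
      proof -
        have "sqrt (\<delta> * 2 ^ i) = sqrt \<delta> * sqrt 2 ^ i" by (simp add: real_sqrt_mult real_sqrt_power)
        moreover have "(2 ^ i) powr (- s) = (2 powr (- s)) ^ i"
          by (simp add: powr_realpow[symmetric] powr_powr powr_power mult.commute)
        then have "(\<delta> / 2 * 2 ^ i) powr (- s) = (\<delta> / 2) powr (- s) * (2 powr (- s)) ^ i"
          using \<delta>(1) powr_mult[of "\<delta> / 2" "2 ^ i" "- s"] by simp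
        ultimately show ?thesis by (simp add: K_def \<rho>_def power_mult_distrib)
      qed
      finally show "(\<Sum>j\<in>{j \<in> {..<n}. m j = i}. lam j powr (- s)) \<le> K * \<rho> ^ i" .
    qed
    also have "\<dots> = K * (\<Sum>i<M. \<rho> ^ i)" by (simp add: sum_distrib_left)
    also have "\<dots> \<le> K * (1 / (1 - \<rho>))"
    proof (rule mult_left_mono[OF _ K])
      have "(\<Sum>i<M. \<rho> ^ i) \<le> (\<Sum>i. \<rho> ^ i)" using \<rho> by (intro sum_le_suminf summable_geometric) auto
      then show "(\<Sum>i<M. \<rho> ^ i) \<le> 1 / (1 - \<rho>)" using \<rho> by (simp add: suminf_geometric)
    qed
    finally show "(\<Sum>j<n. lam j powr (- s)) \<le> K * (1 / (1 - \<rho>))" .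
  qed simp
qed

section \<open>Eigenvalue counting and interpolation of eigenfunctions\<close>

context eigen_graph
begin

lemma min_length: "e \<in> edges \<Gamma> \<Longrightarrow> Min (len ` edges \<Gamma>) \<le> len e" "0 < Min (len ` edges \<Gamma>)"
  using fin_edges edges_ne elen_pos by auto

lemma edge_term_le:
  assumes "e \<in> edges \<Gamma>"
  shows "(LINT x|Leb e. (edge u e x)\<^sup>2) \<le> ip u u"
    "(LINT x|Leb e. (dv u e x)\<^sup>2) \<le> energy u"
  unfolding L2_self energy_def using assms fin_edges by (auto intro!: member_le_sum)

lemma lam_lower:
  assumes "\<And>u. u \<in> H1_graph \<Longrightarrow> \<delta> * (ip u u + energy u) \<le> form u u" "0 < \<delta>"
  shows "\<delta> \<le> lam j"
proof -
  have bb: "ip (b j) (b j) = 1" using b_orthonormal by (simp add: L2.orthonormal_def)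
  have "\<delta> * (1 + energy (b j)) \<le> lam j" using assms(1)[OF b_H1[of j]] by (simp add: form_eigen[OF b_H1] bb)
  moreover have "0 \<le> \<delta> * energy (b j)" using energy_nonneg[of "b j"] assms(2) by simp
  ultimately show ?thesis by (simp add: distrib_left)
qed

text \<open>The reproducing sum of the eigenfunctions below a level is tested against itself, with the
  trace inequality at the length scale of that level.\<close>

lemma Weyl_bound:
  assumes \<delta>: "\<And>u. u \<in> H1_graph \<Longrightarrow> \<delta> * (ip u u + energy u) \<le> form u u" "0 < \<delta>"
  obtains C where "0 \<le> C" "\<And>n \<Lambda>. \<delta> \<le> \<Lambda> \<Longrightarrow> real (card {j. j < n \<and> lam j \<le> \<Lambda>}) \<le> C * sqrt \<Lambda>"
proof -
  define m where "m = Min (len ` edges \<Gamma>)"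
  have m: "0 < m" using min_length(2) by (simp add: m_def)
  define C0 where "C0 = (4 / m + m / 2) / sqrt \<delta>"
  have pt: "(\<Sum>j\<in>J. (edge (b j) e y)\<^sup>2) \<le> C0 * sqrt \<Lambda>"
    if J: "finite J" "\<And>j. j \<in> J \<Longrightarrow> lam j \<le> \<Lambda>" and \<Lambda>: "\<delta> \<le> \<Lambda>" and e: "e \<in> edges \<Gamma>" and y: "y \<in> {0..len e}" for J \<Lambda> e y
  proof -
    define c where "c j = edge (b j) e y" for j
    \<comment> \<open>The value of \<open>z\<close> at the base point \<open>y\<close> and the
      squared norm of \<open>z\<close> are both \<open>T\<close>, so a bound of the point value by
      norms becomes a bound for \<open>T\<close>.\<close>
    define z where "z = (\<lambda>p. \<Sum>j\<in>J. c j * b j p)"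
    define T where "T = (\<Sum>j\<in>J. (c j)\<^sup>2)"
    have T0: "0 \<le> T" by (simp add: T_def sum_nonneg)
    have zH: "z \<in> H1_graph" unfolding z_def by (rule b_comb_H1[OF J(1)])
    have zz: "ip z z = T" "form z z \<le> \<Lambda> * T"
      unfolding z_def form_comb[OF J(1)] T_def sum_distrib_left by (auto intro!: sum_mono mult_right_mono J(2))
    have "0 \<le> \<delta> * ip z z" using zz(1) T0 \<delta>(2) by simp
    then have "\<delta> * energy z \<le> \<Lambda> * T" using \<delta>(1)[OF zH] zz(2) by (simp add: distrib_left)
    then have en: "energy z \<le> \<Lambda> * T / \<delta>" using \<delta>(2) by (simp add: field_simps)
    define \<rho> where "\<rho> = sqrt (\<Lambda> / \<delta>)"
    have \<rho>1: "1 \<le> \<rho>" using \<Lambda> \<delta>(2) by (simp add: \<rho>_def)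
    have \<rho>2: "\<rho> * \<rho> = \<Lambda> / \<delta>" using \<Lambda> \<delta>(2) by (simp add: \<rho>_def)
    \<comment> \<open>This length balances the two trace terms. It is at most half of the shortest
      edge, so every point of an edge is an end of a segment of length \<open>r\<close> inside that
      edge.\<close>
    define r where "r = m / 2 / \<rho>"
    have r: "0 < r" using m \<rho>1 by (simp add: r_def)
    have "r \<le> m / 2 / 1" unfolding r_def using m \<rho>1 by (intro divide_left_mono) auto
    also have "\<dots> \<le> len e / 2" using min_length(1)[OF e] by (simp add: m_def)
    finally have r2: "r \<le> len e / 2" .
    define p where "p = (if y \<le> len e / 2 then y else y - r)"
    have "0 \<le> p" "p + r \<le> len e" "y = p \<or> y = p + r" using y r2 r by (auto simp: p_def)
    from L2_interval_trace[OF less_imp_le[OF elen_pos[OF e]] H1_deriv[OF zH e] this(1) r this(2,3), of 1]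
    have "(edge z e y)\<^sup>2 \<le> 2 / r * (LINT x|Leb e. (edge z e x)\<^sup>2) + r * (LINT x|Leb e. (dv z e x)\<^sup>2)"
      by simp
    also have "\<dots> \<le> 2 / r * T + r * (\<Lambda> * T / \<delta>)"
      using edge_term_le[OF e, of z] zz(1) en r by (intro add_mono mult_left_mono) auto
    also have "\<dots> = (2 / r + r * (\<rho> * \<rho>)) * T" unfolding \<rho>2 by (simp add: algebra_simps)
    also have "2 / r + r * (\<rho> * \<rho>) = (4 / m + m / 2) * \<rho>" using \<rho>1 m by (simp add: r_def field_simps)
    also have "edge z e y = T" by (simp add: z_def T_def on_edge_def c_def power2_eq_square)
    finally have "T * T \<le> (4 / m + m / 2) * \<rho> * T" by (simp add: power2_eq_square)
    then have "T \<le> (4 / m + m / 2) * \<rho>" using T0 m \<rho>1 by (cases "T = 0") auto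
    also have "\<dots> = C0 * sqrt \<Lambda>" by (simp add: C0_def \<rho>_def real_sqrt_divide)
    finally show ?thesis by (simp add: T_def c_def)
  qed
  define l where "l = (\<Sum>e\<in>edges \<Gamma>. len e)"
  have l0: "0 \<le> l" unfolding l_def by (intro sum_nonneg) (simp add: less_imp_le elen_pos)
  show thesis
  proof (rule that[of "l * C0"])
    show "0 \<le> l * C0" using l0 m \<delta>(2) by (simp add: C0_def)
    fix n and \<Lambda> :: real assume \<Lambda>: "\<delta> \<le> \<Lambda>"
    define J where "J = {j. j < n \<and> lam j \<le> \<Lambda>}"
    have J: "finite J" "\<And>j. j \<in> J \<Longrightarrow> lam j \<le> \<Lambda>" by (auto simp: J_def)
    have bi: "integrable (Leb e) (\<lambda>x. (edge (b j) e x)\<^sup>2)" if "e \<in> edges \<Gamma>" for e j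
      using b_L2[of j] that by (auto simp: L2_graph_def square_integrable_def)
    \<comment> \<open>Each eigenfunction has norm 1, so integrating the pointwise bound over the
      graph counts them.\<close>
    have "real (card J) = (\<Sum>j\<in>J. ip (b j) (b j))" using b_orthonormal by (simp add: L2.orthonormal_def)
    also have "\<dots> = (\<Sum>e\<in>edges \<Gamma>. \<Sum>j\<in>J. LINT x|Leb e. (edge (b j) e x)\<^sup>2)"
      unfolding L2_self by (rule sum.swap)
    also have "\<dots> = (\<Sum>e\<in>edges \<Gamma>. LINT x|Leb e. (\<Sum>j\<in>J. (edge (b j) e x)\<^sup>2))"
      by (intro sum.cong refl Bochner_Integration.integral_sum[symmetric] bi)
    also have "\<dots> \<le> (\<Sum>e\<in>edges \<Gamma>. len e * (C0 * sqrt \<Lambda>))"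
    proof (rule sum_mono)
      fix e assume e: "e \<in> edges \<Gamma>"
      have "(LINT x|Leb e. (\<Sum>j\<in>J. (edge (b j) e x)\<^sup>2)) \<le> (LINT x|Leb e. C0 * sqrt \<Lambda>)"
        using pt[OF J \<Lambda> e]
        by (intro integral_mono Bochner_Integration.integrable_sum bi e finite_measure.integrable_const finite_measure_interval)
          (auto simp: space_restrict_space)
      also have "\<dots> = len e * (C0 * sqrt \<Lambda>)"
        using elen_pos[OF e] by (simp add: measure_restrict_space)
      finally show "(LINT x|Leb e. (\<Sum>j\<in>J. (edge (b j) e x)\<^sup>2)) \<le> len e * (C0 * sqrt \<Lambda>)" .
    qed
    also have "\<dots> = l * C0 * sqrt \<Lambda>" by (simp add: l_def sum_distrib_right mult.assoc)
    finally show "real (card {j. j < n \<and> lam j \<le> \<Lambda>}) \<le> l * C0 * sqrt \<Lambda>" by (simp add: J_def)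
  qed
qed

lemma lam_summable:
  assumes "1 / 2 < s" shows "summable (\<lambda>j. lam j powr (- s))"
proof -
  obtain \<delta> where \<delta>: "0 < \<delta>" "\<And>u. u \<in> H1_graph \<Longrightarrow> \<delta> * (ip u u + energy u) \<le> form u u"
    using form_coercive by blast
  obtain C where "0 \<le> C" "\<And>n \<Lambda>. \<delta> \<le> \<Lambda> \<Longrightarrow> real (card {j. j < n \<and> lam j \<le> \<Lambda>}) \<le> C * sqrt \<Lambda>"
    using Weyl_bound[OF \<delta>(2,1)] by blast
  then show ?thesis by (intro summable_powr_of_counting[OF \<delta>(1) lam_lower[OF \<delta>(2,1)] _ _ assms])
qed

text \<open>\<open>interval_slope_error\<close> asks for a pointwise bound of the squared flux; the
  trace inequality on half of the edge derives it from the two integrals on the right-hand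
  side.\<close>

lemma edge_interpolation_error:
  obtains K where "0 \<le> K"
    "\<And>z g e v q n. z \<in> H1_graph \<Longrightarrow> e \<in> edges \<Gamma> \<Longrightarrow> 0 < n e \<Longrightarrow> edge_flux z g e v q \<Longrightarrow>
      (LINT x|Leb e. (dv (\<lambda>p. z p - interpolant n z p) e x)\<^sup>2) \<le>
      (max_mesh_width \<Gamma> n)\<^sup>2 * (K * ((LINT x|Leb e. (edge a e x * v x)\<^sup>2) + (LINT x|Leb e. (q x)\<^sup>2)))"
proof -
  obtain L where L: "0 \<le> L" "\<And>e x y. e \<in> edges \<Gamma> \<Longrightarrow> x \<in> {0..len e} \<Longrightarrow> y \<in> {0..len e} \<Longrightarrow> \<bar>edge a e x - edge a e y\<bar> \<le> L * \<bar>x - y\<bar>"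
    using Lipschitz_on_edges[OF a(1)] by blast
  define R where "R = 2 * L\<^sup>2 / a0 ^ 4"
  define lm where "lm = Max (len ` edges \<Gamma>)"
  define K where "K = 2 / a0\<^sup>2 + R * (4 + lm\<^sup>2)"
  have R: "0 \<le> R" by (simp add: R_def)
  show thesis
  proof (rule that[of K])
    show "0 \<le> K" using R by (simp add: K_def)
    fix z g v q and e :: 'e and n :: "'e \<Rightarrow> nat"
    assume z: "z \<in> H1_graph" and e: "e \<in> edges \<Gamma>" and n: "0 < n e" and fl: "edge_flux z g e v q"
    let ?l = "len e" and ?h = "mesh_width \<Gamma> n e" and ?a = "edge a e"
    let ?M = "leb ?l"
    define I where "I = (LINT x|?M. (?a x * v x)\<^sup>2)"
    define Q where "Q = (LINT x|?M. (q x)\<^sup>2)"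
    define d where "d i = (edge z e (real (i + 1) * ?h) - edge z e (real i * ?h)) / ?h" for i
    have sl: "slope n z e = d" by (simp add: slope_def d_def fun_eq_iff)
    have l: "0 < ?l" by (rule elen_pos[OF e])
    note mw = mesh_width_facts[where n=n, OF e n]
    note fd = edge_fluxD[OF fl]
    obtain v' where v': "has_L2_deriv ?l v v'" using fd(2) by blast
    have P: "(?a x * v x)\<^sup>2 \<le> 4 / ?l * I + ?l / 2 * Q" if "x \<in> {0..?l}" for x
    proof -
      define p where "p = (if x \<le> ?l / 2 then x else x - ?l / 2)"
      have "0 \<le> p" "0 < ?l / 2" "p + ?l / 2 \<le> ?l" "x = p \<or> x = p + ?l / 2" using that l by (auto simp: p_def)
      from L2_interval_trace[OF less_imp_le[OF l] fd(3) this, of 1] show ?thesis by (simp add: I_def Q_def)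
    qed
    have dz: "has_L2_deriv ?l (edge (\<lambda>p. 1 * z p + (-1) * interpolant n z p) e) (\<lambda>x. 1 * v x + (-1) * d (nat \<lfloor>x / ?h\<rfloor>))"
      unfolding on_edge_lincomb sl[symmetric] by (intro has_L2_deriv_lincomb fd(1) interpolant_deriv e n)
    then have dz: "has_L2_deriv ?l (edge (\<lambda>p. z p - interpolant n z p) e) (\<lambda>x. v x - d (nat \<lfloor>x / ?h\<rfloor>))" by simp
    have sq: "integrable ?M (\<lambda>x. (v x - d (nat \<lfloor>x / ?h\<rfloor>))\<^sup>2)" using has_L2_derivD(1)[OF dz] by (simp add: square_integrable_def)
    have "(LINT x|?M. (dv (\<lambda>p. z p - interpolant n z p) e x)\<^sup>2) = (LINT x|?M. (v x - d (nat \<lfloor>x / ?h\<rfloor>))\<^sup>2)"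
    proof (rule integral_cong_AE)
      have "has_L2_deriv ?l (edge (\<lambda>p. z p - interpolant n z p) e) (dv (\<lambda>p. z p - interpolant n z p) e)"
        unfolding dv_def by (rule has_L2_deriv_weak_deriv(2)[OF l dz])
      from has_L2_derivD(1)[OF this]
      show "(\<lambda>x. (dv (\<lambda>p. z p - interpolant n z p) e x)\<^sup>2) \<in> borel_measurable ?M" by (auto simp: square_integrable_def)
      show "(\<lambda>x. (v x - d (nat \<lfloor>x / ?h\<rfloor>))\<^sup>2) \<in> borel_measurable ?M" using sq by blast
      show "AE x in ?M. (dv (\<lambda>p. z p - interpolant n z p) e x)\<^sup>2 = (v x - d (nat \<lfloor>x / ?h\<rfloor>))\<^sup>2"
        using dv_unique[OF e dz] by eventually_elim simp
    qed
    also have "\<dots> = integral {0..?l} (\<lambda>x. (v x - d (nat \<lfloor>x / ?h\<rfloor>))\<^sup>2)"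
      by (rule lebesgue_integral_eq_integral) (use sq in auto)
    also have "\<dots> \<le> ?h\<^sup>2 * (2 / a0\<^sup>2 * Q + 2 * (4 / ?l * I + ?l / 2 * Q) * L\<^sup>2 * ?l / a0 ^ 4)"
      unfolding d_def Q_def
      by (rule interval_slope_error[OF l mw(2) mw(1) n fd(1) v' fd(3) a0_pos a_edge[OF e] L(2)[OF e] L(1) P[unfolded Q_def]])
    also have "2 * (4 / ?l * I + ?l / 2 * Q) * L\<^sup>2 * ?l / a0 ^ 4 = R * ((4 / ?l * I + ?l / 2 * Q) * ?l)"
      by (simp add: R_def)
    also have "(4 / ?l * I + ?l / 2 * Q) * ?l = 4 * I + ?l\<^sup>2 / 2 * Q"
      using l by (simp add: distrib_right power2_eq_square)
    also have "?h\<^sup>2 * (2 / a0\<^sup>2 * Q + R * (4 * I + ?l\<^sup>2 / 2 * Q)) \<le> (max_mesh_width \<Gamma> n)\<^sup>2 * (K * (I + Q))"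
    proof (rule mult_mono)
      have IQ: "0 \<le> I" "0 \<le> Q" by (simp_all add: I_def Q_def)
      have "?l \<le> lm" unfolding lm_def using fin_edges e by simp
      then have "?l\<^sup>2 \<le> lm\<^sup>2" using l by (intro power_mono) auto
      then have l2: "?l\<^sup>2 / 2 \<le> 4 + lm\<^sup>2" "4 \<le> 4 + lm\<^sup>2" using zero_le_power2[of lm] by linarith+
      have "R * (4 * I + ?l\<^sup>2 / 2 * Q) \<le> R * ((4 + lm\<^sup>2) * I + (4 + lm\<^sup>2) * Q)"
        by (intro mult_left_mono add_mono mult_right_mono l2 IQ R)
      moreover have "0 \<le> 2 / a0\<^sup>2 * I" using IQ by simp
      ultimately show "2 / a0\<^sup>2 * Q + R * (4 * I + ?l\<^sup>2 / 2 * Q) \<le> K * (I + Q)"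
        unfolding K_def distrib_left distrib_right by (simp add: mult.assoc)
      show "?h\<^sup>2 \<le> (max_mesh_width \<Gamma> n)\<^sup>2" using mw(1,3) by (intro power_mono) auto
      show "0 \<le> 2 / a0\<^sup>2 * Q + R * (4 * I + ?l\<^sup>2 / 2 * Q)" using R IQ by simp
    qed simp
    finally show "(LINT x|?M. (dv (\<lambda>p. z p - interpolant n z p) e x)\<^sup>2) \<le>
      (max_mesh_width \<Gamma> n)\<^sup>2 * (K * ((LINT x|?M. (?a x * v x)\<^sup>2) + (LINT x|?M. (q x)\<^sup>2)))" by (simp add: I_def Q_def)
  qed
qed

text \<open>Starting from 0 at a vertex, such a function is bounded on each edge by its derivative
  alone, and the terms with \<open>\<alpha>\<close> drop out. Interpolation errors are of this
  kind.\<close>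

lemma vanishing_form_bound:
  obtains K where "0 \<le> K"
    "\<And>w. w \<in> H1_graph \<Longrightarrow> (\<And>v. v \<in> vertices \<Gamma> \<Longrightarrow> w (Vertex v) = 0) \<Longrightarrow> form w w \<le> K * energy w"
proof -
  obtain A where A: "\<And>e x. e \<in> edges \<Gamma> \<Longrightarrow> x \<in> {0..len e} \<Longrightarrow> \<bar>edge a e x\<bar> \<le> A" using a_bound by blast
  obtain B where B: "0 \<le> B" "\<And>e. e \<in> edges \<Gamma> \<Longrightarrow> AE x in Leb e. \<bar>(edge \<kappa> e x)\<^sup>2\<bar> \<le> B"
    using kappa_sq_bound by blast
  define lm where "lm = Max (len ` edges \<Gamma>)"
  have A0: "0 \<le> A" using A edges_ne elen_pos by (metis abs_ge_zero all_not_in_conv atLeastAtMost_iff less_imp_le order_refl order_trans)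
  show thesis
  proof (rule that[of "B * lm\<^sup>2 + A"])
    show "0 \<le> B * lm\<^sup>2 + A" using A0 B(1) by simp
    fix w assume w: "w \<in> H1_graph" and z: "\<And>v. v \<in> vertices \<Gamma> \<Longrightarrow> w (Vertex v) = 0"
    have edge: "(LINT x|Leb e. (edge \<kappa> e x)\<^sup>2 * edge w e x * edge w e x)
        + (LINT x|Leb e. edge a e x * dv w e x * dv w e x)
      \<le> (B * lm\<^sup>2 + A) * (LINT x|Leb e. (dv w e x)\<^sup>2)" if e: "e \<in> edges \<Gamma>" for e
    proof -
      let ?l = "len e"
      let ?M = "leb ?l"
      define E where "E = (LINT x|?M. (dv w e x)\<^sup>2)"
      have l: "0 < ?l" by (rule elen_pos[OF e])
      have ds: "square_integrable ?l (dv w e)" by (rule dv_sq[OF w e])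
      then have E2: "integrable ?M (\<lambda>x. (dv w e x)\<^sup>2)" by (simp add: square_integrable_def)
      have ws: "square_integrable ?l (edge w e)" using w H1_subset_L2 e by (auto simp: L2_graph_def)
      have EI: "E = integral {0..?l} (\<lambda>t. (dv w e t)\<^sup>2)"
        unfolding E_def by (rule lebesgue_integral_eq_integral) (use E2 in auto)
      have E0: "0 \<le> E" by (simp add: E_def)
      have "?l \<le> lm" unfolding lm_def using fin_edges e by simp
      then have ll: "?l * ?l \<le> lm\<^sup>2" using l unfolding power2_eq_square by (intro mult_mono) auto
      have w0: "edge w e 0 = 0" using on_edge_ends(1)[OF e] z end_verts(1)[OF e] by simp
      have wb: "(edge w e x)\<^sup>2 \<le> ?l * E" if "x \<in> {0..?l}" for x
        using has_L2_deriv_increment_square[OF H1_deriv[OF w e], of 0 x ?l 0] that w0 l by (simp add: EI)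
      have "(LINT x|?M. (edge \<kappa> e x)\<^sup>2 * edge w e x * edge w e x) \<le> (LINT x|?M. B * (?l * E))"
      proof (rule integral_mono_AE)
        show "integrable ?M (\<lambda>x. (edge \<kappa> e x)\<^sup>2 * edge w e x * edge w e x)"
          by (intro square_integrable_mult_integrable kappa_sq ws e)
        show "integrable ?M (\<lambda>x. B * (?l * E))" by (rule finite_measure.integrable_const[OF finite_measure_interval])
        have "AE x in ?M. (edge w e x)\<^sup>2 \<le> ?l * E" using wb by (intro AE_I2) auto
        with B(2)[OF e] show "AE x in ?M. (edge \<kappa> e x)\<^sup>2 * edge w e x * edge w e x \<le> B * (?l * E)"
        proof eventually_elim
          case (elim x)
          then have "(edge \<kappa> e x)\<^sup>2 * (edge w e x)\<^sup>2 \<le> B * (?l * E)" using B(1) by (intro mult_mono) auto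
          then show ?case by (simp add: power2_eq_square mult.assoc)
        qed
      qed
      also have "\<dots> = B * (?l * ?l) * E" using l by (simp add: measure_restrict_space)
      also have "\<dots> \<le> B * lm\<^sup>2 * E" using ll B(1) E0 by (intro mult_right_mono mult_left_mono) auto
      finally have 1: "(LINT x|?M. (edge \<kappa> e x)\<^sup>2 * edge w e x * edge w e x) \<le> B * lm\<^sup>2 * E" .
      have "(LINT x|?M. edge a e x * dv w e x * dv w e x) \<le> (LINT x|?M. A * (dv w e x)\<^sup>2)"
      proof (rule integral_mono)
        show "integrable ?M (\<lambda>x. edge a e x * dv w e x * dv w e x)" by (intro square_integrable_mult_integrable a_sq ds e)
        show "integrable ?M (\<lambda>x. A * (dv w e x)\<^sup>2)" using E2 by simp
        fix x assume "x \<in> space ?M"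
        then have "edge a e x \<le> A" using A[OF e, of x] by (simp add: space_restrict_space)
        then have "edge a e x * (dv w e x)\<^sup>2 \<le> A * (dv w e x)\<^sup>2" by (intro mult_right_mono) auto
        then show "edge a e x * dv w e x * dv w e x \<le> A * (dv w e x)\<^sup>2" by (simp add: power2_eq_square mult.assoc)
      qed
      then have 2: "(LINT x|?M. edge a e x * dv w e x * dv w e x) \<le> A * E" by (simp add: E_def)
      show ?thesis using 1 2 unfolding E_def[symmetric] by (simp add: distrib_right)
    qed
    have "form w w = (\<Sum>e\<in>edges \<Gamma>. (LINT x|Leb e. (edge \<kappa> e x)\<^sup>2 * edge w e x * edge w e x)
        + (LINT x|Leb e. edge a e x * dv w e x * dv w e x))"
      unfolding form_eq L2_inner_def sum.distrib using z by (simp add: on_edge_def)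
    also have "\<dots> \<le> (\<Sum>e\<in>edges \<Gamma>. (B * lm\<^sup>2 + A) * (LINT x|Leb e. (dv w e x)\<^sup>2))"
      by (rule sum_mono[OF edge])
    finally show "form w w \<le> (B * lm\<^sup>2 + A) * energy w" by (simp add: energy_def sum_distrib_left)
  qed
qed

text \<open>\<open>g\<close> is the operator applied to \<open>z\<close>, with squared norm
  \<open>G\<close>. Coercivity bounds the squared norm and the energy of \<open>z\<close> by
  \<open>G / \<delta>\<^sup>2\<close>, and the equation for \<open>q\<close> then bounds all the
  integrals in the edgewise error by \<open>G\<close>.\<close>

lemma interpolation_error:
  obtains K where "0 < K"
    "\<And>n c m. (\<And>e. e \<in> edges \<Gamma> \<Longrightarrow> 0 < n e) \<Longrightarrow> \<exists>w\<in>fem_space \<Gamma> n.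
      form (\<lambda>p. (\<Sum>j<m. c j * b j p) - w p) (\<lambda>p. (\<Sum>j<m. c j * b j p) - w p) \<le> K * (max_mesh_width \<Gamma> n)\<^sup>2 * (\<Sum>j<m. (lam j * c j)\<^sup>2)"
proof -
  obtain \<delta> where \<delta>: "0 < \<delta>" "\<And>u. u \<in> H1_graph \<Longrightarrow> \<delta> * (ip u u + energy u) \<le> form u u"
    using form_coercive by blast
  obtain A where A: "\<And>e x. e \<in> edges \<Gamma> \<Longrightarrow> x \<in> {0..len e} \<Longrightarrow> \<bar>edge a e x\<bar> \<le> A" using a_bound by blast
  obtain B where B: "0 \<le> B" "\<And>e. e \<in> edges \<Gamma> \<Longrightarrow> AE x in Leb e. \<bar>(edge \<kappa> e x)\<^sup>2\<bar> \<le> B"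
    using kappa_sq_bound by blast
  obtain K1 where K1: "0 \<le> K1"
    "\<And>z g e v q n. z \<in> H1_graph \<Longrightarrow> e \<in> edges \<Gamma> \<Longrightarrow> 0 < n e \<Longrightarrow> edge_flux z g e v q \<Longrightarrow>
      (LINT x|Leb e. (dv (\<lambda>p. z p - interpolant n z p) e x)\<^sup>2) \<le>
      (max_mesh_width \<Gamma> n)\<^sup>2 * (K1 * ((LINT x|Leb e. (edge a e x * v x)\<^sup>2) + (LINT x|Leb e. (q x)\<^sup>2)))"
    using edge_interpolation_error by blast
  obtain K2 where K2: "0 \<le> K2"
    "\<And>w. w \<in> H1_graph \<Longrightarrow> (\<And>v. v \<in> vertices \<Gamma> \<Longrightarrow> w (Vertex v) = 0) \<Longrightarrow> form w w \<le> K2 * energy w"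
    using vanishing_form_bound by blast
  \<comment> \<open>The three summands stem from the flux \<open>a z'\<close> and, inside
    \<open>q\<close>, from the term with \<open>\<kappa>\<close> and from \<open>g\<close>. The
    summand 1 in \<open>K\<close> below makes it positive.\<close>
  define T where "T = A\<^sup>2 / \<delta>\<^sup>2 + 2 * B\<^sup>2 / \<delta>\<^sup>2 + 2"
  define K where "K = K2 * (K1 * T) + 1"
  have T0: "0 \<le> T" by (simp add: T_def)
  show thesis
  proof (rule that[of K])
    show "0 < K" using K1(1) K2(1) T0 by (simp add: K_def add_nonneg_pos)
    fix n :: "'e \<Rightarrow> nat" and c :: "nat \<Rightarrow> real" and m assume n: "\<And>e. e \<in> edges \<Gamma> \<Longrightarrow> 0 < n e"
    define z where "z = (\<lambda>p. \<Sum>j<m. c j * b j p)"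
    define g where "g = (\<lambda>p. \<Sum>j<m. lam j * c j * b j p)"
    define G where "G = (\<Sum>j<m. (lam j * c j)\<^sup>2)"
    have zH: "z \<in> H1_graph" unfolding z_def by (rule b_comb_H1) simp
    have gH: "g \<in> H1_graph" unfolding g_def by (rule b_comb_H1) simp
    have gg: "ip g g = G" unfolding g_def G_def by (rule form_comb(2)) simp
    have lam: "\<delta> \<le> lam j" for j by (rule lam_lower[OF \<delta>(2,1)])
    have c1: "\<delta> * (lam j * (c j)\<^sup>2) \<le> (lam j * c j)\<^sup>2" "\<delta> * (\<delta> * (c j)\<^sup>2) \<le> (lam j * c j)\<^sup>2" for j
    proof -
      have 0: "0 \<le> lam j * (c j)\<^sup>2" "0 \<le> \<delta> * (c j)\<^sup>2" using lam[of j] \<delta>(1) by auto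
      have "\<delta> * (lam j * (c j)\<^sup>2) \<le> lam j * (lam j * (c j)\<^sup>2)" by (rule mult_right_mono[OF lam 0(1)])
      then show 1: "\<delta> * (lam j * (c j)\<^sup>2) \<le> (lam j * c j)\<^sup>2" by (simp add: power2_eq_square mult_ac)
      have "\<delta> * (c j)\<^sup>2 \<le> lam j * (c j)\<^sup>2" by (rule mult_right_mono[OF lam]) simp
      then have "\<delta> * (\<delta> * (c j)\<^sup>2) \<le> \<delta> * (lam j * (c j)\<^sup>2)" using \<delta>(1) by (intro mult_left_mono) auto
      then show "\<delta> * (\<delta> * (c j)\<^sup>2) \<le> (lam j * c j)\<^sup>2" using 1 by linarith
    qed
    have "\<delta> * (\<delta> * ip z z) \<le> G" "\<delta> * form z z \<le> G"
      unfolding z_def form_comb[OF finite_lessThan] G_def sum_distrib_left by (intro sum_mono c1)+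
    moreover have "\<delta> * energy z \<le> form z z"
    proof -
      have "0 \<le> \<delta> * ip z z" using \<delta>(1) zH H1_subset_L2 by (intro mult_nonneg_nonneg L2.pos) auto
      then show ?thesis using \<delta>(2)[OF zH] by (simp add: distrib_left)
    qed
    then have "\<delta> * (\<delta> * energy z) \<le> \<delta> * form z z" using \<delta>(1) by (intro mult_left_mono) auto
    ultimately have "\<delta> * (\<delta> * ip z z) \<le> G" "\<delta> * (\<delta> * energy z) \<le> G" by linarith+
    then have zb: "ip z z \<le> G / \<delta>\<^sup>2" "energy z \<le> G / \<delta>\<^sup>2"
      using \<delta>(1) by (simp_all add: pos_le_divide_eq power2_eq_square mult_ac)
    define w where "w = interpolant n z"
    define h where "h = max_mesh_width \<Gamma> n"
    have wV: "w \<in> fem_space \<Gamma> n" unfolding w_def by (rule interpolant_fem[OF n])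
    have eH: "(\<lambda>p. z p - w p) \<in> H1_graph" by (rule H1.diff[OF zH subsetD[OF fem_subset_H1[where n=n, OF n] wV]])
    have "energy (\<lambda>p. z p - w p) \<le> (\<Sum>e\<in>edges \<Gamma>. h\<^sup>2 * (K1 * (A\<^sup>2 * (LINT x|Leb e. (dv z e x)\<^sup>2)
       + (2 * B\<^sup>2 * (LINT x|Leb e. (edge z e x)\<^sup>2) + 2 * (LINT x|Leb e. (edge g e x)\<^sup>2)))))"
      unfolding energy_def
    proof (rule sum_mono)
      fix e assume e: "e \<in> edges \<Gamma>"
      let ?M = "Leb e"
      obtain v q where fl: "edge_flux z g e v q" unfolding z_def g_def using combination_flux[OF e] by blast
      note fd = edge_fluxD[OF fl]
      have zs: "integrable ?M (\<lambda>x. (edge z e x)\<^sup>2)" and gs: "integrable ?M (\<lambda>x. (edge g e x)\<^sup>2)"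
        using zH gH H1_subset_L2 e by (auto simp: L2_graph_def square_integrable_def)
      have "(LINT x|?M. (dv (\<lambda>p. z p - w p) e x)\<^sup>2) \<le> h\<^sup>2 * (K1 * ((LINT x|?M. (edge a e x * v x)\<^sup>2) + (LINT x|?M. (q x)\<^sup>2)))"
        unfolding w_def h_def by (rule K1(2)[where n=n, OF zH e n[OF e] fl])
      also have "\<dots> \<le> h\<^sup>2 * (K1 * (A\<^sup>2 * (LINT x|?M. (dv z e x)\<^sup>2) + (2 * B\<^sup>2 * (LINT x|?M. (edge z e x)\<^sup>2) + 2 * (LINT x|?M. (edge g e x)\<^sup>2))))"
      proof (intro mult_left_mono add_mono K1(1))
        have "(LINT x|?M. (edge a e x * v x)\<^sup>2) \<le> (LINT x|?M. A\<^sup>2 * (dv z e x)\<^sup>2)"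
        proof (rule integral_mono_AE)
          show "integrable ?M (\<lambda>x. (edge a e x * v x)\<^sup>2)"
            using a_sq[OF e has_L2_derivD(1)[OF fd(1)]] by (simp add: square_integrable_def)
          show "integrable ?M (\<lambda>x. A\<^sup>2 * (dv z e x)\<^sup>2)" using dv_sq[OF zH e] by (simp add: square_integrable_def)
          have "AE x in ?M. \<bar>edge a e x\<bar> \<le> A" using A[OF e] by (intro AE_I2) auto
          with dv_unique[OF e fd(1)] show "AE x in ?M. (edge a e x * v x)\<^sup>2 \<le> A\<^sup>2 * (dv z e x)\<^sup>2"
          proof eventually_elim
            case (elim x)
            have "\<bar>edge a e x\<bar>\<^sup>2 \<le> A\<^sup>2" by (rule power_mono[OF elim(2)]) simp
            then show ?case unfolding elim(1) power_mult_distrib by (intro mult_right_mono) auto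
          qed
        qed
        then show "(LINT x|?M. (edge a e x * v x)\<^sup>2) \<le> A\<^sup>2 * (LINT x|?M. (dv z e x)\<^sup>2)" by simp
        have "(LINT x|?M. (q x)\<^sup>2) \<le> (LINT x|?M. 2 * B\<^sup>2 * (edge z e x)\<^sup>2 + 2 * (edge g e x)\<^sup>2)"
        proof (rule integral_mono_AE)
          show "integrable ?M (\<lambda>x. (q x)\<^sup>2)" using has_L2_derivD(1)[OF fd(3)] by (simp add: square_integrable_def)
          show "integrable ?M (\<lambda>x. 2 * B\<^sup>2 * (edge z e x)\<^sup>2 + 2 * (edge g e x)\<^sup>2)" using zs gs by simp
          show "AE x in ?M. (q x)\<^sup>2 \<le> 2 * B\<^sup>2 * (edge z e x)\<^sup>2 + 2 * (edge g e x)\<^sup>2"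
            using fd(4) B(2)[OF e]
          proof eventually_elim
            case (elim x)
            have "(q x)\<^sup>2 \<le> 2 * ((edge \<kappa> e x)\<^sup>2 * edge z e x)\<^sup>2 + 2 * (edge g e x)\<^sup>2"
              using square_sum_le[of "(edge \<kappa> e x)\<^sup>2 * edge z e x" "- edge g e x"] unfolding elim(1) by simp
            moreover have "((edge \<kappa> e x)\<^sup>2)\<^sup>2 \<le> B\<^sup>2" using elim(2) by (intro power_mono) auto
            then have "((edge \<kappa> e x)\<^sup>2 * edge z e x)\<^sup>2 \<le> B\<^sup>2 * (edge z e x)\<^sup>2"
              unfolding power_mult_distrib by (intro mult_right_mono) auto
            ultimately show ?case by linarith
          qed
        qed
        then show "(LINT x|?M. (q x)\<^sup>2) \<le> 2 * B\<^sup>2 * (LINT x|?M. (edge z e x)\<^sup>2) + 2 * (LINT x|?M. (edge g e x)\<^sup>2)"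
          using zs gs by simp
      qed simp
      finally show "(LINT x|?M. (dv (\<lambda>p. z p - w p) e x)\<^sup>2) \<le> h\<^sup>2 * (K1 * (A\<^sup>2 * (LINT x|?M. (dv z e x)\<^sup>2) + (2 * B\<^sup>2 * (LINT x|?M. (edge z e x)\<^sup>2) + 2 * (LINT x|?M. (edge g e x)\<^sup>2))))" .
    qed
    also have "\<dots> = h\<^sup>2 * (K1 * (A\<^sup>2 * energy z + (2 * B\<^sup>2 * ip z z + 2 * G)))"
      unfolding gg[symmetric] L2_self energy_def by (simp only: sum_distrib_left[symmetric] sum.distrib)
    also have "\<dots> \<le> h\<^sup>2 * (K1 * (A\<^sup>2 * (G / \<delta>\<^sup>2) + (2 * B\<^sup>2 * (G / \<delta>\<^sup>2) + 2 * G)))"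
      using K1(1) zb by (intro mult_left_mono add_mono order_refl) auto
    also have "\<dots> = K1 * T * (h\<^sup>2 * G)" by (simp add: T_def algebra_simps)
    finally have en: "energy (\<lambda>p. z p - w p) \<le> K1 * T * (h\<^sup>2 * G)" .
    \<comment> \<open>Vertices are nodes, so the interpolation error vanishes there and its form is
      bounded by its energy.\<close>
    have "w (Vertex v) = z (Vertex v)" if "v \<in> vertices \<Gamma>" for v using that by (simp add: w_def interpolant_def points_def)
    then have "form (\<lambda>p. z p - w p) (\<lambda>p. z p - w p) \<le> K2 * energy (\<lambda>p. z p - w p)" by (intro K2(2) eH) simp
    also have "\<dots> \<le> K2 * (K1 * T * (h\<^sup>2 * G))" by (rule mult_left_mono[OF en K2(1)])
    also have "\<dots> \<le> K * (h\<^sup>2 * G)"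
    proof -
      have "0 \<le> h\<^sup>2 * G" by (simp add: G_def sum_nonneg)
      then show ?thesis by (simp add: K_def distrib_right mult.assoc)
    qed
    finally show "\<exists>w\<in>fem_space \<Gamma> n. form (\<lambda>p. (\<Sum>j<m. c j * b j p) - w p) (\<lambda>p. (\<Sum>j<m. c j * b j p) - w p)
        \<le> K * (max_mesh_width \<Gamma> n)\<^sup>2 * (\<Sum>j<m. (lam j * c j)\<^sup>2)"
      using wV unfolding z_def h_def G_def by (auto simp: mult.assoc)
  qed
qed

end

section \<open>Completeness\<close>

text \<open>Stating the limit as \<open>lim\<close> at every point lets one function on the graph serve all edges at once.\<close>

lemma L2_interval_fast_Cauchy:
  assumes F: "\<And>k. square_integrable l (F k)"
    and fast: "\<And>k m. k \<le> m \<Longrightarrow> (LINT x|leb l. (F m x - F k x)\<^sup>2) \<le> (1 / 4) ^ k"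
  shows "square_integrable l (\<lambda>x. lim (\<lambda>k. F k x))"
    "(LINT x|leb l. (lim (\<lambda>k. F k x) - F k x)\<^sup>2) \<le> (1 / 4) ^ k"
proof -
  let ?M = "leb l"
  define G where "G x = lim (\<lambda>k. F k x)" for x
  have dsq: "square_integrable l (\<lambda>x. F m x - F k x)" for m k
    using square_integrable_lincomb[OF F F, of 1 m "-1" k] by simp
  have Fm: "F k \<in> borel_measurable ?M" for k using F by (simp add: square_integrable_def)
  have Gm: "G \<in> borel_measurable ?M" unfolding G_def[abs_def] by (rule borel_measurable_lim_metric[OF Fm])
  have nn: "(\<integral>\<^sup>+x. ennreal ((F m x - F k x)\<^sup>2) \<partial>?M) = ennreal (LINT x|?M. (F m x - F k x)\<^sup>2)" for m k
    using dsq[of m k] by (intro nn_integral_eq_integral) (auto simp: square_integrable_def)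
  \<comment> \<open>The weights \<open>2 ^ k\<close> leave the summable bounds
    \<open>(1 / 2) ^ k\<close> for the integrals and allow the passage from squares to
    increments.\<close>
  have "AE x in ?M. summable (\<lambda>k. 2 ^ k * (F (Suc k) x - F k x)\<^sup>2)"
  proof -
    have "(\<integral>\<^sup>+x. (\<Sum>k. ennreal (2 ^ k * (F (Suc k) x - F k x)\<^sup>2)) \<partial>?M) = (\<Sum>k. \<integral>\<^sup>+x. ennreal (2 ^ k * (F (Suc k) x - F k x)\<^sup>2) \<partial>?M)"
      using Fm by (intro nn_integral_suminf) auto
    also have "\<dots> = (\<Sum>k. ennreal (2 ^ k * (LINT x|?M. (F (Suc k) x - F k x)\<^sup>2)))"
      using Fm by (intro suminf_cong) (simp add: ennreal_mult nn_integral_cmult nn)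
    also have "\<dots> \<le> (\<Sum>k. ennreal ((1 / 2) ^ k))"
    proof (intro suminf_le ennreal_leI)
      fix k
      have "2 ^ k * (LINT x|?M. (F (Suc k) x - F k x)\<^sup>2) \<le> 2 ^ k * (1 / 4) ^ k" by (intro mult_left_mono fast) auto
      also have "\<dots> = (2 * (1 / 4)) ^ k" by (rule power_mult_distrib[symmetric])
      finally show "2 ^ k * (LINT x|?M. (F (Suc k) x - F k x)\<^sup>2) \<le> (1 / 2) ^ k" by simp
    qed auto
    also have "\<dots> < \<infinity>" by (subst suminf_ennreal2) (auto intro!: summable_geometric)
    finally have "AE x in ?M. (\<Sum>k. ennreal (2 ^ k * (F (Suc k) x - F k x)\<^sup>2)) \<noteq> \<infinity>"
      using Fm by (intro nn_integral_PInf_AE) auto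
    then show ?thesis
      by eventually_elim (rule summable_suminf_not_top, auto)
  qed
  then have conv: "AE x in ?M. (\<lambda>m. F m x) \<longlonglongrightarrow> G x"
  proof eventually_elim
    case (elim x)
    \<comment> \<open>Weighted inequality of arithmetic and geometric mean: an increment is at most
      a geometric term plus a term of the convergent series.\<close>
    have "\<bar>F (Suc k) x - F k x\<bar> \<le> (1 / 2) ^ k + 2 ^ k * (F (Suc k) x - F k x)\<^sup>2" for k
    proof -
      have "2 * t \<le> 1 / c + c * t\<^sup>2" if "0 < c" for t c :: real
      proof -
        have "0 \<le> (c * t - 1)\<^sup>2 / c" using that by simp
        then show ?thesis using that by (simp add: field_simps power2_eq_square)
      qed
      from this[of "2 ^ k" "\<bar>F (Suc k) x - F k x\<bar>"]
      have "2 * \<bar>F (Suc k) x - F k x\<bar> \<le> (1 / 2) ^ k + 2 ^ k * (F (Suc k) x - F k x)\<^sup>2" by (simp add: power_one_over)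
      moreover have "\<bar>F (Suc k) x - F k x\<bar> \<le> 2 * \<bar>F (Suc k) x - F k x\<bar>" by simp
      ultimately show ?thesis by (rule order_trans[rotated])
    qed
    then have "summable (\<lambda>k. F (Suc k) x - F k x)"
      using summable_comparison_test'[OF summable_add[OF summable_geometric[of "1 / 2 :: real"] elim], of 0 "\<lambda>k. F (Suc k) x - F k x"] by simp
    then have "convergent (\<lambda>m. \<Sum>k<m. F (Suc k) x - F k x)" by (simp add: summable_iff_convergent)
    then have "convergent (\<lambda>m. F m x - F 0 x)" using sum_lessThan_telescope[of "\<lambda>k. F k x"] by simp
    then have "convergent (\<lambda>m. F m x)" using convergent_add[OF _ convergent_const[of "F 0 x"]] by fastforce
    then show ?case by (simp add: G_def convergent_LIMSEQ_iff)
  qed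
  \<comment> \<open>Fatou's lemma transfers the Cauchy estimate to the limit.\<close>
  have fat: "(\<integral>\<^sup>+x. ennreal ((G x - F k x)\<^sup>2) \<partial>?M) \<le> ennreal ((1 / 4) ^ k)" for k
  proof -
    have "(\<integral>\<^sup>+x. ennreal ((G x - F k x)\<^sup>2) \<partial>?M) = (\<integral>\<^sup>+x. liminf (\<lambda>m. ennreal ((F m x - F k x)\<^sup>2)) \<partial>?M)"
    proof (rule nn_integral_cong_AE)
      show "AE x in ?M. ennreal ((G x - F k x)\<^sup>2) = liminf (\<lambda>m. ennreal ((F m x - F k x)\<^sup>2))"
        using conv
      proof eventually_elim
        case (elim x)
        then have "(\<lambda>m. ennreal ((F m x - F k x)\<^sup>2)) \<longlonglongrightarrow> ennreal ((G x - F k x)\<^sup>2)"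
          by (intro tendsto_ennrealI tendsto_intros)
        from lim_imp_Liminf[OF sequentially_bot this] show ?case by (rule sym)
      qed
    qed
    also have "\<dots> \<le> liminf (\<lambda>m. \<integral>\<^sup>+x. ennreal ((F m x - F k x)\<^sup>2) \<partial>?M)"
      using Fm by (intro nn_integral_liminf) auto
    also have "\<dots> \<le> ennreal ((1 / 4) ^ k)"
    proof (rule Liminf_le)
      show "\<forall>\<^sub>F m in sequentially. (\<integral>\<^sup>+x. ennreal ((F m x - F k x)\<^sup>2) \<partial>?M) \<le> ennreal ((1 / 4) ^ k)"
        using eventually_ge_at_top[of k]
      proof eventually_elim
        case (elim m)
        then show ?case unfolding nn by (intro ennreal_leI fast)
      qed
    qed simp
    finally show ?thesis .
  qed
  have int: "integrable ?M (\<lambda>x. (G x - F k x)\<^sup>2)" for k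
    by (rule integrableI_bounded) (use Gm Fm fat[of k] in \<open>auto intro: order_le_less_trans\<close>)
  have "square_integrable l (\<lambda>x. G x - F 0 x)" using int Gm Fm by (simp add: square_integrable_def)
  from square_integrable_lincomb[OF this F[of 0], of 1 1] have "square_integrable l G" by simp
  then show "square_integrable l (\<lambda>x. lim (\<lambda>k. F k x))" by (simp add: G_def[abs_def])
  have "ennreal (LINT x|?M. (G x - F k x)\<^sup>2) \<le> ennreal ((1 / 4) ^ k)"
    using fat[of k] nn_integral_eq_integral[OF int] by simp
  then show "(LINT x|?M. (lim (\<lambda>k. F k x) - F k x)\<^sup>2) \<le> (1 / 4) ^ k" by (simp add: G_def)
qed

context metric_graph_locale
begin

text \<open>A subsequence of the partial sums with tails at most \<open>(1 / 4) ^ k\<close> has a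
  limit on every edge; the triangle inequality extends the convergence in norm to all partial
  sums.\<close>

lemma Riesz_Fischer:
  assumes b: "L2.orthonormal UNIV b" and c: "summable (\<lambda>j. (c j)\<^sup>2)"
  shows "\<exists>u\<in>L2_graph \<Gamma>. series_converges_to \<Gamma> (\<lambda>j p. c j * b j p) u"
proof -
  define s where "s n p = (\<Sum>j<n. c j * b j p)" for n p
  have sX: "s n \<in> L2_graph \<Gamma>" for n
    unfolding s_def[abs_def] using b by (intro L2.sum_mem) (auto simp: L2.orthonormal_def)
  define t where "t m = (\<Sum>j. (c (j + m))\<^sup>2)" for m
  have tail: "ip (\<lambda>p. s n p - s m p) (\<lambda>p. s n p - s m p) \<le> t m" if "m \<le> n" for m n
  proof -
    have "(\<lambda>p. s n p - s m p) = (\<lambda>p. \<Sum>j\<in>{m..<n}. c j * b j p)"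
    proof
      fix p
      show "s n p - s m p = (\<Sum>j\<in>{m..<n}. c j * b j p)"
        using sum_diff_nat_ivl[OF le0 that, of "\<lambda>j. c j * b j p"] by (simp add: s_def atLeast0LessThan)
    qed
    then have "ip (\<lambda>p. s n p - s m p) (\<lambda>p. s n p - s m p) = (\<Sum>j\<in>{m..<n}. c j * c j)"
      using L2.orthonormal_sum(3)[OF b, of "{m..<n}" c c] by simp
    also have "\<dots> = (\<Sum>j<n - m. (c (j + m))\<^sup>2)"
      using sum.shift_bounds_nat_ivl[of "\<lambda>j. c j * c j" 0 m "n - m"] that by (simp add: power2_eq_square atLeast0LessThan)
    also have "\<dots> \<le> t m" unfolding t_def by (intro sum_le_suminf summable_ignore_initial_segment c) auto
    finally show ?thesis .
  qed
  have t0: "t \<longlonglongrightarrow> 0"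
    using suminf_exist_split2[OF c] by (simp add: t_def[abs_def])
  \<comment> \<open>Taking the least index makes \<open>N\<close> monotone, so the tail estimate
    compares any two members of the subsequence.\<close>
  define N where "N k = (LEAST m. t m \<le> (1 / 4) ^ k)" for k
  have ex: "\<exists>m. t m \<le> (1 / 4) ^ k" for k
    using order_tendstoD(2)[OF t0, of "(1 / 4) ^ k"] by (auto simp: eventually_sequentially intro: less_imp_le)
  have N: "t (N k) \<le> (1 / 4) ^ k" for k unfolding N_def by (rule LeastI_ex[OF ex])
  have Nmono: "N k \<le> N m" if "k \<le> m" for k m
  proof -
    have "t (N m) \<le> (1 / 4) ^ k" by (rule order_trans[OF N power_decreasing[OF that]]) auto
    then show ?thesis unfolding N_def[of k] by (rule Least_le)
  qed
  define u where "u p = lim (\<lambda>k. s (N k) p)" for p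
  have edge: "square_integrable (len e) (edge u e)"
    "(LINT x|Leb e. (edge u e x - edge (s (N k)) e x)\<^sup>2) \<le> (1 / 4) ^ k" if e: "e \<in> edges \<Gamma>" for e k
  proof -
    have sq: "square_integrable (len e) (edge (s (N k)) e)" for k using sX e by (simp add: L2_graph_def)
    have fast: "(LINT x|Leb e. (edge (s (N m)) e x - edge (s (N k)) e x)\<^sup>2) \<le> (1 / 4) ^ k" if "k \<le> m" for k m
    proof -
      have "(LINT x|Leb e. (edge (s (N m)) e x - edge (s (N k)) e x)\<^sup>2)
        \<le> (\<Sum>e\<in>edges \<Gamma>. LINT x|Leb e. (edge (s (N m)) e x - edge (s (N k)) e x)\<^sup>2)"
        using e fin_edges by (intro member_le_sum) auto
      also have "\<dots> = ip (\<lambda>p. s (N m) p - s (N k) p) (\<lambda>p. s (N m) p - s (N k) p)"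
        by (simp add: L2_inner_def on_edge_def power2_eq_square)
      also have "\<dots> \<le> (1 / 4) ^ k" using tail[OF Nmono[OF that]] N[of k] by simp
      finally show ?thesis .
    qed
    from L2_interval_fast_Cauchy[of "len e" "\<lambda>k. edge (s (N k)) e", OF sq fast]
    show "square_integrable (len e) (edge u e)"
      "(LINT x|Leb e. (edge u e x - edge (s (N k)) e x)\<^sup>2) \<le> (1 / 4) ^ k"
      by (simp_all add: on_edge_def[abs_def] u_def[abs_def])
  qed
  have uX: "u \<in> L2_graph \<Gamma>" using edge(1) by (simp add: L2_graph_def)
  define D where "D = real (card (edges \<Gamma>))"
  have uN: "ip (\<lambda>p. u p - s (N k) p) (\<lambda>p. u p - s (N k) p) \<le> D * (1 / 4) ^ k" for k
  proof -
    have "ip (\<lambda>p. u p - s (N k) p) (\<lambda>p. u p - s (N k) p) = (\<Sum>e\<in>edges \<Gamma>. LINT x|Leb e. (edge u e x - edge (s (N k)) e x)\<^sup>2)"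
      by (simp add: L2_inner_def on_edge_def power2_eq_square)
    also have "\<dots> \<le> (\<Sum>e\<in>edges \<Gamma>. (1 / 4) ^ k)" by (intro sum_mono edge(2))
    finally show ?thesis by (simp add: D_def)
  qed
  have bound: "L2_norm \<Gamma> (\<lambda>p. u p - s n p) \<le> (sqrt D + 1) * (1 / 2) ^ k" if "N k \<le> n" for n k
  proof -
    have h: "sqrt ((1 / 4) ^ k) = (1 / 2) ^ k"
      by (rule real_sqrt_unique) (simp_all add: power2_eq_square flip: power_mult_distrib)
    have "L2_norm \<Gamma> (\<lambda>p. u p - s n p) = sqrt (ip (\<lambda>p. (u p - s (N k) p) + (s (N k) p - s n p)) (\<lambda>p. (u p - s (N k) p) + (s (N k) p - s n p)))"
      by (simp add: L2_norm_def)
    also have "\<dots> \<le> sqrt (ip (\<lambda>p. u p - s (N k) p) (\<lambda>p. u p - s (N k) p)) + sqrt (ip (\<lambda>p. s (N k) p - s n p) (\<lambda>p. s (N k) p - s n p))"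
      by (intro L2.triangle L2.diff uX sX)
    also have "\<dots> \<le> sqrt (D * (1 / 4) ^ k) + sqrt ((1 / 4) ^ k)"
    proof (intro add_mono real_sqrt_le_mono uN)
      have "ip (\<lambda>p. s (N k) p - s n p) (\<lambda>p. s (N k) p - s n p) = ip (\<lambda>p. s n p - s (N k) p) (\<lambda>p. s n p - s (N k) p)"
        by (simp add: L2_inner_def on_edge_def algebra_simps)
      then show "ip (\<lambda>p. s (N k) p - s n p) (\<lambda>p. s (N k) p - s n p) \<le> (1 / 4) ^ k"
        using tail[OF that] N[of k] by simp
    qed
    also have "\<dots> = (sqrt D + 1) * (1 / 2) ^ k" by (simp add: real_sqrt_mult h distrib_right)
    finally show ?thesis .
  qed
  have "(\<lambda>n. L2_norm \<Gamma> (\<lambda>p. u p - s n p)) \<longlonglongrightarrow> 0"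
  proof (rule LIMSEQ_I)
    fix r :: real assume r: "0 < r"
    have D: "0 < sqrt D + 1" by (simp add: D_def add_nonneg_pos)
    obtain k where "(1 / 2) ^ k < r / (sqrt D + 1)" using real_arch_pow_inv[of "r / (sqrt D + 1)" "1 / 2"] r D by auto
    then have k: "(sqrt D + 1) * (1 / 2) ^ k < r" using D by (simp add: pos_less_divide_eq mult.commute)
    have "norm (L2_norm \<Gamma> (\<lambda>p. u p - s n p) - 0) < r" if "N k \<le> n" for n
      using bound[OF that] k L2.pos[OF L2.diff[OF uX sX[of n]]] by (simp add: L2_norm_def)
    then show "\<exists>n0. \<forall>n\<ge>n0. norm (L2_norm \<Gamma> (\<lambda>p. u p - s n p) - 0) < r" by blast
  qed
  then show ?thesis using uX unfolding series_converges_to_def s_def by blast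
qed

end

section \<open>The discrete solution\<close>

locale fem_galerkin = eigen_graph \<Gamma> \<kappa> a \<kappa>0 a0 \<alpha> S d0 b lam +
  G: galerkin "L2_graph \<Gamma>" "fem_space \<Gamma> n" "L2_inner \<Gamma>" "bilinear_form \<Gamma> \<kappa> a \<alpha>" "metric_graph_locale.H1_graph \<Gamma>" b lam K \<delta> e \<theta> N
  for \<Gamma> :: "('v, 'e) metric_graph" and \<kappa> a \<kappa>0 a0 \<alpha> S d0 b lam and n :: "'e \<Rightarrow> nat" and K \<delta> e \<theta> N
begin

abbreviation V :: "(('v, 'e) point \<Rightarrow> real) set" where "V \<equiv> fem_space \<Gamma> n"

lemma V_eqI:
  assumes "u \<in> V" "v \<in> V" "\<And>i. i < N \<Longrightarrow> ip u (e i) = ip v (e i)"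
  shows "u = v"
proof -
  have "u = (\<lambda>p. \<Sum>i<N. ip u (e i) * e i p)" by (rule G.e_span[OF assms(1)])
  also have "\<dots> = (\<lambda>p. \<Sum>i<N. ip v (e i) * e i p)" by (simp add: assms(3))
  also have "\<dots> = v" by (rule G.e_span[OF assms(2), symmetric])
  finally show ?thesis .
qed

lemma comb_V: "(\<lambda>p. \<Sum>i<N. c i * e i p) \<in> V"
  by (intro G.B.sum_mem) (auto simp: G.eV)

lemma comb_coef: "i < N \<Longrightarrow> ip (\<lambda>p. \<Sum>i<N. c i * e i p) (e i) = c i"
  using L2.orthonormal_sum(2)[OF G.e_on finite_lessThan order_refl, of i c] by (simp only: lessThan_iff if_True)

text \<open>Evaluates the \<open>THE\<close> terms for the projection and the discrete operator: a
  functional determined by its values on the basis is represented by the one vector with these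
  coordinates.\<close>

lemma represent:
  assumes z: "z \<in> V" "\<And>i. i < N \<Longrightarrow> ip z (e i) = \<phi> (e i)"
    and \<phi>: "\<And>w. w \<in> V \<Longrightarrow> \<phi> w = (\<Sum>i<N. ip w (e i) * \<phi> (e i))"
  shows "(THE u. u \<in> V \<and> (\<forall>w\<in>V. ip u w = \<phi> w)) = z"
proof (rule the_equality)
  have "ip z w = \<phi> w" if w: "w \<in> V" for w
  proof -
    have "ip z w = ip z (\<lambda>p. \<Sum>i<N. ip w (e i) * e i p)"
      using G.e_span[OF w] by metis
    also have "\<dots> = (\<Sum>i<N. ip w (e i) * ip z (e i))"
      using z(1) G.VX by (intro L2.sum_right) (auto simp: G.eX)
    also have "\<dots> = \<phi> w" unfolding \<phi>[OF w] by (simp add: z(2))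
    finally show ?thesis .
  qed
  then show "z \<in> V \<and> (\<forall>w\<in>V. ip z w = \<phi> w)" using z(1) by blast
  fix u assume u: "u \<in> V \<and> (\<forall>w\<in>V. ip u w = \<phi> w)"
  then show "u = z" using z by (intro V_eqI) (auto simp: G.eV)
qed

lemma fem_proj_eq:
  assumes "f \<in> L2_graph \<Gamma>"
  shows "fem_proj \<Gamma> n f = (\<lambda>p. \<Sum>i<N. ip f (e i) * e i p)"
  unfolding fem_proj_def
proof (rule represent[OF comb_V comb_coef])
  fix w assume w: "w \<in> V"
  have "ip f w = ip f (\<lambda>p. \<Sum>i<N. ip w (e i) * e i p)"
    using G.e_span[OF w] by metis
  also have "\<dots> = (\<Sum>i<N. ip w (e i) * ip f (e i))"
    using assms by (intro L2.sum_right) (auto simp: G.eX)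
  finally show "ip f w = (\<Sum>i<N. ip w (e i) * ip f (e i))" .
qed

lemma fem_op_eq:
  assumes u: "u \<in> V"
  shows "fem_op \<Gamma> \<kappa> a \<alpha> n u = (\<lambda>p. \<Sum>i<N. (\<theta> i * ip u (e i)) * e i p)"
  unfolding fem_op_def
proof (rule represent[OF comb_V])
  fix i assume i: "i < N"
  have "bilinear_form \<Gamma> \<kappa> a \<alpha> u (e i) = bilinear_form \<Gamma> \<kappa> a \<alpha> (e i) u" by (rule G.B.sym[OF u G.eV[OF i]])
  also have "\<dots> = \<theta> i * ip (e i) u" by (rule G.e_eigen[OF i u])
  also have "ip (e i) u = ip u (e i)" using u G.VX by (intro L2.sym G.eX[OF i]) auto
  finally show "ip (\<lambda>p. \<Sum>i<N. (\<theta> i * ip u (e i)) * e i p) (e i) = bilinear_form \<Gamma> \<kappa> a \<alpha> u (e i)"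
    unfolding comb_coef[OF i] by simp
next
  fix w assume w: "w \<in> V"
  have "bilinear_form \<Gamma> \<kappa> a \<alpha> u w = bilinear_form \<Gamma> \<kappa> a \<alpha> u (\<lambda>p. \<Sum>i<N. ip w (e i) * e i p)"
    using G.e_span[OF w] by metis
  also have "\<dots> = (\<Sum>i<N. ip w (e i) * bilinear_form \<Gamma> \<kappa> a \<alpha> u (e i))"
    using u by (intro G.B.sum_right) (auto simp: G.eV)
  finally show "bilinear_form \<Gamma> \<kappa> a \<alpha> u w = (\<Sum>i<N. ip w (e i) * bilinear_form \<Gamma> \<kappa> a \<alpha> u (e i))" .
qed

text \<open>In the basis \<open>e\<close> the map under \<open>inv_into\<close> is diagonal with
  positive entries \<open>1 + s * \<theta> i\<close>, hence injective and inverted entry by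
  entry.\<close>

lemma fem_resolvent_eq:
  assumes f: "f \<in> V" and s: "0 < s"
  shows "fem_resolvent \<Gamma> \<kappa> a \<alpha> n s f = (\<lambda>p. \<Sum>i<N. (ip f (e i) / (1 + s * \<theta> i)) * e i p)"
proof -
  define T where "T u p = u p + s * fem_op \<Gamma> \<kappa> a \<alpha> n u p" for u p
  have T1: "1 + s * \<theta> i \<noteq> 0" if "i < N" for i
    using mult_pos_pos[OF s G.\<theta>_pos[OF that]] by linarith
  have op: "fem_op \<Gamma> \<kappa> a \<alpha> n u \<in> V" if "u \<in> V" for u unfolding fem_op_eq[OF that] by (rule comb_V)
  have TV: "T u \<in> V" if "u \<in> V" for u
    unfolding T_def[abs_def] using G.B.lincomb[OF that op[OF that], of 1 s] by simp
  have Tc: "ip (T u) (e i) = (1 + s * \<theta> i) * ip u (e i)" if u: "u \<in> V" and i: "i < N" for u i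
  proof -
    have "ip (T u) (e i) = 1 * ip u (e i) + s * ip (fem_op \<Gamma> \<kappa> a \<alpha> n u) (e i)"
      unfolding T_def[abs_def] using L2.lincomb_left[OF subsetD[OF G.VX u] subsetD[OF G.VX op[OF u]] G.eX[OF i], of 1 s] by simp
    also have "ip (fem_op \<Gamma> \<kappa> a \<alpha> n u) (e i) = \<theta> i * ip u (e i)"
      unfolding fem_op_eq[OF u] by (rule comb_coef[OF i])
    finally show ?thesis by (simp add: distrib_right)
  qed
  have inj: "inj_on T V"
  proof (rule inj_onI)
    fix u v assume uv: "u \<in> V" "v \<in> V" "T u = T v"
    show "u = v"
    proof (rule V_eqI[OF uv(1,2)])
      fix i assume i: "i < N"
      show "ip u (e i) = ip v (e i)"
        using Tc[OF uv(1) i] Tc[OF uv(2) i] T1[OF i] uv(3) by simp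
    qed
  qed
  have Tf: "T (\<lambda>p. \<Sum>i<N. (ip f (e i) / (1 + s * \<theta> i)) * e i p) = f"
  proof (rule V_eqI[OF TV[OF comb_V] f])
    fix i assume i: "i < N"
    show "ip (T (\<lambda>p. \<Sum>i<N. (ip f (e i) / (1 + s * \<theta> i)) * e i p)) (e i) = ip f (e i)"
      unfolding Tc[OF comb_V i] comb_coef[OF i] using T1[OF i] by simp
  qed
  have "fem_resolvent \<Gamma> \<kappa> a \<alpha> n s = inv_into V T" by (simp add: fem_resolvent_def T_def[abs_def])
  moreover have "inv_into V T (T w) = w" if "w \<in> V" for w by (rule inv_into_f_f[OF inj that])
  from this[OF comb_V[of "\<lambda>i. ip f (e i) / (1 + s * \<theta> i)"]] have "inv_into V T f = (\<lambda>p. \<Sum>i<N. (ip f (e i) / (1 + s * \<theta> i)) * e i p)"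
    by (simp only: Tf)
  ultimately show ?thesis by simp
qed

text \<open>The quadrature for the scalar \<open>\<theta> i\<close>, that is, an approximation of
  \<open>\<theta> i powr (- \<beta>)\<close>.\<close>

definition weight :: "real \<Rightarrow> real \<Rightarrow> nat \<Rightarrow> real" where
  "weight k \<beta> i = 2 * k * sin (pi * \<beta>) / pi *
     (\<Sum>l\<in>{- \<lceil>pi\<^sup>2 / (4 * \<beta> * k\<^sup>2)\<rceil>..\<lceil>pi\<^sup>2 / (4 * (1 - \<beta>) * k\<^sup>2)\<rceil>}.
        exp (2 * \<beta> * of_int l * k) / (1 + exp (2 * of_int l * k) * \<theta> i))"

lemma quadrature_eq:
  assumes f: "f \<in> V"
  shows "quadrature \<Gamma> \<kappa> a \<alpha> n k \<beta> f = (\<lambda>p. \<Sum>i<N. (weight k \<beta> i * ip f (e i)) * e i p)"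
proof
  fix p
  let ?L = "{- \<lceil>pi\<^sup>2 / (4 * \<beta> * k\<^sup>2)\<rceil>..\<lceil>pi\<^sup>2 / (4 * (1 - \<beta>) * k\<^sup>2)\<rceil>}"
  have "quadrature \<Gamma> \<kappa> a \<alpha> n k \<beta> f p = 2 * k * sin (pi * \<beta>) / pi *
    (\<Sum>l\<in>?L. \<Sum>i<N. exp (2 * \<beta> * of_int l * k) / (1 + exp (2 * of_int l * k) * \<theta> i) * (ip f (e i) * e i p))"
    unfolding quadrature_def fem_resolvent_eq[OF f exp_gt_zero] by (simp add: sum_distrib_left)
  also have "\<dots> = 2 * k * sin (pi * \<beta>) / pi *
    (\<Sum>i<N. (\<Sum>l\<in>?L. exp (2 * \<beta> * of_int l * k) / (1 + exp (2 * of_int l * k) * \<theta> i)) * (ip f (e i) * e i p))"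
    by (subst sum.swap) (simp only: sum_distrib_right)
  also have "\<dots> = (\<Sum>i<N. (weight k \<beta> i * ip f (e i)) * e i p)"
    unfolding weight_def by (simp only: sum_distrib_left[where A = "{..<N}"] mult.assoc)
  finally show "quadrature \<Gamma> \<kappa> a \<alpha> n k \<beta> f p = (\<Sum>i<N. (weight k \<beta> i * ip f (e i)) * e i p)" .
qed

lemma series_coef:
  assumes u: "u \<in> L2_graph \<Gamma>" and w: "w \<in> L2_graph \<Gamma>" and f: "\<And>j. f j \<in> L2_graph \<Gamma>"
    and s: "series_converges_to \<Gamma> (\<lambda>j p. c j * f j p) u"
  shows "(\<lambda>j. c j * ip (f j) w) sums ip u w"
proof -
  let ?S = "\<lambda>m p. \<Sum>j<m. c j * f j p"
  have S: "?S m \<in> L2_graph \<Gamma>" for m by (intro L2.sum_mem) (auto simp: f)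
  have "(\<lambda>m. (L2_norm \<Gamma> (\<lambda>p. u p - ?S m p))\<^sup>2) \<longlonglongrightarrow> 0\<^sup>2"
    using s unfolding series_converges_to_def by (rule tendsto_power)
  moreover have "(L2_norm \<Gamma> (\<lambda>p. u p - ?S m p))\<^sup>2 = ip (\<lambda>p. u p - ?S m p) (\<lambda>p. u p - ?S m p)" for m
    unfolding L2_norm_def by (rule real_sqrt_pow2[OF L2.pos[OF L2.diff[OF u S]]])
  ultimately have "(\<lambda>m. ip (\<lambda>p. u p - ?S m p) (\<lambda>p. u p - ?S m p)) \<longlonglongrightarrow> 0" by (simp only: zero_power2)
  from L2.tendsto_left[OF u w S this] show ?thesis
    unfolding sums_def by (subst (asm) L2.sum_left) (auto simp: f w)
qed

text \<open>In finite dimension the series converges in norm exactly when its \<open>N\<close>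
  coordinate series do; otherwise \<open>series_sum\<close> returns 0. The coordinates are the same
  for every limit that the choice may pick.\<close>

lemma fem_noise_eq:
  fixes \<xi> :: "nat \<Rightarrow> 'w \<Rightarrow> real"
  shows "fem_noise \<Gamma> n b \<xi> \<omega> \<in> V"
    "i < N \<Longrightarrow> ip (fem_noise \<Gamma> n b \<xi> \<omega>) (e i) =
      (if \<forall>i<N. summable (\<lambda>j. G.coef j i * \<xi> j \<omega>) then (\<Sum>j. G.coef j i * \<xi> j \<omega>) else 0)"
proof -
  let ?f = "\<lambda>j p. \<xi> j \<omega> * fem_proj \<Gamma> n (b j) p"
  let ?C = "\<forall>i<N. summable (\<lambda>j. G.coef j i * \<xi> j \<omega>)"
  have PV: "fem_proj \<Gamma> n (b j) \<in> V" for j unfolding fem_proj_eq[OF b_L2] by (rule comb_V)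
  have PX: "fem_proj \<Gamma> n (b j) \<in> L2_graph \<Gamma>" for j using PV G.VX by blast
  have Pc: "ip (fem_proj \<Gamma> n (b j)) (e i) = G.coef j i" if "i < N" for i j
    unfolding fem_proj_eq[OF b_L2] comb_coef[OF that] G.coef_def ..
  have coef: "(\<lambda>j. G.coef j i * \<xi> j \<omega>) sums ip u (e i)" if "u \<in> V" "series_converges_to \<Gamma> ?f u" "i < N" for u i
    using series_coef[OF _ G.eX[OF that(3)] PX that(2)] that(1) G.VX Pc[OF that(3)] by (auto simp: mult.commute)
  have "\<exists>u\<in>V. series_converges_to \<Gamma> ?f u" if ?C
  proof (intro bexI[OF _ comb_V])
    define \<eta> where "\<eta> i = (\<Sum>j. G.coef j i * \<xi> j \<omega>)" for i
    have lim: "(\<lambda>m. \<Sum>j<m. G.coef j i * \<xi> j \<omega>) \<longlonglongrightarrow> \<eta> i" if "i < N" for i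
      using \<open>?C\<close> that unfolding \<eta>_def by (intro summable_LIMSEQ) auto
    have "(\<Sum>i<N. \<eta> i * e i p) - (\<Sum>j<m. ?f j p) = (\<Sum>i<N. (\<eta> i - (\<Sum>j<m. G.coef j i * \<xi> j \<omega>)) * e i p)" for m p
    proof -
      have "(\<Sum>j<m. ?f j p) = (\<Sum>j<m. \<Sum>i<N. (G.coef j i * \<xi> j \<omega>) * e i p)"
        unfolding fem_proj_eq[OF b_L2] by (simp add: sum_distrib_left G.coef_def mult_ac)
      also have "\<dots> = (\<Sum>i<N. (\<Sum>j<m. G.coef j i * \<xi> j \<omega>) * e i p)" by (subst sum.swap) (simp add: sum_distrib_right)
      finally show ?thesis by (simp add: left_diff_distrib sum_subtractf)
    qed
    then have "L2_norm \<Gamma> (\<lambda>p. (\<Sum>i<N. \<eta> i * e i p) - (\<Sum>j<m. ?f j p)) = sqrt (\<Sum>i<N. (\<eta> i - (\<Sum>j<m. G.coef j i * \<xi> j \<omega>)) * (\<eta> i - (\<Sum>j<m. G.coef j i * \<xi> j \<omega>)))" for m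
      by (simp add: L2_norm_def L2.orthonormal_sum(3)[OF G.e_on])
    moreover have "(\<lambda>m. sqrt (\<Sum>i<N. (\<eta> i - (\<Sum>j<m. G.coef j i * \<xi> j \<omega>)) * (\<eta> i - (\<Sum>j<m. G.coef j i * \<xi> j \<omega>)))) \<longlonglongrightarrow> sqrt (\<Sum>i<N. (\<eta> i - \<eta> i) * (\<eta> i - \<eta> i))"
      by (intro tendsto_intros lim) auto
    ultimately show "series_converges_to \<Gamma> ?f (\<lambda>p. \<Sum>i<N. \<eta> i * e i p)"
      unfolding series_converges_to_def by simp
  qed
  moreover have ?C if c: "\<exists>u\<in>V. series_converges_to \<Gamma> ?f u"
  proof -
    obtain u where "u \<in> V" "series_converges_to \<Gamma> ?f u" by (rule bexE[OF c])
    from coef[OF this] show ?C by (auto simp: sums_iff)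
  qed
  ultimately have ex: "(\<exists>u\<in>V. series_converges_to \<Gamma> ?f u) = ?C" by (rule iffI[rotated])
  have pick: "fem_noise \<Gamma> n b \<xi> \<omega> \<in> V \<and> series_converges_to \<Gamma> ?f (fem_noise \<Gamma> n b \<xi> \<omega>)" if ?C
  proof -
    have ex': "\<exists>u\<in>V. series_converges_to \<Gamma> ?f u" using that unfolding ex .
    from someI_ex[OF ex'[unfolded Bex_def]] show ?thesis
      unfolding fem_noise_def series_sum_def if_P[OF ex'] .
  qed
  have none: "fem_noise \<Gamma> n b \<xi> \<omega> = (\<lambda>_. 0)" if "\<not> ?C"
    using that unfolding ex[symmetric] fem_noise_def series_sum_def by (rule if_not_P)
  show "fem_noise \<Gamma> n b \<xi> \<omega> \<in> V" using pick none fem_zero by (cases ?C) auto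
  assume i: "i < N"
  show "ip (fem_noise \<Gamma> n b \<xi> \<omega>) (e i) = (if ?C then (\<Sum>j. G.coef j i * \<xi> j \<omega>) else 0)"
  proof (cases ?C)
    case True
    with pick have "(\<lambda>j. G.coef j i * \<xi> j \<omega>) sums ip (fem_noise \<Gamma> n b \<xi> \<omega>) (e i)" by (intro coef i) auto
    with True show ?thesis by (simp add: sums_iff)
  next
    case False
    show ?thesis unfolding none[OF False] if_not_P[OF False] by (rule L2.zero_left[OF G.eX[OF i]])
  qed
qed

text \<open>By Riesz-Fischer and Parseval the series converges exactly when the squares of its
  coefficients are summable. A limit is unique only up to null sets, so the choice is seen through
  inner products.\<close>

lemma solution_eq:
  fixes \<xi> :: "nat \<Rightarrow> 'w \<Rightarrow> real" and \<beta> :: real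
  defines "x \<equiv> \<lambda>j \<omega>. lam j powr (- \<beta>) * \<xi> j \<omega>"
  shows "solution \<Gamma> \<beta> b lam \<xi> \<omega> \<in> L2_graph \<Gamma>"
    "ip (solution \<Gamma> \<beta> b lam \<xi> \<omega>) (solution \<Gamma> \<beta> b lam \<xi> \<omega>) =
      (if summable (\<lambda>j. (x j \<omega>)\<^sup>2) then \<Sum>j. (x j \<omega>)\<^sup>2 else 0)"
    "i < N \<Longrightarrow> ip (solution \<Gamma> \<beta> b lam \<xi> \<omega>) (e i) =
      (if summable (\<lambda>j. (x j \<omega>)\<^sup>2) then \<Sum>j. x j \<omega> * G.coef j i else 0)"
proof -
  let ?f = "\<lambda>j p. x j \<omega> * b j p"
  let ?U = "solution \<Gamma> \<beta> b lam \<xi> \<omega>"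
  have U: "?U = series_sum \<Gamma> (L2_graph \<Gamma>) ?f" by (simp add: solution_def x_def)
  have coef: "ip u (b j) = x j \<omega>" if "u \<in> L2_graph \<Gamma>" "series_converges_to \<Gamma> ?f u" for u j
  proof -
    have "(\<lambda>i. x i \<omega> * ip (b i) (b j)) sums ip u (b j)" by (rule series_coef[OF that(1) b_L2 b_L2 that(2)])
    moreover have "(\<lambda>i. x i \<omega> * ip (b i) (b j)) = (\<lambda>i. if i = j then x i \<omega> else 0)"
      using b_orthonormal by (auto simp: L2.orthonormal_def)
    ultimately show ?thesis using sums_single[of j "\<lambda>i. x i \<omega>"] sums_unique2 by fastforce
  qed
  have sq: "(\<lambda>j. (x j \<omega>)\<^sup>2) sums ip u u" if "u \<in> L2_graph \<Gamma>" "series_converges_to \<Gamma> ?f u" for u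
    using b_complete[OF that(1)] coef[OF that] by simp
  have pick: "?U \<in> L2_graph \<Gamma>" "series_converges_to \<Gamma> ?f ?U" if "summable (\<lambda>j. (x j \<omega>)\<^sup>2)"
  proof -
    have "\<exists>u. u \<in> L2_graph \<Gamma> \<and> series_converges_to \<Gamma> ?f u" using Riesz_Fischer[OF b_orthonormal that] by blast
    from someI_ex[OF this] this show "?U \<in> L2_graph \<Gamma>" "series_converges_to \<Gamma> ?f ?U"
      unfolding U series_sum_def by auto
  qed
  have none: "?U = (\<lambda>_. 0)" if "\<not> summable (\<lambda>j. (x j \<omega>)\<^sup>2)"
    using sq that unfolding U series_sum_def by (auto simp: sums_iff)
  show "?U \<in> L2_graph \<Gamma>" using pick(1) none L2.zero by (cases "summable (\<lambda>j. (x j \<omega>)\<^sup>2)") auto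
  show "ip ?U ?U = (if summable (\<lambda>j. (x j \<omega>)\<^sup>2) then \<Sum>j. (x j \<omega>)\<^sup>2 else 0)"
  proof (cases "summable (\<lambda>j. (x j \<omega>)\<^sup>2)")
    case True
    then show ?thesis using sq[OF pick[OF True]] by (simp add: sums_iff)
  next
    case False
    show ?thesis unfolding none[OF False] if_not_P[OF False] by (rule L2.zero_left[OF L2.zero])
  qed
  assume i: "i < N"
  show "ip ?U (e i) = (if summable (\<lambda>j. (x j \<omega>)\<^sup>2) then \<Sum>j. x j \<omega> * G.coef j i else 0)"
  proof (cases "summable (\<lambda>j. (x j \<omega>)\<^sup>2)")
    case True
    have "(\<lambda>j. x j \<omega> * ip (b j) (e i)) sums ip ?U (e i)"
      by (rule series_coef[OF pick(1)[OF True] G.eX[OF i] b_L2 pick(2)[OF True]])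
    then show ?thesis using True by (simp add: sums_iff G.coef_def)
  next
    case False
    show ?thesis unfolding none[OF False] if_not_P[OF False] by (rule L2.zero_left[OF G.eX[OF i]])
  qed
qed

text \<open>Valid at every \<open>\<omega>\<close>, whether or not the series converge: the error
  becomes an explicit expression in the variables \<open>\<xi> j\<close>, from which its
  measurability follows.\<close>

lemma error_eq:
  fixes \<xi> :: "nat \<Rightarrow> 'w \<Rightarrow> real" and \<beta> :: real
  defines "x \<equiv> \<lambda>j \<omega>. lam j powr (- \<beta>) * \<xi> j \<omega>"
  defines "E \<equiv> \<lambda>\<omega>. summable (\<lambda>j. (x j \<omega>)\<^sup>2)"
    and "\<eta> \<equiv> \<lambda>\<omega> i. if \<forall>i<N. summable (\<lambda>j. G.coef j i * \<xi> j \<omega>) then (\<Sum>j. G.coef j i * \<xi> j \<omega>) else 0"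
  shows "(L2_norm \<Gamma> (\<lambda>p. solution \<Gamma> \<beta> b lam \<xi> \<omega> p - approx_solution \<Gamma> \<kappa> a \<alpha> n k \<beta> b \<xi> \<omega> p))\<^sup>2 =
    (if E \<omega> then \<Sum>j. (x j \<omega>)\<^sup>2 else 0)
    - 2 * (\<Sum>i<N. (weight k \<beta> i * \<eta> \<omega> i) * (if E \<omega> then \<Sum>j. x j \<omega> * G.coef j i else 0))
    + (\<Sum>i<N. (weight k \<beta> i)\<^sup>2 * (\<eta> \<omega> i)\<^sup>2)"
proof -
  let ?U = "solution \<Gamma> \<beta> b lam \<xi> \<omega>"
  let ?A = "approx_solution \<Gamma> \<kappa> a \<alpha> n k \<beta> b \<xi> \<omega>"
  have A: "?A = (\<lambda>p. \<Sum>i<N. (weight k \<beta> i * \<eta> \<omega> i) * e i p)"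
    unfolding approx_solution_def quadrature_eq[OF fem_noise_eq(1)] \<eta>_def
    by (intro ext sum.cong refl) (simp add: fem_noise_eq(2))
  have AX: "?A \<in> L2_graph \<Gamma>" unfolding A by (rule subsetD[OF G.VX comb_V])
  have UX: "?U \<in> L2_graph \<Gamma>" by (rule solution_eq(1))
  have "(L2_norm \<Gamma> (\<lambda>p. ?U p - ?A p))\<^sup>2 = ip ?U ?U - 2 * ip ?U ?A + ip ?A ?A"
    using L2.pos[OF L2.diff[OF UX AX]] L2.diff_self[OF UX AX] by (simp add: L2_norm_def)
  also have "ip ?A ?A = (\<Sum>i<N. (weight k \<beta> i)\<^sup>2 * (\<eta> \<omega> i)\<^sup>2)"
    unfolding A L2.orthonormal_sum(3)[OF G.e_on finite_lessThan order_refl] by (simp add: power2_eq_square mult_ac)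
  also have "ip ?U ?A = (\<Sum>i<N. (weight k \<beta> i * \<eta> \<omega> i) * ip ?U (e i))"
    unfolding A by (intro L2.sum_right UX) (auto simp: G.eX)
  also have "\<dots> = (\<Sum>i<N. (weight k \<beta> i * \<eta> \<omega> i) * (if E \<omega> then \<Sum>j. x j \<omega> * G.coef j i else 0))"
    unfolding E_def x_def by (intro sum.cong refl) (simp add: solution_eq(3))
  also have "ip ?U ?U = (if E \<omega> then \<Sum>j. (x j \<omega>)\<^sup>2 else 0)"
    unfolding E_def x_def by (rule solution_eq(2))
  finally show ?thesis .
qed

section \<open>Moments of the error\<close>

lemma coef_sq_suminf: "i < N \<Longrightarrow> (\<Sum>j. (G.coef j i)\<^sup>2) = 1"
  using G.coef_sums by (simp add: sums_iff)

text \<open>Twice the modulus of \<open>c\<close> is at most \<open>lam * c^2 + 1 / lam\<close>. The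
  first series is bounded by the energy of \<open>e i\<close>, the second converges by the growth of
  the eigenvalues.\<close>

lemma coef_abs_summable: assumes i: "i < N" shows "summable (\<lambda>j. \<bar>G.coef j i\<bar>)"
proof -
  have s1: "summable (\<lambda>j. lam j * (G.coef j i)\<^sup>2)"
    using G.coef_energy[OF i] G.lam_pos by (intro summableI_nonneg_bounded[where x = "\<theta> i"]) (auto simp: less_imp_le)
  have s2: "summable (\<lambda>j. 1 / lam j)"
    using lam_summable[of 1] G.lam_pos by (simp add: powr_minus powr_one less_imp_le inverse_eq_divide)
  have "norm \<bar>G.coef j i\<bar> \<le> lam j * (G.coef j i)\<^sup>2 + 1 / lam j" for j
  proof -
    have l: "0 < lam j" by (rule G.lam_pos)
    have "0 \<le> (lam j * \<bar>G.coef j i\<bar> - 1)\<^sup>2 / lam j" using l by simp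
    also have "\<dots> = lam j * (G.coef j i)\<^sup>2 + 1 / lam j - 2 * \<bar>G.coef j i\<bar>"
      using l by (simp add: field_simps power2_eq_square)
    finally show ?thesis by simp
  qed
  then show ?thesis by (intro summable_comparison_test'[OF summable_add[OF s1 s2], of 0]) blast
qed

lemma coef_powr_abs_summable:
  assumes i: "i < N" and \<beta>: "0 < \<beta>" shows "summable (\<lambda>j. \<bar>lam j powr (- \<beta>) * G.coef j i\<bar>)"
proof -
  have "norm \<bar>lam j powr (- \<beta>) * G.coef j i\<bar> \<le> \<delta> powr (- \<beta>) * \<bar>G.coef j i\<bar>" for j
    unfolding abs_mult real_norm_def abs_idempotent
    using G.lam_ge[of j] G.\<delta> \<beta> by (intro mult_right_mono) (auto intro!: powr_mono2')
  then show ?thesis by (intro summable_comparison_test'[OF summable_mult[OF coef_abs_summable[OF i]], of 0]) blast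
qed

text \<open>Where their series diverge, \<open>solution\<close> and \<open>fem_noise\<close> are \<open>0\<close>.  These null sets are tracked
  because the measure need not be complete, so that measurability of the error does not follow from
  its almost sure value.\<close>

lemma mean_square_error:
  fixes \<xi> :: "nat \<Rightarrow> 'w \<Rightarrow> real" and \<beta> :: real
  assumes noise: "standard_normal_sequence M \<xi>" and \<beta>: "1 / 4 < \<beta>" "\<beta> \<le> 1"
    and K: "0 < K" and r: "0 \<le> r" "r \<le> 1"
    and s2: "(\<lambda>j. lam j powr (- 2 * \<beta> + 2 * r)) sums C1"
    and quad: "\<And>i. i < N \<Longrightarrow> \<bar>\<theta> i powr (- \<beta>) - weight k \<beta> i\<bar> \<le> \<epsilon>"
  defines "err \<equiv> \<lambda>\<omega>. (L2_norm \<Gamma> (\<lambda>p. solution \<Gamma> \<beta> b lam \<xi> \<omega> p - approx_solution \<Gamma> \<kappa> a \<alpha> n k \<beta> b \<xi> \<omega> p))\<^sup>2"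
  shows "integrable M err" "(LINT \<omega>|M. err \<omega>) \<le> C1 * K powr (2 * r) + N * (4 * K powr (2 * \<beta>) + 2 * \<epsilon>\<^sup>2)"
proof -
  interpret noise: normal_sequence M \<xi> by unfold_locales (rule noise)
  define x where "x j \<omega> = lam j powr (- \<beta>) * \<xi> j \<omega>" for j \<omega>
  define E where "E \<omega> \<longleftrightarrow> summable (\<lambda>j. (x j \<omega>)\<^sup>2)" for \<omega>
  define F where "F \<omega> \<longleftrightarrow> (\<forall>i<N. summable (\<lambda>j. G.coef j i * \<xi> j \<omega>))" for \<omega>
  define y where "y i \<omega> = (\<Sum>j. G.coef j i * \<xi> j \<omega>)" for i \<omega>
  define z where "z i \<omega> = (\<Sum>j. (lam j powr (- \<beta>) * G.coef j i) * \<xi> j \<omega>)" for i \<omega>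
  define X where "X \<omega> = (\<Sum>j. lam j powr (- 2 * \<beta>) * (\<xi> j \<omega>)\<^sup>2)" for \<omega>
  let ?q = "weight k \<beta>"
  have x2: "(x j \<omega>)\<^sup>2 = lam j powr (- 2 * \<beta>) * (\<xi> j \<omega>)\<^sup>2" for j \<omega>
    by (simp add: x_def power_mult_distrib power2_eq_square powr_add[symmetric])
  have xc: "x j \<omega> * G.coef j i = (lam j powr (- \<beta>) * G.coef j i) * \<xi> j \<omega>" for i j \<omega> by (simp add: x_def)
  have err: "err \<omega> = (if E \<omega> then X \<omega> else 0)
      - 2 * (\<Sum>i<N. (?q i * (if F \<omega> then y i \<omega> else 0)) * (if E \<omega> then z i \<omega> else 0))
      + (\<Sum>i<N. (?q i)\<^sup>2 * (if F \<omega> then y i \<omega> else 0)\<^sup>2)" for \<omega>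
    unfolding err_def error_eq E_def F_def X_def y_def z_def xc[symmetric] x2[symmetric] by (simp only: x_def)
  \<comment> \<open>The error with all case distinctions removed: it agrees with \<open>err\<close>
    almost surely, and its mean is the Hilbert-Schmidt expression.\<close>
  define g where "g \<omega> = X \<omega> - 2 * (\<Sum>i<N. ?q i * (y i \<omega> * z i \<omega>)) + (\<Sum>i<N. (?q i)\<^sup>2 * (y i \<omega> * y i \<omega>))" for \<omega>
  have meas: "\<xi> j \<in> borel_measurable M" for j by (rule noise.meas)
  have summ: "Measurable.pred M (\<lambda>\<omega>. summable (\<lambda>j. f j \<omega>))" if "\<And>j. f j \<in> borel_measurable M" for f :: "nat \<Rightarrow> 'w \<Rightarrow> real"
  proof -
    \<comment> \<open>The Cauchy criterion describes convergence by countably many conditions on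
      partial sums.\<close>
    have "{\<omega> \<in> space M. Cauchy (\<lambda>m. \<Sum>j<m. f j \<omega>)} \<in> sets M" using that by (intro sets_Collect_Cauchy borel_measurable_sum)
    then show ?thesis by (simp add: pred_def summable_iff_convergent Cauchy_convergent_iff)
  qed
  have cm: "(\<lambda>\<omega>. c * \<xi> j \<omega>) \<in> borel_measurable M" for c j by (rule borel_measurable_times[OF borel_measurable_const meas])
  have Em: "Measurable.pred M E"
    unfolding E_def[abs_def] x_def by (rule summ) (rule borel_measurable_power[OF cm])
  have Fm: "Measurable.pred M F"
    unfolding F_def[abs_def] lessThan_iff[symmetric] Ball_def[symmetric]
    by (rule pred_intros_finite(3)[OF finite_lessThan]) (rule summ, rule cm)
  have ms: "X \<in> borel_measurable M" "y i \<in> borel_measurable M" "z i \<in> borel_measurable M" for i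
    unfolding X_def[abs_def] y_def[abs_def] z_def[abs_def]
    by (rule borel_measurable_suminf, rule cm borel_measurable_times[OF borel_measurable_const borel_measurable_power[OF meas]])+
  have errm: "err \<in> borel_measurable M"
  proof -
    have yF: "(\<lambda>\<omega>. if F \<omega> then y i \<omega> else 0) \<in> borel_measurable M" for i
      by (rule measurable_If[OF ms(2) borel_measurable_const Fm[unfolded pred_def]])
    have zE: "(\<lambda>\<omega>. if E \<omega> then z i \<omega> else 0) \<in> borel_measurable M" for i
      by (rule measurable_If[OF ms(3) borel_measurable_const Em[unfolded pred_def]])
    have XE: "(\<lambda>\<omega>. if E \<omega> then X \<omega> else 0) \<in> borel_measurable M"
      by (rule measurable_If[OF ms(1) borel_measurable_const Em[unfolded pred_def]])
    show ?thesis
      unfolding err[abs_def]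
      by (intro borel_measurable_add borel_measurable_diff borel_measurable_times borel_measurable_sum borel_measurable_power
          borel_measurable_const yF zE XE)
  qed
  have s1: "summable (\<lambda>j. lam j powr (- 2 * \<beta>))" using lam_summable[of "2 * \<beta>"] \<beta> by simp
  have \<beta>0: "0 < \<beta>" using \<beta> by simp
  note XI = noise.square_series[OF s1 powr_ge_zero]
  have Xi: "integrable M X" "(LINT \<omega>|M. X \<omega>) = (\<Sum>j. lam j powr (- 2 * \<beta>))"
    unfolding X_def[abs_def] by (rule XI(2), rule XI(3))
  have yy: "integrable M (\<lambda>\<omega>. y i \<omega> * y i \<omega>)" "(LINT \<omega>|M. y i \<omega> * y i \<omega>) = 1" if i: "i < N" for i
  proof -
    note c = coef_abs_summable[OF i]
    show "integrable M (\<lambda>\<omega>. y i \<omega> * y i \<omega>)" unfolding y_def by (rule noise.linear_series_product(1)[OF c c])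
    have "(LINT \<omega>|M. y i \<omega> * y i \<omega>) = (\<Sum>j. G.coef j i * G.coef j i)"
      unfolding y_def by (rule noise.linear_series_product(2)[OF c c])
    then show "(LINT \<omega>|M. y i \<omega> * y i \<omega>) = 1" using coef_sq_suminf[OF i] by (simp only: power2_eq_square)
  qed
  have yz: "integrable M (\<lambda>\<omega>. y i \<omega> * z i \<omega>)" "(LINT \<omega>|M. y i \<omega> * z i \<omega>) = (\<Sum>j. lam j powr (- \<beta>) * (G.coef j i)\<^sup>2)" if i: "i < N" for i
  proof -
    note c = coef_abs_summable[OF i] coef_powr_abs_summable[OF i \<beta>0]
    show "integrable M (\<lambda>\<omega>. y i \<omega> * z i \<omega>)" unfolding y_def z_def by (rule noise.linear_series_product(1)[OF c])
    have "(LINT \<omega>|M. y i \<omega> * z i \<omega>) = (\<Sum>j. G.coef j i * (lam j powr (- \<beta>) * G.coef j i))"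
      unfolding y_def z_def by (rule noise.linear_series_product(2)[OF c])
    also have "\<dots> = (\<Sum>j. lam j powr (- \<beta>) * (G.coef j i)\<^sup>2)" by (simp only: power2_eq_square mult.left_commute)
    finally show "(LINT \<omega>|M. y i \<omega> * z i \<omega>) = (\<Sum>j. lam j powr (- \<beta>) * (G.coef j i)\<^sup>2)" .
  qed
  define P where "P \<omega> = (\<Sum>i<N. ?q i * (y i \<omega> * z i \<omega>))" for \<omega>
  define Q where "Q \<omega> = (\<Sum>i<N. (?q i)\<^sup>2 * (y i \<omega> * y i \<omega>))" for \<omega>
  have Pi: "integrable M P" "(LINT \<omega>|M. P \<omega>) = (\<Sum>i<N. ?q i * (\<Sum>j. lam j powr (- \<beta>) * (G.coef j i)\<^sup>2))"
    unfolding P_def[abs_def] using yz by (auto simp: Bochner_Integration.integral_sum intro!: sum.cong)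
  have Qi: "integrable M Q" "(LINT \<omega>|M. Q \<omega>) = (\<Sum>i<N. (?q i)\<^sup>2)"
    unfolding Q_def[abs_def] using yy by (auto simp: Bochner_Integration.integral_sum intro!: sum.cong)
  have gPQ: "g = (\<lambda>\<omega>. X \<omega> - 2 * P \<omega> + Q \<omega>)" by (simp add: g_def P_def Q_def fun_eq_iff)
  have gi: "integrable M g" unfolding gPQ using Xi(1) Pi(1) Qi(1) by simp
  have "(LINT \<omega>|M. g \<omega>) = (\<Sum>j. lam j powr (- 2 * \<beta>)) - 2 * (\<Sum>i<N. ?q i * (\<Sum>j. lam j powr (- \<beta>) * (G.coef j i)\<^sup>2)) + (\<Sum>i<N. (?q i)\<^sup>2)"
    unfolding gPQ Xi(2)[symmetric] Pi(2)[symmetric] Qi(2)[symmetric] using Xi(1) Pi(1) Qi(1) by simp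
  also have "\<dots> \<le> C1 * K powr (2 * r) + N * (4 * K powr (2 * \<beta>) + 2 * \<epsilon>\<^sup>2)"
    by (rule G.Hilbert_Schmidt_error[OF \<beta>0 \<beta>(2) K r s1 s2 quad])
  finally have gle: "(LINT \<omega>|M. g \<omega>) \<le> C1 * K powr (2 * r) + N * (4 * K powr (2 * \<beta>) + 2 * \<epsilon>\<^sup>2)" .
  have "AE \<omega> in M. E \<omega>" unfolding E_def x2 by (rule XI(1))
  moreover have "AE \<omega> in M. F \<omega>"
  proof -
    have "AE \<omega> in M. summable (\<lambda>j. G.coef j i * \<xi> j \<omega>)" if "i < N" for i
      using noise.abs_series[OF coef_abs_summable[OF that]]
    proof eventually_elim
      case (elim \<omega>)
      then show ?case by (rule summable_rabs_cancel[OF conjunct1])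
    qed
    then have "AE \<omega> in M. \<forall>i\<in>{..<N}. summable (\<lambda>j. G.coef j i * \<xi> j \<omega>)" by (intro AE_finite_allI finite_lessThan) (simp only: lessThan_iff)
    then show ?thesis unfolding F_def Ball_def lessThan_iff .
  qed
  ultimately have ae: "AE \<omega> in M. g \<omega> = err \<omega>"
  proof eventually_elim
    case (elim \<omega>)
    then show ?case by (simp only: err g_def if_True mult.assoc, simp only: power2_eq_square)
  qed
  show "integrable M err" by (rule integrable_cong_AE_imp[OF gi errm ae])
  have "(LINT \<omega>|M. g \<omega>) = (LINT \<omega>|M. err \<omega>)"
    by (rule integral_cong_AE[OF borel_measurable_integrable[OF gi] errm ae])
  then show "(LINT \<omega>|M. err \<omega>) \<le> C1 * K powr (2 * r) + N * (4 * K powr (2 * \<beta>) + 2 * \<epsilon>\<^sup>2)" using gle by simp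
qed

end

lemma (in eigen_graph) fem_galerkin_exists:
  assumes n: "\<And>e. e \<in> edges \<Gamma> \<Longrightarrow> 0 < n e"
    and \<delta>: "0 < \<delta>" "\<And>u. u \<in> H1_graph \<Longrightarrow> \<delta> * (ip u u + energy u) \<le> form u u"
    and K: "0 \<le> K" "\<And>c m. \<exists>w\<in>fem_space \<Gamma> n.
      form (\<lambda>p. (\<Sum>j<m. c j * b j p) - w p) (\<lambda>p. (\<Sum>j<m. c j * b j p) - w p) \<le> K * (\<Sum>j<m. (lam j * c j)\<^sup>2)"
  shows "\<exists>e \<theta>. fem_galerkin \<Gamma> \<kappa> a \<kappa>0 a0 \<alpha> S d0 b lam n K \<delta> e \<theta> (fem_dim \<Gamma> n)"
proof -
  let ?B = "bilinear_form \<Gamma> \<kappa> a \<alpha>"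
  have VH: "fem_space \<Gamma> n \<subseteq> H1_graph" by (rule fem_subset_H1[where n=n, OF n])
  have B: "semi_inner (fem_space \<Gamma> n) ?B"
    unfolding form_def[symmetric] by (rule H1.sub[OF fem_zero fem_lincomb VH])
  have BY: "semi_inner H1_graph ?B" unfolding form_def[symmetric] by (rule H1.semi_inner_axioms)
  have VX: "fem_space \<Gamma> n \<subseteq> L2_graph \<Gamma>" using VH H1_subset_L2 by (rule order_trans)
  have P: "form_pair (L2_graph \<Gamma>) (fem_space \<Gamma> n) (ip) ?B"
  proof (intro form_pair.intro form_pair_axioms.intro semi_inner_L2 B VX)
    show "v = (\<lambda>_. 0)" if "v \<in> fem_space \<Gamma> n" "ip v v = 0" for v
      using that by (intro L2_zero_imp) (auto simp: fem_space_def)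
    show "\<exists>S. finite S \<and> fem_space \<Gamma> n \<subseteq> pointwise.span S" by (rule fem_finite_span[where n=n, OF n])
  qed
  have dim: "fem_dim \<Gamma> n = pointwise.dim (fem_space \<Gamma> n)" by (simp add: fem_dim_def)
  obtain e \<theta> where e: "\<And>i. i < fem_dim \<Gamma> n \<Longrightarrow> e i \<in> fem_space \<Gamma> n" "L2.orthonormal {..<fem_dim \<Gamma> n} e"
    "\<And>i v. i < fem_dim \<Gamma> n \<Longrightarrow> v \<in> fem_space \<Gamma> n \<Longrightarrow> ?B (e i) v = \<theta> i * ip (e i) v"
    "\<And>v. v \<in> fem_space \<Gamma> n \<Longrightarrow> v = (\<lambda>p. \<Sum>i<fem_dim \<Gamma> n. ip v (e i) * e i p)"
    unfolding dim by (rule form_pair.eigenbasis_exists[OF P]) blast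
  have co: "\<delta> * ip u u \<le> ?B u u" if "u \<in> H1_graph" for u
  proof -
    have "0 \<le> \<delta> * energy u" using \<delta>(1) energy_nonneg by simp
    then show ?thesis using \<delta>(2)[OF that] by (simp add: form_def distrib_left)
  qed
  have "galerkin (L2_graph \<Gamma>) (fem_space \<Gamma> n) (ip) ?B H1_graph b lam K \<delta> e \<theta> (fem_dim \<Gamma> n)"
    by (intro galerkin.intro galerkin_axioms.intro P BY VH H1_subset_L2 b_H1 b_orthonormal b_complete
        form_eigen[unfolded form_def] \<delta>(1) co K(1) K(2)[unfolded form_def] e)
  then have "fem_galerkin \<Gamma> \<kappa> a \<kappa>0 a0 \<alpha> S d0 b lam n K \<delta> e \<theta> (fem_dim \<Gamma> n)"
    by (rule fem_galerkin.intro[OF eigen_graph_axioms])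
  then show ?thesis by blast
qed

lemma sqrt_sum_bound:
  fixes A B D N :: real
  assumes "0 \<le> A" "0 \<le> B" "0 \<le> D" "0 \<le> N"
  shows "sqrt (A\<^sup>2 + N * (4 * B\<^sup>2 + 2 * D\<^sup>2)) \<le> A + 2 * B * sqrt N + 2 * D * sqrt N"
proof (rule real_le_lsqrt)
  have "(A + 2 * B * s + 2 * D * s)\<^sup>2 = A\<^sup>2 + s\<^sup>2 * (4 * B\<^sup>2 + 4 * D\<^sup>2) + (4 * A * B * s + 4 * A * D * s + 8 * B * D * s\<^sup>2)" for s
    by (simp add: power2_eq_square algebra_simps)
  from this[of "sqrt N"] have "(A + 2 * B * sqrt N + 2 * D * sqrt N)\<^sup>2
      = A\<^sup>2 + N * (4 * B\<^sup>2 + 4 * D\<^sup>2) + (4 * A * B * sqrt N + 4 * A * D * sqrt N + 8 * B * D * N)"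
    using assms(4) by simp
  moreover have "0 \<le> 4 * A * B * sqrt N + 4 * A * D * sqrt N + 8 * B * D * N" using assms by simp
  moreover have "N * (4 * B\<^sup>2 + 2 * D\<^sup>2) \<le> N * (4 * B\<^sup>2 + 4 * D\<^sup>2)" using assms by (intro mult_left_mono) auto
  ultimately show "A\<^sup>2 + N * (4 * B\<^sup>2 + 2 * D\<^sup>2) \<le> (A + 2 * B * sqrt N + 2 * D * sqrt N)\<^sup>2" by linarith
qed (use assms in simp)

theorem theorem6p6:
  fixes \<Gamma> :: "('v, 'e) metric_graph"
    and \<kappa> a :: "('v, 'e) point \<Rightarrow> real"
    and \<kappa>0 a0 \<alpha> S \<beta> \<sigma> :: real
    and d0 :: nat
    and b :: "nat \<Rightarrow> ('v, 'e) point \<Rightarrow> real"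
    and lam :: "nat \<Rightarrow> real"
    and M :: "'w measure"
    and \<xi> :: "nat \<Rightarrow> 'w \<Rightarrow> real"
  assumes graph: "compact_metric_graph \<Gamma>" "connected_graph \<Gamma>"
    and kappa: "\<kappa> \<in> Linfty_graph \<Gamma>" "0 < \<kappa>0"
      "\<forall>e\<in>edges \<Gamma>. AE x in lebesgue_on {0..elen \<Gamma> e}. \<kappa>0 \<le> on_edge \<Gamma> \<kappa> e x"
    and a: "Lipschitz_on_graph \<Gamma> a" "\<forall>p\<in>points \<Gamma>. 0 < a p"
      "a0 \<in> a ` points \<Gamma>" "\<forall>p\<in>points \<Gamma>. a0 \<le> a p"
    and d0: "d0 = Min (degree \<Gamma> ` vertices \<Gamma>)"
    and S: "S = \<bar>\<alpha>\<bar> / real d0"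
    and alpha: "0 \<le> \<alpha> \<or>
      (\<kappa>0\<^sup>2 > 4 * S / Min (elen \<Gamma> ` edges \<Gamma>) \<and> 2 * S * Max (elen \<Gamma> ` edges \<Gamma>) \<le> a0)"
    and eigenbasis: "orthonormal_eigenbasis \<Gamma> \<kappa> a \<alpha> b lam"
    and noise: "standard_normal_sequence M \<xi>"
    and beta: "1 / 4 < \<beta>" "\<beta> < 1"
    and sigma: "1 / 4 < \<sigma>" "\<sigma> < \<beta>"
  shows "\<forall>k0>0. \<exists>C>0. \<forall>k n. 0 < k \<and> k \<le> k0 \<and> (\<forall>e\<in>edges \<Gamma>. 2 \<le> n e) \<longrightarrow>
    (let err = (\<lambda>\<omega>. (L2_norm \<Gamma> (\<lambda>p. solution \<Gamma> \<beta> b lam \<xi> \<omega> p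
                                   - approx_solution \<Gamma> \<kappa> a \<alpha> n k \<beta> b \<xi> \<omega> p))\<^sup>2);
         h = max_mesh_width \<Gamma> n;
         N = real (fem_dim \<Gamma> n)
     in integrable M err \<and>
        sqrt (LINT \<omega>|M. err \<omega>) \<le>
          C * (h powr (2 * \<sigma> - 1 / 2) + h powr (2 * \<sigma>) * sqrt N + exp (- pi\<^sup>2 / (2 * k)) * sqrt N))"
proof (intro allI impI, goal_cases)
  case k0: (1 k0)
  interpret eigen_graph \<Gamma> \<kappa> a \<kappa>0 a0 \<alpha> S d0 b lam
    by unfold_locales (fact graph kappa a d0 S alpha eigenbasis)+
  obtain \<delta> where \<delta>: "0 < \<delta>" "\<And>u. u \<in> H1_graph \<Longrightarrow> \<delta> * (L2_inner \<Gamma> u u + energy u) \<le> form u u"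
    using form_coercive by blast
  obtain K where K: "0 < K"
    "\<And>n c m. (\<And>e. e \<in> edges \<Gamma> \<Longrightarrow> 0 < n e) \<Longrightarrow> \<exists>w\<in>fem_space \<Gamma> n.
      form (\<lambda>p. (\<Sum>j<m. c j * b j p) - w p) (\<lambda>p. (\<Sum>j<m. c j * b j p) - w p) \<le> K * (max_mesh_width \<Gamma> n)\<^sup>2 * (\<Sum>j<m. (lam j * c j)\<^sup>2)"
    using interpolation_error by blast
  have \<beta>0: "0 < \<beta>" using beta by simp
  obtain Cq where Cq: "0 \<le> Cq" and quad: "\<And>k l. 0 < k \<Longrightarrow> k \<le> k0 \<Longrightarrow> \<delta> \<le> l \<Longrightarrow>
    \<bar>l powr (- \<beta>) - 2 * k * sin (pi * \<beta>) / pi *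
      (\<Sum>l'\<in>{- \<lceil>pi\<^sup>2 / (4 * \<beta> * k\<^sup>2)\<rceil>..\<lceil>pi\<^sup>2 / (4 * (1 - \<beta>) * k\<^sup>2)\<rceil>}.
        exp (2 * \<beta> * of_int l' * k) / (1 + exp (2 * of_int l' * k) * l))\<bar> \<le> Cq * exp (- pi\<^sup>2 / (2 * k))"
    using sinc_quadrature_error[OF \<beta>0 beta(2) \<delta>(1) k0] by blast
  \<comment> \<open>This makes \<open>(K * h\<^sup>2) powr r\<close> a multiple of
    \<open>h powr (2 * \<sigma> - 1 / 2)\<close>, while
    \<open>2 * \<beta> - 2 * r = 2 * (\<beta> - \<sigma>) + 1 / 2\<close> stays above the threshold
    1/2 of \<open>lam_summable\<close>.\<close>
  define r where "r = \<sigma> - 1 / 4"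
  have r: "0 \<le> r" "r \<le> 1" using sigma beta by (auto simp: r_def)
  define C1 where "C1 = (\<Sum>j. lam j powr (- 2 * \<beta> + 2 * r))"
  have s2: "(\<lambda>j. lam j powr (- 2 * \<beta> + 2 * r)) sums C1"
    using lam_summable[of "2 * \<beta> - 2 * r"] sigma by (simp add: C1_def r_def summable_sums)
  have C1: "0 \<le> C1" unfolding C1_def by (rule suminf_nonneg[OF sums_summable[OF s2]]) simp
  \<comment> \<open>The mesh width never exceeds the longest edge, so the surplus power
    \<open>h powr (2 * \<beta> - 2 * \<sigma>)\<close> goes into the constant.\<close>
  define H where "H = Max (elen \<Gamma> ` edges \<Gamma>)"
  \<comment> \<open>One summand for each of the three error terms, and 1 to keep the constant
    positive.\<close>
  define C where "C = sqrt C1 * K powr r + 2 * K powr \<beta> * H powr (2 * \<beta> - 2 * \<sigma>) + 2 * Cq + 1"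
  show ?case
  proof (intro exI[of _ C] conjI allI impI)
    show "0 < C" using C1 Cq by (simp add: C_def add_nonneg_pos)
    fix k :: real and n :: "'e \<Rightarrow> nat"
    assume kn: "0 < k \<and> k \<le> k0 \<and> (\<forall>e\<in>edges \<Gamma>. 2 \<le> n e)"
    then have n: "0 < n e" if "e \<in> edges \<Gamma>" for e using that by fastforce
    define h where "h = max_mesh_width \<Gamma> n"
    define N where "N = real (fem_dim \<Gamma> n)"
    define \<epsilon> where "\<epsilon> = Cq * exp (- pi\<^sup>2 / (2 * k))"
    have h: "0 < h" "h \<le> H"
    proof -
      obtain e where e: "e \<in> edges \<Gamma>" using edges_ne by blast
      show "0 < h" using mesh_width_facts(1,3)[where n=n, OF e n[OF e]] by (simp add: h_def)
      have "mesh_width \<Gamma> n e \<le> H" if e: "e \<in> edges \<Gamma>" for e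
        using mesh_width_facts(4)[where n=n, OF e n[OF e]] fin_edges e unfolding H_def by (meson Max_ge finite_imageI imageI order_trans)
      then show "h \<le> H" unfolding h_def max_mesh_width_def using fin_edges edges_ne by simp
    qed
    have Kh: "0 < K * h\<^sup>2" using K(1) h(1) by simp
    obtain e \<theta> where "fem_galerkin \<Gamma> \<kappa> a \<kappa>0 a0 \<alpha> S d0 b lam n (K * h\<^sup>2) \<delta> e \<theta> (fem_dim \<Gamma> n)"
      using fem_galerkin_exists[where n=n, OF n \<delta> less_imp_le[OF Kh] K(2)[where n=n, OF n, folded h_def]] by blast
    then interpret F: fem_galerkin \<Gamma> \<kappa> a \<kappa>0 a0 \<alpha> S d0 b lam n "K * h\<^sup>2" \<delta> e \<theta> "fem_dim \<Gamma> n" .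
    let ?err = "\<lambda>\<omega>. (L2_norm \<Gamma> (\<lambda>p. solution \<Gamma> \<beta> b lam \<xi> \<omega> p - approx_solution \<Gamma> \<kappa> a \<alpha> n k \<beta> b \<xi> \<omega> p))\<^sup>2"
    have w: "\<bar>\<theta> i powr (- \<beta>) - F.weight k \<beta> i\<bar> \<le> \<epsilon>" if "i < fem_dim \<Gamma> n" for i
      unfolding \<epsilon>_def F.weight_def using kn F.G.\<theta>_ge[OF that] by (intro quad) auto
    note ms = F.mean_square_error[OF noise beta(1) less_imp_le[OF beta(2)] Kh r s2 w]
    have p1: "(K * h\<^sup>2) powr s = K powr s * h powr (2 * s)" for s
      using K(1) h(1) by (simp add: powr_mult powr_powr flip: powr_numeral)
    have pw: "(x powr s)\<^sup>2 = x powr (2 * s)" for x s :: real by (simp add: power2_eq_square flip: powr_add)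
    define A where "A = sqrt C1 * (K * h\<^sup>2) powr r"
    define B where "B = (K * h\<^sup>2) powr \<beta>"
    have A2: "A\<^sup>2 = C1 * (K * h\<^sup>2) powr (2 * r)" and B2: "B\<^sup>2 = (K * h\<^sup>2) powr (2 * \<beta>)"
      unfolding A_def B_def power_mult_distrib pw using C1 by simp_all
    have "sqrt (LINT \<omega>|M. ?err \<omega>) \<le> sqrt (A\<^sup>2 + N * (4 * B\<^sup>2 + 2 * \<epsilon>\<^sup>2))"
      using ms(2) by (intro real_sqrt_le_mono) (simp add: A2 B2 N_def)
    also have "\<dots> \<le> A + 2 * B * sqrt N + 2 * \<epsilon> * sqrt N"
      by (rule sqrt_sum_bound) (use C1 Cq in \<open>auto simp: A_def B_def \<epsilon>_def N_def\<close>)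
    also have "A = sqrt C1 * K powr r * h powr (2 * \<sigma> - 1 / 2)" by (simp add: A_def p1 r_def)
    also have "B \<le> K powr \<beta> * H powr (2 * \<beta> - 2 * \<sigma>) * h powr (2 * \<sigma>)"
    proof -
      have "h powr (2 * \<beta>) = h powr (2 * \<beta> - 2 * \<sigma>) * h powr (2 * \<sigma>)" by (simp add: powr_add[symmetric])
      also have "\<dots> \<le> H powr (2 * \<beta> - 2 * \<sigma>) * h powr (2 * \<sigma>)"
        using h sigma by (intro mult_right_mono powr_mono2) auto
      finally show ?thesis by (simp add: B_def p1 mult.assoc mult_left_mono)
    qed
    also have "sqrt C1 * K powr r * h powr (2 * \<sigma> - 1 / 2) + 2 * (K powr \<beta> * H powr (2 * \<beta> - 2 * \<sigma>) * h powr (2 * \<sigma>)) * sqrt N + 2 * \<epsilon> * sqrt N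
      \<le> C * h powr (2 * \<sigma> - 1 / 2) + C * (h powr (2 * \<sigma>) * sqrt N) + C * (exp (- pi\<^sup>2 / (2 * k)) * sqrt N)"
    proof (intro add_mono)
      have nn: "0 \<le> sqrt C1 * K powr r" "0 \<le> 2 * K powr \<beta> * H powr (2 * \<beta> - 2 * \<sigma>)" "0 \<le> 2 * Cq" using C1 Cq by auto
      show "sqrt C1 * K powr r * h powr (2 * \<sigma> - 1 / 2) \<le> C * h powr (2 * \<sigma> - 1 / 2)"
        using nn unfolding C_def by (intro mult_right_mono) (linarith, simp)
      have "2 * K powr \<beta> * H powr (2 * \<beta> - 2 * \<sigma>) * (h powr (2 * \<sigma>) * sqrt N) \<le> C * (h powr (2 * \<sigma>) * sqrt N)"
        using nn unfolding C_def by (intro mult_right_mono) (auto simp: N_def)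
      then show "2 * (K powr \<beta> * H powr (2 * \<beta> - 2 * \<sigma>) * h powr (2 * \<sigma>)) * sqrt N \<le> C * (h powr (2 * \<sigma>) * sqrt N)"
        by (simp add: mult_ac)
      have "2 * Cq * (exp (- pi\<^sup>2 / (2 * k)) * sqrt N) \<le> C * (exp (- pi\<^sup>2 / (2 * k)) * sqrt N)"
        using nn unfolding C_def by (intro mult_right_mono) (auto simp: N_def)
      then show "2 * \<epsilon> * sqrt N \<le> C * (exp (- pi\<^sup>2 / (2 * k)) * sqrt N)" by (simp add: \<epsilon>_def mult_ac)
    qed
    finally have "sqrt (LINT \<omega>|M. ?err \<omega>) \<le> C * (h powr (2 * \<sigma> - 1 / 2) + h powr (2 * \<sigma>) * sqrt N + exp (- pi\<^sup>2 / (2 * k)) * sqrt N)"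
      by (simp add: distrib_left N_def mult_right_mono)
    then show "let err = ?err; h = max_mesh_width \<Gamma> n; N = real (fem_dim \<Gamma> n)
      in integrable M err \<and> sqrt (LINT \<omega>|M. err \<omega>) \<le> C * (h powr (2 * \<sigma> - 1 / 2) + h powr (2 * \<sigma>) * sqrt N + exp (- pi\<^sup>2 / (2 * k)) * sqrt N)"
      using ms(1) unfolding Let_def h_def N_def by blast
  qed
qed

end
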